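(* Let $W=C_0([0,1],\mathbb R)$ be the classical Wiener space with Wiener measure $\mu$. Let $f\in\mathbb D_{2,1}$ be such that $c=E[\exp(-f)]<\infty$, let $L=\frac1ce^{-f}$ and let $\nu$ be the probability $d\nu=L\,d\mu$. Assume that $d_H(\mu,\nu)<\infty$, let $T=I_W+\nabla\varphi$ be the optimal transport map of $\mu$ to $\nu$, and let $\Lambda=\dfrac1{L\circ T}$. Then, $\mu$-almost surely, $$\Lambda=\exp\left\{\int_0^1E_\nu[D_tf|\mathcal F_t]\circ T\,dB^T_t-\frac12\int_0^1\big(E_\nu[D_tf|\mathcal F_t]\big)^2\circ T\,dt\right\},$$ where $B^T$ is the $\mu$-Brownian motion given by the martingale part of the $\mu$-semimartingale $T_t(x)=x(t)+\int_0^tD_\tau\varphi(x)\,d\tau$ in its natural filtration, i.e. $B^T_t=T_t+\int_0^tE_\nu[D_\tau f|\mathcal F_\tau]\circ T\,d\tau$.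
   Context: Setting: $W=C_0([0,1],\mathbb R)$ with the Wiener measure $\mu$, coordinate process $W_t(x)=x(t)$ and its (completed) natural filtration $(\mathcal F_t,t\in[0,1])$; $H$ is the Cameron–Martin space of absolutely continuous functions vanishing at $0$ with square-integrable derivative, $|h|_H^2=\int_0^1|\dot h(s)|^2ds$, and $|z|_H=\infty$ for $z\in W\setminus H$. $E$ is expectation under $\mu$ and $E_\nu$ under $\nu$. $\nabla$ is the $H$-valued Sobolev (Malliavin) derivative, $\mathbb D_{2,1}$ its domain in $L^2(\mu)$, and for $g\in\mathbb D_{2,1}$, $D_tg$ denotes the Lebesgue density of $t\mapsto\nabla g(x)(t)$, i.e. $\nabla g(t)=\int_0^tD_\tau g\,d\tau$. The existence of the conditional expectations $E_\nu[D_tf|\mathcal F_t]$ (in a jointly measurable, adapted version) is presupposed by the statement. Transport map: $\Sigma(\mu,\nu)$ is the set of probability measures on $W\times W$ with marginals $\mu$ and $\nu$, $d_H^2(\mu,\nu)=\inf_{\beta\in\Sigma(\mu,\nu)}\int|x-y|_H^2\,d\beta(x,y)$. It is known that if $d_H(\mu,\nu)<\infty$ there is a $\varphi\in\mathbb D_{2,1}$ which is $1$-convex (i.e. $h\mapsto\varphi(\cdot+h)+\frac12|h|_H^2$ is an $L^0(\mu)$-valued convex function on $H$), unique up to a constant, such that $T=I_W+\nabla\varphi$ maps $\mu$ to $\nu$ and the image of $\mu$ under $x\mapsto(x,T(x))$ is the unique minimizer; $T$ is the optimal transport map and it is almost surely invertible. The natural filtration of $(T_t)$ is $\mathcal F^T_t=\sigma(T_s,s\le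 t)$ ($\mu$-completed), and the process $B^T$ above is a $\mu$-Brownian motion with respect to $(\mathcal F^T_t)$. *)

theory Defs
  imports "HOL-Probability.Probability"
begin

section \<open>Path space and Cameron--Martin space\<close>

text \<open>Paths on \<open>[0,1]\<close> are total functions that vanish outside \<open>[0,1]\<close>, so that equality of paths
  is equality of functions and the vector space operations are pointwise.\<close>

type_synonym path = "real \<Rightarrow> real"

definition path_space :: "path set" where
  "path_space = {x. continuous_on {0..1} x \<and> x 0 = 0 \<and> (\<forall>t. t \<notin> {0..1} \<longrightarrow> x t = 0)}"

text \<open>The \<open>\<sigma>\<close>-algebra generated by the evaluations is the Borel \<open>\<sigma>\<close>-algebra of the uniform norm.\<close>

definition path_borel :: "path measure" where
  "path_borel = sigma path_space
     {{x \<in> path_space. x t \<in> A} | t A. t \<in> {0..1} \<and> A \<in> sets borel}"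

definition coord :: "real \<Rightarrow> path \<Rightarrow> real" where
  "coord t x = x t"

abbreviation leb01 :: "real measure" where
  "leb01 \<equiv> restrict_space lborel {0..1}"

definition abs_continuous_01 :: "path \<Rightarrow> bool" where
  "abs_continuous_01 h \<longleftrightarrow>
     (\<forall>\<epsilon>>0. \<exists>\<delta>>0. \<forall>(n::nat) a b.
        (\<forall>i<n. 0 \<le> a i \<and> a i \<le> b i \<and> b i \<le> 1) \<longrightarrow>
        disjoint_family_on (\<lambda>i. {a i<..<b i}) {..<n} \<longrightarrow>
        (\<Sum>i<n. b i - a i) < \<delta> \<longrightarrow>
        (\<Sum>i<n. \<bar>h (b i) - h (a i)\<bar>) < \<epsilon>)"

text \<open>An absolutely continuous function is differentiable almost everywhere; the value of
  \<^const>\<open>deriv\<close> on the exceptional null set is irrelevant to the integrals below.\<close>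

definition cameron_martin :: "path set" where
  "cameron_martin = {h \<in> path_space. abs_continuous_01 h \<and>
     (\<integral>\<^sup>+t. ennreal ((deriv h t)\<^sup>2) \<partial>leb01) < \<infinity>}"

definition cm_norm_sq :: "path \<Rightarrow> ennreal" where
  "cm_norm_sq h =
     (if h \<in> cameron_martin then \<integral>\<^sup>+t. ennreal ((deriv h t)\<^sup>2) \<partial>leb01 else \<infinity>)"


section \<open>Filtrations, Brownian motion, Wiener measure\<close>

text \<open>Augmented by the null sets of \<open>M\<close>; it will be used with complete \<open>M\<close> only.\<close>

definition natural_filtration ::
    "'a measure \<Rightarrow> (real \<Rightarrow> 'a \<Rightarrow> real) \<Rightarrow> real \<Rightarrow> 'a measure" where
  "natural_filtration M X t = sigma (space M)
     ({X s -` A \<inter> space M | s A. s \<in> {0..t} \<and> A \<in> sets borel} \<union> null_sets M)"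

definition adapted_01 :: "(real \<Rightarrow> 'a measure) \<Rightarrow> (real \<Rightarrow> 'a \<Rightarrow> real) \<Rightarrow> bool" where
  "adapted_01 F X \<longleftrightarrow> (\<forall>t\<in>{0..1}. X t \<in> borel_measurable (F t))"

definition measurable_process :: "'a measure \<Rightarrow> (real \<Rightarrow> 'a \<Rightarrow> real) \<Rightarrow> bool" where
  "measurable_process M X \<longleftrightarrow> (\<lambda>(t, x). X t x) \<in> borel_measurable (leb01 \<Otimes>\<^sub>M M)"

definition brownian_motion ::
    "'a measure \<Rightarrow> (real \<Rightarrow> 'a measure) \<Rightarrow> (real \<Rightarrow> 'a \<Rightarrow> real) \<Rightarrow> bool" where
  "brownian_motion M F B \<longleftrightarrow>
     prob_space M \<and> filtration (space M) F \<and> (\<forall>t\<in>{0..1}. subalgebra M (F t)) \<and>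
     adapted_01 F B \<and>
     (AE x in M. B 0 x = 0) \<and> (AE x in M. continuous_on {0..1} (\<lambda>t. B t x)) \<and>
     (\<forall>s t. 0 \<le> s \<and> s < t \<and> t \<le> 1 \<longrightarrow>
        distributed M lborel (\<lambda>x. B t x - B s x) (\<lambda>y. ennreal (normal_density 0 (sqrt (t - s)) y)) \<and>
        prob_space.indep_set M (sets (F s))
          {(\<lambda>x. B t x - B s x) -` A \<inter> space M | A. A \<in> sets borel})"

text \<open>The Wiener measure on its completed \<open>\<sigma>\<close>-algebra: random variables below are measurable with
  respect to the completion of the Borel \<open>\<sigma>\<close>-algebra.\<close>

definition wiener_measure :: "path measure \<Rightarrow> bool" where
  "wiener_measure \<mu> \<longleftrightarrow>
     (\<exists>P. sets P = sets path_borel \<and> \<mu> = completion P) \<and>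
     brownian_motion \<mu> (natural_filtration \<mu> coord) coord"


section \<open>Malliavin derivative\<close>

text \<open>\<open>q \<alpha>\<close> is the iterated partial derivative, along the word \<open>\<alpha>\<close> of coordinate indices, of the
  function \<open>q []\<close> of the first \<open>n\<close> coordinates. As all the \<open>q \<alpha>\<close> are bounded, they are continuous,
  and \<open>q []\<close> ranges exactly over \<open>C\<^sub>b\<^sup>\<infinity>(\<real>\<^sup>n)\<close>.\<close>

definition smooth_bounded :: "nat \<Rightarrow> (nat list \<Rightarrow> (nat \<Rightarrow> real) \<Rightarrow> real) \<Rightarrow> bool" where
  "smooth_bounded n q \<longleftrightarrow> (\<forall>\<alpha>\<in>lists {..<n}.
     (\<forall>y z. (\<forall>i<n. y i = z i) \<longrightarrow> q \<alpha> y = q \<alpha> z) \<and>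
     (\<exists>C. \<forall>y. \<bar>q \<alpha> y\<bar> \<le> C) \<and>
     (\<forall>y. \<forall>i<n. ((\<lambda>r. q \<alpha> (y(i := r))) has_real_derivative q (i # \<alpha>) y) (at (y i))))"

text \<open>\<open>t \<mapsto> min t s\<close> is the element of the Cameron--Martin space representing the evaluation at \<open>s\<close>.\<close>

definition cylindrical :: "(path \<Rightarrow> real) \<Rightarrow> (path \<Rightarrow> path) \<Rightarrow> bool" where
  "cylindrical F G \<longleftrightarrow> (\<exists>n s q. (\<forall>i<n. s i \<in> {0..1}) \<and> smooth_bounded n q \<and>
     F = (\<lambda>x. q [] (\<lambda>j. x (s j))) \<and>
     G = (\<lambda>x t. indicator {0..1} t * (\<Sum>i<n. q [i] (\<lambda>j. x (s j)) * min t (s i))))"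

text \<open>\<open>malliavin_derivative \<mu> g G\<close>: \<open>g\<close> belongs to \<open>\<D>\<^bsub>2,1\<^esub>\<close>, the domain of the closure in
  \<open>L\<^sup>2(\<mu>)\<close> of the gradient on smooth cylindrical functions, and \<open>G\<close> is a version of \<open>\<nabla>g\<close>. As the
  Borel \<open>\<sigma>\<close>-algebra of the separable Hilbert space \<open>H\<close> is generated by the evaluations, the
  measurability condition on \<open>G\<close> is that of an \<open>H\<close>-valued random variable.\<close>

definition malliavin_derivative ::
    "path measure \<Rightarrow> (path \<Rightarrow> real) \<Rightarrow> (path \<Rightarrow> path) \<Rightarrow> bool" where
  "malliavin_derivative \<mu> g G \<longleftrightarrow>
     g \<in> borel_measurable \<mu> \<and> integrable \<mu> (\<lambda>x. (g x)\<^sup>2) \<and>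
     G \<in> space \<mu> \<rightarrow> cameron_martin \<and> (\<forall>t\<in>{0..1}. (\<lambda>x. G x t) \<in> borel_measurable \<mu>) \<and>
     (\<exists>F \<Gamma>. (\<forall>n. cylindrical (F n) (\<Gamma> n)) \<and>
        (\<lambda>n::nat. \<integral>\<^sup>+x. ennreal ((F n x - g x)\<^sup>2) \<partial>\<mu>) \<longlonglongrightarrow> 0 \<and>
        (\<lambda>n::nat. \<integral>\<^sup>+x. cm_norm_sq (\<lambda>t. \<Gamma> n x t - G x t) \<partial>\<mu>) \<longlonglongrightarrow> 0)"

text \<open>\<open>D t x\<close> is a jointly measurable version of \<open>D\<^sub>t g(x)\<close> when \<open>G = \<nabla>g\<close>.\<close>

definition lebesgue_density ::
    "path measure \<Rightarrow> (path \<Rightarrow> path) \<Rightarrow> (real \<Rightarrow> path \<Rightarrow> real) \<Rightarrow> bool" where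
  "lebesgue_density \<mu> G D \<longleftrightarrow> measurable_process \<mu> D \<and>
     (AE x in \<mu>. integrable leb01 (\<lambda>t. D t x) \<and>
        (\<forall>t\<in>{0..1}. G x t = (LINT \<tau>:{0..t}|lborel. D \<tau> x)))"


section \<open>Optimal transport for the Cameron--Martin cost\<close>

definition couplings :: "path measure \<Rightarrow> path measure \<Rightarrow> (path \<times> path) measure set" where
  "couplings \<mu> \<nu> = {\<beta>. sets \<beta> = sets (\<mu> \<Otimes>\<^sub>M \<nu>) \<and> distr \<beta> \<mu> fst = \<mu> \<and> distr \<beta> \<nu> snd = \<nu>}"

definition cm_cost :: "(path \<times> path) measure \<Rightarrow> ennreal" where
  "cm_cost \<beta> = (\<integral>\<^sup>+(x, y). cm_norm_sq (\<lambda>t. x t - y t) \<partial>\<beta>)"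

definition cm_dist_sq :: "path measure \<Rightarrow> path measure \<Rightarrow> ennreal" where
  "cm_dist_sq \<mu> \<nu> = (INF \<beta>\<in>couplings \<mu> \<nu>. cm_cost \<beta>)"

definition optimal_coupling ::
    "path measure \<Rightarrow> path measure \<Rightarrow> (path \<times> path) measure \<Rightarrow> bool" where
  "optimal_coupling \<mu> \<nu> \<beta> \<longleftrightarrow> \<beta> \<in> couplings \<mu> \<nu> \<and> cm_cost \<beta> = cm_dist_sq \<mu> \<nu>"

text \<open>Convexity of \<open>h \<mapsto> \<phi>(\<cdot> + h) + \<bar>h\<bar>\<^sup>2/2\<close> in \<open>L\<^sup>0(\<mu>)\<close>: the exceptional null set may
  depend on \<open>h\<close>, \<open>k\<close> and \<open>a\<close>.\<close>

definition one_convex :: "path measure \<Rightarrow> (path \<Rightarrow> real) \<Rightarrow> bool" where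
  "one_convex \<mu> \<phi> \<longleftrightarrow>
     (\<forall>h\<in>cameron_martin. \<forall>k\<in>cameron_martin. \<forall>a\<in>{0..1}. AE x in \<mu>.
        (let \<Phi> = (\<lambda>h. \<phi> (\<lambda>t. x t + h t) + enn2real (cm_norm_sq h) / 2)
         in \<Phi> (\<lambda>t. a * h t + (1 - a) * k t) \<le> a * \<Phi> h + (1 - a) * \<Phi> k))"

definition optimal_transport_map ::
    "path measure \<Rightarrow> path measure \<Rightarrow> (path \<Rightarrow> real) \<Rightarrow> (path \<Rightarrow> path) \<Rightarrow> bool" where
  "optimal_transport_map \<mu> \<nu> \<phi> T \<longleftrightarrow>
     (\<exists>G. malliavin_derivative \<mu> \<phi> G \<and> T = (\<lambda>x t. x t + G x t)) \<and> one_convex \<mu> \<phi> \<and>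
     T \<in> measurable \<mu> \<nu> \<and> distr \<mu> \<nu> T = \<nu> \<and>
     (\<forall>\<beta>. optimal_coupling \<mu> \<nu> \<beta> \<longleftrightarrow> \<beta> = distr \<mu> (\<mu> \<Otimes>\<^sub>M \<nu>) (\<lambda>x. (x, T x)))"


section \<open>Conditional expectation of a process and Ito integral\<close>

text \<open>\<open>u\<close> is a jointly measurable and adapted version of \<open>E\<^sub>\<nu>[D\<^sub>t | F\<^sub>t]\<close>, defined for almost every
  \<open>t\<close>. Finiteness of the conditional expectation of \<open>\<bar>D\<^sub>t\<bar>\<close> is what its existence means;
  integrability of \<open>D\<^sub>t\<close> under \<open>\<nu>\<close> is sufficient but not required.\<close>

definition cond_exp_process ::
    "'a measure \<Rightarrow> (real \<Rightarrow> 'a measure) \<Rightarrow> (real \<Rightarrow> 'a \<Rightarrow> real) \<Rightarrow> (real \<Rightarrow> 'a \<Rightarrow> real) \<Rightarrow> bool" where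
  "cond_exp_process \<nu> F D u \<longleftrightarrow> measurable_process \<nu> u \<and> adapted_01 F u \<and>
     (AE t in leb01. AE x in \<nu>.
        nn_cond_exp \<nu> (F t) (\<lambda>x. ennreal \<bar>D t x\<bar>) x < \<infinity> \<and>
        u t x = real_cond_exp \<nu> (F t) (D t) x)"

definition tendsto_in_prob :: "'a measure \<Rightarrow> (nat \<Rightarrow> 'a \<Rightarrow> real) \<Rightarrow> ('a \<Rightarrow> real) \<Rightarrow> bool" where
  "tendsto_in_prob M X Y \<longleftrightarrow>
     (\<forall>\<epsilon>>0. (\<lambda>n. measure M {x \<in> space M. \<bar>X n x - Y x\<bar> > \<epsilon>}) \<longlonglongrightarrow> 0)"

text \<open>The step process with value \<open>\<xi> i\<close> on \<open>]s i, s (i + 1)]\<close> for \<open>i < m\<close>.\<close>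

definition step_process ::
    "(real \<Rightarrow> 'a measure) \<Rightarrow> nat \<Rightarrow> (nat \<Rightarrow> real) \<Rightarrow> (nat \<Rightarrow> 'a \<Rightarrow> real) \<Rightarrow> bool" where
  "step_process F m s \<xi> \<longleftrightarrow> s 0 = 0 \<and> s m = 1 \<and> (\<forall>i<m. s i < s (Suc i)) \<and>
     (\<forall>i<m. \<xi> i \<in> borel_measurable (F (s i)) \<and> (\<exists>C. \<forall>x\<in>space (F (s i)). \<bar>\<xi> i x\<bar> \<le> C))"

definition step_value ::
    "nat \<Rightarrow> (nat \<Rightarrow> real) \<Rightarrow> (nat \<Rightarrow> 'a \<Rightarrow> real) \<Rightarrow> real \<Rightarrow> 'a \<Rightarrow> real" where
  "step_value m s \<xi> t x = (\<Sum>i<m. \<xi> i x * indicator {s i<..s (Suc i)} t)"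

definition step_integral ::
    "(real \<Rightarrow> 'a \<Rightarrow> real) \<Rightarrow> nat \<Rightarrow> (nat \<Rightarrow> real) \<Rightarrow> (nat \<Rightarrow> 'a \<Rightarrow> real) \<Rightarrow> 'a \<Rightarrow> real" where
  "step_integral B m s \<xi> x = (\<Sum>i<m. \<xi> i x * (B (s (Suc i)) x - B (s i) x))"

text \<open>\<open>I\<close> is a version of \<open>\<integral>\<^sub>0\<^sup>1 u\<^sub>t dB\<^sub>t\<close>, for measurable adapted \<open>u\<close> with \<open>\<integral>\<^sub>0\<^sup>1 u\<^sub>t\<^sup>2 dt < \<infinity>\<close>
  almost surely. The null set where that integral is infinite contributes nothing to the probabilities
  in the approximation condition.\<close>

definition has_ito_integral ::
    "'a measure \<Rightarrow> (real \<Rightarrow> 'a measure) \<Rightarrow> (real \<Rightarrow> 'a \<Rightarrow> real) \<Rightarrow> (real \<Rightarrow> 'a \<Rightarrow> real) \<Rightarrow>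
     ('a \<Rightarrow> real) \<Rightarrow> bool" where
  "has_ito_integral M F B u I \<longleftrightarrow>
     measurable_process M u \<and> adapted_01 F u \<and>
     (AE x in M. integrable leb01 (\<lambda>t. (u t x)\<^sup>2)) \<and> I \<in> borel_measurable M \<and>
     (\<exists>m s \<xi>. (\<forall>n. step_process F (m n) (s n) (\<xi> n)) \<and>
        tendsto_in_prob M
          (\<lambda>n x. LINT t|leb01. (step_value (m n) (s n) (\<xi> n) t x - u t x)\<^sup>2) (\<lambda>x. 0) \<and>
        tendsto_in_prob M (\<lambda>n. step_integral B (m n) (s n) (\<xi> n)) I)"

end

theory Submission
  imports Defs
begin

text \<open>The optimality of \<open>T\<close> plays no role: only \<open>T\<^sub>*\<mu> = \<nu>\<close> is used. It suffices that under \<open>\<nu>\<close> the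
  process \<open>B\<^sub>t = W\<^sub>t + \<integral>\<^sub>0\<^sup>t u\<close> is a Brownian motion for the filtration of \<open>W\<close> and that
  \<open>\<integral>\<^sub>0\<^sup>1 u dB = - ln L + 1/2 \<integral> u\<^sup>2\<close>; both statements are then pulled back along \<open>T\<close>.

  For a step process \<open>v\<close> put \<open>N(v) = exp(- \<integral> v dW - 1/2 \<integral> v\<^sup>2)\<close>. Suppose that \<open>N(v\<^sub>k) \<rightarrow> L\<close> in
  \<open>L\<^sup>1(\<mu>)\<close> and \<open>v\<^sub>k(t) \<rightarrow> u(t)\<close> almost surely for almost every \<open>t\<close>. The identity
  \<open>E[sqrt(N(v) N(w)) exp(1/8 \<integral> (v - w)\<^sup>2)] = 1\<close> and Fatou's lemma yield \<open>\<integral> (v\<^sub>k - u)\<^sup>2 \<rightarrow> 0\<close> almost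
  surely along a subsequence. Girsanov's theorem for step processes and
  \<open>\<integral> v\<^sub>k dB = - ln N(v\<^sub>k) - 1/2 \<integral> v\<^sub>k\<^sup>2 + \<integral> v\<^sub>k u\<close> then pass to the limit.

  To find \<open>v\<^sub>k\<close>, approximate \<open>f\<close> by cylindrical \<open>f\<^sub>k\<close> and let \<open>g\<^sub>k = 1 / (exp f\<^sub>k + 1/k)\<close>. On a fine grid
  \<open>v\<^sub>k = - E[D g\<^sub>k | F] / E[g\<^sub>k | F]\<close>, conditioned at the left end point of each interval. A second order
  expansion shows that the Hellinger affinity of \<open>g\<^sub>k / E g\<^sub>k\<close> and \<open>N(v\<^sub>k)\<close> tends to \<open>1\<close> with the mesh of
  the grid, so \<open>N(v\<^sub>k) \<rightarrow> L\<close>; conditional monotone convergence and Bayes' formula give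
  \<open>v\<^sub>k(t) \<rightarrow> E\<^sub>\<nu>[D\<^sub>t f | F\<^sub>t]\<close>.\<close>

section \<open>Lebesgue's differentiation theorem\<close>

text \<open>The obstacle is integrability. \<open>f\<close> is only in L^2 with an L^2 gradient, so
  exp (- f) need not have an integrable gradient, \<open>L\<close> is merely integrable, and D_t f
  may fail to be \<nu>-integrable; neither a martingale representation in L^2 nor Ito's isometry
  applies. Two choices answer this. Exponentials are compared by their Hellinger affinity, which is
  finite for all densities, turns products along the grid into sums of errors, and bounds the
  distance of the integrands by the L^1 distance of the densities. And exp (- f) is replaced by 1 /
  (exp f + \<kappa>), because this function of f and minus its derivative are bounded and both
  increase as \<kappa> decreases to 0, so that monotone convergence takes the place of domination.
  For fixed t the limit is taken along a whole sequence with summable errors, since a subsequence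
  would depend on t. Lebesgue's theorem enters because the Cameron-Martin norm is defined through
  \<open>deriv\<close>, while D_t f is known only as an integrand.\<close>

lemma negligible_indefinite_integral_deriv_aux:
  fixes g :: "real \<Rightarrow> real"
  assumes g: "g integrable_on {a..b}" and \<delta>: "\<delta> > 0"
  defines "h \<equiv> \<lambda>t. integral {a..t} g"
  shows "negligible {x\<in>{a..b}. \<forall>r>0. \<exists>y\<in>{a..b}. y \<noteq> x \<and> \<bar>y - x\<bar> < r \<and>
           \<delta> * \<bar>y - x\<bar> < \<bar>h y - h x - g x * (y - x)\<bar>}" (is "negligible ?E")
  unfolding negligible_outer_le
proof (intro allI impI)
  fix e :: real assume "e > 0"
  \<comment> \<open>Henstock's bound will give disjoint bad intervals a total length of at most e /
    10, and Vitali's fivefold enlargement makes this e / 2.\<close>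
  then have e': "\<delta> * e / 10 > 0" using \<delta> by simp
  have gc: "g integrable_on cbox a b" using g by simp
  obtain \<gamma> where \<gamma>: "gauge \<gamma>"
    and H: "\<And>p. \<lbrakk>p tagged_partial_division_of (cbox a b); \<gamma> fine p\<rbrakk> \<Longrightarrow>
             sum (\<lambda>(x,k). norm(measure lborel k *\<^sub>R g x - integral k g)) p < \<delta> * e / 10"
    by (rule Henstock_lemma[OF gc e']) (blast intro: that)
  have "\<exists>y\<in>{a..b}. y \<noteq> x \<and> closed_segment x y \<subseteq> \<gamma> x \<and>
           \<delta> * \<bar>y - x\<bar> < \<bar>h y - h x - g x * (y - x)\<bar>" if x: "x \<in> ?E" for x
  proof -
    have "open (\<gamma> x)" "x \<in> \<gamma> x" using \<gamma> by (auto simp: gauge_def)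
    then obtain r where r: "r > 0" "ball x r \<subseteq> \<gamma> x" using open_contains_ball by blast
    obtain y where y: "y\<in>{a..b}" "y \<noteq> x" "\<bar>y - x\<bar> < r"
      "\<delta> * \<bar>y - x\<bar> < \<bar>h y - h x - g x * (y - x)\<bar>" using x r(1) by blast
    have "closed_segment x y \<subseteq> ball x r"
      using y(3) r(1) by (intro closed_segment_subset) (auto simp: dist_real_def)
    with r y show ?thesis by blast
  qed
  then have "\<forall>x\<in>?E. \<exists>y. y\<in>{a..b} \<and> y \<noteq> x \<and> closed_segment x y \<subseteq> \<gamma> x \<and>
           \<delta> * \<bar>y - x\<bar> < \<bar>h y - h x - g x * (y - x)\<bar>" by blast
  from bchoice[OF this] obtain y where yE: "\<forall>x\<in>?E. y x\<in>{a..b} \<and> y x \<noteq> x \<and>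
     closed_segment x (y x) \<subseteq> \<gamma> x \<and> \<delta> * \<bar>y x - x\<bar> < \<bar>h (y x) - h x - g x * (y x - x)\<bar>" ..
  note y = yE[rule_format, THEN conjunct1] yE[rule_format, THEN conjunct2, THEN conjunct1]
    yE[rule_format, THEN conjunct2, THEN conjunct2, THEN conjunct1]
    yE[rule_format, THEN conjunct2, THEN conjunct2, THEN conjunct2]
  \<comment> \<open>The segment from the tag x to \<open>y x\<close> is rewritten as a ball, the
    form the covering lemma works with; x is one of its two end points.\<close>
  define c where "c = (\<lambda>x. (x + y x) / 2)"
  define r where "r = (\<lambda>x. \<bar>y x - x\<bar> / 2)"
  have seg: "cball (c x) (r x) = closed_segment x (y x)" for x
    unfolding c_def r_def by (auto simp: cball_eq_atLeastAtMost closed_segment_eq_real_ivl field_simps)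
  have xin: "x \<in> cball (c x) (r x)" for x unfolding seg by simp
  have rpos: "x \<in> ?E \<Longrightarrow> 0 < r x \<and> r x \<le> b - a" for x
    using y(1,2)[of x] unfolding r_def by auto
  obtain C where C: "countable C" "C \<subseteq> ?E"
     "pairwise (\<lambda>i j. disjnt (cball (c i) (r i)) (cball (c j) (r j))) C"
     "?E \<subseteq> (\<Union>i\<in>C. cball (c i) (5 * r i))"
    by (rule Vitali_covering_lemma_cballs[where S="?E" and K="?E" and a=c and r=r and B="b - a"]) (use xin rpos in auto)
  have bound: "(\<Sum>x\<in>D. 10 * r x) \<le> e" if D: "D \<subseteq> C" "finite D" for D
  proof -
    define p where "p = (\<lambda>x. (x, cball (c x) (r x))) ` D"
    have inj: "inj_on (\<lambda>x. (x, cball (c x) (r x))) D" by (auto simp: inj_on_def)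
    have "p tagged_partial_division_of (cbox a b)"
      unfolding tagged_partial_division_of_def
    proof (intro conjI allI impI)
      show "finite p" using D by (simp add: p_def)
      fix x K assume xK: "(x, K) \<in> p"
      then have x: "x \<in> ?E" using D C by (auto simp: p_def)
      show "x \<in> K" using xK xin by (auto simp: p_def)
      show "K \<subseteq> cbox a b" using xK y(1)[OF x] x
        by (auto simp: p_def seg closed_segment_eq_real_ivl split: if_splits)
      show "\<exists>a b. K = cbox a b" using xK
        by (auto simp: p_def cball_eq_atLeastAtMost)
    next
      fix x1 K1 x2 K2 assume "(x1, K1) \<in> p \<and> (x2, K2) \<in> p \<and> (x1, K1) \<noteq> (x2, K2)"
      then have K: "K1 = cball (c x1) (r x1)" "K2 = cball (c x2) (r x2)"
        and "x1 \<in> C" "x2 \<in> C" "x1 \<noteq> x2"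
        using D by (auto simp: p_def)
      then have "disjnt K1 K2" using C(3) by (auto simp: pairwise_def)
      then show "interior K1 \<inter> interior K2 = {}"
        using interior_subset by (fastforce simp: disjnt_def)
    qed
    moreover have "\<gamma> fine p"
      unfolding fine_def
    proof (intro ballI, clarify)
      fix x K z assume "(x, K) \<in> p" "z \<in> K"
      then have "x \<in> ?E" "z \<in> closed_segment x (y x)" using D C(2) by (auto simp: p_def seg)
      then show "z \<in> \<gamma> x" using y(3)[of x] by blast
    qed
    ultimately have "sum (\<lambda>(x,k). norm(measure lborel k *\<^sub>R g x - integral k g)) p < \<delta> * e / 10"
      by (rule H)
    also have "sum (\<lambda>(x,k). norm(measure lborel k *\<^sub>R g x - integral k g)) p =
       (\<Sum>x\<in>D. \<bar>measure lborel (cball (c x) (r x)) * g x - integral (cball (c x) (r x)) g\<bar>)"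
      unfolding p_def by (subst sum.reindex[OF inj]) simp
    finally have 1: "(\<Sum>x\<in>D. \<bar>measure lborel (cball (c x) (r x)) * g x - integral (cball (c x) (r x)) g\<bar>) < \<delta> * e / 10" .
    have 2: "\<delta> * (2 * r x) \<le> \<bar>measure lborel (cball (c x) (r x)) * g x - integral (cball (c x) (r x)) g\<bar>"
      if "x \<in> D" for x
    proof -
      have x: "x \<in> ?E" using that D C by auto
      have int: "integral {u..v} g = h v - h u" if "a \<le> u" "u \<le> v" "v \<le> b" for u v
      proof -
        have "g integrable_on {a..v}"
          using g that by (meson atLeastatMost_subset_iff integrable_subinterval_real order_refl)
        from Henstock_Kurzweil_Integration.integral_combine[OF that(1,2) this]
        show ?thesis by (simp add: h_def)
      qed
      show ?thesis
      proof (cases "x < y x")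
        case True
        then have "cball (c x) (r x) = {x..y x}" by (simp add: seg closed_segment_eq_real_ivl)
        then have "measure lborel (cball (c x) (r x)) * g x - integral (cball (c x) (r x)) g
            = - (h (y x) - h x - g x * (y x - x))" using int[of x "y x"] y(1)[OF x] x True
          by (simp add: algebra_simps)
        then show ?thesis using y(4)[OF x] by (simp only: abs_minus_cancel) (simp add: r_def)
      next
        case False
        with y(2)[OF x] have yx: "y x < x" by simp
        then have "cball (c x) (r x) = {y x..x}" by (simp add: seg closed_segment_eq_real_ivl)
        then have "measure lborel (cball (c x) (r x)) * g x - integral (cball (c x) (r x)) g
            = h (y x) - h x - g x * (y x - x)" using int[of "y x" x] y(1)[OF x] x yx
          by (simp add: algebra_simps)
        then show ?thesis using y(4)[OF x] by (simp only:) (simp add: r_def)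
      qed
    qed
    have "\<delta> * (\<Sum>x\<in>D. 2 * r x) = (\<Sum>x\<in>D. \<delta> * (2 * r x))" by (simp add: sum_distrib_left)
    also have "\<dots> \<le> (\<Sum>x\<in>D. \<bar>measure lborel (cball (c x) (r x)) * g x - integral (cball (c x) (r x)) g\<bar>)"
      by (rule sum_mono) (rule 2)
    also have "\<dots> \<le> \<delta> * (e / 10)" using 1 by simp
    finally have "(\<Sum>x\<in>D. 2 * r x) \<le> e / 10" using \<delta> by simp
    moreover have "(\<Sum>x\<in>D. 10 * r x) = 5 * (\<Sum>x\<in>D. 2 * r x)" by (simp add: sum_distrib_left)
    ultimately show ?thesis using \<open>e > 0\<close> by linarith
  qed
  have meas: "measure lebesgue (\<Union>i\<in>D. cball (c i) (5 * r i)) \<le> e" if D: "D \<subseteq> C" "finite D" for D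
  proof -
    have "measure lebesgue (\<Union>i\<in>D. cball (c i) (5 * r i)) \<le> (\<Sum>i\<in>D. measure lebesgue (cball (c i) (5 * r i)))"
      by (rule measure_UNION_le) (use D in auto)
    also have "\<dots> = (\<Sum>x\<in>D. 10 * r x)"
    proof (rule sum.cong[OF refl])
      fix x assume "x \<in> D"
      then have "0 < r x" using rpos D C by auto
      then show "measure lebesgue (cball (c x) (5 * r x)) = 10 * r x"
        by (simp add: cball_eq_atLeastAtMost)
    qed
    also have "\<dots> \<le> e" by (rule bound[OF D])
    finally show ?thesis .
  qed
  show "\<exists>T. ?E \<subseteq> T \<and> T \<in> lmeasurable \<and> measure lebesgue T \<le> e"
  proof (intro exI conjI)
    show "?E \<subseteq> (\<Union>i\<in>C. cball (c i) (5 * r i))" by (rule C(4))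
    show "(\<Union>i\<in>C. cball (c i) (5 * r i)) \<in> lmeasurable"
      by (rule fmeasurable_UN_bound[OF C(1) _ meas]) auto
    show "measure lebesgue (\<Union>i\<in>C. cball (c i) (5 * r i)) \<le> e"
      by (rule measure_UN_bound[OF C(1) _ meas]) auto
  qed
qed

text \<open>Lebesgue's differentiation theorem: Henstock's lemma bounds the total length of disjoint
  intervals on which the difference quotient is off by more than \<open>\<delta>\<close>, and Vitali's covering
  lemma turns this into a bound on the exceptional set.\<close>

theorem negligible_indefinite_integral_deriv:
  fixes g :: "real \<Rightarrow> real"
  assumes g: "g integrable_on {a..b}"
  shows "negligible {x\<in>{a<..<b}. \<not> ((\<lambda>t. integral {a..t} g) has_real_derivative g x) (at x)}"
proof -
  define h where "h = (\<lambda>t. integral {a..t} g)"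
  define E where "E = (\<lambda>\<delta>. {x\<in>{a..b}. \<forall>r>0. \<exists>y\<in>{a..b}. y \<noteq> x \<and> \<bar>y - x\<bar> < r \<and>
           \<delta> * \<bar>y - x\<bar> < \<bar>h y - h x - g x * (y - x)\<bar>})"
  have "negligible (\<Union>n. E (1 / real (Suc n)))"
  proof (rule negligible_countable_Union)
    fix S assume "S \<in> range (\<lambda>n. E (1 / real (Suc n)))"
    then obtain n where S: "S = E (1 / real (Suc n))" by blast
    show "negligible S" unfolding S E_def h_def
      by (rule negligible_indefinite_integral_deriv_aux[OF g]) simp
  qed simp
  moreover have "{x\<in>{a<..<b}. \<not> (h has_real_derivative g x) (at x)} \<subseteq> (\<Union>n. E (1 / real (Suc n)))"
  proof clarify
    fix x assume x: "x \<in> {a<..<b}" and nd: "\<not> (h has_real_derivative g x) (at x)"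
    show "x \<in> (\<Union>n. E (1 / real (Suc n)))"
    proof (rule ccontr)
      assume "x \<notin> (\<Union>n. E (1 / real (Suc n)))"
      then have *: "\<exists>r>0. \<forall>y\<in>{a..b}. y \<noteq> x \<longrightarrow> \<bar>y - x\<bar> < r \<longrightarrow>
           \<bar>h y - h x - g x * (y - x)\<bar> \<le> 1 / real (Suc n) * \<bar>y - x\<bar>" for n
        using x unfolding E_def by (fastforce simp: not_less)
      have "(\<lambda>y. (h y - h x) / (y - x)) \<midarrow>x\<rightarrow> g x"
        unfolding LIM_eq
      proof (intro allI impI)
        fix e :: real assume "e > 0"
        then obtain n where n: "1 / real (Suc n) < e"
          using nat_approx_posE by blast
        obtain r where r: "r > 0" "\<forall>y\<in>{a..b}. y \<noteq> x \<longrightarrow> \<bar>y - x\<bar> < r \<longrightarrow>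
           \<bar>h y - h x - g x * (y - x)\<bar> \<le> 1 / real (Suc n) * \<bar>y - x\<bar>" using *[of n] by blast
        show "\<exists>s>0. \<forall>y. y \<noteq> x \<and> norm (y - x) < s \<longrightarrow> norm ((h y - h x) / (y - x) - g x) < e"
        proof (intro exI conjI allI impI)
          show "0 < min r (min (x - a) (b - x))" using x r by simp
          fix y assume y: "y \<noteq> x \<and> norm (y - x) < min r (min (x - a) (b - x))"
          then have "y \<in> {a..b}" by (auto simp: abs_if split: if_splits)
          then have "\<bar>h y - h x - g x * (y - x)\<bar> \<le> 1 / real (Suc n) * \<bar>y - x\<bar>"
            using r(2) y by (simp del: of_nat_Suc)
          moreover have "(h y - h x) / (y - x) - g x = (h y - h x - g x * (y - x)) / (y - x)"
            using y by (simp add: field_simps)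
          ultimately have "norm ((h y - h x) / (y - x) - g x) \<le> 1 / real (Suc n)"
            using y by (simp only: real_norm_def abs_divide) (simp add: pos_divide_le_eq del: of_nat_Suc)
          then show "norm ((h y - h x) / (y - x) - g x) < e" using n by linarith
        qed
      qed
      then show False using nd by (simp add: has_field_derivative_iff)
    qed
  qed
  ultimately show ?thesis unfolding h_def by (rule negligible_subset)
qed

section \<open>Gaussian estimates\<close>

text \<open>The parameter is the variance, because it will be the length of a time interval.\<close>

definition gauss :: "real \<Rightarrow> real measure" where
  "gauss h = density lborel (\<lambda>y. ennreal (normal_density 0 (sqrt h) y))"

lemma sets_gauss [simp, measurable_cong]: "sets (gauss h) = sets borel"
  and space_gauss [simp]: "space (gauss h) = UNIV"
  by (simp_all add: gauss_def)

lemma prob_space_gauss: "h > 0 \<Longrightarrow> prob_space (gauss h)"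
  unfolding gauss_def by (rule prob_space_normal_density) simp

text \<open>Completing the square. This is the one-dimensional Cameron-Martin formula on which every
  change of measure below is built.\<close>

lemma normal_density_exp_shift:
  assumes "h > 0"
  shows "normal_density 0 (sqrt h) z * exp (c * z) = exp (c\<^sup>2 * h / 2) * normal_density (c * h) (sqrt h) z"
proof -
  have "- z\<^sup>2 / (2 * h) + c * z = c\<^sup>2 * h / 2 - (z - c * h)\<^sup>2 / (2 * h)"
    using assms by (simp add: field_simps power2_eq_square)
  then show ?thesis
    using assms by (simp add: normal_density_def flip: exp_add)
qed

lemma nn_integral_gauss_exp:
  assumes h: "h > 0" and [measurable]: "f \<in> borel_measurable borel"
  shows "(\<integral>\<^sup>+z. ennreal (exp (c * z)) * f z \<partial>gauss h)
       = ennreal (exp (c\<^sup>2 * h / 2)) * (\<integral>\<^sup>+z. f (z + c * h) \<partial>gauss h)"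
proof -
  have "(\<integral>\<^sup>+z. ennreal (exp (c * z)) * f z \<partial>gauss h)
      = (\<integral>\<^sup>+z. ennreal (exp (c\<^sup>2 * h / 2)) * (ennreal (normal_density (c * h) (sqrt h) z) * f z) \<partial>lborel)"
    unfolding gauss_def using normal_density_exp_shift[OF h]
    by (subst nn_integral_density)
       (auto simp: mult.assoc[symmetric] simp flip: ennreal_mult intro!: nn_integral_cong)
  also have "\<dots> = ennreal (exp (c\<^sup>2 * h / 2)) * (\<integral>\<^sup>+z. ennreal (normal_density (c * h) (sqrt h) z) * f z \<partial>lborel)"
    by (subst nn_integral_cmult) auto
  also have "(\<integral>\<^sup>+z. ennreal (normal_density (c * h) (sqrt h) z) * f z \<partial>lborel)
      = (\<integral>\<^sup>+z. ennreal (normal_density (c * h) (sqrt h) (c * h + 1 * z)) * f (c * h + 1 * z) \<partial>lborel)"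
    by (subst nn_integral_real_affine[where c=1 and t="c * h"]) auto
  also have "\<dots> = (\<integral>\<^sup>+z. f (z + c * h) \<partial>gauss h)"
    unfolding gauss_def
    by (subst nn_integral_density) (auto simp: normal_density_def add.commute intro!: nn_integral_cong)
  finally show ?thesis .
qed

lemma gauss_mgf:
  assumes h: "h > 0"
  shows "integrable (gauss h) (\<lambda>z. exp (c * z))" "(\<integral>z. exp (c * z) \<partial>gauss h) = exp (c\<^sup>2 * h / 2)"
proof -
  interpret prob_space "gauss h" by (rule prob_space_gauss[OF h])
  have *: "(\<integral>\<^sup>+z. ennreal (exp (c * z)) \<partial>gauss h) = ennreal (exp (c\<^sup>2 * h / 2))"
    using nn_integral_gauss_exp[OF h, of "\<lambda>_. 1" c] emeasure_space_1 by simp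
  show "integrable (gauss h) (\<lambda>z. exp (c * z))"
    by (rule integrableI_nn_integral_finite[OF _ _ *]) auto
  show "(\<integral>z. exp (c * z) \<partial>gauss h) = exp (c\<^sup>2 * h / 2)"
    by (subst integral_eq_nn_integral) (auto simp: *)
qed

text \<open>Reduction to variance 1 exposes the powers of \<open>h\<close> in the moment
  bounds.\<close>

lemma nn_integral_gauss_scale:
  assumes h: "h > 0" and [measurable]: "f \<in> borel_measurable borel"
  shows "(\<integral>\<^sup>+z. f z \<partial>gauss h) = (\<integral>\<^sup>+z. f (sqrt h * z) \<partial>gauss 1)"
proof -
  have "(\<integral>\<^sup>+z. f z \<partial>gauss h) = (\<integral>\<^sup>+z. ennreal (normal_density 0 (sqrt h) z) * f z \<partial>lborel)"
    unfolding gauss_def by (subst nn_integral_density) auto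
  also have "\<dots> = ennreal (sqrt h) * (\<integral>\<^sup>+z. ennreal (normal_density 0 (sqrt h) (0 + sqrt h * z)) * f (0 + sqrt h * z) \<partial>lborel)"
    by (subst nn_integral_real_affine[where c="sqrt h" and t=0]) (use h in auto)
  also have "\<dots> = (\<integral>\<^sup>+z. ennreal (sqrt h) * (ennreal (normal_density 0 (sqrt h) (0 + sqrt h * z)) * f (0 + sqrt h * z)) \<partial>lborel)"
    by (subst nn_integral_cmult) auto
  also have "\<dots> = (\<integral>\<^sup>+z. ennreal (normal_density 0 1 z) * f (sqrt h * z) \<partial>lborel)"
  proof (rule nn_integral_cong)
    fix z
    have "sqrt h * normal_density 0 (sqrt h) (0 + sqrt h * z) = normal_density 0 1 z"
      using h by (simp add: normal_density_def power_mult_distrib real_sqrt_mult)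
    then show "ennreal (sqrt h) * (ennreal (normal_density 0 (sqrt h) (0 + sqrt h * z)) * f (0 + sqrt h * z))
       = ennreal (normal_density 0 1 z) * f (sqrt h * z)"
      using h by (simp add: mult.assoc[symmetric] flip: ennreal_mult)
  qed
  also have "\<dots> = (\<integral>\<^sup>+z. f (sqrt h * z) \<partial>gauss 1)"
    unfolding gauss_def by (subst nn_integral_density) auto
  finally show ?thesis .
qed

text \<open>exp (c |z|) is at most exp (c z) + exp (- c z), whence the factor 2.\<close>

lemma gauss_exp_abs:
  assumes h: "h > 0"
  shows "integrable (gauss h) (\<lambda>z. exp (c * \<bar>z\<bar>))" "(\<integral>z. exp (c * \<bar>z\<bar>) \<partial>gauss h) \<le> 2 * exp (c\<^sup>2 * h / 2)"
proof -
  have le: "exp (c * \<bar>z\<bar>) \<le> exp (c * z) + exp (- c * z)" for z :: real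
    by (auto simp: abs_if)
  have i: "integrable (gauss h) (\<lambda>z. exp (c * z) + exp (- c * z))"
    by (intro Bochner_Integration.integrable_add gauss_mgf h)
  show 1: "integrable (gauss h) (\<lambda>z. exp (c * \<bar>z\<bar>))"
    by (rule Bochner_Integration.integrable_bound[OF i]) (use le in \<open>auto intro!: AE_I2\<close>)
  have "(\<integral>z. exp (c * \<bar>z\<bar>) \<partial>gauss h) \<le> (\<integral>z. exp (c * z) + exp (- c * z) \<partial>gauss h)"
    by (rule integral_mono[OF 1 i le])
  also have "\<dots> = 2 * exp (c\<^sup>2 * h / 2)"
    using gauss_mgf[OF h, of c] gauss_mgf[OF h, of "-c"] by simp
  finally show "(\<integral>z. exp (c * \<bar>z\<bar>) \<partial>gauss h) \<le> 2 * exp (c\<^sup>2 * h / 2)" .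
qed

text \<open>Fourth power of t \<le> exp t at t = |z| / 4, whence 256 = 4^4.\<close>

lemma power4_le_exp: "\<bar>z\<bar> ^ 4 \<le> 256 * exp \<bar>z::real\<bar>"
proof -
  have "\<bar>z\<bar> / 4 \<le> exp (\<bar>z\<bar> / 4)" using exp_ge_add_one_self[of "\<bar>z\<bar> / 4"] by linarith
  then have "(\<bar>z\<bar> / 4) ^ 4 \<le> exp (\<bar>z\<bar> / 4) ^ 4" by (intro power_mono) auto
  also have "\<dots> = exp \<bar>z\<bar>" by (simp flip: exp_of_nat_mult)
  finally show ?thesis by (simp add: power_divide)
qed

text \<open>Scaling z by sqrt h produces the factor h^2, while h \<le> 1 keeps the rate of the
  exponential below c; 512 is 2 * 256. An error of order h^2 per interval is what can be summed over
  a fine grid.\<close>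

lemma gauss_power4_exp_abs:
  assumes h: "0 < h" "h \<le> 1" and c: "c \<ge> 0"
  shows "integrable (gauss h) (\<lambda>z. z ^ 4 * exp (c * \<bar>z\<bar>))"
    "(\<integral>z. z ^ 4 * exp (c * \<bar>z\<bar>) \<partial>gauss h) \<le> 512 * exp ((c + 1)\<^sup>2 / 2) * h\<^sup>2"
proof -
  have bnd: "z ^ 4 * exp (c * \<bar>z\<bar>) \<le> 256 * exp ((c + 1) * \<bar>z\<bar>)" for z :: real
  proof -
    have "z ^ 4 * exp (c * \<bar>z\<bar>) \<le> 256 * exp \<bar>z\<bar> * exp (c * \<bar>z\<bar>)"
      using power4_le_exp[of z] by (intro mult_right_mono) (auto simp: power_even_abs_numeral)
    then show ?thesis by (simp add: mult.assoc distrib_right flip: exp_add) (simp add: add.commute)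
  qed
  show 1: "integrable (gauss h) (\<lambda>z. z ^ 4 * exp (c * \<bar>z\<bar>))"
    by (rule Bochner_Integration.integrable_bound[OF integrable_mult_right[OF gauss_exp_abs(1)[OF h(1)], of 256 "c + 1"]])
       (use bnd in \<open>auto intro!: AE_I2\<close>)
  have "(\<integral>\<^sup>+z. ennreal (z ^ 4 * exp (c * \<bar>z\<bar>)) \<partial>gauss h)
      = (\<integral>\<^sup>+z. ennreal ((sqrt h * z) ^ 4 * exp (c * \<bar>sqrt h * z\<bar>)) \<partial>gauss 1)"
    by (rule nn_integral_gauss_scale[OF h(1)]) auto
  also have "\<dots> \<le> (\<integral>\<^sup>+z. ennreal (h\<^sup>2 * (256 * exp ((c + 1) * \<bar>z\<bar>))) \<partial>gauss 1)"
  proof (intro nn_integral_mono ennreal_leI)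
    fix z :: real
    have "sqrt h * \<bar>z\<bar> \<le> \<bar>z\<bar>" using h by (intro mult_left_le_one_le) auto
    then have "c * \<bar>sqrt h * z\<bar> \<le> c * \<bar>z\<bar>" using h c by (auto simp: abs_mult intro!: mult_left_mono)
    moreover have "sqrt h ^ 4 = h\<^sup>2" using h
      by (metis less_eq_real_def mult_2 numeral_Bit0 power_add real_sqrt_pow2 power2_eq_square)
    ultimately have "(sqrt h * z) ^ 4 * exp (c * \<bar>sqrt h * z\<bar>) \<le> h\<^sup>2 * (z ^ 4 * exp (c * \<bar>z\<bar>))"
      by (auto simp: power_mult_distrib mult.assoc intro!: mult_left_mono)
    also have "\<dots> \<le> h\<^sup>2 * (256 * exp ((c + 1) * \<bar>z\<bar>))"
      by (intro mult_left_mono bnd) auto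
    finally show "(sqrt h * z) ^ 4 * exp (c * \<bar>sqrt h * z\<bar>) \<le> h\<^sup>2 * (256 * exp ((c + 1) * \<bar>z\<bar>))" .
  qed
  also have "\<dots> = ennreal (\<integral>z. h\<^sup>2 * (256 * exp ((c + 1) * \<bar>z\<bar>)) \<partial>gauss 1)"
    by (intro nn_integral_eq_integral) (auto intro!: gauss_exp_abs)
  also have "\<dots> \<le> ennreal (512 * exp ((c + 1)\<^sup>2 / 2) * h\<^sup>2)"
    using mult_left_mono[OF gauss_exp_abs(2)[of 1 "c + 1"], of "256 * h\<^sup>2"]
    by (intro ennreal_leI) (simp add: algebra_simps)
  finally have "ennreal (\<integral>z. z ^ 4 * exp (c * \<bar>z\<bar>) \<partial>gauss h) \<le> ennreal (512 * exp ((c + 1)\<^sup>2 / 2) * h\<^sup>2)"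
    by (subst (asm) nn_integral_eq_integral[OF 1]) auto
  then show "(\<integral>z. z ^ 4 * exp (c * \<bar>z\<bar>) \<partial>gauss h) \<le> 512 * exp ((c + 1)\<^sup>2 / 2) * h\<^sup>2"
    by (subst (asm) ennreal_le_iff) auto
qed

section \<open>Second order comparison of a positive function with an exponential\<close>

lemma exp_second_order: "\<bar>exp w - 1 - w\<bar> \<le> w\<^sup>2 * exp \<bar>w::real\<bar>"
proof -
  obtain t where t: "\<bar>t\<bar> \<le> \<bar>w\<bar>" "exp w = (\<Sum>m<2. w ^ m / fact m) + exp t / fact 2 * w ^ 2"
    using Maclaurin_exp_le[of w 2] by blast
  then have "\<bar>exp w - 1 - w\<bar> = exp t / 2 * w\<^sup>2"
    by (simp add: numeral_2_eq_2)
  also have "\<dots> \<le> exp \<bar>w\<bar> * w\<^sup>2"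
  proof (intro mult_right_mono)
    have "exp t \<le> exp \<bar>w\<bar>" using t(1) by simp
    then show "exp t / 2 \<le> exp \<bar>w\<bar>" using exp_gt_zero[of t] by linarith
  qed simp
  finally show ?thesis by (simp add: mult.commute)
qed

text \<open>The gap between arithmetic and geometric mean is (sqrt x - sqrt y)^2 / 2, and sqrt x -
  sqrt y is x - y divided by sqrt x + sqrt y. The constant rests on a lower bound for x alone, since
  y is going to be an exponential that comes arbitrarily close to 0.\<close>

lemma sqrt_mult_ge_quadratic:
  fixes x y k :: real
  assumes "x > 0" "y > 0" "1 / k \<le> x" "k > 0"
  shows "(x + y) / 2 - k * (x - y)\<^sup>2 / 2 \<le> sqrt (x * y)"
proof -
  have "(x + y) - 2 * sqrt (x * y) = (sqrt x - sqrt y)\<^sup>2"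
    using assms by (simp add: power2_diff real_sqrt_mult)
  also have "\<dots> = (x - y)\<^sup>2 / (sqrt x + sqrt y)\<^sup>2"
  proof -
    have "x - y = (sqrt x - sqrt y) * (sqrt x + sqrt y)"
      using assms by (simp add: algebra_simps)
    moreover have "sqrt x + sqrt y > 0" using assms by (simp add: add_pos_pos)
    ultimately show ?thesis by (simp add: power_mult_distrib)
  qed
  also have "\<dots> \<le> (x - y)\<^sup>2 / (1 / k)"
  proof (rule divide_left_mono)
    have "1 / k \<le> (sqrt x)\<^sup>2" using assms by simp
    also have "\<dots> \<le> (sqrt x + sqrt y)\<^sup>2" using assms by (intro power_mono) auto
    finally show "1 / k \<le> (sqrt x + sqrt y)\<^sup>2" .
    then show "0 < (sqrt x + sqrt y)\<^sup>2 * (1 / k)" using assms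
      by (smt (verit) mult_pos_pos zero_less_divide_1_iff)
  qed simp
  also have "\<dots> = k * (x - y)\<^sup>2" by simp
  finally show ?thesis by (simp add: field_simps)
qed

lemma gauss_second_moment:
  assumes h: "h > 0"
  shows "integrable (gauss h) (\<lambda>z. z\<^sup>2)" "(\<integral>z. z\<^sup>2 \<partial>gauss h) = h"
proof -
  have *: "has_bochner_integral lborel (\<lambda>x. normal_density 0 (sqrt h) x * x\<^sup>2) h"
    using normal_moment_even[of "sqrt h" 0 1] h by (simp add: fact_numeral)
  show "integrable (gauss h) (\<lambda>z. z\<^sup>2)"
    unfolding gauss_def using integrable.intros[OF *] by (subst integrable_density) auto
  show "(\<integral>z. z\<^sup>2 \<partial>gauss h) = h"
    unfolding gauss_def using has_bochner_integral_integral_eq[OF *] by (subst integral_density) auto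
qed

lemma gauss_first_moment:
  assumes h: "h > 0"
  shows "integrable (gauss h) (\<lambda>z. z)" "(\<integral>z. z \<partial>gauss h) = 0"
proof -
  have *: "has_bochner_integral lborel (\<lambda>x. normal_density 0 (sqrt h) x * x) 0"
    using normal_moment_odd[of "sqrt h" 0 0] h by simp
  show "integrable (gauss h) (\<lambda>z. z)"
    unfolding gauss_def using integrable.intros[OF *] by (subst integrable_density) auto
  show "(\<integral>z. z \<partial>gauss h) = 0"
    unfolding gauss_def using has_bochner_integral_integral_eq[OF *] by (subst integral_density) auto
qed

lemma integral_le_nn_integral:
  assumes "integrable M f"
  shows "ennreal (\<integral>x. f x \<partial>M) \<le> (\<integral>\<^sup>+x. ennreal (f x) \<partial>M)"
proof -
  have "(\<integral>x. f x \<partial>M) \<le> (\<integral>x. max 0 (f x) \<partial>M)"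
    using assms by (intro integral_mono) auto
  then have "ennreal (\<integral>x. f x \<partial>M) \<le> ennreal (\<integral>x. max 0 (f x) \<partial>M)" by (rule ennreal_leI)
  also have "\<dots> = (\<integral>\<^sup>+x. ennreal (max 0 (f x)) \<partial>M)"
    by (rule nn_integral_eq_integral[symmetric]) (use assms in auto)
  finally show ?thesis by (simp add: ennreal_max_0)
qed

text \<open>Both p / m and y have the first order expansion 1 - v z, with remainders of order z^2 +
  h up to an exponential factor. Here p and p0 are the values at z and 0 of a function with
  derivative d at 0, while m and D stand for Gaussian averages of the function and of its
  derivative.\<close>

lemma hellinger_one_step_pointwise:
  fixes K a h p p0 m d D v z :: real
  assumes a: "0 < a" and K: "1 \<le> K" "a \<le> 1" and h: "0 < h" "h \<le> 1"
    and p: "\<bar>p - p0 - d * z\<bar> \<le> K * z\<^sup>2" and m: "a \<le> m" "\<bar>m - p0\<bar> \<le> K * h"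
    and D: "\<bar>D\<bar> \<le> K" "\<bar>D - d\<bar> \<le> K * sqrt h" and v: "v = - D / m"
  defines "y \<equiv> exp (- v * z - v\<^sup>2 * h / 2)"
  shows "(p / m - y)\<^sup>2 \<le> 200 * (K / a) ^ 8 * exp (2 * (K / a)\<^sup>2) * (z ^ 4 * exp (2 * (K / a) * \<bar>z\<bar>) + h\<^sup>2 * exp (2 * (K / a) * \<bar>z\<bar>))"
proof -
  define q where "q = K / a"
  have q1: "1 \<le> q" using a K by (simp add: q_def)
  have mpos: "m > 0" using a m by linarith
  have vq: "\<bar>v\<bar> \<le> q"
    using v D(1) m a K mpos unfolding q_def by (auto simp: abs_divide intro!: frac_le)
  \<comment> \<open>The replacement of d by D costs sqrt h |z|, which is of the same order as the
    Taylor remainder.\<close>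
  have hz: "sqrt h * \<bar>z\<bar> \<le> h + z\<^sup>2"
  proof -
    have "2 * (sqrt h * \<bar>z\<bar>) \<le> (sqrt h)\<^sup>2 + \<bar>z\<bar>\<^sup>2"
      using sum_squares_bound[of "sqrt h" "\<bar>z\<bar>"] by simp
    moreover have "0 \<le> sqrt h * \<bar>z\<bar>" using h by simp
    ultimately have "sqrt h * \<bar>z\<bar> \<le> (sqrt h)\<^sup>2 + \<bar>z\<bar>\<^sup>2" by linarith
    then show ?thesis using h by simp
  qed
  define s where "s = z\<^sup>2 + h"
  have s0: "0 \<le> s" using h by (simp add: s_def)
  have R: "\<bar>p / m - 1 + v * z\<bar> \<le> q * (2 * s)"
  proof -
    have "p / m - 1 + v * z = ((p - p0 - d * z) - (m - p0) - (D - d) * z) / m"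
      using mpos unfolding v by (simp add: field_simps)
    then have "\<bar>p / m - 1 + v * z\<bar> = \<bar>(p - p0 - d * z) - (m - p0) - (D - d) * z\<bar> / m"
      using mpos by (simp add: abs_divide)
    also have "\<dots> \<le> (K * (2 * s)) / a"
    proof (rule frac_le)
      have "\<bar>(D - d) * z\<bar> \<le> K * sqrt h * \<bar>z\<bar>"
        using D(2) by (simp add: abs_mult mult_right_mono)
      also have "\<dots> \<le> K * (h + z\<^sup>2)" using hz K by (simp add: mult.assoc mult_left_mono)
      finally have "\<bar>(p - p0 - d * z) - (m - p0) - (D - d) * z\<bar> \<le> K * z\<^sup>2 + K * h + K * (h + z\<^sup>2)"
        using p m(2) by linarith
      then show "\<bar>(p - p0 - d * z) - (m - p0) - (D - d) * z\<bar> \<le> K * (2 * s)"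
        by (simp add: s_def algebra_simps)
      show "0 \<le> K * (2 * s)" using s0 K by simp
    qed (use a m in auto)
    finally show ?thesis by (simp add: q_def)
  qed
  define w where "w = - v * z - v\<^sup>2 * h / 2"
  have v2: "v\<^sup>2 \<le> q\<^sup>2" using vq q1 by (simp add: abs_le_square_iff[symmetric])
  have v2h: "0 \<le> v\<^sup>2 * h" "v\<^sup>2 * h \<le> q\<^sup>2 * h" using v2 h by (auto intro: mult_right_mono)
  have q2h: "q\<^sup>2 * h \<le> q\<^sup>2" using h by (simp add: mult_left_le)
  have wabs: "\<bar>w\<bar> \<le> q * \<bar>z\<bar> + q\<^sup>2"
  proof -
    have "\<bar>v * z\<bar> \<le> q * \<bar>z\<bar>" using vq by (simp add: abs_mult mult_right_mono)
    then show ?thesis unfolding w_def using v2h q2h by linarith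
  qed
  have w2: "w\<^sup>2 \<le> 2 * q ^ 4 * s"
  proof -
    have "w\<^sup>2 \<le> 2 * (v * z)\<^sup>2 + 2 * (v\<^sup>2 * h / 2)\<^sup>2"
      unfolding w_def using sum_squares_bound[of "v * z" "v\<^sup>2 * h / 2"]
      by (simp add: power2_eq_square algebra_simps)
    moreover have "(v * z)\<^sup>2 \<le> q\<^sup>2 * z\<^sup>2" using v2 by (simp add: power_mult_distrib mult_right_mono)
    moreover have "(v\<^sup>2 * h / 2)\<^sup>2 \<le> q ^ 4 * h"
    proof -
      have "(v\<^sup>2 * h / 2)\<^sup>2 \<le> (q\<^sup>2 * h)\<^sup>2" using v2h by (intro power_mono) auto
      also have "\<dots> = q ^ 4 * h * h" by (simp add: power_mult_distrib power2_eq_square power4_eq_xxxx)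
      also have "\<dots> \<le> q ^ 4 * h * 1" using h q1 by (intro mult_left_mono) auto
      finally show ?thesis by simp
    qed
    moreover have "q\<^sup>2 * z\<^sup>2 \<le> q ^ 4 * z\<^sup>2" using q1 by (intro mult_right_mono power_increasing) auto
    ultimately show ?thesis by (simp add: s_def algebra_simps)
  qed
  define E where "E = exp (q * \<bar>z\<bar> + q\<^sup>2)"
  have E1: "1 \<le> E" using q1 by (simp add: E_def)
  have Y: "\<bar>y - 1 + v * z\<bar> \<le> 3 * q ^ 4 * s * E"
  proof -
    have "\<bar>exp w - 1 - w\<bar> \<le> w\<^sup>2 * exp \<bar>w\<bar>" by (rule exp_second_order)
    also have "\<dots> \<le> 2 * q ^ 4 * s * E"
      unfolding E_def using wabs w2 s0 q1 by (intro mult_mono) auto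
    finally have "\<bar>exp w - 1 - w\<bar> \<le> 2 * q ^ 4 * s * E" .
    moreover have "\<bar>w + v * z\<bar> \<le> q ^ 4 * s * E"
    proof -
      have "\<bar>w + v * z\<bar> \<le> q\<^sup>2 * h" unfolding w_def using v2h by simp
      also have "\<dots> \<le> q ^ 4 * s" unfolding s_def using q1 h
        by (intro mult_mono power_increasing) auto
      also have "\<dots> \<le> q ^ 4 * s * E" using mult_left_mono[OF E1, of "q ^ 4 * s"] s0 q1 by simp
      finally show ?thesis .
    qed
    moreover have "y = exp w" by (simp add: y_def w_def)
    ultimately show ?thesis by linarith
  qed
  have RY: "\<bar>p / m - y\<bar> \<le> 5 * q ^ 4 * s * E"
  proof -
    have "q * (2 * s) \<le> 2 * (q ^ 4 * s * E)"
    proof -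
      have "q \<le> q ^ 4" using q1 power_increasing[of 1 4 q] by simp
      then have "q * s \<le> q ^ 4 * s" using s0 by (rule mult_right_mono)
      also have "\<dots> \<le> q ^ 4 * s * E" using mult_left_mono[OF E1, of "q ^ 4 * s"] s0 q1 by simp
      finally show ?thesis by simp
    qed
    then show ?thesis using R Y by linarith
  qed
  have "(p / m - y)\<^sup>2 = \<bar>p / m - y\<bar>\<^sup>2" by simp
  also have "\<dots> \<le> (5 * q ^ 4 * s * E)\<^sup>2"
    by (intro power_mono RY) auto
  also have "\<dots> = 25 * q ^ 8 * s\<^sup>2 * E\<^sup>2"
    by (simp add: power_mult_distrib flip: power_mult)
  also have "\<dots> \<le> 25 * q ^ 8 * (2 * (z ^ 4 + h\<^sup>2)) * E\<^sup>2"
  proof (intro mult_right_mono mult_left_mono)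
    show "s\<^sup>2 \<le> 2 * (z ^ 4 + h\<^sup>2)"
      unfolding s_def using sum_squares_bound[of "z\<^sup>2" h]
      by (simp add: power2_sum flip: power_mult)
  qed (use q1 in auto)
  also have "E\<^sup>2 = exp (2 * q\<^sup>2) * exp (2 * q * \<bar>z\<bar>)"
    unfolding E_def by (simp flip: exp_double exp_add add: algebra_simps)
  finally have "(p / m - y)\<^sup>2 \<le> 50 * (q ^ 8 * exp (2 * q\<^sup>2) * (z ^ 4 * exp (2 * q * \<bar>z\<bar>) + h\<^sup>2 * exp (2 * q * \<bar>z\<bar>)))"
    by (simp add: algebra_simps)
  also have "\<dots> \<le> 200 * (q ^ 8 * exp (2 * q\<^sup>2) * (z ^ 4 * exp (2 * q * \<bar>z\<bar>) + h\<^sup>2 * exp (2 * q * \<bar>z\<bar>)))"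
    using q1 by (intro mult_right_mono) auto
  finally show ?thesis by (simp add: q_def mult.assoc)
qed

text \<open>\<open>P z / m\<close> and the exponential both have mean 1 under \<open>gauss h\<close>
  and agree to first order, so their affinity falls short of 1 only by their mean square distance.
  The constant is quantified first: it depends on \<open>a\<close> and \<open>K\<close> alone and
  therefore serves every interval of every grid.\<close>

lemma hellinger_one_step:
  fixes K a :: real
  assumes a: "0 < a" "a \<le> 1" and K: "1 \<le> K"
  shows "\<exists>C. \<forall>h P d D m v. 0 < h \<longrightarrow> h \<le> 1 \<longrightarrow> P \<in> borel_measurable borel \<longrightarrow>
     (\<forall>z. a \<le> P z \<and> P z \<le> K \<and> \<bar>P z - P 0 - d * z\<bar> \<le> K * z\<^sup>2) \<longrightarrow>
     m = (\<integral>z. P z \<partial>gauss h) \<longrightarrow> \<bar>D\<bar> \<le> K \<longrightarrow> \<bar>D - d\<bar> \<le> K * sqrt h \<longrightarrow> v = - D / m \<longrightarrow>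
     ennreal (1 - C * h\<^sup>2) \<le> (\<integral>\<^sup>+z. ennreal (sqrt (P z / m * exp (- v * z - v\<^sup>2 * h / 2))) \<partial>gauss h)"
proof -
  define q where "q = K / a"
  define c where "c = 200 * q ^ 8 * exp (2 * q\<^sup>2)"
  define c4 where "c4 = 512 * exp ((2 * q + 1)\<^sup>2 / 2) + 2 * exp ((2 * q)\<^sup>2 / 2)"
  have q1: "1 \<le> q" using a K by (simp add: q_def)
  have c0: "0 \<le> c" using q1 by (simp add: c_def)
  show ?thesis
  \<comment> \<open>\<open>c * c4 * h^2\<close> will bound the mean square of
    \<open>P z / m - y z\<close>, and \<open>sqrt_mult_ge_quadratic\<close> with constant
    \<open>q\<close> loses q / 2 times that.\<close>
  proof (intro exI[of _ "q * (c * c4) / 2"] allI impI)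
    fix h d D m v :: real and P
    assume h: "0 < h" "h \<le> 1" and [measurable]: "P \<in> borel_measurable borel"
      and P: "\<forall>z. a \<le> P z \<and> P z \<le> K \<and> \<bar>P z - P 0 - d * z\<bar> \<le> K * z\<^sup>2"
      and m: "m = (\<integral>z. P z \<partial>gauss h)" and D: "\<bar>D\<bar> \<le> K" "\<bar>D - d\<bar> \<le> K * sqrt h" and v: "v = - D / m"
    interpret prob_space "gauss h" by (rule prob_space_gauss[OF h(1)])
    have absP: "\<bar>P z\<bar> \<le> K" for z using P[rule_format, of z] a by linarith
    have iP: "integrable (gauss h) P"
      by (rule integrable_const_bound[of _ K]) (use absP in auto)
    note gz = gauss_first_moment[OF h(1)] and gsq = gauss_second_moment[OF h(1)]
    have ma: "a \<le> m" 
    proof -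
      have "(\<integral>z. a \<partial>gauss h) \<le> m" unfolding m using P by (intro integral_mono iP) auto
      then show ?thesis using prob_space by simp
    qed
    have mP0: "\<bar>m - P 0\<bar> \<le> K * h"
    proof -
      have "m - P 0 = (\<integral>z. P z - P 0 - d * z \<partial>gauss h)"
        unfolding m using iP gz prob_space by simp
      also have "\<bar>\<dots>\<bar> \<le> (\<integral>z. \<bar>P z - P 0 - d * z\<bar> \<partial>gauss h)" by (rule integral_abs_bound)
      also have "\<dots> \<le> (\<integral>z. K * z\<^sup>2 \<partial>gauss h)"
        using P iP gz gsq by (intro integral_mono) auto
      also have "\<dots> = K * h" using gsq by simp
      finally show ?thesis .
    qed
    define y where "y = (\<lambda>z. exp (- v * z - v\<^sup>2 * h / 2))"
    have [measurable]: "y \<in> borel_measurable borel" by (simp add: y_def)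
    have iy: "integrable (gauss h) y" "(\<integral>z. y z \<partial>gauss h) = 1"
    proof -
      have yeq: "y = (\<lambda>z. exp (- v\<^sup>2 * h / 2) * exp ((- v) * z))"
        by (simp add: y_def fun_eq_iff flip: exp_add)
      show "integrable (gauss h) y"
        unfolding yeq by (intro integrable_mult_right gauss_mgf h)
      have "(\<integral>z. y z \<partial>gauss h) = exp (- v\<^sup>2 * h / 2) * exp ((- v)\<^sup>2 * h / 2)"
        unfolding yeq by (simp only: integral_mult_right_zero gauss_mgf(2)[OF h(1)])
      then show "(\<integral>z. y z \<partial>gauss h) = 1" by (simp flip: exp_add)
    qed
    have sq: "(P z / m - y z)\<^sup>2 \<le> c * (z ^ 4 * exp (2 * q * \<bar>z\<bar>) + h\<^sup>2 * exp (2 * q * \<bar>z\<bar>))" for z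
      unfolding y_def c_def q_def
      by (rule hellinger_one_step_pointwise[OF a(1) K a(2) h _ ma mP0 D v]) (use P in blast)
    have ib: "integrable (gauss h) (\<lambda>z. c * (z ^ 4 * exp (2 * q * \<bar>z\<bar>) + h\<^sup>2 * exp (2 * q * \<bar>z\<bar>)))"
      using gauss_power4_exp_abs(1)[OF h, of "2 * q"] gauss_exp_abs(1)[OF h(1), of "2 * q"] q1 by auto
    have isq: "integrable (gauss h) (\<lambda>z. (P z / m - y z)\<^sup>2)"
      by (rule Bochner_Integration.integrable_bound[OF ib]) (use sq c0 in \<open>auto intro!: AE_I2 simp: abs_mult\<close>)
    have "(\<integral>z. (P z / m - y z)\<^sup>2 \<partial>gauss h) \<le> (\<integral>z. c * (z ^ 4 * exp (2 * q * \<bar>z\<bar>) + h\<^sup>2 * exp (2 * q * \<bar>z\<bar>)) \<partial>gauss h)"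
      by (rule integral_mono[OF isq ib sq])
    also have "\<dots> = c * ((\<integral>z. z ^ 4 * exp (2 * q * \<bar>z\<bar>) \<partial>gauss h) + h\<^sup>2 * (\<integral>z. exp (2 * q * \<bar>z\<bar>) \<partial>gauss h))"
      using gauss_power4_exp_abs(1)[OF h, of "2 * q"] gauss_exp_abs(1)[OF h(1), of "2 * q"] q1 by simp
    also have "\<dots> \<le> c * (512 * exp ((2 * q + 1)\<^sup>2 / 2) * h\<^sup>2 + h\<^sup>2 * (2 * exp ((2 * q)\<^sup>2 / 2)))"
    proof (intro mult_left_mono add_mono c0)
      show "(\<integral>z. z ^ 4 * exp (2 * q * \<bar>z\<bar>) \<partial>gauss h) \<le> 512 * exp ((2 * q + 1)\<^sup>2 / 2) * h\<^sup>2"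
        using gauss_power4_exp_abs(2)[OF h, of "2 * q"] q1 by simp
      have "(\<integral>z. exp (2 * q * \<bar>z\<bar>) \<partial>gauss h) \<le> 2 * exp ((2 * q)\<^sup>2 * h / 2)" by (rule gauss_exp_abs(2)[OF h(1)])
      also have "\<dots> \<le> 2 * exp ((2 * q)\<^sup>2 / 2)" using mult_left_le[of h "(2 * q)\<^sup>2"] h by (simp add: mult.commute)
      finally show "(\<integral>z. exp (2 * q * \<bar>z\<bar>) \<partial>gauss h) \<le> 2 * exp ((2 * q)\<^sup>2 / 2)" .
    qed simp
    also have "\<dots> = c * c4 * h\<^sup>2" by (simp add: c4_def algebra_simps)
    finally have I: "(\<integral>z. (P z / m - y z)\<^sup>2 \<partial>gauss h) \<le> c * c4 * h\<^sup>2" .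
    have low: "(P z / m + y z) / 2 - q * (P z / m - y z)\<^sup>2 / 2 \<le> sqrt (P z / m * y z)" for z
    proof (rule sqrt_mult_ge_quadratic)
      have mK: "m \<le> K"
      proof -
        have "m \<le> (\<integral>z. K \<partial>gauss h)" unfolding m using P by (intro integral_mono iP) auto
        then show ?thesis using prob_space by simp
      qed
      have "a / K \<le> P z / m" using P a ma mK K by (intro frac_le) (auto intro: order_trans[of _ a])
      then show "1 / q \<le> P z / m" by (simp add: q_def)
      show "0 < P z / m" using P[rule_format, of z] a ma by (intro divide_pos_pos) linarith+
    qed (use q1 in \<open>auto simp: y_def\<close>)
    have ilow: "integrable (gauss h) (\<lambda>z. (P z / m + y z) / 2 - q * (P z / m - y z)\<^sup>2 / 2)"
      using iP iy isq by auto
    have "1 - q * (c * c4) / 2 * h\<^sup>2 \<le> 1 - q * (\<integral>z. (P z / m - y z)\<^sup>2 \<partial>gauss h) / 2"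
      using mult_left_mono[OF I, of q] q1 by simp
    also have "\<dots> = (\<integral>z. (P z / m + y z) / 2 - q * (P z / m - y z)\<^sup>2 / 2 \<partial>gauss h)"
      using iP iy isq m a ma by simp
    finally have "ennreal (1 - q * (c * c4) / 2 * h\<^sup>2) \<le> ennreal (\<integral>z. (P z / m + y z) / 2 - q * (P z / m - y z)\<^sup>2 / 2 \<partial>gauss h)"
      by (rule ennreal_leI)
    also have "\<dots> \<le> (\<integral>\<^sup>+z. ennreal ((P z / m + y z) / 2 - q * (P z / m - y z)\<^sup>2 / 2) \<partial>gauss h)"
      by (rule integral_le_nn_integral[OF ilow])
    also have "\<dots> \<le> (\<integral>\<^sup>+z. ennreal (sqrt (P z / m * y z)) \<partial>gauss h)"
      by (intro nn_integral_mono ennreal_leI low)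
    finally show "ennreal (1 - q * (c * c4) / 2 * h\<^sup>2) \<le> (\<integral>\<^sup>+z. ennreal (sqrt (P z / m * exp (- v * z - v\<^sup>2 * h / 2))) \<partial>gauss h)"
      by (simp add: y_def)
  qed
qed

section \<open>Step processes and their exponentials\<close>

text \<open>By independence the law of (x, X x) on \<open>G\<close> times the line is a product
  measure, so the first argument can be frozen while the second is integrated out.\<close>

lemma nn_integral_freeze:
  assumes M: "prob_space M" and G: "subalgebra M G" and X[measurable]: "X \<in> borel_measurable M"
    and ind: "prob_space.indep_set M (sets G) {X -` A \<inter> space M | A. A \<in> sets borel}"
    and g: "g \<in> borel_measurable (G \<Otimes>\<^sub>M borel)"
  shows "(\<integral>\<^sup>+x. g (x, X x) \<partial>M) = (\<integral>\<^sup>+x. (\<integral>\<^sup>+z. g (x, z) \<partial>distr M borel X) \<partial>M)"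
proof -
  interpret prob_space M by fact
  have sp: "space G = space M" using G by (simp add: subalgebra_def)
  have idm: "(\<lambda>x. x) \<in> measurable M G" using G by (auto simp: subalgebra_def measurable_def)
  have mp: "(\<lambda>x. (x, X x)) \<in> measurable M (G \<Otimes>\<^sub>M borel)" using idm by measurable
  interpret X: prob_space "distr M borel X" by (rule prob_space_distr) simp
  interpret I: prob_space "distr M G (\<lambda>x. x)" by (rule prob_space_distr[OF idm])
  have eq: "distr M G (\<lambda>x. x) \<Otimes>\<^sub>M distr M borel X = distr M (G \<Otimes>\<^sub>M borel) (\<lambda>x. (x, X x))"
  proof (rule pair_measure_eqI)
    show "sigma_finite_measure (distr M G (\<lambda>x. x))" "sigma_finite_measure (distr M borel X)"
      by unfold_locales
    show "sets (distr M G (\<lambda>x. x) \<Otimes>\<^sub>M distr M borel X) = sets (distr M (G \<Otimes>\<^sub>M borel) (\<lambda>x. (x, X x)))"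
      by (simp cong: sets_pair_measure_cong)
    fix A B assume "A \<in> sets (distr M G (\<lambda>x. x))" "B \<in> sets (distr M borel X)"
    then have A: "A \<in> sets G" and B: "B \<in> sets borel" by auto
    have A': "A \<in> sets M" "A \<subseteq> space M" using A G sets.sets_into_space[OF A] sp by (auto simp: subalgebra_def)
    have "prob (A \<inter> (X -` B \<inter> space M)) = prob A * prob (X -` B \<inter> space M)"
      by (rule indep_setD[OF ind A]) (use B in blast)
    then have "emeasure M (A \<inter> (X -` B \<inter> space M)) = emeasure M A * emeasure M (X -` B \<inter> space M)"
      by (simp add: emeasure_eq_measure ennreal_mult)
    moreover have "(\<lambda>x. (x, X x)) -` (A \<times> B) \<inter> space M = A \<inter> (X -` B \<inter> space M)" by auto
    moreover have "(\<lambda>x. x) -` A \<inter> space M = A" using A' by auto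
    ultimately show "emeasure (distr M G (\<lambda>x. x)) A * emeasure (distr M borel X) B =
        emeasure (distr M (G \<Otimes>\<^sub>M borel) (\<lambda>x. (x, X x))) (A \<times> B)"
      using A B by (subst (1 2 3) emeasure_distr) (auto intro: idm mp)
  qed
  have g': "g \<in> borel_measurable (distr M G (\<lambda>x. x) \<Otimes>\<^sub>M distr M borel X)"
    using g by (simp add: measurable_cong_sets[OF sets_pair_measure_cong[OF sets_distr sets_distr] refl])
  have "(\<integral>\<^sup>+x. g (x, X x) \<partial>M) = (\<integral>\<^sup>+p. g p \<partial>(distr M G (\<lambda>x. x) \<Otimes>\<^sub>M distr M borel X))"
    unfolding eq by (rule nn_integral_distr[symmetric, OF mp]) (use g in simp)
  also have "\<dots> = (\<integral>\<^sup>+x. (\<integral>\<^sup>+z. g (x, z) \<partial>distr M borel X) \<partial>distr M G (\<lambda>x. x))"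
    by (rule X.nn_integral_fst[symmetric, OF g'])
  also have "\<dots> = (\<integral>\<^sup>+x. (\<integral>\<^sup>+z. g (x, z) \<partial>distr M borel X) \<partial>M)"
    by (rule nn_integral_distr[OF idm])
       (use X.borel_measurable_nn_integral_fst[OF g'] in \<open>simp add: measurable_cong_sets[OF sets_distr refl]\<close>)
  finally show ?thesis .
qed

locale brownian_setting =
  fixes M :: "'a measure" and F :: "real \<Rightarrow> 'a measure" and W :: "real \<Rightarrow> 'a \<Rightarrow> real"
  assumes bm: "brownian_motion M F W"
begin

lemma prob_space_M: "prob_space M" and filtration_F: "filtration (space M) F"
  and subalg_F: "t \<in> {0..1} \<Longrightarrow> subalgebra M (F t)"
  and W_F: "t \<in> {0..1} \<Longrightarrow> W t \<in> borel_measurable (F t)"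
  using bm by (auto simp: brownian_motion_def adapted_01_def)

sublocale prob_space M by (rule prob_space_M)

lemma F_mono: "s \<le> t \<Longrightarrow> sets (F s) \<subseteq> sets (F t)" and space_F [simp]: "space (F t) = space M"
  using filtration_F by (auto simp: filtration_def)

lemma measurable_F_mono: "f \<in> borel_measurable (F s) \<Longrightarrow> s \<le> t \<Longrightarrow> f \<in> borel_measurable (F t)"
  using F_mono by (auto simp: measurable_def)

lemma measurable_F_M: "f \<in> borel_measurable (F s) \<Longrightarrow> s \<in> {0..1} \<Longrightarrow> f \<in> borel_measurable M"
  using subalg_F by (meson measurable_from_subalg)

lemma W_M [measurable]: "t \<in> {0..1} \<Longrightarrow> W t \<in> borel_measurable M"
  by (rule measurable_F_M[OF W_F])

lemma distr_increment:
  assumes "0 \<le> s" "s < t" "t \<le> 1"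
  shows "distr M borel (\<lambda>x. W t x - W s x) = gauss (t - s)"
proof -
  have "distributed M lborel (\<lambda>x. W t x - W s x) (\<lambda>y. ennreal (normal_density 0 (sqrt (t - s)) y))"
    using bm assms by (auto simp: brownian_motion_def)
  then have "distr M lborel (\<lambda>x. W t x - W s x) = gauss (t - s)"
    by (simp add: distributed_def gauss_def)
  moreover have "distr M lborel (\<lambda>x. W t x - W s x) = distr M borel (\<lambda>x. W t x - W s x)"
    by (rule distr_cong) auto
  ultimately show ?thesis by simp
qed

lemma nn_integral_increment:
  assumes st: "0 \<le> s" "s < t" "t \<le> 1" and g: "g \<in> borel_measurable (F s \<Otimes>\<^sub>M borel)"
  shows "(\<integral>\<^sup>+x. g (x, W t x - W s x) \<partial>M) = (\<integral>\<^sup>+x. (\<integral>\<^sup>+z. g (x, z) \<partial>gauss (t - s)) \<partial>M)"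
proof -
  have "W t \<in> borel_measurable M" "W s \<in> borel_measurable M" using st by (auto intro!: W_M)
  then have X: "(\<lambda>x. W t x - W s x) \<in> borel_measurable M" by simp
  have "prob_space.indep_set M (sets (F s)) {(\<lambda>x. W t x - W s x) -` A \<inter> space M |A. A \<in> sets borel}"
    using bm st by (auto simp: brownian_motion_def)
  from nn_integral_freeze[OF prob_space_M subalg_F X this g] st
  show ?thesis by (simp add: distr_increment)
qed

text \<open>Given \<open>F s\<close>, the increment is Gaussian and the exponential tilts its mean
  by - v (t - s); adding v (t - s) restores the original law.\<close>

lemma nn_integral_girsanov_step:
  assumes st: "0 \<le> s" "s < t" "t \<le> 1" and v[measurable]: "v \<in> borel_measurable (F s)"
    and Z[measurable]: "Z \<in> borel_measurable (F s)" and g[measurable]: "g \<in> borel_measurable (F s \<Otimes>\<^sub>M borel)"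
  shows "(\<integral>\<^sup>+x. Z x * ennreal (exp (- v x * (W t x - W s x) - (v x)\<^sup>2 * (t - s) / 2)) *
             g (x, W t x - W s x + v x * (t - s)) \<partial>M)
       = (\<integral>\<^sup>+x. Z x * (\<integral>\<^sup>+z. g (x, z) \<partial>gauss (t - s)) \<partial>M)"
proof -
  let ?h = "t - s"
  have "(\<integral>\<^sup>+x. Z x * ennreal (exp (- v x * (W t x - W s x) - (v x)\<^sup>2 * ?h / 2)) *
             g (x, W t x - W s x + v x * ?h) \<partial>M)
     = (\<integral>\<^sup>+x. \<integral>\<^sup>+z. Z x * ennreal (exp (- v x * z - (v x)\<^sup>2 * ?h / 2)) * g (x, z + v x * ?h) \<partial>gauss ?h \<partial>M)"
    using nn_integral_increment[OF st, of "\<lambda>(x, z). Z x * ennreal (exp (- v x * z - (v x)\<^sup>2 * ?h / 2)) * g (x, z + v x * ?h)"]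
    by simp
  also have "\<dots> = (\<integral>\<^sup>+x. Z x * (\<integral>\<^sup>+z. g (x, z) \<partial>gauss ?h) \<partial>M)"
  proof (rule nn_integral_cong)
    fix x assume "x \<in> space M"
    then have x: "x \<in> space (F s)" by simp
    have [measurable]: "(\<lambda>z. g (x, z)) \<in> borel_measurable borel" using x by measurable
    have "(\<integral>\<^sup>+z. Z x * ennreal (exp (- v x * z - (v x)\<^sup>2 * ?h / 2)) * g (x, z + v x * ?h) \<partial>gauss ?h)
       = (\<integral>\<^sup>+z. (Z x * ennreal (exp (- (v x)\<^sup>2 * ?h / 2))) * (ennreal (exp ((- v x) * z)) * g (x, z + v x * ?h)) \<partial>gauss ?h)"
    proof (rule nn_integral_cong)
      fix z
      have "ennreal (exp (- v x * z - (v x)\<^sup>2 * ?h / 2))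
          = ennreal (exp (- (v x)\<^sup>2 * ?h / 2)) * ennreal (exp ((- v x) * z))"
        by (simp flip: ennreal_mult exp_add)
      then show "Z x * ennreal (exp (- v x * z - (v x)\<^sup>2 * ?h / 2)) * g (x, z + v x * ?h)
        = (Z x * ennreal (exp (- (v x)\<^sup>2 * ?h / 2))) * (ennreal (exp ((- v x) * z)) * g (x, z + v x * ?h))"
        by (simp add: mult_ac)
    qed
    also have "\<dots> = (Z x * ennreal (exp (- (v x)\<^sup>2 * ?h / 2))) * (\<integral>\<^sup>+z. ennreal (exp ((- v x) * z)) * g (x, z + v x * ?h) \<partial>gauss ?h)"
      by (rule nn_integral_cmult) measurable
    also have "(\<integral>\<^sup>+z. ennreal (exp ((- v x) * z)) * g (x, z + v x * ?h) \<partial>gauss ?h)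
       = ennreal (exp ((v x)\<^sup>2 * ?h / 2)) * (\<integral>\<^sup>+z. g (x, z) \<partial>gauss ?h)"
      using nn_integral_gauss_exp[of ?h "\<lambda>z. g (x, z + v x * ?h)" "- v x"] st by simp
    also have "Z x * ennreal (exp (- (v x)\<^sup>2 * ?h / 2)) * (ennreal (exp ((v x)\<^sup>2 * ?h / 2)) * (\<integral>\<^sup>+z. g (x, z) \<partial>gauss ?h))
       = Z x * (\<integral>\<^sup>+z. g (x, z) \<partial>gauss ?h) * (ennreal (exp (- (v x)\<^sup>2 * ?h / 2)) * ennreal (exp ((v x)\<^sup>2 * ?h / 2)))"
      by (simp add: mult_ac)
    also have "ennreal (exp (- (v x)\<^sup>2 * ?h / 2)) * ennreal (exp ((v x)\<^sup>2 * ?h / 2)) = 1"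
      by (simp flip: ennreal_mult exp_add)
    finally show "(\<integral>\<^sup>+z. Z x * ennreal (exp (- v x * z - (v x)\<^sup>2 * ?h / 2)) * g (x, z + v x * ?h) \<partial>gauss ?h) = Z x * (\<integral>\<^sup>+z. g (x, z) \<partial>gauss ?h)"
      by simp
  qed
  finally show ?thesis .
qed

end

section \<open>Time grids, step processes and their refinement\<close>

definition time_grid :: "nat \<Rightarrow> (nat \<Rightarrow> real) \<Rightarrow> bool" where
  "time_grid m s \<longleftrightarrow> s 0 = 0 \<and> s m = 1 \<and> (\<forall>i<m. s i < s (Suc i))"

lemma time_grid_less: "time_grid m s \<Longrightarrow> i < j \<Longrightarrow> j \<le> m \<Longrightarrow> s i < s j"
proof (induction j)
  case (Suc j)
  then have "s j < s (Suc j)" by (simp add: time_grid_def)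
  with Suc show ?case by (cases "i = j") auto
qed simp

lemma time_grid_le: "time_grid m s \<Longrightarrow> i \<le> j \<Longrightarrow> j \<le> m \<Longrightarrow> s i \<le> s j"
  using time_grid_less[of m s i j] by (cases "i = j") auto

lemma time_grid_less_iff: "time_grid m s \<Longrightarrow> i \<le> m \<Longrightarrow> j \<le> m \<Longrightarrow> s i < s j \<longleftrightarrow> i < j"
  by (metis linorder_neqE_nat order_less_asym order_less_irrefl time_grid_less)

lemma time_grid_range: "time_grid m s \<Longrightarrow> i \<le> m \<Longrightarrow> 0 \<le> s i \<and> s i \<le> 1"
  using time_grid_le[of m s 0 i] time_grid_le[of m s i m] by (auto simp: time_grid_def)

lemma time_grid_locate:
  assumes g: "time_grid m s" and t: "0 < t" "t \<le> 1"
  obtains i where "i < m" "s i < t" "t \<le> s (Suc i)"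
proof -
  define k where "k = (LEAST k. t \<le> s k)"
  have "t \<le> s m" using g t by (simp add: time_grid_def)
  then have k: "t \<le> s k" "k \<le> m" unfolding k_def by (auto intro: LeastI Least_le)
  have "k \<noteq> 0" using k g t by (intro notI) (simp add: time_grid_def)
  then obtain i where i: "k = Suc i" using not0_implies_Suc by blast
  have "\<not> t \<le> s i" using i not_less_Least[of i "\<lambda>k. t \<le> s k"] by (simp add: k_def[symmetric])
  with i k show ?thesis by (intro that[of i]) auto
qed

lemma time_grid_unique:
  assumes g: "time_grid m s" and "i < m" "s i < t" "t \<le> s (Suc i)" "j < m" "s j < t" "t \<le> s (Suc j)"
  shows "i = j"
proof (rule ccontr)
  assume "i \<noteq> j"
  then consider "Suc i \<le> j" | "Suc j \<le> i" by linarith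
  then show False
    using time_grid_le[OF g, of "Suc i" j] time_grid_le[OF g, of "Suc j" i] assms by cases auto
qed

lemma step_value_at:
  assumes g: "time_grid m s" and i: "i < m" "s i < t" "t \<le> s (Suc i)"
  shows "step_value m s \<xi> t x = \<xi> i x"
proof -
  have "step_value m s \<xi> t x = (\<Sum>j<m. if j = i then \<xi> i x else 0)"
    unfolding step_value_def
  proof (rule sum.cong[OF refl])
    fix j assume "j \<in> {..<m}"
    then have "s j < t \<and> t \<le> s (Suc j) \<longleftrightarrow> j = i" using time_grid_unique[OF g i, of j] i by auto
    then show "\<xi> j x * indicator {s j<..s (Suc j)} t = (if j = i then \<xi> i x else 0)"
      by (auto simp: indicator_def)
  qed
  also have "\<dots> = \<xi> i x" using i by (simp add: sum.delta)
  finally show ?thesis .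
qed

lemma step_value_outside:
  assumes g: "time_grid m s" and t: "t \<notin> {0<..1}"
  shows "step_value m s \<xi> t x = 0"
  unfolding step_value_def
proof (rule sum.neutral, rule ballI)
  fix i assume i: "i \<in> {..<m}"
  then have "0 \<le> s i" "s (Suc i) \<le> 1" using time_grid_range[OF g, of i] time_grid_range[OF g, of "Suc i"] by auto
  then show "\<xi> i x * indicator {s i<..s (Suc i)} t = 0" using t by (auto simp: indicator_def)
qed

text \<open>At each time at most one summand is nonzero, so any operation may be applied interval by
  interval. The condition \<open>f 0 0 = 0\<close> takes care of the times outside ]0, 1], where all
  step values vanish.\<close>

lemma step_value_comp:
  assumes g: "time_grid m s" and "f 0 0 = 0"
  shows "f (step_value m s \<xi> t x) (step_value m s \<eta> t x) = step_value m s (\<lambda>i x. f (\<xi> i x) (\<eta> i x)) t x"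
proof (cases "t \<in> {0<..1}")
  case True
  then have t: "0 < t" "t \<le> 1" by auto
  obtain i where i: "i < m" "s i < t" "t \<le> s (Suc i)" using time_grid_locate[OF g t] .
  show ?thesis unfolding step_value_at[OF g i] ..
next
  case False
  show ?thesis unfolding step_value_outside[OF g False] by (rule assms(2))
qed

lemma integral_step_value:
  assumes g: "time_grid m s"
  shows "integrable leb01 (\<lambda>t. step_value m s \<xi> t x)"
    "(LINT t|leb01. step_value m s \<xi> t x) = (\<Sum>i<m. \<xi> i x * (s (Suc i) - s i))"
proof -
  have 1: "integrable leb01 (\<lambda>t. indicator {s i<..s (Suc i)} t :: real)"
    "(LINT t|leb01. indicator {s i<..s (Suc i)} t) = s (Suc i) - s i" if "i < m" for i
  proof -
    have r: "0 \<le> s i" "s i < s (Suc i)" "s (Suc i) \<le> 1"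
      using time_grid_range[OF g, of i] time_grid_range[OF g, of "Suc i"] that g by (auto simp: time_grid_def)
    have eq: "(\<lambda>t. indicator {0..1} t *\<^sub>R (indicator {s i<..s (Suc i)} t :: real)) = indicator {s i<..s (Suc i)}"
      using r by (auto simp: indicator_def fun_eq_iff)
    have i: "integrable lborel (indicator {s i<..s (Suc i)} :: real \<Rightarrow> real)"
      using r by (intro integrable_real_indicator) auto
    show "integrable leb01 (\<lambda>t. indicator {s i<..s (Suc i)} t :: real)"
      by (subst integrable_restrict_space) (simp, simp only: eq i)
    show "(LINT t|leb01. indicator {s i<..s (Suc i)} t) = s (Suc i) - s i"
      using r by (subst integral_restrict_space) (simp, simp only: eq, simp)
  qed
  have 2: "integrable leb01 (\<lambda>t. \<xi> i x * indicator {s i<..s (Suc i)} t)" if "i \<in> {..<m}" for i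
    using 1(1)[of i] that by (intro integrable_mult_right) simp
  show "integrable leb01 (\<lambda>t. step_value m s \<xi> t x)"
    unfolding step_value_def by (rule Bochner_Integration.integrable_sum[OF 2])
  have "(LINT t|leb01. step_value m s \<xi> t x) = (\<Sum>i<m. LINT t|leb01. \<xi> i x * indicator {s i<..s (Suc i)} t)"
    unfolding step_value_def by (rule Bochner_Integration.integral_sum[OF 2])
  also have "\<dots> = (\<Sum>i<m. \<xi> i x * (s (Suc i) - s i))"
    by (rule sum.cong[OF refl]) (use 1 in simp)
  finally show "(LINT t|leb01. step_value m s \<xi> t x) = (\<Sum>i<m. \<xi> i x * (s (Suc i) - s i))" .
qed

lemma time_grid_of_finite:
  assumes "finite S" "0 \<in> S" "1 \<in> S" "S \<subseteq> {0..1}"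
  obtains m s where "time_grid m s" "s ` {..m} = S"
proof -
  define l where "l = sorted_list_of_set S"
  have l: "sorted_wrt (<) l" "set l = S" "distinct l" using assms by (auto simp: l_def)
  then have ne: "l \<noteq> []" using assms by auto
  define m where "m = length l - 1"
  have len: "length l = Suc m" using ne by (simp add: m_def)
  have lt: "i < j \<Longrightarrow> j \<le> m \<Longrightarrow> l ! i < l ! j" for i j
    using l(1) len by (auto simp: sorted_wrt_iff_nth_less)
  have mem: "y \<in> S \<longleftrightarrow> (\<exists>k\<le>m. l ! k = y)" for y
    unfolding l(2)[symmetric] in_set_conv_nth len by (simp add: less_Suc_eq_le)
  have im: "(\<lambda>i. l ! i) ` {..m} = S"
  proof (intro set_eqI)
    fix y show "y \<in> (\<lambda>i. l ! i) ` {..m} \<longleftrightarrow> y \<in> S" unfolding mem by (auto simp: image_iff)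
  qed
  have z: "l ! 0 = 0"
  proof -
    obtain k where k: "k \<le> m" "l ! k = 0" using mem assms(2) by blast
    have "l ! 0 \<in> S" unfolding mem by blast
    then have "0 \<le> l ! 0" using assms(4) by auto
    then show ?thesis using lt[of 0 k] k by (cases "k = 0") auto
  qed
  have o: "l ! m = 1"
  proof -
    obtain k where k: "k \<le> m" "l ! k = 1" using mem assms(3) by blast
    have "l ! m \<in> S" unfolding mem by blast
    then have "l ! m \<le> 1" using assms(4) by auto
    then show ?thesis using lt[of k m] k by (cases "k = m") auto
  qed
  have "time_grid m (\<lambda>i. l ! i)"
    unfolding time_grid_def using z o lt by simp
  then show ?thesis using im by (rule that)
qed

lemma step_process_iff:
  "step_process F m s \<xi> \<longleftrightarrow> time_grid m s \<and>
     (\<forall>i<m. \<xi> i \<in> borel_measurable (F (s i)) \<and> (\<exists>C. \<forall>x\<in>space (F (s i)). \<bar>\<xi> i x\<bar> \<le> C))"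
  by (auto simp: step_process_def time_grid_def)

lemma time_grid_sub_point: "s ` {..m} \<subseteq> s' ` {..m'} \<Longrightarrow> j \<le> m \<Longrightarrow> \<exists>k\<le>m'. s j = s' k"
  by (auto simp: image_subset_iff image_iff)

text \<open>The value on a fine interval is read off at its right end point, which belongs to the
  interval because intervals are open on the left and closed on the right.\<close>

definition refine_step :: "nat \<Rightarrow> (nat \<Rightarrow> real) \<Rightarrow> (nat \<Rightarrow> 'a \<Rightarrow> real) \<Rightarrow> (nat \<Rightarrow> real) \<Rightarrow> nat \<Rightarrow> 'a \<Rightarrow> real" where
  "refine_step m s \<xi> s' i x = step_value m s \<xi> (s' (Suc i)) x"

lemma
  assumes g: "time_grid m s" and g': "time_grid m' s'" and sub: "s ` {..m} \<subseteq> s' ` {..m'}"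
  shows step_value_refine: "step_value m' s' (refine_step m s \<xi> s') t x = step_value m s \<xi> t x"
    and step_integral_refine: "step_integral B m' s' (refine_step m s \<xi> s') x = step_integral B m s \<xi> x"
proof -
  \<comment> \<open>No coarse grid point lies in the interior of a fine interval, so all times of a
    fine interval see the same coarse one.\<close>
  have grid_lt: "s j < t \<longleftrightarrow> s j < s' (Suc i)"
    if "j \<le> m" "i < m'" "s' i < t" "t \<le> s' (Suc i)" for i j t
  proof -
    obtain k where k: "k \<le> m'" "s j = s' k" using time_grid_sub_point[OF sub \<open>j \<le> m\<close>] by blast
    have "s' k < s' (Suc i) \<Longrightarrow> s' k \<le> s' i"
      using time_grid_less_iff[OF g', of k "Suc i"] time_grid_le[OF g', of k i] k that by auto
    then show ?thesis using k that by auto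
  qed
  show "step_value m' s' (refine_step m s \<xi> s') t x = step_value m s \<xi> t x"
  proof (cases "t \<in> {0<..1}")
    case True
    then have t: "0 < t" "t \<le> 1" by auto
    obtain i where i: "i < m'" "s' i < t" "t \<le> s' (Suc i)" using time_grid_locate[OF g' t] .
    have "step_value m' s' (refine_step m s \<xi> s') t x = step_value m s \<xi> (s' (Suc i)) x"
      by (simp add: step_value_at[OF g' i] refine_step_def)
    also have "\<dots> = step_value m s \<xi> t x"
    proof -
      have "indicator {s j<..s (Suc j)} (s' (Suc i)) = (indicator {s j<..s (Suc j)} t :: real)" if "j < m" for j
        using grid_lt[of j i t] grid_lt[of "Suc j" i t] that i
        by (simp add: indicator_def not_less[symmetric])
      then show ?thesis by (simp add: step_value_def)
    qed
    finally show ?thesis .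
  qed (simp add: step_value_outside[OF g] step_value_outside[OF g'])
  \<comment> \<open>The fine intervals inside the coarse one are those with index from k to l - 1,
    and their increments telescope.\<close>
  have tele: "(\<Sum>i<m'. indicator {s j<..s (Suc j)} (s' (Suc i)) * (B (s' (Suc i)) x - B (s' i) x))
      = B (s (Suc j)) x - B (s j) x" if j: "j < m" for j
  proof -
    obtain k l where k: "k \<le> m'" "s j = s' k" and l: "l \<le> m'" "s (Suc j) = s' l"
      using time_grid_sub_point[OF sub, of j] time_grid_sub_point[OF sub, of "Suc j"] j by auto
    have kl: "k < l" using k l time_grid_less_iff[OF g', of k l] g j by (auto simp: time_grid_def)
    have "(\<Sum>i<m'. indicator {s j<..s (Suc j)} (s' (Suc i)) * (B (s' (Suc i)) x - B (s' i) x))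
        = (\<Sum>i<m'. if i \<in> {k..<l} then B (s' (Suc i)) x - B (s' i) x else 0)"
    proof (rule sum.cong[OF refl])
      fix i assume "i \<in> {..<m'}"
      then have "s' k < s' (Suc i) \<longleftrightarrow> k \<le> i" "s' (Suc i) \<le> s' l \<longleftrightarrow> i < l"
        using time_grid_less_iff[OF g', of k "Suc i"] time_grid_less_iff[OF g', of l "Suc i"] k l by auto
      then show "indicator {s j<..s (Suc j)} (s' (Suc i)) * (B (s' (Suc i)) x - B (s' i) x)
          = (if i \<in> {k..<l} then B (s' (Suc i)) x - B (s' i) x else 0)"
        by (simp add: indicator_def k l)
    qed
    also have "\<dots> = (\<Sum>i\<in>{k..<l}. B (s' (Suc i)) x - B (s' i) x)"
      using l by (subst sum.inter_restrict[symmetric]) (auto intro!: sum.cong)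
    also have "\<dots> = B (s' l) x - B (s' k) x"
      using kl by (intro sum_Suc_diff') simp
    finally show ?thesis by (simp add: k l)
  qed
  have "step_integral B m' s' (refine_step m s \<xi> s') x
     = (\<Sum>i<m'. \<Sum>j<m. \<xi> j x * (indicator {s j<..s (Suc j)} (s' (Suc i)) * (B (s' (Suc i)) x - B (s' i) x)))"
    unfolding step_integral_def refine_step_def step_value_def sum_distrib_right mult.assoc ..
  also have "\<dots> = (\<Sum>j<m. \<xi> j x * (\<Sum>i<m'. indicator {s j<..s (Suc j)} (s' (Suc i)) * (B (s' (Suc i)) x - B (s' i) x)))"
    by (subst sum.swap) (simp only: sum_distrib_left)
  also have "\<dots> = step_integral B m s \<xi> x"
    unfolding step_integral_def by (rule sum.cong[OF refl], subst tele) auto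
  finally show "step_integral B m' s' (refine_step m s \<xi> s') x = step_integral B m s \<xi> x" .
qed

lemma (in brownian_setting) step_process_refine:
  assumes \<xi>: "step_process F m s \<xi>" and g': "time_grid m' s'" and sub: "s ` {..m} \<subseteq> s' ` {..m'}"
  shows "step_process F m' s' (refine_step m s \<xi> s')"
  unfolding step_process_iff
proof (intro conjI g' allI impI)
  fix i assume i: "i < m'"
  have g: "time_grid m s" using \<xi> by (simp add: step_process_iff)
  have "(\<lambda>x. \<xi> j x * indicator {s j<..s (Suc j)} (s' (Suc i))) \<in> borel_measurable (F (s' i))" if j: "j < m" for j
  proof (cases "s j < s' (Suc i)")
    case True
    obtain k where k: "k \<le> m'" "s j = s' k" using time_grid_sub_point[OF sub, of j] j by auto
    then have "s j \<le> s' i"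
      using time_grid_less_iff[OF g', of k "Suc i"] time_grid_le[OF g', of k i] i True by auto
    then have "\<xi> j \<in> borel_measurable (F (s' i))"
      using \<xi> j by (auto simp: step_process_iff intro: measurable_F_mono)
    then show ?thesis by simp
  qed (simp add: indicator_def)
  then show "refine_step m s \<xi> s' i \<in> borel_measurable (F (s' i))"
    unfolding refine_step_def[abs_def] step_value_def by (intro borel_measurable_sum) auto
  have "\<forall>j\<in>{..<m}. \<exists>C. \<forall>x\<in>space M. \<bar>\<xi> j x\<bar> \<le> C" using \<xi> by (auto simp: step_process_iff)
  from bchoice[OF this] obtain C where C: "\<forall>j\<in>{..<m}. \<forall>x\<in>space M. \<bar>\<xi> j x\<bar> \<le> C j" ..
  show "\<exists>C. \<forall>x\<in>space (F (s' i)). \<bar>refine_step m s \<xi> s' i x\<bar> \<le> C"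
  proof (intro exI[of _ "\<Sum>j<m. C j"] ballI)
    fix x assume x: "x \<in> space (F (s' i))"
    have "\<bar>refine_step m s \<xi> s' i x\<bar> \<le> (\<Sum>j<m. \<bar>\<xi> j x * indicator {s j<..s (Suc j)} (s' (Suc i))\<bar>)"
      unfolding refine_step_def step_value_def by (rule sum_abs)
    also have "\<dots> \<le> (\<Sum>j<m. C j)"
    proof (rule sum_mono)
      fix j assume "j \<in> {..<m}"
      then have "\<bar>\<xi> j x\<bar> \<le> C j" using C x by simp
      then show "\<bar>\<xi> j x * indicator {s j<..s (Suc j)} (s' (Suc i))\<bar> \<le> C j"
        using order_trans[OF abs_ge_zero \<open>\<bar>\<xi> j x\<bar> \<le> C j\<close>] by (simp add: indicator_def)
    qed
    finally show "\<bar>refine_step m s \<xi> s' i x\<bar> \<le> (\<Sum>j<m. C j)" .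
  qed
qed

section \<open>Exponentials of step processes and Girsanov's theorem for them\<close>

lemma nn_integral_gauss_conv:
  assumes a: "a > 0" and b: "b > 0" and f[measurable]: "f \<in> borel_measurable borel"
  shows "(\<integral>\<^sup>+w. \<integral>\<^sup>+z. f (w + z) \<partial>gauss a \<partial>gauss b) = (\<integral>\<^sup>+z. f z \<partial>gauss (b + a))"
proof -
  let ?n = "\<lambda>c z. ennreal (normal_density 0 (sqrt c) z)"
  have "(\<integral>\<^sup>+w. \<integral>\<^sup>+z. f (w + z) \<partial>gauss a \<partial>gauss b) = (\<integral>\<^sup>+w. \<integral>\<^sup>+z. ?n b w * (?n a z * f (w + z)) \<partial>lborel \<partial>lborel)"
    unfolding gauss_def
    by (subst nn_integral_density, simp, measurable, simp add: nn_integral_density nn_integral_cmult)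
  also have "\<dots> = (\<integral>\<^sup>+w. \<integral>\<^sup>+z. ?n b w * (?n a (- w + 1 * z) * f (w + (- w + 1 * z))) \<partial>lborel \<partial>lborel)"
  proof (rule nn_integral_cong)
    fix w show "(\<integral>\<^sup>+z. ?n b w * (?n a z * f (w + z)) \<partial>lborel)
      = (\<integral>\<^sup>+z. ?n b w * (?n a (- w + 1 * z) * f (w + (- w + 1 * z))) \<partial>lborel)"
      using nn_integral_real_affine[of "\<lambda>z. ?n b w * (?n a z * f (w + z))" 1 "- w"] by simp
  qed
  also have "\<dots> = (\<integral>\<^sup>+w. \<integral>\<^sup>+z. ?n a (z - w) * ?n b w * f z \<partial>lborel \<partial>lborel)"
    by (simp add: mult_ac)
  also have "\<dots> = (\<integral>\<^sup>+z. \<integral>\<^sup>+w. ?n a (z - w) * ?n b w * f z \<partial>lborel \<partial>lborel)"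
    by (rule lborel_pair.Fubini'[symmetric]) measurable
  also have "\<dots> = (\<integral>\<^sup>+z. (\<integral>\<^sup>+w. ennreal (normal_density 0 (sqrt a) (z - w) * normal_density 0 (sqrt b) w) \<partial>lborel) * f z \<partial>lborel)"
    by (intro nn_integral_cong, subst nn_integral_multc[symmetric]) (auto simp: ennreal_mult)
  also have "\<dots> = (\<integral>\<^sup>+z. ?n (b + a) z * f z \<partial>lborel)"
    using fun_cong[OF conv_normal_density_zero_mean[of "sqrt a" "sqrt b"]] a b by (simp add: add.commute)
  also have "\<dots> = (\<integral>\<^sup>+z. f z \<partial>gauss (b + a))"
    unfolding gauss_def by (subst nn_integral_density) auto
  finally show ?thesis .
qed

text \<open>The Doleans-Dade exponential at time 1 of minus the stochastic integral of the step
  process.\<close>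

definition step_exp :: "(real \<Rightarrow> 'a \<Rightarrow> real) \<Rightarrow> nat \<Rightarrow> (nat \<Rightarrow> real) \<Rightarrow> (nat \<Rightarrow> 'a \<Rightarrow> real) \<Rightarrow> 'a \<Rightarrow> real" where
  "step_exp W m s \<xi> x =
     exp (- step_integral W m s \<xi> x - (LINT t|leb01. (step_value m s \<xi> t x)\<^sup>2) / 2)"

text \<open>The same exponential stopped at \<open>s n\<close>, in the form that is adapted and
  grows by one factor per interval.\<close>

definition step_exp_upto :: "(real \<Rightarrow> 'a \<Rightarrow> real) \<Rightarrow> (nat \<Rightarrow> real) \<Rightarrow> (nat \<Rightarrow> 'a \<Rightarrow> real) \<Rightarrow> nat \<Rightarrow> 'a \<Rightarrow> real" where
  "step_exp_upto W s \<xi> n x =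
     exp (\<Sum>i<n. - \<xi> i x * (W (s (Suc i)) x - W (s i) x) - (\<xi> i x)\<^sup>2 * (s (Suc i) - s i) / 2)"

lemma step_exp_pos: "0 < step_exp W m s \<xi> x" "0 < step_exp_upto W s \<xi> n x"
  by (simp_all add: step_exp_def step_exp_upto_def)

lemma integral_step_value_sq:
  assumes g: "time_grid m s"
  shows "integrable leb01 (\<lambda>t. (step_value m s \<xi> t x - step_value m s \<eta> t x)\<^sup>2)"
    "(LINT t|leb01. (step_value m s \<xi> t x - step_value m s \<eta> t x)\<^sup>2) = (\<Sum>i<m. (\<xi> i x - \<eta> i x)\<^sup>2 * (s (Suc i) - s i))"
proof -
  have "(\<lambda>t. (step_value m s \<xi> t x - step_value m s \<eta> t x)\<^sup>2) = (\<lambda>t. step_value m s (\<lambda>i x. (\<xi> i x - \<eta> i x)\<^sup>2) t x)"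
    by (rule ext, rule step_value_comp[OF g, of "\<lambda>a b. (a - b)\<^sup>2"]) simp
  then show "integrable leb01 (\<lambda>t. (step_value m s \<xi> t x - step_value m s \<eta> t x)\<^sup>2)"
    "(LINT t|leb01. (step_value m s \<xi> t x - step_value m s \<eta> t x)\<^sup>2) = (\<Sum>i<m. (\<xi> i x - \<eta> i x)\<^sup>2 * (s (Suc i) - s i))"
    using integral_step_value[OF g] by simp_all
qed

lemma step_value_zero: "step_value m s (\<lambda>i x. 0) t x = 0"
  by (simp add: step_value_def)

lemma integral_step_value_sq0:
  assumes g: "time_grid m s"
  shows "integrable leb01 (\<lambda>t. (step_value m s \<xi> t x)\<^sup>2)"
    "(LINT t|leb01. (step_value m s \<xi> t x)\<^sup>2) = (\<Sum>i<m. (\<xi> i x)\<^sup>2 * (s (Suc i) - s i))"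
  using integral_step_value_sq[OF g, of \<xi> x "\<lambda>i x. 0"] by (simp_all add: step_value_zero)

lemma step_exp_eq: "time_grid m s \<Longrightarrow> step_exp W m s \<xi> x = step_exp_upto W s \<xi> m x"
  unfolding step_exp_def step_exp_upto_def integral_step_value_sq0 step_integral_def
  by (simp add: sum_subtractf sum_negf sum_divide_distrib)

lemma step_exp_upto_Suc:
  "step_exp_upto W s \<xi> (Suc n) x = step_exp_upto W s \<xi> n x *
     exp (- \<xi> n x * (W (s (Suc n)) x - W (s n) x) - (\<xi> n x)\<^sup>2 * (s (Suc n) - s n) / 2)"
  by (simp add: step_exp_upto_def exp_add)

lemma step_exp_refine:
  assumes g: "time_grid m s" and g': "time_grid m' s'" and sub: "s ` {..m} \<subseteq> s' ` {..m'}"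
  shows "step_exp W m' s' (refine_step m s \<xi> s') x = step_exp W m s \<xi> x"
  by (simp add: step_exp_def step_value_refine[OF assms] step_integral_refine[OF assms])

lemma step_value_truncate:
  assumes g: "time_grid m s" and n: "n \<le> m"
  shows "indicator {0..s n} t * step_value m s \<xi> t x = step_value m s (\<lambda>i x. if i < n then \<xi> i x else 0) t x"
proof (cases "t \<in> {0<..1}")
  case True
  then have t: "0 < t" "t \<le> 1" by auto
  obtain i where i: "i < m" "s i < t" "t \<le> s (Suc i)" using time_grid_locate[OF g t] .
  have "t \<le> s n \<longleftrightarrow> i < n"
    using time_grid_le[OF g, of "Suc i" n] time_grid_le[OF g, of n i] i n by (cases "i < n") auto
  then show ?thesis unfolding step_value_at[OF g i] using t by (simp add: indicator_def)
next
  case False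
  show ?thesis unfolding step_value_outside[OF g False] by simp
qed

lemma set_integral_step_value_leb01:
  assumes g: "time_grid m s"
  shows "(LINT t|lborel. step_value m s \<xi> t x) = (LINT t|leb01. step_value m s \<xi> t x)"
proof -
  have "indicator {0..1} t *\<^sub>R step_value m s \<xi> t x = step_value m s \<xi> t x" for t
    using step_value_outside[OF g, of t] by (cases "t \<in> {0..1}") auto
  then show ?thesis by (subst integral_restrict_space) (simp, simp only:)
qed

lemma set_integral_step_value:
  assumes g: "time_grid m s" and n: "n \<le> m"
  shows "(LINT t:{0..s n}|lborel. step_value m s \<xi> t x) = (\<Sum>i<n. \<xi> i x * (s (Suc i) - s i))"
proof -
  have "(LINT t:{0..s n}|lborel. step_value m s \<xi> t x) = (\<Sum>i<m. (if i < n then \<xi> i x else 0) * (s (Suc i) - s i))"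
    by (simp add: set_lebesgue_integral_def step_value_truncate[OF g n]
        set_integral_step_value_leb01[OF g] integral_step_value[OF g])
  also have "\<dots> = (\<Sum>i<n. (if i < n then \<xi> i x else 0) * (s (Suc i) - s i))"
    using n by (intro sum.mono_neutral_right) auto
  finally show ?thesis by simp
qed

context brownian_setting
begin

lemma step_exp_upto_measurable:
  assumes \<xi>: "step_process F m s \<xi>" and n: "n \<le> m"
  shows "step_exp_upto W s \<xi> n \<in> borel_measurable (F (s n))"
proof -
  have g: "time_grid m s" using \<xi> by (simp add: step_process_iff)
  have "(\<lambda>x. - \<xi> i x * (W (s (Suc i)) x - W (s i) x) - (\<xi> i x)\<^sup>2 * (s (Suc i) - s i) / 2) \<in> borel_measurable (F (s n))"
    if i: "i < n" for i
  proof -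
    have [measurable]: "\<xi> i \<in> borel_measurable (F (s n))"
      using \<xi> n i time_grid_le[OF g, of i n] by (auto simp: step_process_iff intro: measurable_F_mono[of _ "s i"])
    have "W (s j) \<in> borel_measurable (F (s n))" if "j \<le> n" for j
      using time_grid_le[OF g, of j n] time_grid_range[OF g, of j] that n
      by (auto intro!: measurable_F_mono[of _ "s j"] W_F)
    from this[of i] this[of "Suc i"] i
    have [measurable]: "W (s i) \<in> borel_measurable (F (s n))" "W (s (Suc i)) \<in> borel_measurable (F (s n))" by auto
    show ?thesis by measurable
  qed
  then show ?thesis unfolding step_exp_upto_def[abs_def]
    by (intro measurable_compose[OF _ borel_measurable_exp] borel_measurable_sum) auto
qed

lemma step_exp_measurable:
  assumes \<xi>: "step_process F m s \<xi>"
  shows "step_exp W m s \<xi> \<in> borel_measurable M"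
proof -
  have g: "time_grid m s" using \<xi> by (simp add: step_process_iff)
  have "step_exp W m s \<xi> = step_exp_upto W s \<xi> m" by (rule ext) (rule step_exp_eq[OF g])
  moreover have "s m = 1" using g by (simp add: time_grid_def)
  ultimately show ?thesis
    using measurable_F_M[OF step_exp_upto_measurable[OF \<xi> order_refl]] by simp
qed

lemma nn_integral_step_exp_Suc:
  assumes \<xi>: "step_process F m s \<xi>" and n: "n < m"
    and Z[measurable]: "Z \<in> borel_measurable (F (s n))" and g[measurable]: "g \<in> borel_measurable (F (s n) \<Otimes>\<^sub>M borel)"
  shows "(\<integral>\<^sup>+x. Z x * ennreal (step_exp_upto W s \<xi> (Suc n) x) *
             g (x, W (s (Suc n)) x - W (s n) x + \<xi> n x * (s (Suc n) - s n)) \<partial>M)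
      = (\<integral>\<^sup>+x. Z x * ennreal (step_exp_upto W s \<xi> n x) * (\<integral>\<^sup>+z. g (x, z) \<partial>gauss (s (Suc n) - s n)) \<partial>M)"
proof -
  have gr: "time_grid m s" using \<xi> by (simp add: step_process_iff)
  have [measurable]: "step_exp_upto W s \<xi> n \<in> borel_measurable (F (s n))"
    using step_exp_upto_measurable[OF \<xi>] n by simp
  have st: "0 \<le> s n" "s n < s (Suc n)" "s (Suc n) \<le> 1"
    using time_grid_range[OF gr, of n] time_grid_range[OF gr, of "Suc n"] n gr by (auto simp: time_grid_def)
  have "\<xi> n \<in> borel_measurable (F (s n))" using \<xi> n by (simp add: step_process_iff)
  from nn_integral_girsanov_step[OF st this, of "\<lambda>x. Z x * ennreal (step_exp_upto W s \<xi> n x)" g]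
  show ?thesis by (simp add: step_exp_upto_Suc ennreal_mult less_imp_le[OF step_exp_pos(2)] mult.assoc)
qed

text \<open>Each new factor has conditional mean 1, so the exponential is a martingale; this is the
  martingale property tested against \<open>Z\<close>.\<close>

lemma nn_integral_step_exp_upto:
  assumes \<xi>: "step_process F m s \<xi>" and k: "k \<le> n" "n \<le> m" and Z: "Z \<in> borel_measurable (F (s k))"
  shows "(\<integral>\<^sup>+x. Z x * ennreal (step_exp_upto W s \<xi> n x) \<partial>M) = (\<integral>\<^sup>+x. Z x * ennreal (step_exp_upto W s \<xi> k x) \<partial>M)"
  using k
proof (induction n rule: dec_induct)
  case (step n)
  have gr: "time_grid m s" using \<xi> by (simp add: step_process_iff)
  have st: "s k \<le> s n" "s n < s (Suc n)" using time_grid_le[OF gr, of k n] step gr by (auto simp: time_grid_def)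
  have "emeasure (gauss (s (Suc n) - s n)) UNIV = 1"
    using prob_space.emeasure_space_1[OF prob_space_gauss[of "s (Suc n) - s n"]] st by simp
  then show ?case
    using nn_integral_step_exp_Suc[OF \<xi>, of n Z "\<lambda>_. 1"] step measurable_F_mono st
    by (simp add: measurable_F_mono[OF Z])
qed simp

lemma nn_integral_step_exp:
  assumes \<xi>: "step_process F m s \<xi>"
  shows "(\<integral>\<^sup>+x. ennreal (step_exp W m s \<xi> x) \<partial>M) = 1"
proof -
  have g: "time_grid m s" using \<xi> by (simp add: step_process_iff)
  show ?thesis using nn_integral_step_exp_upto[OF \<xi>, of 0 m "\<lambda>_. 1"]
    by (simp add: step_exp_eq[OF g] step_exp_upto_def emeasure_space_1)
qed

lemma integral_step_exp:
  assumes \<xi>: "step_process F m s \<xi>"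
  shows "integrable M (step_exp W m s \<xi>)" "(\<integral>x. step_exp W m s \<xi> x \<partial>M) = 1"
proof -
  note [measurable] = step_exp_measurable[OF \<xi>]
  show "integrable M (step_exp W m s \<xi>)"
    by (rule integrableI_nonneg) (auto simp: nn_integral_step_exp[OF \<xi>] intro!: AE_I2 less_imp_le step_exp_pos)
  show "(\<integral>x. step_exp W m s \<xi> x \<partial>M) = 1"
    by (subst integral_eq_nn_integral) (auto simp: nn_integral_step_exp[OF \<xi>] intro!: AE_I2 less_imp_le step_exp_pos)
qed

text \<open>Girsanov's theorem for step processes: with density \<^const>\<open>step_exp_upto\<close>, the process
  \<open>W + \<integral>\<xi>\<close> has independent Gaussian increments.\<close>

lemma nn_integral_step_girsanov_grid:
  assumes \<xi>: "step_process F m s \<xi>" and k: "k < n" "n \<le> m" and Z: "Z \<in> borel_measurable (F (s k))"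
    and f: "f \<in> borel_measurable borel"
  shows "(\<integral>\<^sup>+x. Z x * ennreal (step_exp_upto W s \<xi> n x) *
            f (\<Sum>i\<in>{k..<n}. W (s (Suc i)) x - W (s i) x + \<xi> i x * (s (Suc i) - s i)) \<partial>M)
       = (\<integral>\<^sup>+x. Z x * ennreal (step_exp_upto W s \<xi> k x) \<partial>M) * (\<integral>\<^sup>+z. f z \<partial>gauss (s n - s k))"
  using Suc_leI[OF k(1)] k(2) f
\<comment> \<open>Integrating out the last increment replaces \<open>f\<close> by its convolution
  with a Gaussian law, hence \<open>f\<close> is arbitrary. The induction starts at
  \<open>Suc k\<close>, because \<open>gauss 0\<close> is not a probability.\<close>
proof (induction n arbitrary: f rule: dec_induct)
  case base
  note [measurable] = base(2) Z step_exp_upto_measurable[OF \<xi>, of k]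
  have km: "k < m" using base by simp
  have "Z \<in> borel_measurable (F (s k))" "step_exp_upto W s \<xi> k \<in> borel_measurable (F (s k))"
    using Z step_exp_upto_measurable[OF \<xi>, of k] km by auto
  then have m: "(\<lambda>x. Z x * ennreal (step_exp_upto W s \<xi> k x)) \<in> borel_measurable (F (s k))" by measurable
  have "s k \<in> {0..1}" using time_grid_range[of m s k] \<xi> km by (simp add: step_process_iff)
  then have "(\<lambda>x. Z x * ennreal (step_exp_upto W s \<xi> k x)) \<in> borel_measurable M"
    using measurable_from_subalg[OF subalg_F m] by simp
  then show ?case
    using nn_integral_step_exp_Suc[OF \<xi> km Z, of "\<lambda>(x, z). f z"] by (simp add: nn_integral_multc)
next
  case (step n)
  have gr: "time_grid m s" using \<xi> by (simp add: step_process_iff)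
  have km: "k \<le> n" "n < m" "n \<le> m" "k < n" using step by auto
  have st: "s k < s n" "s n < s (Suc n)" using time_grid_less[OF gr, of k n] km gr by (auto simp: time_grid_def)
  note [measurable] = step.prems(2)
  have inc: "(\<lambda>x. W (s (Suc i)) x - W (s i) x + \<xi> i x * (s (Suc i) - s i)) \<in> borel_measurable (F (s n))"
    if i: "i < n" for i
  proof -
    have [measurable]: "\<xi> i \<in> borel_measurable (F (s n))"
      using \<xi> km i time_grid_le[OF gr, of i n] by (auto simp: step_process_iff intro: measurable_F_mono[of _ "s i"])
    have "W (s j) \<in> borel_measurable (F (s n))" if "j \<le> n" for j
      using time_grid_le[OF gr, of j n] time_grid_range[OF gr, of j] that km
      by (auto intro!: measurable_F_mono[of _ "s j"] W_F)
    from this[of i] this[of "Suc i"] i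
    have [measurable]: "W (s i) \<in> borel_measurable (F (s n))" "W (s (Suc i)) \<in> borel_measurable (F (s n))" by auto
    show ?thesis by measurable
  qed
  define S where "S = (\<lambda>x. \<Sum>i\<in>{k..<n}. W (s (Suc i)) x - W (s i) x + \<xi> i x * (s (Suc i) - s i))"
  have [measurable]: "S \<in> borel_measurable (F (s n))"
    unfolding S_def by (rule borel_measurable_sum) (use inc in auto)
  have Zn: "Z \<in> borel_measurable (F (s n))" using Z st by (auto intro: measurable_F_mono)
  interpret G: prob_space "gauss (s (Suc n) - s n)" by (rule prob_space_gauss) (use st in simp)
  have fm: "(\<lambda>w. \<integral>\<^sup>+z. f (w + z) \<partial>gauss (s (Suc n) - s n)) \<in> borel_measurable borel"
    by measurable
  have "(\<integral>\<^sup>+x. Z x * ennreal (step_exp_upto W s \<xi> (Suc n) x) *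
            f (\<Sum>i\<in>{k..<Suc n}. W (s (Suc i)) x - W (s i) x + \<xi> i x * (s (Suc i) - s i)) \<partial>M)
     = (\<integral>\<^sup>+x. Z x * ennreal (step_exp_upto W s \<xi> n x) * (\<integral>\<^sup>+z. f (S x + z) \<partial>gauss (s (Suc n) - s n)) \<partial>M)"
  proof -
    have "(\<lambda>(x, z). f (S x + z)) \<in> borel_measurable (F (s n) \<Otimes>\<^sub>M borel)" by measurable
    from nn_integral_step_exp_Suc[OF \<xi> km(2) Zn this] km show ?thesis by (simp add: S_def)
  qed
  also have "\<dots> = (\<integral>\<^sup>+x. Z x * ennreal (step_exp_upto W s \<xi> k x) \<partial>M) *
      (\<integral>\<^sup>+w. \<integral>\<^sup>+z. f (w + z) \<partial>gauss (s (Suc n) - s n) \<partial>gauss (s n - s k))"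
    unfolding S_def by (rule step.IH[OF km(3) fm])
  also have "(\<integral>\<^sup>+w. \<integral>\<^sup>+z. f (w + z) \<partial>gauss (s (Suc n) - s n) \<partial>gauss (s n - s k)) = (\<integral>\<^sup>+z. f z \<partial>gauss (s (Suc n) - s k))"
    using nn_integral_gauss_conv[of "s (Suc n) - s n" "s n - s k" f] st by simp
  finally show ?case .
qed

text \<open>Inserting \<open>a\<close> and \<open>b\<close> into the grid alters neither the
  exponential nor the drift and reduces the claim to grid points. The factors of the exponential
  after \<open>b\<close> disappear by the martingale property.\<close>

lemma nn_integral_step_girsanov:
  assumes \<xi>: "step_process F m s \<xi>" and ab: "0 \<le> a" "a < b" "b \<le> 1" and A: "A \<in> sets (F a)"
    and f: "f \<in> borel_measurable borel"
  shows "(\<integral>\<^sup>+x. indicator A x * ennreal (step_exp W m s \<xi> x) *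
            f (W b x - W a x + ((LINT t:{0..b}|lborel. step_value m s \<xi> t x) - (LINT t:{0..a}|lborel. step_value m s \<xi> t x))) \<partial>M)
       = (\<integral>\<^sup>+x. indicator A x * ennreal (step_exp W m s \<xi> x) \<partial>M) * (\<integral>\<^sup>+z. f z \<partial>gauss (b - a))"
proof -
  have g: "time_grid m s" using \<xi> by (simp add: step_process_iff)
  have gr: "s ` {..m} \<subseteq> {0..1}" using time_grid_range[OF g] by auto
  have e: "0 \<in> s ` {..m}" "1 \<in> s ` {..m}" using g by (auto simp: time_grid_def image_iff intro: bexI[of _ 0] bexI[of _ m])
  obtain m' s' where g': "time_grid m' s'" and im: "s' ` {..m'} = s ` {..m} \<union> {a, b}"
    using time_grid_of_finite[of "s ` {..m} \<union> {a, b}"] gr e ab by auto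
  define \<eta> where "\<eta> = refine_step m s \<xi> s'"
  have sub: "s ` {..m} \<subseteq> s' ` {..m'}" using im by auto
  have \<eta>: "step_process F m' s' \<eta>" unfolding \<eta>_def by (rule step_process_refine[OF \<xi> g' sub])
  have eq: "step_exp W m s \<xi> x = step_exp W m' s' \<eta> x" "step_value m s \<xi> t x = step_value m' s' \<eta> t x" for x t
    unfolding \<eta>_def by (simp_all add: step_exp_refine[OF g g' sub] step_value_refine[OF g g' sub])
  have "a \<in> s' ` {..m'}" "b \<in> s' ` {..m'}" using im by auto
  then obtain k n where k: "k \<le> m'" "a = s' k" and n: "n \<le> m'" "b = s' n" by auto
  have kn: "k < n" using ab k n time_grid_less_iff[OF g', of k n] by simp
  have Z: "(indicator A :: 'a \<Rightarrow> ennreal) \<in> borel_measurable (F (s' k))" "(indicator A :: 'a \<Rightarrow> ennreal) \<in> borel_measurable (F (s' n))"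
    using A F_mono[of a b] ab k n by auto
  have tele: "(\<Sum>i\<in>{k..<n}. W (s' (Suc i)) x - W (s' i) x + \<eta> i x * (s' (Suc i) - s' i))
     = W b x - W a x + ((LINT t:{0..b}|lborel. step_value m' s' \<eta> t x) - (LINT t:{0..a}|lborel. step_value m' s' \<eta> t x))" for x
  proof -
    have "(\<Sum>i\<in>{k..<n}. W (s' (Suc i)) x - W (s' i) x) = W b x - W a x"
      using sum_Suc_diff'[of k n "\<lambda>i. W (s' i) x"] kn k n by simp
    moreover have "(\<Sum>i<n. \<eta> i x * (s' (Suc i) - s' i)) = (\<Sum>i<k. \<eta> i x * (s' (Suc i) - s' i)) + (\<Sum>i\<in>{k..<n}. \<eta> i x * (s' (Suc i) - s' i))"
      using kn by (simp add: sum.atLeastLessThan_concat[of 0 k n, symmetric] lessThan_atLeast0)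
    ultimately show ?thesis
      using set_integral_step_value[OF g', of n \<eta> x] set_integral_step_value[OF g', of k \<eta> x] k n
      by (simp add: sum.distrib)
  qed
  have fS: "(\<lambda>x. f (\<Sum>i\<in>{k..<n}. W (s' (Suc i)) x - W (s' i) x + \<eta> i x * (s' (Suc i) - s' i))) \<in> borel_measurable (F (s' n))"
  proof (rule measurable_compose[OF _ f], rule borel_measurable_sum)
    fix i assume i: "i \<in> {k..<n}"
    have [measurable]: "\<eta> i \<in> borel_measurable (F (s' n))"
      using \<eta> i n time_grid_le[OF g', of i n] by (auto simp: step_process_iff intro: measurable_F_mono[of _ "s' i"])
    have "W (s' j) \<in> borel_measurable (F (s' n))" if "j \<le> n" for j
      using time_grid_le[OF g', of j n] time_grid_range[OF g', of j] that n
      by (auto intro!: measurable_F_mono[of _ "s' j"] W_F)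
    from this[of i] this[of "Suc i"] i
    have [measurable]: "W (s' i) \<in> borel_measurable (F (s' n))" "W (s' (Suc i)) \<in> borel_measurable (F (s' n))" by auto
    show "(\<lambda>x. W (s' (Suc i)) x - W (s' i) x + \<eta> i x * (s' (Suc i) - s' i)) \<in> borel_measurable (F (s' n))"
      using i by measurable
  qed
  have "(\<integral>\<^sup>+x. indicator A x * ennreal (step_exp W m s \<xi> x) *
            f (W b x - W a x + ((LINT t:{0..b}|lborel. step_value m s \<xi> t x) - (LINT t:{0..a}|lborel. step_value m s \<xi> t x))) \<partial>M)
     = (\<integral>\<^sup>+x. (indicator A x * f (\<Sum>i\<in>{k..<n}. W (s' (Suc i)) x - W (s' i) x + \<eta> i x * (s' (Suc i) - s' i))) *
             ennreal (step_exp_upto W s' \<eta> m' x) \<partial>M)"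
    unfolding tele eq step_exp_eq[OF g'] by (simp add: mult_ac)
  also have "\<dots> = (\<integral>\<^sup>+x. (indicator A x * f (\<Sum>i\<in>{k..<n}. W (s' (Suc i)) x - W (s' i) x + \<eta> i x * (s' (Suc i) - s' i))) *
             ennreal (step_exp_upto W s' \<eta> n x) \<partial>M)"
    by (rule nn_integral_step_exp_upto[OF \<eta> n(1) order_refl]) (use Z fS in measurable)
  also have "\<dots> = (\<integral>\<^sup>+x. indicator A x * ennreal (step_exp_upto W s' \<eta> n x) *
       f (\<Sum>i\<in>{k..<n}. W (s' (Suc i)) x - W (s' i) x + \<eta> i x * (s' (Suc i) - s' i)) \<partial>M)"
    by (simp add: mult_ac)
  also have "\<dots> = (\<integral>\<^sup>+x. indicator A x * ennreal (step_exp_upto W s' \<eta> k x) \<partial>M) * (\<integral>\<^sup>+z. f z \<partial>gauss (s' n - s' k))"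
    by (rule nn_integral_step_girsanov_grid[OF \<eta> kn n(1) Z(1) f])
  also have "(\<integral>\<^sup>+x. indicator A x * ennreal (step_exp_upto W s' \<eta> k x) \<partial>M) = (\<integral>\<^sup>+x. indicator A x * ennreal (step_exp W m s \<xi> x) \<partial>M)"
    unfolding eq step_exp_eq[OF g'] by (rule nn_integral_step_exp_upto[OF \<eta> k(1) order_refl Z(1), symmetric])
  finally show ?thesis using k n by simp
qed

text \<open>The Hellinger affinity of two step densities is controlled by the distance of the step
  processes, because \<open>(a\<^sup>2 + b\<^sup>2) / 4 = ((a + b) / 2)\<^sup>2 / 2 + (a - b)\<^sup>2 / 8\<close>.\<close>

lemma nn_integral_hellinger_step:
  assumes \<xi>: "step_process F m s \<xi>" and \<eta>: "step_process F m' s' \<eta>"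
  shows "(\<integral>\<^sup>+x. ennreal (sqrt (step_exp W m s \<xi> x * step_exp W m' s' \<eta> x) *
            exp ((LINT t|leb01. (step_value m s \<xi> t x - step_value m' s' \<eta> t x)\<^sup>2) / 8)) \<partial>M) = 1"
proof -
  have g: "time_grid m s" "time_grid m' s'" using \<xi> \<eta> by (simp_all add: step_process_iff)
  have gr: "s ` {..m} \<subseteq> {0..1}" "s' ` {..m'} \<subseteq> {0..1}" using time_grid_range[OF g(1)] time_grid_range[OF g(2)] by auto
  have e: "0 \<in> s ` {..m}" "1 \<in> s ` {..m}" using g by (auto simp: time_grid_def image_iff intro: bexI[of _ 0] bexI[of _ m])
  obtain M' S where g': "time_grid M' S" and im: "S ` {..M'} = s ` {..m} \<union> s' ` {..m'}"
    using time_grid_of_finite[of "s ` {..m} \<union> s' ` {..m'}"] gr e by auto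
  have sub: "s ` {..m} \<subseteq> S ` {..M'}" "s' ` {..m'} \<subseteq> S ` {..M'}" using im by auto
  define p where "p = refine_step m s \<xi> S"
  define q where "q = refine_step m' s' \<eta> S"
  have pq: "step_process F M' S p" "step_process F M' S q"
    unfolding p_def q_def by (rule step_process_refine[OF \<xi> g' sub(1)], rule step_process_refine[OF \<eta> g' sub(2)])
  have eq: "step_exp W m s \<xi> x = step_exp W M' S p x" "step_value m s \<xi> t x = step_value M' S p t x"
    "step_exp W m' s' \<eta> x = step_exp W M' S q x" "step_value m' s' \<eta> t x = step_value M' S q t x" for x t
    unfolding p_def q_def
    by (simp_all add: step_exp_refine[OF g(1) g' sub(1)] step_value_refine[OF g(1) g' sub(1)]
         step_exp_refine[OF g(2) g' sub(2)] step_value_refine[OF g(2) g' sub(2)])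
  \<comment> \<open>The midpoint of the two processes: the integrand of the claim is its
    exponential, and that has integral 1.\<close>
  define r where "r = (\<lambda>i x. (p i x + q i x) / 2)"
  have r: "step_process F M' S r"
    unfolding step_process_iff
  proof (intro conjI g' allI impI)
    fix i assume i: "i < M'"
    have [measurable]: "p i \<in> borel_measurable (F (S i))" "q i \<in> borel_measurable (F (S i))"
      using pq i by (simp_all add: step_process_iff)
    show "r i \<in> borel_measurable (F (S i))" unfolding r_def by measurable
    obtain C where "\<forall>x\<in>space (F (S i)). \<bar>p i x\<bar> \<le> C" using pq(1) i unfolding step_process_iff by blast
    moreover obtain D where "\<forall>x\<in>space (F (S i)). \<bar>q i x\<bar> \<le> D" using pq(2) i unfolding step_process_iff by blast
    ultimately have "\<forall>x\<in>space (F (S i)). \<bar>r i x\<bar> \<le> (C + D) / 2"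
      unfolding r_def by (auto intro!: order_trans[OF abs_triangle_ineq add_mono])
    then show "\<exists>C. \<forall>x\<in>space (F (S i)). \<bar>r i x\<bar> \<le> C" by blast
  qed
  have "sqrt (step_exp W M' S p x * step_exp W M' S q x) * exp ((LINT t|leb01. (step_value M' S p t x - step_value M' S q t x)\<^sup>2) / 8)
     = step_exp W M' S r x" for x
  proof -
    have gen: "(sum a I + sum b I) / 2 + sum c I / 8 = (\<Sum>i\<in>I. (a i + b i) / 2 + c i / 8)"
      for a b c :: "nat \<Rightarrow> real" and I
      by (simp add: sum.distrib sum_divide_distrib add_divide_distrib)
    let ?e = "\<lambda>p i. - p i x * (W (S (Suc i)) x - W (S i) x) - (p i x)\<^sup>2 * (S (Suc i) - S i) / 2"
    have "sqrt (exp a * exp b) = exp ((a + b) / 2)" for a b :: real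
      by (metis exp_add exp_gt_zero field_sum_of_halves real_sqrt_abs abs_of_pos power2_eq_square)
    then have "sqrt (step_exp W M' S p x * step_exp W M' S q x) * exp ((LINT t|leb01. (step_value M' S p t x - step_value M' S q t x)\<^sup>2) / 8)
      = exp (((\<Sum>i<M'. ?e p i) + (\<Sum>i<M'. ?e q i)) / 2 + (\<Sum>i<M'. (p i x - q i x)\<^sup>2 * (S (Suc i) - S i)) / 8)"
      by (simp add: step_exp_eq[OF g'] step_exp_upto_def integral_step_value_sq[OF g'] exp_add)
    also have "((\<Sum>i<M'. ?e p i) + (\<Sum>i<M'. ?e q i)) / 2 + (\<Sum>i<M'. (p i x - q i x)\<^sup>2 * (S (Suc i) - S i)) / 8
      = (\<Sum>i<M'. (?e p i + ?e q i) / 2 + (p i x - q i x)\<^sup>2 * (S (Suc i) - S i) / 8)"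
      by (rule gen)
    also have "\<dots> = (\<Sum>i<M'. ?e r i)"
      by (rule sum.cong[OF refl]) (simp add: r_def field_simps power2_eq_square)
    finally show ?thesis by (simp add: step_exp_eq[OF g'] step_exp_upto_def)
  qed
  then show ?thesis unfolding eq using nn_integral_step_exp[OF r] by simp
qed

end

section \<open>Limits of exponentials of step processes\<close>

lemma finite_measure_leb01: "finite_measure leb01"
  by (rule finite_measureI) (simp add: emeasure_restrict_space space_restrict_space)

lemma sigma_finite_leb01: "sigma_finite_measure leb01"
  by (rule finite_measure.axioms(1)[OF finite_measure_leb01])

lemma space_leb01 [simp]: "space leb01 = {0..1}"
  by (simp add: space_restrict_space)

lemma measurable_process_section:
  assumes "measurable_process M u" "x \<in> space M"
  shows "(\<lambda>t. u t x) \<in> borel_measurable leb01"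
proof -
  have "(\<lambda>t. case (t, x) of (t, x) \<Rightarrow> u t x) \<in> borel_measurable leb01"
    using assms unfolding measurable_process_def by measurable
  then show ?thesis by simp
qed

lemma measurable_step_value:
  assumes "time_grid m s" "\<And>i. i < m \<Longrightarrow> \<xi> i \<in> borel_measurable M"
  shows "measurable_process M (step_value m s \<xi>)"
  unfolding measurable_process_def step_value_def split_beta
proof (rule borel_measurable_sum)
  fix i assume i: "i \<in> {..<m}"
  have [measurable]: "\<xi> i \<in> borel_measurable M" using assms i by auto
  have [measurable]: "(\<lambda>t. indicator {s i<..s (Suc i)} t :: real) \<in> borel_measurable leb01"
    by (intro measurable_restrict_space1) simp
  show "(\<lambda>p. \<xi> i (snd p) * indicator {s i<..s (Suc i)} (fst p)) \<in> borel_measurable (leb01 \<Otimes>\<^sub>M M)"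
    by measurable
qed

text \<open>The geometric mean is at least the minimum.\<close>

lemma sqrt_diff_bound:
  fixes a b :: real assumes "0 \<le> a" "0 \<le> b"
  shows "(a + b) / 2 - sqrt (a * b) \<le> \<bar>a - b\<bar> / 2"
proof -
  have "min a b = sqrt (min a b * min a b)" using assms by simp
  also have "\<dots> \<le> sqrt (a * b)" using assms by (intro real_sqrt_le_mono mult_mono) auto
  finally have "min a b \<le> sqrt (a * b)" .
  moreover have "(a + b) / 2 - min a b = \<bar>a - b\<bar> / 2" by (simp add: min_def abs_if field_simps)
  ultimately show ?thesis by linarith
qed

context brownian_setting
begin

lemma step_process_measurable:
  assumes "step_process F m s \<xi>"
  shows "i < m \<Longrightarrow> \<xi> i \<in> borel_measurable M" "measurable_process M (step_value m s \<xi>)"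
proof -
  have g: "time_grid m s" using assms by (simp add: step_process_iff)
  show *: "\<xi> i \<in> borel_measurable M" if "i < m" for i
    using assms that time_grid_range[OF g, of i] by (intro measurable_F_M[of _ "s i"]) (auto simp: step_process_iff)
  show "measurable_process M (step_value m s \<xi>)" by (rule measurable_step_value[OF g *])
qed

text \<open>Write S for the root of the product and D for the squared distance. Since S exp (D / 8)
  has mean 1 and exp x \<ge> 1 + x, the mean of S D is at most 8 (1 - E S), and 1 - E S is at most
  half the L^1 distance of the exponentials.\<close>

lemma nn_integral_step_distance:
  assumes \<xi>: "step_process F m s \<xi>" and \<eta>: "step_process F m' s' \<eta>"
  shows "(\<integral>\<^sup>+x. ennreal (sqrt (step_exp W m s \<xi> x * step_exp W m' s' \<eta> x)) *
            (\<integral>\<^sup>+t. ennreal ((step_value m s \<xi> t x - step_value m' s' \<eta> t x)\<^sup>2) \<partial>leb01) \<partial>M)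
     \<le> ennreal (4 * (\<integral>x. \<bar>step_exp W m s \<xi> x - step_exp W m' s' \<eta> x\<bar> \<partial>M))"
proof -
  let ?N = "step_exp W m s \<xi>" and ?N' = "step_exp W m' s' \<eta>"
  define D where "D = (\<lambda>x. LINT t|leb01. (step_value m s \<xi> t x - step_value m' s' \<eta> t x)\<^sup>2)"
  have g: "time_grid m s" "time_grid m' s'" using \<xi> \<eta> by (simp_all add: step_process_iff)
  have D0: "0 \<le> D x" for x unfolding D_def by simp
  have [measurable]: "(\<lambda>(t, x). step_value m s \<xi> t x) \<in> borel_measurable (leb01 \<Otimes>\<^sub>M M)"
    "(\<lambda>(t, x). step_value m' s' \<eta> t x) \<in> borel_measurable (leb01 \<Otimes>\<^sub>M M)"
    using step_process_measurable(2)[OF \<xi>] step_process_measurable(2)[OF \<eta>] by (simp_all add: measurable_process_def)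
  interpret L: sigma_finite_measure leb01 by (rule sigma_finite_leb01)
  have [measurable]: "D \<in> borel_measurable M"
    unfolding D_def by measurable
  note [measurable] = step_exp_measurable[OF \<xi>] step_exp_measurable[OF \<eta>]
  have iD: "integrable leb01 (\<lambda>t. (step_value m s \<xi> t x - step_value m' s' \<eta> t x)\<^sup>2)" if "x \<in> space M" for x
  proof (rule Bochner_Integration.integrable_bound)
    show "integrable leb01 (\<lambda>t. 2 * (step_value m s \<xi> t x)\<^sup>2 + 2 * (step_value m' s' \<eta> t x)\<^sup>2)"
      by (intro Bochner_Integration.integrable_add integrable_mult_right
          integral_step_value_sq0(1)[OF g(1)] integral_step_value_sq0(1)[OF g(2)])
    have m1: "(\<lambda>t. step_value m s \<xi> t x) \<in> borel_measurable leb01" "(\<lambda>t. step_value m' s' \<eta> t x) \<in> borel_measurable leb01"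
      using measurable_process_section[OF step_process_measurable(2)[OF \<xi>] that]
       measurable_process_section[OF step_process_measurable(2)[OF \<eta>] that] by simp_all
    then show "(\<lambda>t. (step_value m s \<xi> t x - step_value m' s' \<eta> t x)\<^sup>2) \<in> borel_measurable leb01" by measurable
    show "AE t in leb01. norm ((step_value m s \<xi> t x - step_value m' s' \<eta> t x)\<^sup>2)
        \<le> norm (2 * (step_value m s \<xi> t x)\<^sup>2 + 2 * (step_value m' s' \<eta> t x)\<^sup>2)"
    proof (rule AE_I2)
      fix t
      have "(a - b)\<^sup>2 \<le> 2 * a\<^sup>2 + 2 * b\<^sup>2" for a b :: real
        using sum_squares_bound[of a "-b"] by (simp add: power2_diff)
      then show "norm ((step_value m s \<xi> t x - step_value m' s' \<eta> t x)\<^sup>2)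
        \<le> norm (2 * (step_value m s \<xi> t x)\<^sup>2 + 2 * (step_value m' s' \<eta> t x)\<^sup>2)" by simp
    qed
  qed
  have nnD: "(\<integral>\<^sup>+t. ennreal ((step_value m s \<xi> t x - step_value m' s' \<eta> t x)\<^sup>2) \<partial>leb01) = ennreal (D x)"
    if "x \<in> space M" for x
    unfolding D_def by (rule nn_integral_eq_integral[OF iD[OF that]]) simp
  define S where "S = (\<lambda>x. sqrt (?N x * ?N' x))"
  have S0: "0 \<le> S x" for x unfolding S_def by (simp add: less_imp_le[OF step_exp_pos(1)])
  have [measurable]: "S \<in> borel_measurable M" unfolding S_def by measurable
  have iN: "integrable M ?N" "integrable M ?N'" "(\<integral>x. ?N x \<partial>M) = 1" "(\<integral>x. ?N' x \<partial>M) = 1"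
    using integral_step_exp[OF \<xi>] integral_step_exp[OF \<eta>] by auto
  have hell: "(\<integral>\<^sup>+x. ennreal (S x * exp (D x / 8)) \<partial>M) = 1"
    using nn_integral_hellinger_step[OF \<xi> \<eta>] by (simp add: S_def D_def)
  have iE: "integrable M (\<lambda>x. S x * exp (D x / 8))" "(\<integral>x. S x * exp (D x / 8) \<partial>M) = 1"
  proof -
    show "integrable M (\<lambda>x. S x * exp (D x / 8))"
      by (rule integrableI_nonneg) (use S0 in \<open>auto simp: hell\<close>)
    show "(\<integral>x. S x * exp (D x / 8) \<partial>M) = 1"
      by (subst integral_eq_nn_integral) (use S0 in \<open>auto simp: hell\<close>)
  qed
  have SE: "S x \<le> S x * exp (D x / 8)" "S x * D x \<le> 8 * (S x * exp (D x / 8) - S x)" for x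
  proof -
    have "1 + D x / 8 \<le> exp (D x / 8)" by (rule exp_ge_add_one_self)
    from mult_left_mono[OF this S0[of x]] show "S x * D x \<le> 8 * (S x * exp (D x / 8) - S x)"
      by (simp add: algebra_simps)
    show "S x \<le> S x * exp (D x / 8)" using S0[of x] D0[of x] by (simp add: mult_le_cancel_left1)
  qed
  have iS: "integrable M S"
    by (rule Bochner_Integration.integrable_bound[OF iE(1)]) (use SE(1) S0 in \<open>auto intro!: AE_I2\<close>)
  have iSD: "integrable M (\<lambda>x. S x * D x)"
    by (rule Bochner_Integration.integrable_bound[of M "\<lambda>x. 8 * (S x * exp (D x / 8) - S x)"])
       (use iE(1) iS SE D0 S0 in \<open>auto intro!: AE_I2\<close>)
  have "(\<integral>x. S x * D x \<partial>M) \<le> (\<integral>x. 8 * (S x * exp (D x / 8) - S x) \<partial>M)"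
    using iE(1) iS SE(2) by (intro integral_mono iSD) auto
  also have "\<dots> = 8 * (1 - (\<integral>x. S x \<partial>M))" using iE iS by simp
  also have "1 - (\<integral>x. S x \<partial>M) = (\<integral>x. (?N x + ?N' x) / 2 - S x \<partial>M)"
    using iN iS by simp
  also have "\<dots> \<le> (\<integral>x. \<bar>?N x - ?N' x\<bar> / 2 \<partial>M)"
  proof (rule integral_mono)
    fix x show "(?N x + ?N' x) / 2 - S x \<le> \<bar>?N x - ?N' x\<bar> / 2"
      unfolding S_def by (rule sqrt_diff_bound) (rule less_imp_le[OF step_exp_pos(1)])+
  qed (use iN iS in auto)
  finally have "(\<integral>x. S x * D x \<partial>M) \<le> 4 * (\<integral>x. \<bar>?N x - ?N' x\<bar> \<partial>M)" by simp
  then have "ennreal (\<integral>x. S x * D x \<partial>M) \<le> ennreal (4 * (\<integral>x. \<bar>?N x - ?N' x\<bar> \<partial>M))" by (rule ennreal_leI)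
  moreover have "(\<integral>\<^sup>+x. ennreal (S x) * (\<integral>\<^sup>+t. ennreal ((step_value m s \<xi> t x - step_value m' s' \<eta> t x)\<^sup>2) \<partial>leb01) \<partial>M)
     = (\<integral>\<^sup>+x. ennreal (S x * D x) \<partial>M)"
    using S0 D0 by (intro nn_integral_cong) (simp add: nnD ennreal_mult)
  moreover have "(\<integral>\<^sup>+x. ennreal (S x * D x) \<partial>M) = ennreal (\<integral>x. S x * D x \<partial>M)"
    by (rule nn_integral_eq_integral[OF iSD]) (use S0 D0 in auto)
  ultimately show ?thesis by (simp add: S_def)
qed

text \<open>Convergence of the exponentials in L^1 makes the step processes Cauchy in the weighted
  distance of \<open>nn_integral_step_distance\<close>. Fatou's lemma in the second index puts
  \<open>u\<close> in place of the second process, and the weight can be divided out because its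
  limit \<open>L x\<close> is positive.\<close>

lemma step_limit_subseq:
  assumes step: "\<And>k. step_process F (m k) (s k) (\<xi> k)"
    and L[measurable]: "integrable M L" and Lpos: "\<And>x. 0 < L x"
    and L1: "(\<lambda>k. \<integral>x. \<bar>step_exp W (m k) (s k) (\<xi> k) x - L x\<bar> \<partial>M) \<longlonglongrightarrow> 0"
    and u: "measurable_process M u"
    and conv: "AE x in M. AE t in leb01. (\<lambda>k. step_value (m k) (s k) (\<xi> k) t x) \<longlonglongrightarrow> u t x"
  obtains r where "strict_mono r"
    "AE x in M. (\<lambda>k. step_exp W (m (r k)) (s (r k)) (\<xi> (r k)) x) \<longlonglongrightarrow> L x"
    "AE x in M. integrable leb01 (\<lambda>t. (u t x)\<^sup>2)"
    "AE x in M. (\<lambda>k. LINT t|leb01. (step_value (m (r k)) (s (r k)) (\<xi> (r k)) t x - u t x)\<^sup>2) \<longlonglongrightarrow> 0"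
proof -
  interpret L: sigma_finite_measure leb01 by (rule sigma_finite_leb01)
  define N where "N = (\<lambda>k. step_exp W (m k) (s k) (\<xi> k))"
  have iN: "integrable M (N k)" for k unfolding N_def by (rule integral_step_exp[OF step])
  \<comment> \<open>First extraction: almost sure convergence of the exponentials, which Fatou's
    lemma below requires.\<close>
  have "\<exists>r::nat\<Rightarrow>nat. strict_mono r \<and> (AE x in M. (\<lambda>k. N (r k) x - L x) \<longlonglongrightarrow> 0)"
    by (rule tendsto_L1_AE_subseq) (use iN L L1 in \<open>auto simp: N_def\<close>)
  then obtain r1 :: "nat \<Rightarrow> nat" where r1: "strict_mono r1" "AE x in M. (\<lambda>k. N (r1 k) x - L x) \<longlonglongrightarrow> 0" by blast
  have N1: "AE x in M. (\<lambda>k. N (r1 k) x) \<longlonglongrightarrow> L x"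
    using r1(2) by eventually_elim (simp add: LIM_zero_iff)
  define v where "v = (\<lambda>k. step_value (m (r1 k)) (s (r1 k)) (\<xi> (r1 k)))"
  define e where "e = (\<lambda>k. \<integral>x. \<bar>N (r1 k) x - L x\<bar> \<partial>M)"
  have e0: "e \<longlonglongrightarrow> 0" using LIMSEQ_subseq_LIMSEQ[OF L1 r1(1)] by (simp add: e_def N_def comp_def)
  have epos: "0 \<le> e k" for k unfolding e_def by simp
  have Npos: "0 < N k x" for k x by (simp add: N_def step_exp_pos)
  have [measurable]: "(\<lambda>(t, x). u t x) \<in> borel_measurable (leb01 \<Otimes>\<^sub>M M)"
    "(\<lambda>(t, x). v k t x) \<in> borel_measurable (leb01 \<Otimes>\<^sub>M M)" "N k \<in> borel_measurable M" "L \<in> borel_measurable M" for k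
    using u step_process_measurable(2)[OF step] iN L by (simp_all add: measurable_process_def v_def)
  have um: "(\<lambda>t. u t x) \<in> borel_measurable leb01" "(\<lambda>t. v k t x) \<in> borel_measurable leb01" if "x \<in> space M" for x k
    using measurable_process_section[OF u that] measurable_process_section[OF step_process_measurable(2)[OF step] that]
    by (simp_all add: v_def)
  have vconv: "AE x in M. AE t in leb01. (\<lambda>k. v k t x) \<longlonglongrightarrow> u t x"
    using conv
  proof eventually_elim
    case (elim x)
    then show ?case
    proof eventually_elim
      case (elim t)
      show ?case using LIMSEQ_subseq_LIMSEQ[OF elim r1(1)] by (simp add: v_def comp_def)
    qed
  qed
  define Q where "Q = (\<lambda>k x. \<integral>\<^sup>+t. ennreal ((v k t x - u t x)\<^sup>2) \<partial>leb01)"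
  have [measurable]: "Q k \<in> borel_measurable M" for k unfolding Q_def by measurable
  have main: "(\<integral>\<^sup>+x. ennreal (sqrt (N (r1 k) x * L x)) * Q k x \<partial>M) \<le> ennreal (4 * e k)" for k
  proof -
    let ?f = "\<lambda>j x t. ennreal (sqrt (N (r1 k) x * N (r1 j) x)) * ennreal ((v k t x - v j t x)\<^sup>2)"
    have "(\<integral>\<^sup>+x. ennreal (sqrt (N (r1 k) x * L x)) * Q k x \<partial>M) =
        (\<integral>\<^sup>+x. \<integral>\<^sup>+t. ennreal (sqrt (N (r1 k) x * L x)) * ennreal ((v k t x - u t x)\<^sup>2) \<partial>leb01 \<partial>M)"
      unfolding Q_def by (intro nn_integral_cong, subst nn_integral_cmult) (use um in auto)
    \<comment> \<open>Fatou's lemma is used twice, for the integral over time here and for the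
      expectation afterwards.\<close>
    also have "\<dots> \<le> (\<integral>\<^sup>+x. liminf (\<lambda>j. \<integral>\<^sup>+t. ?f j x t \<partial>leb01) \<partial>M)"
    proof (rule nn_integral_mono_AE)
      show "AE x in M. (\<integral>\<^sup>+t. ennreal (sqrt (N (r1 k) x * L x)) * ennreal ((v k t x - u t x)\<^sup>2) \<partial>leb01)
         \<le> liminf (\<lambda>j. \<integral>\<^sup>+t. ?f j x t \<partial>leb01)"
        using N1 vconv AE_space
      proof eventually_elim
        case (elim x)
        have "(\<integral>\<^sup>+t. ennreal (sqrt (N (r1 k) x * L x)) * ennreal ((v k t x - u t x)\<^sup>2) \<partial>leb01)
           = (\<integral>\<^sup>+t. liminf (\<lambda>j. ?f j x t) \<partial>leb01)"
        proof (rule nn_integral_cong_AE)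
          show "AE t in leb01. ennreal (sqrt (N (r1 k) x * L x)) * ennreal ((v k t x - u t x)\<^sup>2) = liminf (\<lambda>j. ?f j x t)"
            using elim(2)
          proof eventually_elim
            case (elim t)
            have "(\<lambda>j. ennreal (sqrt (N (r1 k) x * N (r1 j) x) * (v k t x - v j t x)\<^sup>2)) \<longlonglongrightarrow>
                ennreal (sqrt (N (r1 k) x * L x) * (v k t x - u t x)\<^sup>2)"
              by (intro tendsto_ennrealI tendsto_intros elim \<open>(\<lambda>k. N (r1 k) x) \<longlonglongrightarrow> L x\<close>)
            then have "(\<lambda>j. ?f j x t) \<longlonglongrightarrow> ennreal (sqrt (N (r1 k) x * L x)) * ennreal ((v k t x - u t x)\<^sup>2)"
              using Npos Lpos by (simp add: ennreal_mult less_imp_le)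
            then show ?case by (simp add: lim_imp_Liminf)
          qed
        qed
        also have "\<dots> \<le> liminf (\<lambda>j. \<integral>\<^sup>+t. ?f j x t \<partial>leb01)"
          by (rule nn_integral_liminf) (use um[OF elim(3)] in measurable)
        finally show ?case .
      qed
    qed
    also have "\<dots> \<le> liminf (\<lambda>j. \<integral>\<^sup>+x. \<integral>\<^sup>+t. ?f j x t \<partial>leb01 \<partial>M)"
      by (rule nn_integral_liminf) measurable
    also have "\<dots> \<le> liminf (\<lambda>j. ennreal (4 * (e k + e j)))"
    proof (rule Liminf_mono, rule always_eventually, rule allI)
      fix j
      have "(\<integral>\<^sup>+x. \<integral>\<^sup>+t. ?f j x t \<partial>leb01 \<partial>M) = (\<integral>\<^sup>+x. ennreal (sqrt (N (r1 k) x * N (r1 j) x)) *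
            (\<integral>\<^sup>+t. ennreal ((v k t x - v j t x)\<^sup>2) \<partial>leb01) \<partial>M)"
        by (intro nn_integral_cong, subst nn_integral_cmult) (use um in auto)
      also have "\<dots> \<le> ennreal (4 * (\<integral>x. \<bar>N (r1 k) x - N (r1 j) x\<bar> \<partial>M))"
        unfolding N_def v_def by (rule nn_integral_step_distance[OF step step])
      also have "\<dots> \<le> ennreal (4 * (e k + e j))"
      proof (rule ennreal_leI)
        have "(\<integral>x. \<bar>N (r1 k) x - N (r1 j) x\<bar> \<partial>M) \<le> (\<integral>x. \<bar>N (r1 k) x - L x\<bar> + \<bar>N (r1 j) x - L x\<bar> \<partial>M)"
          using iN L by (intro integral_mono) auto
        also have "\<dots> = e k + e j" unfolding e_def using iN L by simp
        finally show "4 * (\<integral>x. \<bar>N (r1 k) x - N (r1 j) x\<bar> \<partial>M) \<le> 4 * (e k + e j)" by simp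
      qed
      finally show "(\<integral>\<^sup>+x. \<integral>\<^sup>+t. ?f j x t \<partial>leb01 \<partial>M) \<le> ennreal (4 * (e k + e j))" .
    qed
    also have "\<dots> = ennreal (4 * (e k + 0))"
      by (intro lim_imp_Liminf tendsto_ennrealI tendsto_intros e0) simp
    finally show ?thesis by simp
  qed
  have Qfin: "AE x in M. \<forall>k. Q k x < \<infinity>"
    unfolding AE_all_countable
  proof
    fix k
    have "(\<integral>\<^sup>+x. ennreal (sqrt (N (r1 k) x * L x)) * Q k x \<partial>M) \<noteq> \<infinity>"
      using main[of k] by (auto simp: top_unique)
    then have "AE x in M. ennreal (sqrt (N (r1 k) x * L x)) * Q k x \<noteq> \<infinity>"
      by (intro nn_integral_PInf_AE) auto
    then show "AE x in M. Q k x < \<infinity>"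
    proof eventually_elim
      case (elim x)
      have "0 < sqrt (N (r1 k) x * L x)" using Npos Lpos by simp
      then have "ennreal (sqrt (N (r1 k) x * L x)) \<noteq> 0" unfolding ennreal_eq_0_iff not_le .
      with elim show ?case by (auto simp: ennreal_mult_eq_top_iff less_top)
    qed
  qed
  define f where "f = (\<lambda>k x. sqrt (N (r1 k) x * L x) * enn2real (Q k x))"
  have f0: "0 \<le> f k x" for k x unfolding f_def using Npos Lpos by (simp add: less_imp_le)
  have [measurable]: "f k \<in> borel_measurable M" for k unfolding f_def by measurable
  have nnf: "(\<integral>\<^sup>+x. ennreal (f k x) \<partial>M) \<le> ennreal (4 * e k)" for k
  proof -
    have "(\<integral>\<^sup>+x. ennreal (f k x) \<partial>M) = (\<integral>\<^sup>+x. ennreal (sqrt (N (r1 k) x * L x)) * Q k x \<partial>M)"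
    proof (rule nn_integral_cong_AE)
      show "AE x in M. ennreal (f k x) = ennreal (sqrt (N (r1 k) x * L x)) * Q k x"
        using Qfin by eventually_elim (use Npos Lpos in \<open>auto simp: f_def ennreal_mult less_imp_le\<close>)
    qed
    then show ?thesis using main[of k] by simp
  qed
  have if_: "integrable M (f k)" for k
    by (rule integrableI_nonneg) (use f0 nnf[of k] in \<open>auto simp: less_top[symmetric] top_unique\<close>)
  have fle: "(\<integral>x. norm (f k x) \<partial>M) \<le> 4 * e k" for k
  proof -
    have "ennreal (\<integral>x. f k x \<partial>M) \<le> ennreal (4 * e k)"
      using nnf[of k] f0 by (subst nn_integral_eq_integral[OF if_, symmetric]) auto
    then show ?thesis using f0 epos by (simp add: ennreal_le_iff)
  qed
  \<comment> \<open>Second extraction: the weighted distances tend to 0 in L^1, hence almost surely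
    along a further subsequence.\<close>
  have "\<exists>r::nat\<Rightarrow>nat. strict_mono r \<and> (AE x in M. (\<lambda>k. f (r k) x) \<longlonglongrightarrow> 0)"
  proof (rule tendsto_L1_AE_subseq[OF if_])
    have "(\<lambda>k. 4 * e k) \<longlonglongrightarrow> 0" using tendsto_mult_right_zero[OF e0] by simp
    then show "(\<lambda>n. \<integral>x. norm (f n x) \<partial>M) \<longlonglongrightarrow> 0"
      by (rule tendsto_sandwich[OF _ _ tendsto_const, rotated 2]) (use fle in auto)
  qed
  then obtain r2 :: "nat \<Rightarrow> nat" where r2: "strict_mono r2" "AE x in M. (\<lambda>k. f (r2 k) x) \<longlonglongrightarrow> 0" by blast
  have N2: "AE x in M. (\<lambda>k. N (r1 (r2 k)) x) \<longlonglongrightarrow> L x"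
    using N1 by eventually_elim (drule LIMSEQ_subseq_LIMSEQ[OF _ r2(1)], simp add: comp_def)
  have iQ: "AE x in M. \<forall>k. integrable leb01 (\<lambda>t. (v k t x - u t x)\<^sup>2)"
    using Qfin AE_space
  proof eventually_elim
    case (elim x)
    show ?case
    proof
      fix k show "integrable leb01 (\<lambda>t. (v k t x - u t x)\<^sup>2)"
        by (rule integrableI_nonneg) (use elim(1) um[OF elim(2)] in \<open>auto simp: Q_def\<close>)
    qed
  qed
  show ?thesis
  proof (rule that[of "r1 \<circ> r2"])
    show "strict_mono (r1 \<circ> r2)" by (rule strict_mono_o[OF r1(1) r2(1)])
    show "AE x in M. (\<lambda>k. step_exp W (m ((r1 \<circ> r2) k)) (s ((r1 \<circ> r2) k)) (\<xi> ((r1 \<circ> r2) k)) x) \<longlonglongrightarrow> L x"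
      using N2 by (simp add: N_def)
    show "AE x in M. integrable leb01 (\<lambda>t. (u t x)\<^sup>2)"
      using iQ AE_space
    proof eventually_elim
      case (elim x)
      have g: "time_grid (m (r1 0)) (s (r1 0))" using step by (simp add: step_process_iff)
      show ?case
      proof (rule Bochner_Integration.integrable_bound)
        show "integrable leb01 (\<lambda>t. 2 * (v 0 t x - u t x)\<^sup>2 + 2 * (v 0 t x)\<^sup>2)"
          using elim(1) integral_step_value_sq0(1)[OF g]
          by (intro Bochner_Integration.integrable_add integrable_mult_right) (auto simp: v_def)
        show "(\<lambda>t. (u t x)\<^sup>2) \<in> borel_measurable leb01" using um(1)[OF elim(2)] by measurable
        show "AE t in leb01. norm ((u t x)\<^sup>2) \<le> norm (2 * (v 0 t x - u t x)\<^sup>2 + 2 * (v 0 t x)\<^sup>2)"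
        proof (rule AE_I2)
          fix t
          have "b\<^sup>2 \<le> 2 * (a - b)\<^sup>2 + 2 * a\<^sup>2" for a b :: real
            using zero_le_power2[of "2 * a - b"] by (simp add: power2_diff power_mult_distrib algebra_simps)
          then show "norm ((u t x)\<^sup>2) \<le> norm (2 * (v 0 t x - u t x)\<^sup>2 + 2 * (v 0 t x)\<^sup>2)" by simp
        qed
      qed
    qed
    show "AE x in M. (\<lambda>k. LINT t|leb01. (step_value (m ((r1 \<circ> r2) k)) (s ((r1 \<circ> r2) k)) (\<xi> ((r1 \<circ> r2) k)) t x - u t x)\<^sup>2) \<longlonglongrightarrow> 0"
      using r2(2) N2 iQ
    proof eventually_elim
      case (elim x)
      have q: "enn2real (Q k x) = (LINT t|leb01. (v k t x - u t x)\<^sup>2)" for k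
        unfolding Q_def using elim(3) by (subst nn_integral_eq_integral) auto
      \<comment> \<open>Dividing by the weight is harmless, as it tends to sqrt (L x * L x), which
        is positive.\<close>
      have "(\<lambda>k. f (r2 k) x / sqrt (N (r1 (r2 k)) x * L x)) \<longlonglongrightarrow> 0 / sqrt (L x * L x)"
        by (intro tendsto_divide elim tendsto_real_sqrt tendsto_mult tendsto_const) (use Lpos[of x] in auto)
      moreover have "f (r2 k) x / sqrt (N (r1 (r2 k)) x * L x) = enn2real (Q (r2 k) x)" for k
        using Npos[of "r1 (r2 k)" x] Lpos[of x] by (simp add: f_def)
      ultimately show ?case by (simp add: q v_def)
    qed
  qed
qed

end

section \<open>Tools for passing to the limit in law and in measurability\<close>

lemma cts_step_range: "c < d \<Longrightarrow> 0 \<le> cts_step c d x \<and> cts_step c d x \<le> 1"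
  by (simp add: cts_step_def divide_le_eq)

lemma cts_step_measurable: "c < d \<Longrightarrow> cts_step c d \<in> borel_measurable borel"
  by (intro borel_measurable_continuous_onI uniformly_continuous_imp_continuous cts_step_uniformly_continuous)

text \<open>The functions \<open>cts_step c (c + 1 / real (Suc n))\<close> tend to the indicator of
  \<open>{..c}\<close>, so their integrals determine the distribution function. Continuous test
  functions are the ones that survive the limit in \<open>limit_law\<close>.\<close>

lemma finite_borel_measure_eqI_cts_step:
  assumes M1: "finite_borel_measure M1" and M2: "finite_borel_measure M2"
    and eq: "\<And>c d. c < d \<Longrightarrow> (\<integral>x. cts_step c d x \<partial>M1) = (\<integral>x. cts_step c d x \<partial>M2)"
  shows "M1 = M2"
proof (rule cdf_unique'[OF M1 M2], rule ext)
  fix c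
  have lim: "(\<lambda>n. \<integral>x. cts_step c (c + 1 / real (Suc n)) x \<partial>N) \<longlonglongrightarrow> cdf N c" if "finite_borel_measure N" for N
  proof -
    interpret finite_borel_measure N by fact
    have "(\<lambda>n. \<integral>x. cts_step c (c + 1 / real (Suc n)) x \<partial>N) \<longlonglongrightarrow> (\<integral>x. indicator {..c} x \<partial>N)"
    proof (rule integral_dominated_convergence[where w="\<lambda>_. 1"])
      show "(\<lambda>x. cts_step c (c + 1 / real (Suc n)) x) \<in> borel_measurable N" for n
        using cts_step_measurable[of c "c + 1 / real (Suc n)"]
        by (simp add: measurable_cong_sets[OF M_is_borel refl])
      show "AE x in N. (\<lambda>n. cts_step c (c + 1 / real (Suc n)) x) \<longlonglongrightarrow> indicator {..c} x"
      proof (rule AE_I2)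
        fix x
        show "(\<lambda>n. cts_step c (c + 1 / real (Suc n)) x) \<longlonglongrightarrow> indicator {..c} x"
        proof (cases "x \<le> c")
          case False
          then obtain n0 where n0: "1 / real (Suc n0) < x - c" using nat_approx_posE[of "x - c"] by auto
          have "cts_step c (c + 1 / real (Suc n)) x = 0" if "n0 \<le> n" for n
          proof -
            have "1 / real (Suc n) \<le> 1 / real (Suc n0)" using that by (intro divide_left_mono) auto
            then show ?thesis using n0 False by (auto simp: cts_step_def)
          qed
          then have "eventually (\<lambda>n. cts_step c (c + 1 / real (Suc n)) x = 0) sequentially"
            by (auto simp: eventually_sequentially)
          then show ?thesis using False by (simp add: tendsto_eventually)
        qed (simp add: cts_step_def)
      qed
      show "AE x in N. norm (cts_step c (c + 1 / real (Suc n)) x) \<le> 1" for n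
      proof (rule AE_I2)
        fix x show "norm (cts_step c (c + 1 / real (Suc n)) x) \<le> 1"
          using cts_step_range[of c "c + 1 / real (Suc n)" x] by simp
      qed
    qed (auto simp: measurable_cong_sets[OF M_is_borel refl])
    then show ?thesis by (simp add: cdf_def M_is_borel)
  qed
  show "cdf M1 c = cdf M2 c"
    using LIMSEQ_unique[OF lim[OF M1]] lim[OF M2] eq by simp
qed

lemma prob_space_leb01: "prob_space leb01"
  by (rule prob_spaceI) (simp add: emeasure_restrict_space space_restrict_space)

text \<open>The Cauchy-Schwarz inequality against 1, read off from the nonnegative variance of |g|
  on the probability space \<open>leb01\<close>.\<close>

lemma leb01_abs_integral_le_sqrt:
  assumes g: "integrable leb01 (\<lambda>t. (g t)\<^sup>2)" and m: "g \<in> borel_measurable leb01"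
  shows "integrable leb01 g" "(LINT t|leb01. \<bar>g t\<bar>) \<le> sqrt (LINT t|leb01. (g t)\<^sup>2)"
proof -
  interpret prob_space leb01 by (rule prob_space_leb01)
  show i: "integrable leb01 g"
  proof (rule Bochner_Integration.integrable_bound[of _ "\<lambda>t. 1 + (g t)\<^sup>2"])
    show "AE t in leb01. norm (g t) \<le> norm (1 + (g t)\<^sup>2)"
    proof (rule AE_I2)
      fix t
      have "2 * \<bar>g t\<bar> \<le> 1 + \<bar>g t\<bar>\<^sup>2" using sum_squares_bound[of 1 "\<bar>g t\<bar>"] by simp
      then show "norm (g t) \<le> norm (1 + (g t)\<^sup>2)" by simp
    qed
  qed (use g m in auto)
  define c where "c = (LINT t|leb01. \<bar>g t\<bar>)"
  have "0 \<le> (LINT t|leb01. (\<bar>g t\<bar> - c)\<^sup>2)" by simp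
  also have "(LINT t|leb01. (\<bar>g t\<bar> - c)\<^sup>2) = (LINT t|leb01. (g t)\<^sup>2 - 2 * c * \<bar>g t\<bar> + c\<^sup>2)"
    by (rule Bochner_Integration.integral_cong) (auto simp: power2_diff)
  also have "\<dots> = (LINT t|leb01. (g t)\<^sup>2) - c\<^sup>2"
    using g i prob_space by (simp add: c_def power2_eq_square)
  finally have "c\<^sup>2 \<le> (LINT t|leb01. (g t)\<^sup>2)" by simp
  then show "(LINT t|leb01. \<bar>g t\<bar>) \<le> sqrt (LINT t|leb01. (g t)\<^sup>2)"
    unfolding c_def[symmetric] by (rule real_le_rsqrt)
qed

lemma set_integral_leb01:
  fixes g :: "real \<Rightarrow> real"
  assumes "t \<le> 1"
  shows "(LINT \<tau>:{0..t}|lborel. g \<tau>) = (LINT \<tau>|leb01. indicator {0..t} \<tau> * g \<tau>)"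
proof -
  have "indicator {0..1} \<tau> *\<^sub>R (indicator {0..t} \<tau> * g \<tau>) = indicator {0..t} \<tau> *\<^sub>R g \<tau>" for \<tau>
    using assms by (auto simp: indicator_def)
  then show ?thesis
    unfolding set_lebesgue_integral_def by (subst integral_restrict_space) (simp, simp only:)
qed

text \<open>The pointwise \<open>lim\<close> is measurable for \<open>F\<close> and differs from
  \<open>f\<close> on a null set only. It is here that the augmentation of the filtration by null
  sets pays off.\<close>

lemma measurable_AE_limit:
  fixes f :: "'a \<Rightarrow> real"
  assumes sub: "subalgebra M F" and null: "null_sets M \<subseteq> sets F"
    and f: "f \<in> borel_measurable M" and g: "\<And>n::nat. g n \<in> borel_measurable F"
    and lim: "AE x in M. (\<lambda>n. g n x) \<longlonglongrightarrow> f x"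
  shows "f \<in> borel_measurable F"
proof -
  have sp: "space F = space M" and ss: "sets F \<subseteq> sets M" using sub by (auto simp: subalgebra_def)
  define h where "h = (\<lambda>x. lim (\<lambda>n. g n x))"
  have hF: "h \<in> borel_measurable F" unfolding h_def by (rule borel_measurable_lim_metric[OF g])
  then have hM: "h \<in> borel_measurable M" using measurable_from_subalg[OF sub] by blast
  have eq: "AE x in M. h x = f x" using lim by eventually_elim (simp add: h_def limI)
  show ?thesis
  proof (rule measurableI)
    fix A :: "real set" assume A: "A \<in> sets borel"
    let ?f = "f -` A \<inter> space M" and ?h = "h -` A \<inter> space M"
    have m: "?f \<in> sets M" "?h \<in> sets M" using f hM A by (auto intro: measurable_sets)
    have "?f - ?h \<in> null_sets M" "?h - ?f \<in> null_sets M"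
    proof -
      have "AE x in M. x \<notin> ?f - ?h" "AE x in M. x \<notin> ?h - ?f" using eq by (eventually_elim, auto)+
      then show "?f - ?h \<in> null_sets M" "?h - ?f \<in> null_sets M"
        using m by (simp_all only: AE_iff_null_sets sets.Diff)
    qed
    then have "?f - ?h \<in> sets F" "?h - ?f \<in> sets F" using null by auto
    moreover have "?h \<in> sets F" using measurable_sets[OF hF A] sp by simp
    ultimately have "(?h - (?h - ?f)) \<union> (?f - ?h) \<in> sets F" by blast
    also have "(?h - (?h - ?f)) \<union> (?f - ?h) = ?f" by auto
    finally show "f -` A \<inter> space F \<in> sets F" by (simp add: sp)
  qed simp
qed

section \<open>Girsanov's theorem in the limit\<close>

text \<open>The situation after both extractions of \<open>step_limit_subseq\<close>:
  \<open>L\<close> is the density of the new measure, and minus \<open>u\<close> is the drift that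
  \<open>W\<close> acquires under it.\<close>

locale girsanov_limit = brownian_setting M F W
  for M :: "'a measure" and F W +
  fixes L :: "'a \<Rightarrow> real" and u :: "real \<Rightarrow> 'a \<Rightarrow> real"
    and m :: "nat \<Rightarrow> nat" and s :: "nat \<Rightarrow> nat \<Rightarrow> real" and \<xi> :: "nat \<Rightarrow> nat \<Rightarrow> 'a \<Rightarrow> real"
  assumes step: "\<And>k. step_process F (m k) (s k) (\<xi> k)"
    and L_int: "integrable M L" and L_pos: "\<And>x. 0 < L x" and L_one: "(\<integral>x. L x \<partial>M) = 1"
    and N_L1: "(\<lambda>k. \<integral>x. \<bar>step_exp W (m k) (s k) (\<xi> k) x - L x\<bar> \<partial>M) \<longlonglongrightarrow> 0"
    and N_conv: "AE x in M. (\<lambda>k. step_exp W (m k) (s k) (\<xi> k) x) \<longlonglongrightarrow> L x"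
    and u_proc: "measurable_process M u"
    and u_sq: "AE x in M. integrable leb01 (\<lambda>t. (u t x)\<^sup>2)"
    and v_conv: "AE x in M. (\<lambda>k. LINT t|leb01. (step_value (m k) (s k) (\<xi> k) t x - u t x)\<^sup>2) \<longlonglongrightarrow> 0"
    and null_F: "\<And>t. null_sets M \<subseteq> sets (F t)"
begin

abbreviation "N k \<equiv> step_exp W (m k) (s k) (\<xi> k)"
abbreviation "v k \<equiv> step_value (m k) (s k) (\<xi> k)"

definition "\<nu> = density M (\<lambda>x. ennreal (L x))"

definition "B t x = W t x + (LINT \<tau>:{0..t}|lborel. u \<tau> x)"

lemma grid: "time_grid (m k) (s k)" using step by (simp add: step_process_iff)

lemma L_meas [measurable]: "L \<in> borel_measurable M" using L_int by simp

lemma N_meas [measurable]: "N k \<in> borel_measurable M" by (rule step_exp_measurable[OF step])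

lemma u_pair [measurable]: "(\<lambda>(t, x). u t x) \<in> borel_measurable (leb01 \<Otimes>\<^sub>M M)"
  using u_proc by (simp add: measurable_process_def)

lemma u_section: "x \<in> space M \<Longrightarrow> (\<lambda>t. u t x) \<in> borel_measurable leb01"
  by (rule measurable_process_section[OF u_proc])

lemma v_section: "x \<in> space M \<Longrightarrow> (\<lambda>t. v k t x) \<in> borel_measurable leb01"
  by (rule measurable_process_section[OF step_process_measurable(2)[OF step]])

lemma space_\<nu> [simp]: "space \<nu> = space M" and sets_\<nu> [simp, measurable_cong]: "sets \<nu> = sets M"
  by (simp_all add: \<nu>_def)

lemma AE_\<nu>: "(AE x in \<nu>. P x) \<longleftrightarrow> (AE x in M. P x)"
  unfolding \<nu>_def by (subst AE_density) (use L_pos in auto)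

lemma prob_space_\<nu>: "prob_space \<nu>"
proof (rule prob_spaceI)
  have "emeasure \<nu> (space \<nu>) = (\<integral>\<^sup>+x. ennreal (L x) \<partial>M)"
    unfolding \<nu>_def by (subst emeasure_density) (auto intro!: nn_integral_cong)
  also have "\<dots> = 1" using nn_integral_eq_integral[OF L_int] L_pos L_one by (simp add: less_imp_le)
  finally show "emeasure \<nu> (space \<nu>) = 1" .
qed

lemma AE_integrable_u:
  "AE x in M. integrable leb01 (\<lambda>t. u t x) \<and> (\<forall>k. integrable leb01 (\<lambda>t. (v k t x - u t x)\<^sup>2))"
  using u_sq AE_space
proof eventually_elim
  case (elim x)
  have "integrable leb01 (\<lambda>t. (v k t x - u t x)\<^sup>2)" for k
  proof (rule Bochner_Integration.integrable_bound)
    show "integrable leb01 (\<lambda>t. 2 * (v k t x)\<^sup>2 + 2 * (u t x)\<^sup>2)"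
      using elim(1) integral_step_value_sq0(1)[OF grid]
      by (intro Bochner_Integration.integrable_add integrable_mult_right)
    show "(\<lambda>t. (v k t x - u t x)\<^sup>2) \<in> borel_measurable leb01" using u_section[OF elim(2)] v_section[OF elim(2)] by measurable
    show "AE t in leb01. norm ((v k t x - u t x)\<^sup>2) \<le> norm (2 * (v k t x)\<^sup>2 + 2 * (u t x)\<^sup>2)"
    proof (rule AE_I2)
      fix t
      have "(a - b)\<^sup>2 \<le> 2 * a\<^sup>2 + 2 * b\<^sup>2" for a b :: real
        using sum_squares_bound[of a "-b"] by (simp add: power2_diff)
      then show "norm ((v k t x - u t x)\<^sup>2) \<le> norm (2 * (v k t x)\<^sup>2 + 2 * (u t x)\<^sup>2)" by simp
    qed
  qed
  then show ?case using leb01_abs_integral_le_sqrt(1)[OF elim(1) u_section[OF elim(2)]] by simp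
qed

text \<open>The L^2 distance over the whole of [0, 1] dominates the difference of the drifts at
  every t, so one null set serves all t.\<close>

lemma AE_integral_conv:
  "AE x in M. \<forall>t\<in>{0..1}. (\<lambda>k. LINT \<tau>:{0..t}|lborel. v k \<tau> x) \<longlonglongrightarrow> (LINT \<tau>:{0..t}|lborel. u \<tau> x)"
  using AE_integrable_u v_conv AE_space
proof eventually_elim
  case (elim x)
  have iu: "integrable leb01 (\<lambda>t. u t x)" and id: "integrable leb01 (\<lambda>t. (v k t x - u t x)\<^sup>2)" for k using elim(1) by auto
  have iv: "integrable leb01 (\<lambda>t. v k t x)" for k by (rule integral_step_value(1)[OF grid])
  show ?case
  proof
    fix t :: real assume t: "t \<in> {0..1}"
    then have t1: "t \<le> 1" by simp
    have bound: "\<bar>(LINT \<tau>:{0..t}|lborel. v k \<tau> x) - (LINT \<tau>:{0..t}|lborel. u \<tau> x)\<bar>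
        \<le> sqrt (LINT t|leb01. (v k t x - u t x)\<^sup>2)" for k
    proof -
      have [measurable]: "(\<lambda>\<tau>. indicator {0..t} \<tau> :: real) \<in> borel_measurable leb01"
        by (intro measurable_restrict_space1) simp
      have ii: "integrable leb01 (\<lambda>\<tau>. indicator {0..t} \<tau> * g \<tau>)" if "integrable leb01 g" for g :: "real \<Rightarrow> real"
      proof (rule Bochner_Integration.integrable_bound[OF that])
        show "(\<lambda>\<tau>. indicator {0..t} \<tau> * g \<tau>) \<in> borel_measurable leb01" using borel_measurable_integrable[OF that] by measurable
      qed (auto simp: indicator_def intro!: AE_I2)
      have eq: "(LINT \<tau>:{0..t}|lborel. v k \<tau> x) - (LINT \<tau>:{0..t}|lborel. u \<tau> x)
         = (LINT \<tau>|leb01. indicator {0..t} \<tau> * v k \<tau> x - indicator {0..t} \<tau> * u \<tau> x)"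
        unfolding set_integral_leb01[OF t1] by (rule Bochner_Integration.integral_diff[symmetric, OF ii[OF iv] ii[OF iu]])
      have "\<bar>(LINT \<tau>:{0..t}|lborel. v k \<tau> x) - (LINT \<tau>:{0..t}|lborel. u \<tau> x)\<bar> \<le> (LINT \<tau>|leb01. \<bar>indicator {0..t} \<tau> * v k \<tau> x - indicator {0..t} \<tau> * u \<tau> x\<bar>)"
        unfolding eq by (rule integral_abs_bound)
      also have "\<dots> \<le> (LINT \<tau>|leb01. \<bar>v k \<tau> x - u \<tau> x\<bar>)"
      proof (rule integral_mono)
        show "integrable leb01 (\<lambda>\<tau>. \<bar>indicator {0..t} \<tau> * v k \<tau> x - indicator {0..t} \<tau> * u \<tau> x\<bar>)"
          by (rule integrable_abs[OF Bochner_Integration.integrable_diff[OF ii[OF iv] ii[OF iu]]])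
        show "integrable leb01 (\<lambda>\<tau>. \<bar>v k \<tau> x - u \<tau> x\<bar>)"
          by (rule integrable_abs[OF Bochner_Integration.integrable_diff[OF iv iu]])
        fix \<tau> show "\<bar>indicator {0..t} \<tau> * v k \<tau> x - indicator {0..t} \<tau> * u \<tau> x\<bar> \<le> \<bar>v k \<tau> x - u \<tau> x\<bar>"
          by (cases "\<tau> \<in> {0..t}", simp) simp
      qed
      also have "\<dots> \<le> sqrt (LINT t|leb01. (v k t x - u t x)\<^sup>2)"
      proof (rule leb01_abs_integral_le_sqrt(2))
        show "integrable leb01 (\<lambda>t. (v k t x - u t x)\<^sup>2)" by (rule id)
        show "(\<lambda>t. v k t x - u t x) \<in> borel_measurable leb01"
          by (rule borel_measurable_diff[OF borel_measurable_integrable[OF iv] borel_measurable_integrable[OF iu]])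
      qed
      finally show ?thesis .
    qed
    have "(\<lambda>k. sqrt (LINT t|leb01. (v k t x - u t x)\<^sup>2)) \<longlonglongrightarrow> 0"
      using tendsto_real_sqrt[OF elim(2)] by simp
    then have "(\<lambda>k. (LINT \<tau>:{0..t}|lborel. v k \<tau> x) - (LINT \<tau>:{0..t}|lborel. u \<tau> x)) \<longlonglongrightarrow> 0"
      by (rule Lim_null_comparison[rotated]) (intro always_eventually allI, unfold real_norm_def, rule bound)
    then show "(\<lambda>k. LINT \<tau>:{0..t}|lborel. v k \<tau> x) \<longlonglongrightarrow> (LINT \<tau>:{0..t}|lborel. u \<tau> x)"
      by (rule LIM_zero_cancel)
  qed
qed

lemma step_drift_measurable:
  assumes t: "t \<in> {0..1}"
  shows "(\<lambda>x. LINT \<tau>:{0..t}|lborel. v k \<tau> x) \<in> borel_measurable (F t)"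
proof -
  \<comment> \<open>The length of the part of the i-th interval before t. It is 0 when the interval
    begins after t, so only values known at time t enter.\<close>
  define c where "c = (\<lambda>i. LINT \<tau>|leb01. indicator {0..t} \<tau> * (indicator {s k i<..s k (Suc i)} \<tau> :: real))"
  have ii: "integrable leb01 (\<lambda>\<tau>. indicator {0..t} \<tau> * (indicator {s k i<..s k (Suc i)} \<tau> :: real))" for i
  proof -
    interpret finite_measure leb01 by (rule finite_measure_leb01)
    have "(\<lambda>\<tau>. indicator {0..t} \<tau> * (indicator {s k i<..s k (Suc i)} \<tau> :: real)) \<in> borel_measurable leb01"
      by (intro measurable_restrict_space1) simp
    then show ?thesis by (rule integrable_const_bound[of _ 1, rotated]) (auto simp: indicator_def)
  qed
  have "(LINT \<tau>:{0..t}|lborel. v k \<tau> x) = (\<Sum>i<m k. \<xi> k i x * c i)" for x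
  proof -
    have "(LINT \<tau>:{0..t}|lborel. v k \<tau> x)
       = (LINT \<tau>|leb01. (\<Sum>i<m k. \<xi> k i x * (indicator {0..t} \<tau> * indicator {s k i<..s k (Suc i)} \<tau>)))"
      using t by (subst set_integral_leb01)
        (simp, simp only: step_value_def sum_distrib_left mult.left_commute[of "indicator {0..t} _" "\<xi> _ _ _"])
    also have "\<dots> = (\<Sum>i<m k. LINT \<tau>|leb01. \<xi> k i x * (indicator {0..t} \<tau> * indicator {s k i<..s k (Suc i)} \<tau>))"
      by (rule Bochner_Integration.integral_sum) (rule integrable_mult_right[OF ii])
    finally show ?thesis by (simp add: c_def)
  qed
  moreover have "(\<lambda>x. \<xi> k i x * c i) \<in> borel_measurable (F t)" if "i < m k" for i
  proof (cases "s k i \<le> t")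
    case True
    have "\<xi> k i \<in> borel_measurable (F (s k i))" using step that by (simp add: step_process_iff)
    then have "\<xi> k i \<in> borel_measurable (F t)" using True by (rule measurable_F_mono)
    then show ?thesis by simp
  next
    case False
    then have "indicator {0..t} \<tau> * (indicator {s k i<..s k (Suc i)} \<tau> :: real) = 0" for \<tau> by (auto simp: indicator_def)
    then have "c i = 0" unfolding c_def by (simp only: Bochner_Integration.integral_zero)
    then show ?thesis by simp
  qed
  ultimately show ?thesis by (simp add: borel_measurable_sum)
qed

lemma drift_M: "t \<le> 1 \<Longrightarrow> (\<lambda>x. LINT \<tau>:{0..t}|lborel. u \<tau> x) \<in> borel_measurable M"
proof -
  assume t: "t \<le> 1"
  interpret L: sigma_finite_measure leb01 by (rule sigma_finite_leb01)
  have [measurable]: "(\<lambda>\<tau>. indicator {0..t} \<tau> :: real) \<in> borel_measurable leb01"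
    by (intro measurable_restrict_space1) simp
  show ?thesis unfolding set_integral_leb01[OF t] by measurable
qed

text \<open>The drift inherits adaptedness from the step drifts, of which it is an almost sure
  limit; no progressive version of \<open>u\<close> has to be constructed.\<close>

lemma drift_F:
  assumes t: "t \<in> {0..1}"
  shows "(\<lambda>x. LINT \<tau>:{0..t}|lborel. u \<tau> x) \<in> borel_measurable (F t)"
proof (rule measurable_AE_limit[OF subalg_F[OF t] null_F drift_M step_drift_measurable[OF t]])
  show "AE x in M. (\<lambda>k. LINT \<tau>:{0..t}|lborel. v k \<tau> x) \<longlonglongrightarrow> (LINT \<tau>:{0..t}|lborel. u \<tau> x)"
    using AE_integral_conv by eventually_elim (use t in auto)
qed (use t in auto)

lemma B_F: "t \<in> {0..1} \<Longrightarrow> B t \<in> borel_measurable (F t)"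
  unfolding B_def[abs_def] using drift_F W_F by (intro borel_measurable_add) auto

lemma B_M: "t \<in> {0..1} \<Longrightarrow> B t \<in> borel_measurable M"
  by (rule measurable_F_M[OF B_F])

lemma AE_continuous_B: "AE x in M. continuous_on {0..1} (\<lambda>t. B t x)"
proof -
  have "AE x in M. continuous_on {0..1} (\<lambda>t. W t x)" using bm by (simp add: brownian_motion_def)
  with AE_integrable_u show ?thesis
  proof eventually_elim
    case (elim x)
    have iu: "integrable leb01 (\<lambda>t. u t x)" using elim by simp
    then have si: "set_integrable lborel {0..1} (\<lambda>t. u t x)"
      unfolding set_integrable_def by (subst (asm) integrable_restrict_space) auto
    then have "(\<lambda>t. u t x) integrable_on {0..1}" by (rule set_borel_integral_eq_integral(1))
    then have c: "continuous_on {0..1} (\<lambda>t. integral {0..t} (\<lambda>\<tau>. u \<tau> x))"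
      by (rule indefinite_integral_continuous_1)
    have "integral {0..t} (\<lambda>\<tau>. u \<tau> x) = (LINT \<tau>:{0..t}|lborel. u \<tau> x)" if "t \<in> {0..1}" for t
      by (rule set_borel_integral_eq_integral(2)[symmetric], rule set_integrable_subset[OF si]) (use that in auto)
    then have "continuous_on {0..1} (\<lambda>t. LINT \<tau>:{0..t}|lborel. u \<tau> x)"
      using continuous_on_cong[OF refl, of "{0..1}" "\<lambda>t. integral {0..t} (\<lambda>\<tau>. u \<tau> x)"] c by simp
    then show ?case unfolding B_def by (intro continuous_on_add elim)
  qed
qed

lemma sets_F_M: "a \<in> {0..1} \<Longrightarrow> A \<in> sets (F a) \<Longrightarrow> A \<in> sets M"
  using subalg_F by (auto simp: subalgebra_def)

lemma step_drift_M: "t \<in> {0..1} \<Longrightarrow> (\<lambda>x. LINT \<tau>:{0..t}|lborel. v k \<tau> x) \<in> borel_measurable M"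
  by (rule measurable_F_M[OF step_drift_measurable])

lemma step_law:
  assumes ab: "0 \<le> a" "a < b" "b \<le> 1" and A: "A \<in> sets (F a)"
    and f[measurable]: "f \<in> borel_measurable borel" and f01: "\<And>y. 0 \<le> f y"
  shows "(\<integral>x. indicator A x * N k x *
        f (W b x - W a x + ((LINT \<tau>:{0..b}|lborel. v k \<tau> x) - (LINT \<tau>:{0..a}|lborel. v k \<tau> x))) \<partial>M)
     = (\<integral>x. indicator A x * N k x \<partial>M) * (\<integral>z. f z \<partial>gauss (b - a))"
proof -
  have [measurable]: "A \<in> sets M" using sets_F_M[OF _ A] ab by auto
  have [measurable]: "W b \<in> borel_measurable M" "W a \<in> borel_measurable M" using W_M ab by auto
  have [measurable]: "(\<lambda>x. LINT \<tau>:{0..b}|lborel. v k \<tau> x) \<in> borel_measurable M" "(\<lambda>x. LINT \<tau>:{0..a}|lborel. v k \<tau> x) \<in> borel_measurable M"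
    using step_drift_M ab by auto
  have N0: "0 \<le> N k x" for x by (rule less_imp_le[OF step_exp_pos(1)])
  let ?X = "\<lambda>x. W b x - W a x + ((LINT \<tau>:{0..b}|lborel. v k \<tau> x) - (LINT \<tau>:{0..a}|lborel. v k \<tau> x))"
  have ind: "ennreal (indicator A x * N k x * f (?X x)) = indicator A x * ennreal (N k x) * ennreal (f (?X x))"
    "ennreal (indicator A x * N k x) = indicator A x * ennreal (N k x)" for x
    using N0[of x] f01[of "?X x"] by (simp_all add: ennreal_mult indicator_def)
  have "(\<integral>x. indicator A x * N k x * f (?X x) \<partial>M) = enn2real (\<integral>\<^sup>+x. ennreal (indicator A x * N k x * f (?X x)) \<partial>M)"
    by (rule integral_eq_nn_integral) (use N0 f01 in auto)
  also have "(\<integral>\<^sup>+x. ennreal (indicator A x * N k x * f (?X x)) \<partial>M)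
      = (\<integral>\<^sup>+x. ennreal (indicator A x * N k x) \<partial>M) * (\<integral>\<^sup>+z. ennreal (f z) \<partial>gauss (b - a))"
    unfolding ind by (rule nn_integral_step_girsanov[OF step ab A]) measurable
  also have "enn2real \<dots> = enn2real (\<integral>\<^sup>+x. ennreal (indicator A x * N k x) \<partial>M) * enn2real (\<integral>\<^sup>+z. ennreal (f z) \<partial>gauss (b - a))"
    by (rule enn2real_mult)
  also have "enn2real (\<integral>\<^sup>+x. ennreal (indicator A x * N k x) \<partial>M) = (\<integral>x. indicator A x * N k x \<partial>M)"
    by (rule integral_eq_nn_integral[symmetric]) (use N0 in auto)
  also have "enn2real (\<integral>\<^sup>+z. ennreal (f z) \<partial>gauss (b - a)) = (\<integral>z. f z \<partial>gauss (b - a))"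
    by (rule integral_eq_nn_integral[symmetric]) (use f01 in auto)
  finally show ?thesis .
qed

text \<open>Replacing the density \<open>N k\<close> by \<open>L\<close> costs at most their L^1
  distance, uniformly over factors bounded by 1; with \<open>L\<close> fixed, dominated convergence
  applies.\<close>

lemma tendsto_integral_density:
  assumes [measurable]: "\<And>k. g k \<in> borel_measurable M" "g' \<in> borel_measurable M"
    and bnd: "\<And>k x. \<bar>g k x\<bar> \<le> 1" "\<And>x. \<bar>g' x\<bar> \<le> 1"
    and conv: "AE x in M. (\<lambda>k. g k x) \<longlonglongrightarrow> g' x"
  shows "(\<lambda>k. \<integral>x. N k x * g k x \<partial>M) \<longlonglongrightarrow> (\<integral>x. L x * g' x \<partial>M)"
proof -
  have iN: "integrable M (N k)" for k by (rule integral_step_exp(1)[OF step])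
  have i1: "integrable M (\<lambda>x. N k x * g k x)" for k
    by (rule Bochner_Integration.integrable_bound[OF iN[of k]])
       (use bnd(1) in \<open>auto simp: abs_mult intro!: AE_I2 mult_left_le\<close>)
  have i2: "integrable M (\<lambda>x. L x * g k x)" for k
    by (rule Bochner_Integration.integrable_bound[OF L_int])
       (use bnd(1) in \<open>auto simp: abs_mult intro!: AE_I2 mult_left_le\<close>)
  have "(\<lambda>k. \<integral>x. L x * g k x \<partial>M) \<longlonglongrightarrow> (\<integral>x. L x * g' x \<partial>M)"
  proof (rule integral_dominated_convergence[where w=L])
    show "AE x in M. (\<lambda>i. L x * g i x) \<longlonglongrightarrow> L x * g' x"
      using conv by eventually_elim (intro tendsto_intros)
    show "AE x in M. norm (L x * g i x) \<le> L x" for i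
      using bnd(1) L_pos by (auto simp: abs_mult less_imp_le intro!: AE_I2 mult_left_le)
  qed (use L_int in auto)
  moreover have "(\<lambda>k. (\<integral>x. N k x * g k x \<partial>M) - (\<integral>x. L x * g k x \<partial>M)) \<longlonglongrightarrow> 0"
  proof (rule Lim_null_comparison[OF _ N_L1], intro always_eventually allI)
    fix k
    have eq: "(\<integral>x. N k x * g k x \<partial>M) - (\<integral>x. L x * g k x \<partial>M) = (\<integral>x. N k x * g k x - L x * g k x \<partial>M)"
      by (rule Bochner_Integration.integral_diff[symmetric, OF i1 i2])
    have "norm ((\<integral>x. N k x * g k x \<partial>M) - (\<integral>x. L x * g k x \<partial>M)) \<le> (\<integral>x. \<bar>N k x * g k x - L x * g k x\<bar> \<partial>M)"
      unfolding eq real_norm_def by (rule integral_abs_bound)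
    also have "\<dots> \<le> (\<integral>x. \<bar>N k x - L x\<bar> \<partial>M)"
    proof (rule integral_mono)
      fix x
      have "\<bar>N k x * g k x - L x * g k x\<bar> = \<bar>N k x - L x\<bar> * \<bar>g k x\<bar>"
        by (simp add: abs_mult[symmetric] left_diff_distrib)
      also have "\<dots> \<le> \<bar>N k x - L x\<bar>" by (rule mult_left_le[OF bnd(1)]) simp
      finally show "\<bar>N k x * g k x - L x * g k x\<bar> \<le> \<bar>N k x - L x\<bar>" .
    qed (use i1 i2 iN L_int in auto)
    finally show "norm ((\<integral>x. N k x * g k x \<partial>M) - (\<integral>x. L x * g k x \<partial>M)) \<le> (\<integral>x. \<bar>N k x - L x\<bar> \<partial>M)" .
  qed
  ultimately have "(\<lambda>k. ((\<integral>x. N k x * g k x \<partial>M) - (\<integral>x. L x * g k x \<partial>M)) + (\<integral>x. L x * g k x \<partial>M)) \<longlonglongrightarrow> 0 + (\<integral>x. L x * g' x \<partial>M)"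
    by (intro tendsto_add)
  then show ?thesis by simp
qed

text \<open>Girsanov's formula for the step processes, tested on an event of the past times a
  bounded continuous function of the increment, so that both sides converge.\<close>

lemma limit_law:
  assumes ab: "0 \<le> a" "a < b" "b \<le> 1" and A: "A \<in> sets (F a)"
    and cd: "c < d"
  shows "(\<integral>x. L x * (indicator A x * cts_step c d (B b x - B a x)) \<partial>M)
     = (\<integral>x. L x * indicator A x \<partial>M) * (\<integral>z. cts_step c d z \<partial>gauss (b - a))"
proof -
  let ?f = "cts_step c d"
  have [measurable]: "?f \<in> borel_measurable borel" by (rule cts_step_measurable[OF cd])
  have f01: "0 \<le> ?f y" "?f y \<le> 1" for y using cts_step_range[OF cd] by auto
  have [measurable]: "A \<in> sets M" using sets_F_M[OF _ A] ab by auto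
  have [measurable]: "W b \<in> borel_measurable M" "W a \<in> borel_measurable M" using W_M ab by auto
  have [measurable]: "B b \<in> borel_measurable M" "B a \<in> borel_measurable M" using B_M ab by auto
  have [measurable]: "(\<lambda>x. LINT \<tau>:{0..b}|lborel. v k \<tau> x) \<in> borel_measurable M" "(\<lambda>x. LINT \<tau>:{0..a}|lborel. v k \<tau> x) \<in> borel_measurable M" for k
    using step_drift_M ab by auto
  define X where "X = (\<lambda>k x. W b x - W a x + ((LINT \<tau>:{0..b}|lborel. v k \<tau> x) - (LINT \<tau>:{0..a}|lborel. v k \<tau> x)))"
  have [measurable]: "X k \<in> borel_measurable M" for k unfolding X_def by measurable
  have cont: "isCont ?f y" for y
    using uniformly_continuous_imp_continuous[OF cts_step_uniformly_continuous[OF cd]]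
    by (simp add: continuous_on_eq_continuous_at)
  have "(\<lambda>k. \<integral>x. N k x * (indicator A x * ?f (X k x)) \<partial>M) \<longlonglongrightarrow> (\<integral>x. L x * (indicator A x * ?f (B b x - B a x)) \<partial>M)"
  proof (rule tendsto_integral_density)
    show "AE x in M. (\<lambda>k. indicator A x * ?f (X k x)) \<longlonglongrightarrow> indicator A x * ?f (B b x - B a x)"
      using AE_integral_conv
    proof eventually_elim
      case (elim x)
      have "(\<lambda>k. X k x) \<longlonglongrightarrow> W b x - W a x + ((LINT \<tau>:{0..b}|lborel. u \<tau> x) - (LINT \<tau>:{0..a}|lborel. u \<tau> x))"
        unfolding X_def by (intro tendsto_intros elim[rule_format]) (use ab in auto)
      then have "(\<lambda>k. X k x) \<longlonglongrightarrow> B b x - B a x" by (simp add: B_def algebra_simps)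
      from isCont_tendsto_compose[OF cont this] show ?case by (intro tendsto_intros)
    qed
  qed (use f01 in \<open>auto simp: indicator_def\<close>)
  moreover have "(\<lambda>k. (\<integral>x. N k x * indicator A x \<partial>M) * (\<integral>z. ?f z \<partial>gauss (b - a)))
     \<longlonglongrightarrow> (\<integral>x. L x * indicator A x \<partial>M) * (\<integral>z. ?f z \<partial>gauss (b - a))"
    by (intro tendsto_mult tendsto_const tendsto_integral_density) (auto simp: indicator_def)
  moreover have "(\<integral>x. N k x * (indicator A x * ?f (X k x)) \<partial>M) = (\<integral>x. N k x * indicator A x \<partial>M) * (\<integral>z. ?f z \<partial>gauss (b - a))" for k
    using step_law[OF ab A cts_step_measurable[OF cd] f01(1), of k] by (simp add: X_def mult_ac)
  ultimately show ?thesis by (simp add: LIMSEQ_unique)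
qed

text \<open>By \<open>limit_law\<close>, on each past event the law of the increment is the Gaussian
  law times the mass of the event. This one formula contains both the distribution of the increment
  and its independence of the past.\<close>

lemma emeasure_\<nu>_increment:
  assumes ab: "0 \<le> a" "a < b" "b \<le> 1" and A: "A \<in> sets (F a)" and C: "C \<in> sets borel"
  shows "emeasure \<nu> (A \<inter> ((\<lambda>x. B b x - B a x) -` C \<inter> space M)) = emeasure \<nu> A * emeasure (gauss (b - a)) C"
proof -
  have AM[measurable]: "A \<in> sets M" using sets_F_M[OF _ A] ab by auto
  have [measurable]: "B b \<in> borel_measurable M" "B a \<in> borel_measurable M" using B_M ab by auto
  let ?X = "\<lambda>x. B b x - B a x"
  define c where "c = (\<integral>x. L x * indicator A x \<partial>M)"
  have c0: "0 \<le> c" unfolding c_def using L_pos by (intro integral_nonneg_AE) (auto simp: less_imp_le)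
  have iLA: "integrable M (\<lambda>x. L x * indicator A x)"
    by (rule integrable_mult_indicator[OF AM L_int, simplified mult.commute real_scaleR_def])
  have emA: "emeasure \<nu> A = ennreal c"
  proof -
    have "emeasure \<nu> A = (\<integral>\<^sup>+x. ennreal (L x * indicator A x) \<partial>M)"
      unfolding \<nu>_def by (subst emeasure_density) (auto intro!: nn_integral_cong simp: indicator_def)
    also have "\<dots> = ennreal c" unfolding c_def
      by (rule nn_integral_eq_integral[OF iLA]) (use L_pos in \<open>auto simp: less_imp_le\<close>)
    finally show ?thesis .
  qed
  \<comment> \<open>\<open>D\<close> is \<nu> restricted to \<open>A\<close>, \<open>M1\<close> the
    law of the increment under it, and \<open>M2\<close> the Gaussian law of the same total
    mass.\<close>
  define D where "D = density M (\<lambda>x. ennreal (L x * indicator A x))"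
  define M1 where "M1 = distr D borel ?X"
  define M2 where "M2 = density (gauss (b - a)) (\<lambda>_. ennreal c)"
  interpret G: prob_space "gauss (b - a)" by (rule prob_space_gauss) (use ab in simp)
  have mX: "?X \<in> borel_measurable D" unfolding D_def by measurable
  have emD: "emeasure D S = emeasure \<nu> (A \<inter> S)" if [measurable]: "S \<in> sets M" for S
    unfolding D_def \<nu>_def by (subst (1 2) emeasure_density) (auto intro!: nn_integral_cong simp: indicator_def)
  have "M1 = M2"
  proof (rule finite_borel_measure_eqI_cts_step)
    show "finite_borel_measure M1"
    proof (intro finite_borel_measure.intro finite_measureI finite_borel_measure_axioms.intro)
      have "emeasure D (space M) = emeasure \<nu> A" using emD[of "space M"] sets.sets_into_space[OF AM] by (simp add: Int_absorb2)
      then show "emeasure M1 (space M1) \<noteq> \<infinity>"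
        unfolding M1_def by (subst emeasure_distr[OF mX]) (auto simp: emA D_def)
    qed (simp add: M1_def)
    show "finite_borel_measure M2"
      by (intro finite_borel_measure.intro finite_measureI finite_borel_measure_axioms.intro) (auto simp: M2_def emeasure_density ennreal_mult_eq_top_iff G.emeasure_space_1[simplified])
    fix p q :: real assume pq: "p < q"
    have [measurable]: "cts_step p q \<in> borel_measurable borel" by (rule cts_step_measurable[OF pq])
    have "(\<integral>x. cts_step p q x \<partial>M1) = (\<integral>x. cts_step p q (?X x) \<partial>D)"
      unfolding M1_def by (rule integral_distr[OF mX]) simp
    also have "\<dots> = (\<integral>x. L x * indicator A x * cts_step p q (?X x) \<partial>M)"
      unfolding D_def using L_pos by (subst integral_density) (auto simp: less_imp_le)
    also have "\<dots> = c * (\<integral>z. cts_step p q z \<partial>gauss (b - a))"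
      using limit_law[OF ab A pq] by (simp add: c_def mult.assoc)
    also have "\<dots> = (\<integral>x. cts_step p q x \<partial>M2)"
      unfolding M2_def using c0 by (subst integral_density) auto
    finally show "(\<integral>x. cts_step p q x \<partial>M1) = (\<integral>x. cts_step p q x \<partial>M2)" .
  qed
  then have "emeasure M1 C = emeasure M2 C" by simp
  moreover have "emeasure M1 C = emeasure \<nu> (A \<inter> (?X -` C \<inter> space M))"
    unfolding M1_def by (subst emeasure_distr[OF mX C]) (use emD[of "?X -` C \<inter> space M"] C in \<open>simp add: D_def\<close>)
  moreover have "emeasure M2 C = ennreal c * emeasure (gauss (b - a)) C"
    unfolding M2_def using C by (subst emeasure_density) (auto simp: nn_integral_cmult_indicator)
  ultimately show ?thesis by (simp add: emA)
qed

text \<open>\<open>emeasure_\<nu>_increment\<close> with the whole space as event gives the law of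
  the increments, and then with general \<open>A\<close> their independence.\<close>

theorem brownian_motion_\<nu>: "brownian_motion \<nu> F B"
  unfolding brownian_motion_def
proof (intro conjI allI impI)
  interpret \<nu>: prob_space \<nu> by (rule prob_space_\<nu>)
  show "prob_space \<nu>" by (rule prob_space_\<nu>)
  show "filtration (space \<nu>) F" using filtration_F by simp
  show "\<forall>t\<in>{0..1}. subalgebra \<nu> (F t)" using subalg_F by (simp add: subalgebra_def)
  show "adapted_01 F B" unfolding adapted_01_def using B_F by blast
  show "AE x in \<nu>. B 0 x = 0"
  proof -
    have "AE x in M. W 0 x = 0" using bm by (simp add: brownian_motion_def)
    moreover have "(LINT \<tau>:{0..0}|lborel. u \<tau> x) = 0" for x
    proof -
      have "(LINT \<tau>:{0..0}|lborel. u \<tau> x) = (LINT \<tau>:{}|lborel. u \<tau> x)"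
        unfolding set_lebesgue_integral_def
      proof (rule integral_cong_AE)
        have "(\<lambda>\<tau>. indicator {0..0::real} \<tau> *\<^sub>R u \<tau> x) = (\<lambda>\<tau>. indicator {0} \<tau> * u 0 x)"
          by (auto simp: indicator_def fun_eq_iff)
        then show "(\<lambda>\<tau>. indicator {0..0::real} \<tau> *\<^sub>R u \<tau> x) \<in> borel_measurable lborel" by simp
        show "AE \<tau> in lborel. indicator {0..0::real} \<tau> *\<^sub>R u \<tau> x = indicator {} \<tau> *\<^sub>R u \<tau> x"
          using AE_lborel_singleton[of "0::real"] by eventually_elim auto
      qed simp
      then show ?thesis by (simp add: set_lebesgue_integral_def)
    qed
    ultimately show ?thesis unfolding AE_\<nu> B_def by simp
  qed
  show "AE x in \<nu>. continuous_on {0..1} (\<lambda>t. B t x)" unfolding AE_\<nu> by (rule AE_continuous_B)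
  fix a b :: real assume "0 \<le> a \<and> a < b \<and> b \<le> 1"
  then have ab: "0 \<le> a" "a < b" "b \<le> 1" by auto
  have [measurable]: "B b \<in> borel_measurable M" "B a \<in> borel_measurable M" using B_M ab by auto
  have sp: "space M \<in> sets (F a)" using sets.top[of "F a"] by simp
  have em: "emeasure \<nu> ((\<lambda>x. B b x - B a x) -` C \<inter> space M) = emeasure (gauss (b - a)) C" if C: "C \<in> sets borel" for C
  proof -
    have "emeasure \<nu> (space M) = 1" using \<nu>.emeasure_space_1 by simp
    then show ?thesis using emeasure_\<nu>_increment[OF ab sp C] by (simp add: Int_absorb1)
  qed
  show "distributed \<nu> lborel (\<lambda>x. B b x - B a x) (\<lambda>y. ennreal (normal_density 0 (sqrt (b - a)) y))"
    unfolding distributed_def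
  proof (intro conjI)
    have "distr \<nu> lborel (\<lambda>x. B b x - B a x) = gauss (b - a)"
    proof (rule measure_eqI)
      fix C assume "C \<in> sets (distr \<nu> lborel (\<lambda>x. B b x - B a x))"
      then have "C \<in> sets borel" by simp
      then show "emeasure (distr \<nu> lborel (\<lambda>x. B b x - B a x)) C = emeasure (gauss (b - a)) C"
        by (subst emeasure_distr) (auto simp: em)
    qed simp
    then show "distr \<nu> lborel (\<lambda>x. B b x - B a x) = density lborel (\<lambda>y. ennreal (normal_density 0 (sqrt (b - a)) y))"
      by (simp add: gauss_def)
  qed measurable
  show "\<nu>.indep_set (sets (F a)) {(\<lambda>x. B b x - B a x) -` A \<inter> space \<nu> |A. A \<in> sets borel}"
    unfolding \<nu>.indep_sets2_eq
  proof (intro conjI ballI)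
    show "sets (F a) \<subseteq> sets \<nu>" using subalg_F[of a] ab by (simp add: subalgebra_def)
    show "{(\<lambda>x. B b x - B a x) -` A \<inter> space \<nu> |A. A \<in> sets borel} \<subseteq> sets \<nu>" by auto
    fix A S assume A: "A \<in> sets (F a)" and "S \<in> {(\<lambda>x. B b x - B a x) -` A \<inter> space \<nu> |A. A \<in> sets borel}"
    then obtain C where C: "C \<in> sets borel" and S: "S = (\<lambda>x. B b x - B a x) -` C \<inter> space M" by auto
    have "emeasure \<nu> (A \<inter> S) = emeasure \<nu> A * emeasure \<nu> S"
      unfolding S emeasure_\<nu>_increment[OF ab A C] em[OF C] ..
    then show "measure \<nu> (A \<inter> S) = measure \<nu> A * measure \<nu> S"
      by (simp add: measure_def enn2real_mult)
  qed
qed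

lemma AE_step_integral_conv:
  "AE x in M. (\<lambda>k. step_integral B (m k) (s k) (\<xi> k) x) \<longlonglongrightarrow> - ln (L x) + (LINT t|leb01. (u t x)\<^sup>2) / 2"
  using AE_integrable_u u_sq v_conv N_conv AE_space
proof eventually_elim
  case (elim x)
  have iu: "integrable leb01 (\<lambda>t. u t x)" and id: "integrable leb01 (\<lambda>t. (v k t x - u t x)\<^sup>2)"
    and iu2: "integrable leb01 (\<lambda>t. (u t x)\<^sup>2)" for k using elim by auto
  have iv2: "integrable leb01 (\<lambda>t. (v k t x)\<^sup>2)" for k by (rule integral_step_value_sq0(1)[OF grid])
  \<comment> \<open>Polarisation trades the mixed integral for the squared distance, whose
    convergence is known, and cancels the square of v contained in the logarithm of
    \<open>N k\<close>.\<close>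
  have vu: "v k t x * u t x = ((v k t x)\<^sup>2 + (u t x)\<^sup>2 - (v k t x - u t x)\<^sup>2) / 2" for k t
    by (simp add: power2_diff)
  have key: "step_integral B (m k) (s k) (\<xi> k) x
      = - ln (N k x) + (LINT t|leb01. (u t x)\<^sup>2) / 2 - (LINT t|leb01. (v k t x - u t x)\<^sup>2) / 2" for k
  proof -
    have seg: "integrable leb01 (\<lambda>t. indicator {s k i<..s k (Suc i)} t * u t x)" for i
    proof (rule Bochner_Integration.integrable_bound[OF iu])
      have [measurable]: "(\<lambda>t. indicator {s k i<..s k (Suc i)} t :: real) \<in> borel_measurable leb01"
        by (intro measurable_restrict_space1) simp
      show "(\<lambda>t. indicator {s k i<..s k (Suc i)} t * u t x) \<in> borel_measurable leb01"
        using borel_measurable_integrable[OF iu] by measurable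
    qed (auto simp: indicator_def intro!: AE_I2)
    have drift: "(LINT \<tau>:{0..s k (Suc i)}|lborel. u \<tau> x) - (LINT \<tau>:{0..s k i}|lborel. u \<tau> x)
        = (LINT t|leb01. indicator {s k i<..s k (Suc i)} t * u t x)" if i: "i < m k" for i
    proof -
      have r: "0 \<le> s k i" "s k i \<le> s k (Suc i)" "s k (Suc i) \<le> 1"
        using time_grid_range[OF grid, of i k] time_grid_range[OF grid, of "Suc i" k] time_grid_le[OF grid, of i "Suc i" k] i by auto
      have ii: "integrable leb01 (\<lambda>\<tau>. indicator {0..t} \<tau> * u \<tau> x)" for t
      proof (rule Bochner_Integration.integrable_bound[OF iu])
        have [measurable]: "(\<lambda>\<tau>. indicator {0..t} \<tau> :: real) \<in> borel_measurable leb01"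
          by (intro measurable_restrict_space1) simp
        show "(\<lambda>\<tau>. indicator {0..t} \<tau> * u \<tau> x) \<in> borel_measurable leb01"
          using borel_measurable_integrable[OF iu] by measurable
      qed (auto simp: indicator_def intro!: AE_I2)
      have r1: "s k i \<le> 1" using r by simp
      have "(LINT \<tau>:{0..s k (Suc i)}|lborel. u \<tau> x) - (LINT \<tau>:{0..s k i}|lborel. u \<tau> x)
        = (LINT \<tau>|leb01. indicator {0..s k (Suc i)} \<tau> * u \<tau> x - indicator {0..s k i} \<tau> * u \<tau> x)"
        unfolding set_integral_leb01[OF r(3)] set_integral_leb01[OF r1]
        by (rule Bochner_Integration.integral_diff[symmetric, OF ii ii])
      also have "\<dots> = (LINT t|leb01. indicator {s k i<..s k (Suc i)} t * u t x)"
        by (rule Bochner_Integration.integral_cong[OF refl]) (use r in \<open>auto simp: indicator_def\<close>)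
      finally show ?thesis .
    qed
    have "step_integral B (m k) (s k) (\<xi> k) x = step_integral W (m k) (s k) (\<xi> k) x
        + (\<Sum>i<m k. \<xi> k i x * ((LINT \<tau>:{0..s k (Suc i)}|lborel. u \<tau> x) - (LINT \<tau>:{0..s k i}|lborel. u \<tau> x)))"
      unfolding step_integral_def B_def sum.distrib[symmetric] by (rule sum.cong) (auto simp: algebra_simps)
    also have "(\<Sum>i<m k. \<xi> k i x * ((LINT \<tau>:{0..s k (Suc i)}|lborel. u \<tau> x) - (LINT \<tau>:{0..s k i}|lborel. u \<tau> x)))
        = (\<Sum>i<m k. LINT t|leb01. \<xi> k i x * (indicator {s k i<..s k (Suc i)} t * u t x))"
      by (rule sum.cong[OF refl]) (simp add: drift)
    also have "\<dots> = (LINT t|leb01. (\<Sum>i<m k. \<xi> k i x * (indicator {s k i<..s k (Suc i)} t * u t x)))"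
      by (rule Bochner_Integration.integral_sum[symmetric]) (rule integrable_mult_right[OF seg])
    also have "\<dots> = (LINT t|leb01. v k t x * u t x)"
      unfolding step_value_def sum_distrib_right mult.assoc ..
    also have "\<dots> = (LINT t|leb01. ((v k t x)\<^sup>2 + (u t x)\<^sup>2 - (v k t x - u t x)\<^sup>2) / 2)"
      unfolding vu ..
    also have "\<dots> = ((LINT t|leb01. (v k t x)\<^sup>2) + (LINT t|leb01. (u t x)\<^sup>2) - (LINT t|leb01. (v k t x - u t x)\<^sup>2)) / 2"
      by (simp only: integral_divide_zero Bochner_Integration.integral_diff[OF Bochner_Integration.integrable_add[OF iv2 iu2] id]
          Bochner_Integration.integral_add[OF iv2 iu2])
    also have "step_integral W (m k) (s k) (\<xi> k) x = - ln (N k x) - (LINT t|leb01. (v k t x)\<^sup>2) / 2"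
      by (simp add: step_exp_def)
    finally show ?thesis by (simp add: field_simps)
  qed
  have "(\<lambda>k. - ln (N k x) + (LINT t|leb01. (u t x)\<^sup>2) / 2 - (LINT t|leb01. (v k t x - u t x)\<^sup>2) / 2)
      \<longlonglongrightarrow> - ln (L x) + (LINT t|leb01. (u t x)\<^sup>2) / 2 - 0 / 2"
    by (intro tendsto_intros elim) (use L_pos[of x] in auto)
  then show ?case unfolding key by simp
qed

end

section \<open>Functionals of finitely many increments\<close>

definition avg :: "real \<Rightarrow> nat \<Rightarrow> ((nat \<Rightarrow> real) \<Rightarrow> real) \<Rightarrow> (nat \<Rightarrow> real) \<Rightarrow> real" where
  "avg h i G y = (\<integral>z. G (y(i := z)) \<partial>gauss h)"

abbreviation seq_borel :: "(nat \<Rightarrow> real) measure" where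
  "seq_borel \<equiv> Pi\<^sub>M UNIV (\<lambda>_. borel)"

definition bounded_meas :: "real \<Rightarrow> real \<Rightarrow> ((nat \<Rightarrow> real) \<Rightarrow> real) \<Rightarrow> bool" where
  "bounded_meas a b G \<longleftrightarrow> G \<in> borel_measurable seq_borel \<and> (\<forall>y. a \<le> G y \<and> G y \<le> b)"

lemma measurable_seq_upd [measurable]:
  assumes "f \<in> measurable N seq_borel" "g \<in> borel_measurable N"
  shows "(\<lambda>x. (f x)(i := g x)) \<in> measurable N seq_borel"
  by (rule measurable_fun_upd[where J=UNIV]) (use assms in auto)

lemma bounded_meas_upd:
  assumes "bounded_meas a b G"
  shows "(\<lambda>z. G (y(i := z))) \<in> borel_measurable borel"
proof -
  have [measurable]: "G \<in> borel_measurable seq_borel" using assms by (simp add: bounded_meas_def)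
  have [measurable]: "(\<lambda>z. y(i := z)) \<in> measurable borel seq_borel"
    by (rule measurable_seq_upd) (auto simp: space_PiM)
  show ?thesis by measurable
qed

lemma bounded_meas_integrable:
  assumes "bounded_meas a b G" "h > 0"
  shows "integrable (gauss h) (\<lambda>z. G (y(i := z)))"
proof -
  interpret prob_space "gauss h" by (rule prob_space_gauss) fact
  show ?thesis
  proof (rule integrable_const_bound[of _ "max \<bar>a\<bar> \<bar>b\<bar>"])
    show "AE z in gauss h. norm (G (y(i := z))) \<le> max \<bar>a\<bar> \<bar>b\<bar>"
    proof (rule AE_I2)
      fix z
      have "a \<le> G (y(i := z))" "G (y(i := z)) \<le> b" using assms by (auto simp: bounded_meas_def)
      then show "norm (G (y(i := z))) \<le> max \<bar>a\<bar> \<bar>b\<bar>" unfolding real_norm_def by linarith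
    qed
  qed (use bounded_meas_upd[OF assms(1)] in simp)
qed

lemma bounded_meas_avg:
  assumes G: "bounded_meas a b G" and h: "h > 0"
  shows "bounded_meas a b (avg h i G)"
  unfolding bounded_meas_def
proof (intro conjI allI)
  interpret prob_space "gauss h" by (rule prob_space_gauss) fact
  have [measurable]: "G \<in> borel_measurable seq_borel" using assms by (simp add: bounded_meas_def)
  show "avg h i G \<in> borel_measurable seq_borel"
    unfolding avg_def[abs_def] by measurable
  fix y
  have "(\<integral>z. a \<partial>gauss h) \<le> avg h i G y" "avg h i G y \<le> (\<integral>z. b \<partial>gauss h)"
    unfolding avg_def
    using G by (intro integral_mono[OF _ bounded_meas_integrable[OF G h]], auto simp: bounded_meas_def)
      (rule order_trans[OF integral_mono[OF bounded_meas_integrable[OF G h], of "\<lambda>_. b"]], auto)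
  then show "a \<le> avg h i G y" "avg h i G y \<le> b" using prob_space by auto
qed

text \<open>The recursion counts the increments already integrated out, beginning with the last one;
  \<open>lev\<close> reindexes it by the number of increments that remain.\<close>

primrec lev_aux :: "(nat \<Rightarrow> real) \<Rightarrow> nat \<Rightarrow> ((nat \<Rightarrow> real) \<Rightarrow> real) \<Rightarrow> nat \<Rightarrow> (nat \<Rightarrow> real) \<Rightarrow> real" where
  "lev_aux s m G 0 = G"
| "lev_aux s m G (Suc j) = avg (s (m - j) - s (m - Suc j)) (m - Suc j) (lev_aux s m G j)"

text \<open>\<open>lev s m G i\<close> integrates out the increments with index \<open>i, \<dots>, m - 1\<close>.\<close>

definition lev :: "(nat \<Rightarrow> real) \<Rightarrow> nat \<Rightarrow> ((nat \<Rightarrow> real) \<Rightarrow> real) \<Rightarrow> nat \<Rightarrow> (nat \<Rightarrow> real) \<Rightarrow> real" where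
  "lev s m G i = lev_aux s m G (m - i)"

lemma lev_top [simp]: "lev s m G m = G"
  by (simp add: lev_def)

lemma lev_step: "i < m \<Longrightarrow> lev s m G i = avg (s (Suc i) - s i) i (lev s m G (Suc i))"
proof -
  assume i: "i < m"
  then have "m - i = Suc (m - Suc i)" by simp
  moreover have "m - (m - Suc i) = Suc i" "m - Suc (m - Suc i) = i" using i by auto
  ultimately show ?thesis by (simp add: lev_def)
qed

lemma lev_bounded_meas:
  assumes g: "time_grid m s" and G: "bounded_meas a b G" and i: "i \<le> m"
  shows "bounded_meas a b (lev s m G i)"
  using i
proof (induction i rule: inc_induct)
  case (step n)
  then have "s (Suc n) - s n > 0" using g by (simp add: time_grid_def)
  with step show ?case by (simp add: lev_step bounded_meas_avg)
qed (use G in simp)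

text \<open>Formulated coordinatewise because both bounds are stable under averaging over the other
  coordinates.\<close>

definition taylor_at :: "nat \<Rightarrow> real \<Rightarrow> ((nat \<Rightarrow> real) \<Rightarrow> real) \<Rightarrow> ((nat \<Rightarrow> real) \<Rightarrow> real) \<Rightarrow> bool" where
  "taylor_at i K G D \<longleftrightarrow> (\<forall>y z. \<bar>G (y(i := z)) - G (y(i := 0)) - D (y(i := 0)) * z\<bar> \<le> K * z\<^sup>2)"

definition lipschitz_at :: "nat \<Rightarrow> real \<Rightarrow> ((nat \<Rightarrow> real) \<Rightarrow> real) \<Rightarrow> bool" where
  "lipschitz_at i K G \<longleftrightarrow> (\<forall>y z. \<bar>G (y(i := z)) - G (y(i := 0))\<bar> \<le> K * \<bar>z\<bar>)"

lemma taylor_at_avg: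
  assumes G: "bounded_meas a b G" and D: "bounded_meas c d D" and h: "h > 0" and l: "l \<noteq> i"
    and T: "taylor_at i K G D"
  shows "taylor_at i K (avg h l G) (avg h l D)"
  unfolding taylor_at_def
proof (intro allI)
  fix y z
  interpret prob_space "gauss h" by (rule prob_space_gauss) fact
  note i = bounded_meas_integrable[OF G h] bounded_meas_integrable[OF D h]
  have eq: "avg h l G (y(i := z)) - avg h l G (y(i := 0)) - avg h l D (y(i := 0)) * z
     = (\<integral>w. G ((y(i := z))(l := w)) - G ((y(i := 0))(l := w)) - D ((y(i := 0))(l := w)) * z \<partial>gauss h)"
    unfolding avg_def using i by simp
  have "\<bar>avg h l G (y(i := z)) - avg h l G (y(i := 0)) - avg h l D (y(i := 0)) * z\<bar>
    \<le> (\<integral>w. \<bar>G ((y(i := z))(l := w)) - G ((y(i := 0))(l := w)) - D ((y(i := 0))(l := w)) * z\<bar> \<partial>gauss h)"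
    unfolding eq by (rule integral_abs_bound)
  also have "\<dots> \<le> (\<integral>w. K * z\<^sup>2 \<partial>gauss h)"
  proof (rule integral_mono)
    fix w
    show "\<bar>G ((y(i := z))(l := w)) - G ((y(i := 0))(l := w)) - D ((y(i := 0))(l := w)) * z\<bar> \<le> K * z\<^sup>2"
      using T[unfolded taylor_at_def, rule_format, of "y(l := w)" z] l by (simp add: fun_upd_twist)
  qed (use i in auto)
  also have "\<dots> = K * z\<^sup>2" using prob_space by simp
  finally show "\<bar>avg h l G (y(i := z)) - avg h l G (y(i := 0)) - avg h l D (y(i := 0)) * z\<bar> \<le> K * z\<^sup>2" .
qed

lemma lipschitz_at_avg:
  assumes G: "bounded_meas a b G" and h: "h > 0" and l: "l \<noteq> i" and T: "lipschitz_at i K G"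
  shows "lipschitz_at i K (avg h l G)"
  unfolding lipschitz_at_def
proof (intro allI)
  fix y z
  interpret prob_space "gauss h" by (rule prob_space_gauss) fact
  note i = bounded_meas_integrable[OF G h]
  have eq: "avg h l G (y(i := z)) - avg h l G (y(i := 0))
     = (\<integral>w. G ((y(i := z))(l := w)) - G ((y(i := 0))(l := w)) \<partial>gauss h)"
    unfolding avg_def using i by simp
  have "\<bar>avg h l G (y(i := z)) - avg h l G (y(i := 0))\<bar>
    \<le> (\<integral>w. \<bar>G ((y(i := z))(l := w)) - G ((y(i := 0))(l := w))\<bar> \<partial>gauss h)"
    unfolding eq by (rule integral_abs_bound)
  also have "\<dots> \<le> (\<integral>w. K * \<bar>z\<bar> \<partial>gauss h)"
  proof (rule integral_mono)
    fix w
    show "\<bar>G ((y(i := z))(l := w)) - G ((y(i := 0))(l := w))\<bar> \<le> K * \<bar>z\<bar>"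
      using T[unfolded lipschitz_at_def, rule_format, of "y(l := w)" z] l by (simp add: fun_upd_twist)
  qed (use i in auto)
  also have "\<dots> = K * \<bar>z\<bar>" using prob_space by simp
  finally show "\<bar>avg h l G (y(i := z)) - avg h l G (y(i := 0))\<bar> \<le> K * \<bar>z\<bar>" .
qed

text \<open>Since i < n, only coordinates other than i are averaged, and these leave both bounds
  intact.\<close>

lemma
  assumes g: "time_grid m s" and G: "bounded_meas a b G" and n: "i < n" "n \<le> m"
  shows lev_taylor_at: "bounded_meas c d D \<Longrightarrow> taylor_at i K G D \<Longrightarrow> taylor_at i K (lev s m G n) (lev s m D n)"
    and lev_lipschitz_at: "lipschitz_at i K G \<Longrightarrow> lipschitz_at i K (lev s m G n)"
proof -
  show "taylor_at i K (lev s m G n) (lev s m D n)" if D: "bounded_meas c d D" and T: "taylor_at i K G D"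
    using n(2,1)
  proof (induction n rule: inc_induct)
    case (step n)
    then have "s (Suc n) - s n > 0" "Suc n \<le> m" using g by (auto simp: time_grid_def)
    with step show ?case
      by (simp add: lev_step) (rule taylor_at_avg[OF lev_bounded_meas[OF g G] lev_bounded_meas[OF g D]], auto)
  qed (use T in simp)
  show "lipschitz_at i K (lev s m G n)" if T: "lipschitz_at i K G"
    using n(2,1)
  proof (induction n rule: inc_induct)
    case (step n)
    then have "s (Suc n) - s n > 0" "Suc n \<le> m" using g by (auto simp: time_grid_def)
    with step show ?case
      by (simp add: lev_step) (rule lipschitz_at_avg[OF lev_bounded_meas[OF g G]], auto)
  qed (use T in simp)
qed

text \<open>Freezing coordinate i commutes with averaging over the coordinates from n on.\<close>

lemma lev_upd_zero:
  assumes n: "i < n" "n \<le> m"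
  shows "lev s m (\<lambda>y. G (y(i := 0))) n = (\<lambda>y. lev s m G n (y(i := 0)))"
  using n(2,1)
proof (induction n rule: inc_induct)
  case (step n)
  then have ni: "n \<noteq> i" and IH: "lev s m (\<lambda>y. G (y(i := 0))) (Suc n) = (\<lambda>y. lev s m G (Suc n) (y(i := 0)))"
    using step.prems by (simp, intro step.IH) simp
  show ?case unfolding lev_step[OF step(2)] avg_def IH fun_upd_twist[OF ni] ..
qed simp

lemma gauss_abs_moment: "h > 0 \<Longrightarrow> integrable (gauss h) (\<lambda>z. \<bar>z\<bar>)" "h > 0 \<Longrightarrow> (\<integral>z. \<bar>z\<bar> \<partial>gauss h) \<le> sqrt h"
proof -
  assume h: "h > 0"
  interpret prob_space "gauss h" by (rule prob_space_gauss) fact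
  show i: "integrable (gauss h) (\<lambda>z. \<bar>z\<bar>)" using gauss_first_moment[OF h] by simp
  define c where "c = (\<integral>z. \<bar>z\<bar> \<partial>gauss h)"
  have "0 \<le> (\<integral>z. (\<bar>z\<bar> - c)\<^sup>2 \<partial>gauss h)" by simp
  also have "(\<integral>z. (\<bar>z\<bar> - c)\<^sup>2 \<partial>gauss h) = (\<integral>z. z\<^sup>2 - 2 * c * \<bar>z\<bar> + c\<^sup>2 \<partial>gauss h)"
    by (rule Bochner_Integration.integral_cong) (auto simp: power2_diff)
  also have "\<dots> = h - c\<^sup>2"
    using gauss_second_moment[OF h] i prob_space by (simp add: c_def power2_eq_square)
  finally show "(\<integral>z. \<bar>z\<bar> \<partial>gauss h) \<le> sqrt h" unfolding c_def[symmetric] by (intro real_le_rsqrt) simp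
qed

section \<open>Integrating out increments as conditional expectation\<close>

context brownian_setting
begin

text \<open>Padding with 0 lets functions of all increments be evaluated at every stage, and makes
  \<open>incr s n x\<close> the base point at which \<open>taylor_at n\<close> expands.\<close>

definition incr :: "(nat \<Rightarrow> real) \<Rightarrow> nat \<Rightarrow> 'a \<Rightarrow> nat \<Rightarrow> real" where
  "incr s n x = (\<lambda>i. if i < n then W (s (Suc i)) x - W (s i) x else 0)"

lemma incr_Suc: "incr s (Suc n) x = (incr s n x)(n := W (s (Suc n)) x - W (s n) x)"
  by (auto simp: incr_def fun_eq_iff less_Suc_eq)

lemma incr_self [simp]: "(incr s n x)(n := 0) = incr s n x"
  by (auto simp: incr_def fun_eq_iff)

lemma incr_measurable:
  assumes g: "time_grid m s" and n: "n \<le> m"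
  shows "incr s n \<in> measurable (F (s n)) seq_borel"
proof (rule measurable_PiM_single')
  fix i :: nat
  have Wm: "W (s j) \<in> borel_measurable (F (s n))" if "j \<le> n" for j
    using time_grid_le[OF g, of j n] time_grid_range[OF g, of j] that n
    by (auto intro!: measurable_F_mono[of _ "s j"] W_F)
  show "(\<lambda>x. incr s n x i) \<in> borel_measurable (F (s n))"
  proof (cases "i < n")
    case True
    then show ?thesis using Wm[of i] Wm[of "Suc i"] by (simp add: incr_def)
  qed (simp add: incr_def)
qed (auto simp: space_PiM)

lemma integral_increment:
  fixes g :: "'a \<times> real \<Rightarrow> real"
  assumes st: "0 \<le> s" "s < t" "t \<le> 1" and g[measurable]: "g \<in> borel_measurable (F s \<Otimes>\<^sub>M borel)"
    and bnd: "\<And>x z. \<bar>g (x, z)\<bar> \<le> C"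
  shows "(\<integral>x. g (x, W t x - W s x) \<partial>M) = (\<integral>x. (\<integral>z. g (x, z) \<partial>gauss (t - s)) \<partial>M)"
proof -
  interpret G: prob_space "gauss (t - s)" by (rule prob_space_gauss) (use st in simp)
  have sub: "subalgebra M (F s)" using subalg_F st by auto
  have [measurable]: "W t \<in> borel_measurable M" "W s \<in> borel_measurable M" using W_M st by auto
  have idm[measurable]: "(\<lambda>x. x) \<in> measurable M (F s)" using sub by (auto simp: subalgebra_def measurable_def)
  have m1: "(\<lambda>x. g (x, W t x - W s x)) \<in> borel_measurable M" by measurable
  have m2F: "(\<lambda>x. \<integral>z. g (x, z) \<partial>gauss (t - s)) \<in> borel_measurable (F s)" by measurable
  then have m2: "(\<lambda>x. \<integral>z. g (x, z) \<partial>gauss (t - s)) \<in> borel_measurable M" using measurable_from_subalg[OF sub] by blast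
  have mz: "(\<lambda>z. g (x, z)) \<in> borel_measurable (gauss (t - s))" if "x \<in> space M" for x
    using that by (auto intro!: measurable_compose[OF measurable_Pair1' g] simp: )
  have iz: "integrable (gauss (t - s)) (\<lambda>z. g (x, z))" if "x \<in> space M" for x
    by (rule G.integrable_const_bound[of _ C]) (use bnd mz[OF that] in auto)
  have bz: "\<bar>\<integral>z. g (x, z) \<partial>gauss (t - s)\<bar> \<le> C" if "x \<in> space M" for x
  proof -
    have "\<bar>\<integral>z. g (x, z) \<partial>gauss (t - s)\<bar> \<le> (\<integral>z. \<bar>g (x, z)\<bar> \<partial>gauss (t - s))" by (rule integral_abs_bound)
    also have "\<dots> \<le> (\<integral>z. C \<partial>gauss (t - s))" using iz[OF that] bnd by (intro integral_mono) auto
    finally show ?thesis using G.prob_space by simp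
  qed
  have i1: "integrable M (\<lambda>x. g (x, W t x - W s x))"
    by (rule integrable_const_bound[of _ C]) (use bnd m1 in auto)
  have i2: "integrable M (\<lambda>x. \<integral>z. g (x, z) \<partial>gauss (t - s))"
    by (rule integrable_const_bound[of _ C]) (use bz m2 in auto)
  \<comment> \<open>Adding \<open>C\<close> makes the integrand nonnegative and reduces the claim to
    \<open>nn_integral_increment\<close>.\<close>
  have nonneg: "0 \<le> g (x, z) + C" for x z using bnd[of x z] by linarith
  have "(\<integral>\<^sup>+x. ennreal (g (x, W t x - W s x) + C) \<partial>M) = (\<integral>\<^sup>+x. (\<integral>\<^sup>+z. ennreal (g (x, z) + C) \<partial>gauss (t - s)) \<partial>M)"
    using nn_integral_increment[OF st, of "\<lambda>p. ennreal (g p + C)"] by simp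
  also have "\<dots> = (\<integral>\<^sup>+x. ennreal ((\<integral>z. g (x, z) \<partial>gauss (t - s)) + C) \<partial>M)"
  proof (rule nn_integral_cong)
    fix x assume x: "x \<in> space M"
    have "(\<integral>\<^sup>+z. ennreal (g (x, z) + C) \<partial>gauss (t - s)) = ennreal (\<integral>z. g (x, z) + C \<partial>gauss (t - s))"
      by (rule nn_integral_eq_integral) (use iz[OF x] nonneg in auto)
    then show "(\<integral>\<^sup>+z. ennreal (g (x, z) + C) \<partial>gauss (t - s)) = ennreal ((\<integral>z. g (x, z) \<partial>gauss (t - s)) + C)"
      using iz[OF x] G.prob_space by simp
  qed
  finally have "ennreal (\<integral>x. g (x, W t x - W s x) + C \<partial>M) = ennreal (\<integral>x. (\<integral>z. g (x, z) \<partial>gauss (t - s)) + C \<partial>M)"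
    using i1 i2 nonneg bz
    by (subst (asm) (1 2) nn_integral_eq_integral) (auto intro!: AE_I2, smt (verit))
  then have "(\<integral>x. g (x, W t x - W s x) + C \<partial>M) = (\<integral>x. (\<integral>z. g (x, z) \<partial>gauss (t - s)) + C \<partial>M)"
  proof (subst (asm) ennreal_inj)
    show "0 \<le> (\<integral>x. g (x, W t x - W s x) + C \<partial>M)" using nonneg by (intro integral_nonneg_AE) auto
    show "0 \<le> (\<integral>x. (\<integral>z. g (x, z) \<partial>gauss (t - s)) + C \<partial>M)"
      using bz by (intro integral_nonneg_AE AE_I2) (smt (verit))
  qed
  then show ?thesis using i1 i2 by simp
qed

text \<open>The increments after \<open>s i\<close> are Gaussian and each is independent of all that
  precedes it, so averaging them out one at a time is conditioning on
  \<open>F (s i)\<close>.\<close>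

lemma cond_exp_lev:
  assumes g: "time_grid m s" and G: "bounded_meas a b G" and i: "i \<le> m"
  shows "AE x in M. real_cond_exp M (F (s i)) (\<lambda>x. G (incr s m x)) x = lev s m G i (incr s i x)"
    and "integrable M (\<lambda>x. lev s m G i (incr s i x))"
    and "(\<lambda>x. lev s m G i (incr s i x)) \<in> borel_measurable (F (s i))"
proof -
  define C where "C = max \<bar>a\<bar> \<bar>b\<bar>"
  have levC: "\<bar>lev s m G n y\<bar> \<le> C" if "n \<le> m" for n y
    using lev_bounded_meas[OF g G that] unfolding bounded_meas_def C_def
    by (smt (verit))
  have levF: "(\<lambda>x. lev s m G n (incr s n x)) \<in> borel_measurable (F (s n))" if "n \<le> m" for n
    by (rule measurable_compose[OF incr_measurable[OF g that]]) (use lev_bounded_meas[OF g G that] in \<open>simp add: bounded_meas_def\<close>)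
  have s01: "n \<le> m \<Longrightarrow> s n \<in> {0..1}" for n using time_grid_range[OF g, of n] by auto
  have levi: "integrable M (\<lambda>x. lev s m G n (incr s n x))" if "n \<le> m" for n
    by (rule integrable_const_bound[of _ C]) (use levC[OF that] measurable_F_M[OF levF[OF that] s01[OF that]] in auto)
  show "integrable M (\<lambda>x. lev s m G i (incr s i x))" "(\<lambda>x. lev s m G i (incr s i x)) \<in> borel_measurable (F (s i))"
    using levi levF i by auto
  interpret S: finite_measure_subalgebra M "F (s i)"
    by unfold_locales (rule subalg_F[OF s01[OF i]])
  have eq: "(\<integral>x. indicator A x * lev s m G n (incr s n x) \<partial>M) = (\<integral>x. indicator A x * lev s m G i (incr s i x) \<partial>M)"
    if A: "A \<in> sets (F (s i))" and n: "i \<le> n" "n \<le> m" for A n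
    using n
  proof (induction n rule: dec_induct)
    case (step n)
    have st: "0 \<le> s n" "s n < s (Suc n)" "s (Suc n) \<le> 1"
      using time_grid_range[OF g, of n] time_grid_range[OF g, of "Suc n"] g step by (auto simp: time_grid_def)
    have An[measurable]: "A \<in> sets (F (s n))" using A F_mono[of "s i" "s n"] time_grid_le[OF g, of i n] step by auto
    have [measurable]: "incr s n \<in> measurable (F (s n)) seq_borel" using incr_measurable[OF g] step by auto
    have [measurable]: "lev s m G (Suc n) \<in> borel_measurable seq_borel"
      using lev_bounded_meas[OF g G, of "Suc n"] step by (simp add: bounded_meas_def)
    have meas: "(\<lambda>(x, z). indicator A x * lev s m G (Suc n) ((incr s n x)(n := z))) \<in> borel_measurable (F (s n) \<Otimes>\<^sub>M borel)"
      by measurable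
    have "(\<integral>x. indicator A x * lev s m G (Suc n) (incr s (Suc n) x) \<partial>M)
       = (\<integral>x. (\<integral>z. indicator A x * lev s m G (Suc n) ((incr s n x)(n := z)) \<partial>gauss (s (Suc n) - s n)) \<partial>M)"
    proof -
      have "0 \<le> C" by (simp add: C_def)
      then have b: "\<bar>case (x, z) of (x, z) \<Rightarrow> indicator A x * lev s m G (Suc n) ((incr s n x)(n := z))\<bar> \<le> C" for x z
        using levC[of "Suc n"] step by (auto simp: indicator_def)
      show ?thesis using integral_increment[OF st meas b] unfolding incr_Suc prod.case .
    qed
    also have "\<dots> = (\<integral>x. indicator A x * lev s m G n (incr s n x) \<partial>M)"
      using step by (simp add: lev_step avg_def)
    finally show ?case using step by simp
  qed simp
  show "AE x in M. real_cond_exp M (F (s i)) (\<lambda>x. G (incr s m x)) x = lev s m G i (incr s i x)"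
  proof (rule S.real_cond_exp_charact)
    fix A assume "A \<in> sets (F (s i))"
    then show "(\<integral>x\<in>A. G (incr s m x) \<partial>M) = (\<integral>x\<in>A. lev s m G i (incr s i x) \<partial>M)"
      using eq[of A m] i by (simp add: set_lebesgue_integral_def)
  qed (use levi[of m] levi[OF i] levF[OF i] in auto)
qed

end

section \<open>Hellinger affinity of a functional and its step exponential\<close>

text \<open>The mean of (sqrt f - sqrt g)^2 is at most 2 \<delta>. Factoring f - g as a difference
  of squares and applying Young's inequality with weight \<epsilon> gives the bound \<delta> /
  \<epsilon> + 2 \<epsilon>, and \<epsilon> = sqrt \<delta> yields 3 sqrt \<delta>.\<close>

lemma hellinger_L1:
  fixes f g :: "'a \<Rightarrow> real"
  assumes f: "integrable M f" "(\<integral>x. f x \<partial>M) = 1" "\<And>x. x \<in> space M \<Longrightarrow> 0 \<le> f x"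
    and g: "integrable M g" "(\<integral>x. g x \<partial>M) = 1" "\<And>x. x \<in> space M \<Longrightarrow> 0 \<le> g x"
    and S: "ennreal (1 - \<delta>) \<le> (\<integral>\<^sup>+x. ennreal (sqrt (f x * g x)) \<partial>M)" and \<delta>: "0 \<le> \<delta>"
  shows "(\<integral>x. \<bar>f x - g x\<bar> \<partial>M) \<le> 3 * sqrt \<delta>"
proof -
  have [measurable]: "f \<in> borel_measurable M" "g \<in> borel_measurable M" using f g by auto
  have am: "sqrt (f x * g x) \<le> (f x + g x) / 2" if "x \<in> space M" for x
    using arith_geo_mean_sqrt[OF f(3)[OF that] g(3)[OF that]] .
  have iS: "integrable M (\<lambda>x. sqrt (f x * g x))"
    by (rule Bochner_Integration.integrable_bound[of M "\<lambda>x. (f x + g x) / 2"])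
       (use f g am in \<open>auto intro!: AE_I2\<close>)
  have "1 - \<delta> \<le> (\<integral>x. sqrt (f x * g x) \<partial>M)"
  proof -
    have "ennreal (1 - \<delta>) \<le> ennreal (\<integral>x. sqrt (f x * g x) \<partial>M)"
      using S by (subst (asm) nn_integral_eq_integral[OF iS]) (use f g in auto)
    moreover have "0 \<le> (\<integral>x. sqrt (f x * g x) \<partial>M)" using f g by (intro integral_nonneg_AE) auto
    ultimately show ?thesis by (simp add: ennreal_le_iff)
  qed
  then have sq: "(\<integral>x. (sqrt (f x) - sqrt (g x))\<^sup>2 \<partial>M) \<le> 2 * \<delta>"
    and sqi: "integrable M (\<lambda>x. (sqrt (f x) - sqrt (g x))\<^sup>2)"
  proof -
    have eq: "(sqrt (f x) - sqrt (g x))\<^sup>2 = f x + g x - 2 * sqrt (f x * g x)" if "x \<in> space M" for x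
      using f(3)[OF that] g(3)[OF that] by (simp add: power2_diff real_sqrt_mult)
    have "integrable M (\<lambda>x. f x + g x - 2 * sqrt (f x * g x))" using f g iS by auto
    then show "integrable M (\<lambda>x. (sqrt (f x) - sqrt (g x))\<^sup>2)"
      by (subst Bochner_Integration.integrable_cong[OF refl eq]) auto
    have "(\<integral>x. (sqrt (f x) - sqrt (g x))\<^sup>2 \<partial>M) = (\<integral>x. f x + g x - 2 * sqrt (f x * g x) \<partial>M)"
      by (rule Bochner_Integration.integral_cong[OF refl eq])
    then show "1 - \<delta> \<le> (\<integral>x. sqrt (f x * g x) \<partial>M) \<Longrightarrow> (\<integral>x. (sqrt (f x) - sqrt (g x))\<^sup>2 \<partial>M) \<le> 2 * \<delta>"
      using f g iS by simp
  qed
  have bound: "(\<integral>x. \<bar>f x - g x\<bar> \<partial>M) \<le> \<delta> / \<epsilon> + 2 * \<epsilon>" if \<epsilon>: "\<epsilon> > 0" for \<epsilon>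
  proof -
    have pw: "\<bar>f x - g x\<bar> \<le> (sqrt (f x) - sqrt (g x))\<^sup>2 / (2 * \<epsilon>) + \<epsilon> * (f x + g x)" if x: "x \<in> space M" for x
    proof -
      define p q where "p = sqrt (f x)" and "q = sqrt (g x)"
      have pq: "p\<^sup>2 = f x" "q\<^sup>2 = g x" "0 \<le> p" "0 \<le> q" using f(3)[OF x] g(3)[OF x] by (auto simp: p_def q_def)
      have e1: "f x - g x = (p - q) * (p + q)" using pq by (simp add: power2_eq_square algebra_simps)
      have "\<bar>f x - g x\<bar> = \<bar>p - q\<bar> * (p + q)" unfolding e1 using pq by (simp add: abs_mult)
      also have "2 * \<epsilon> * (\<bar>p - q\<bar> * (p + q)) \<le> \<bar>p - q\<bar>\<^sup>2 + \<epsilon>\<^sup>2 * (p + q)\<^sup>2"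
        using sum_squares_bound[of "\<bar>p - q\<bar>" "\<epsilon> * (p + q)"] by (simp add: power_mult_distrib mult_ac)
      then have "\<bar>p - q\<bar> * (p + q) \<le> (\<bar>p - q\<bar>\<^sup>2 + \<epsilon>\<^sup>2 * (p + q)\<^sup>2) / (2 * \<epsilon>)"
        using \<epsilon> by (simp add: pos_le_divide_eq mult_ac)
      also have "\<dots> = (p - q)\<^sup>2 / (2 * \<epsilon>) + \<epsilon> / 2 * (p + q)\<^sup>2"
        using \<epsilon> by (simp add: field_simps power2_eq_square)
      also have "\<epsilon> / 2 * (p + q)\<^sup>2 \<le> \<epsilon> / 2 * (2 * (f x + g x))"
        using \<epsilon> sum_squares_bound[of p q] pq by (intro mult_left_mono) (auto simp: power2_sum)
      also have "\<epsilon> / 2 * (2 * (f x + g x)) = \<epsilon> * (f x + g x)" for x by (metis (no_types) mult.assoc nonzero_eq_divide_eq times_divide_eq_left zero_neq_numeral)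
      finally show ?thesis by (simp add: p_def q_def)
    qed
    have "(\<integral>x. \<bar>f x - g x\<bar> \<partial>M) \<le> (\<integral>x. (sqrt (f x) - sqrt (g x))\<^sup>2 / (2 * \<epsilon>) + \<epsilon> * (f x + g x) \<partial>M)"
      using f g sqi by (intro integral_mono pw) auto
    also have "\<dots> = (\<integral>x. (sqrt (f x) - sqrt (g x))\<^sup>2 \<partial>M) / (2 * \<epsilon>) + \<epsilon> * 2"
      using f g sqi by simp
    also have "\<dots> \<le> (2 * \<delta>) / (2 * \<epsilon>) + \<epsilon> * 2" using sq \<epsilon> by (intro add_mono divide_right_mono) auto
    finally show ?thesis by (simp add: mult.commute)
  qed
  show ?thesis
  \<comment> \<open>The choice \<epsilon> = sqrt \<delta> needs \<delta> > 0; for \<delta> = 0 the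
    weight \<epsilon> is sent to 0 instead.\<close>
  proof (cases "\<delta> = 0")
    case True
    have "(\<integral>x. \<bar>f x - g x\<bar> \<partial>M) \<le> 0"
    proof (rule field_le_epsilon)
      fix e :: real assume "e > 0"
      then show "(\<integral>x. \<bar>f x - g x\<bar> \<partial>M) \<le> 0 + e" using bound[of "e / 2"] True by simp
    qed
    then show ?thesis using True by simp
  next
    case False
    then have "0 < sqrt \<delta>" using \<delta> by simp
    moreover have "\<delta> / sqrt \<delta> = sqrt \<delta>" using \<delta> by (rule real_div_sqrt)
    ultimately show ?thesis using bound[of "sqrt \<delta>"] by simp
  qed
qed

text \<open>Lets the losses of successive intervals add up instead of multiply; when they exceed 1
  the left side is truncated to 0.\<close>

lemma ennreal_one_minus_mult:
  assumes "0 \<le> a" "0 \<le> (b::real)"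
  shows "ennreal (1 - (a + b)) \<le> ennreal (1 - b) * ennreal (1 - a)"
proof (cases "a + b \<le> 1")
  case True
  then have "ennreal (1 - b) * ennreal (1 - a) = ennreal ((1 - b) * (1 - a))" using assms by (simp add: ennreal_mult)
  moreover have "1 - (a + b) \<le> (1 - b) * (1 - a)" using assms by (simp add: algebra_simps)
  ultimately show ?thesis by (simp add: ennreal_leI)
qed (simp add: ennreal_neg)

lemma (in finite_measure_subalgebra) real_cond_exp_L1_contraction:
  assumes "integrable M f"
  shows "(\<integral>x. \<bar>real_cond_exp M F f x\<bar> \<partial>M) \<le> (\<integral>x. \<bar>f x\<bar> \<partial>M)"
proof -
  have [measurable]: "f \<in> borel_measurable M" using assms by simp
  have i: "integrable M (real_cond_exp M F f)" using real_cond_exp_int(1)[OF assms] .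
  have "ennreal (\<integral>x. \<bar>real_cond_exp M F f x\<bar> \<partial>M) = (\<integral>\<^sup>+x. ennreal \<bar>real_cond_exp M F f x\<bar> \<partial>M)"
    by (rule nn_integral_eq_integral[symmetric]) (use i in auto)
  also have "\<dots> \<le> (\<integral>\<^sup>+x. nn_cond_exp M F (\<lambda>x. ennreal \<bar>f x\<bar>) x \<partial>M)"
    by (rule nn_integral_mono_AE) (rule real_cond_exp_abs, simp)
  also have "\<dots> = (\<integral>\<^sup>+x. ennreal \<bar>f x\<bar> \<partial>M)"
    using nn_cond_exp_intg[of "\<lambda>_. 1" "\<lambda>x. ennreal \<bar>f x\<bar>"] by simp
  also have "\<dots> = ennreal (\<integral>x. \<bar>f x\<bar> \<partial>M)"
    by (rule nn_integral_eq_integral) (use assms in auto)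
  finally show ?thesis by (simp add: ennreal_le_iff)
qed

context brownian_setting
begin

text \<open>By \<open>cond_exp_lev\<close> both terms of the quotient are conditional expectations
  at the left end point. The sign is that of \<open>step_exp\<close>, whose factor expands as 1 -
  \<xi> z, against 1 + D z / m for the normalised functional.\<close>

definition log_deriv_step ::
    "(nat \<Rightarrow> real) \<Rightarrow> nat \<Rightarrow> ((nat \<Rightarrow> real) \<Rightarrow> real) \<Rightarrow> (nat \<Rightarrow> (nat \<Rightarrow> real) \<Rightarrow> real) \<Rightarrow> nat \<Rightarrow> 'a \<Rightarrow> real" where
  "log_deriv_step s m G D i x = - lev s m (D i) i (incr s i x) / lev s m G i (incr s i x)"

lemma step_process_log_deriv:
  assumes g: "time_grid m s" and a: "0 < a" and G: "bounded_meas a K G"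
    and D: "\<And>i. i < m \<Longrightarrow> bounded_meas (- K) K (D i)"
  shows "step_process F m s (log_deriv_step s m G D)"
  unfolding step_process_iff
proof (intro conjI g allI impI)
  fix i assume i: "i < m"
  have [measurable]: "(\<lambda>x. lev s m (D i) i (incr s i x)) \<in> borel_measurable (F (s i))"
    "(\<lambda>x. lev s m G i (incr s i x)) \<in> borel_measurable (F (s i))"
    using cond_exp_lev(3)[OF g D[OF i], of i] cond_exp_lev(3)[OF g G, of i] i by auto
  show "log_deriv_step s m G D i \<in> borel_measurable (F (s i))"
    unfolding log_deriv_step_def[abs_def] by measurable
  show "\<exists>C. \<forall>x\<in>space (F (s i)). \<bar>log_deriv_step s m G D i x\<bar> \<le> C"
  proof (intro exI[of _ "K / a"] ballI)
    fix x
    have 1: "\<bar>lev s m (D i) i (incr s i x)\<bar> \<le> K"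
      using lev_bounded_meas[OF g D[OF i], of i] i by (simp add: bounded_meas_def abs_le_iff minus_le_iff)
    have 2: "a \<le> lev s m G i (incr s i x)"
      using lev_bounded_meas[OF g G, of i] i by (simp add: bounded_meas_def)
    then show "\<bar>log_deriv_step s m G D i x\<bar> \<le> K / a"
      unfolding log_deriv_step_def abs_divide abs_minus_cancel using 1 a by (intro frac_le) auto
  qed
qed

text \<open>Let J n be the root of the normalised conditional expectation of G at \<open>s n\<close>
  times the exponential up to \<open>s n\<close>. It starts at 1, and given \<open>F (s n)\<close>
  the factor from J n to J (n + 1) has mean at least 1 - C h^2 by \<open>hellinger_one_step\<close>,
  so the losses sum. As C depends only on \<open>a\<close> and \<open>K\<close>, the total loss is
  at most C times the mesh.\<close>

lemma hellinger_log_deriv: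
  assumes a: "0 < a" "a \<le> 1" and K: "1 \<le> K"
  shows "\<exists>C\<ge>0. \<forall>m s G D. time_grid m s \<longrightarrow> bounded_meas a K G \<longrightarrow>
     (\<forall>i<m. bounded_meas (- K) K (D i) \<and> taylor_at i K G (D i) \<and> lipschitz_at i K (D i)) \<longrightarrow>
     ennreal (1 - C * (\<Sum>i<m. (s (Suc i) - s i)\<^sup>2)) \<le>
       (\<integral>\<^sup>+x. ennreal (sqrt (G (incr s m x) / lev s m G 0 (\<lambda>_. 0) * step_exp W m s (log_deriv_step s m G D) x)) \<partial>M)"
proof -
  obtain C0 where C0: "\<forall>h P d D m v. 0 < h \<longrightarrow> h \<le> 1 \<longrightarrow> P \<in> borel_measurable borel \<longrightarrow>
     (\<forall>z. a \<le> P z \<and> P z \<le> K \<and> \<bar>P z - P 0 - d * z\<bar> \<le> K * z\<^sup>2) \<longrightarrow>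
     m = (\<integral>z. P z \<partial>gauss h) \<longrightarrow> \<bar>D\<bar> \<le> K \<longrightarrow> \<bar>D - d\<bar> \<le> K * sqrt h \<longrightarrow> v = - D / m \<longrightarrow>
     ennreal (1 - C0 * h\<^sup>2) \<le> (\<integral>\<^sup>+z. ennreal (sqrt (P z / m * exp (- v * z - v\<^sup>2 * h / 2))) \<partial>gauss h)"
    using hellinger_one_step[OF a K] by blast
  define C where "C = max C0 0"
  show ?thesis
  proof (intro exI[of _ C] conjI allI impI)
    show "0 \<le> C" by (simp add: C_def)
    fix m s G D
    assume g: "time_grid m s" and G: "bounded_meas a K G"
      and DD: "\<forall>i<m. bounded_meas (- K) K (D i) \<and> taylor_at i K G (D i) \<and> lipschitz_at i K (D i)"
    have D: "bounded_meas (- K) K (D i)" "taylor_at i K G (D i)" "lipschitz_at i K (D i)" if "i < m" for i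
      using DD that by auto
    define \<xi> where "\<xi> = log_deriv_step s m G D"
    have \<xi>: "step_process F m s \<xi>"
      unfolding \<xi>_def by (rule step_process_log_deriv[OF g a(1) G D(1)])
    define l0 where "l0 = lev s m G 0 (\<lambda>_. 0)"
    define L where "L = (\<lambda>i x. lev s m G i (incr s i x))"
    have Lb: "a \<le> L i x" if "i \<le> m" for i x
      using lev_bounded_meas[OF g G that] by (simp add: L_def bounded_meas_def)
    have Lpos: "0 < L i x" if "i \<le> m" for i x using Lb[OF that, of x] a by linarith
    have l0: "0 < l0"
    proof -
      have "a \<le> l0" using lev_bounded_meas[OF g G, of 0] by (simp add: l0_def bounded_meas_def)
      then show ?thesis using a by linarith
    qed
    have Lm: "L i \<in> borel_measurable (F (s i))" if "i \<le> m" for i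
      unfolding L_def by (rule cond_exp_lev(3)[OF g G that])
    define J where "J = (\<lambda>i x. ennreal (sqrt (L i x / l0 * step_exp_upto W s \<xi> i x)))"
    have Jm: "J i \<in> borel_measurable (F (s i))" if "i \<le> m" for i
    proof -
      note [measurable] = Lm[OF that] step_exp_upto_measurable[OF \<xi> that]
      show ?thesis unfolding J_def by measurable
    qed
    have main: "ennreal (1 - C * (\<Sum>i<n. (s (Suc i) - s i)\<^sup>2)) \<le> (\<integral>\<^sup>+x. J n x \<partial>M)" if "n \<le> m" for n
      using that
    proof (induction n)
      case 0
      have "J 0 x = 1" for x
        using l0 by (simp add: J_def L_def incr_def step_exp_upto_def l0_def)
      then show ?case by (simp add: emeasure_space_1)
    next
      case (Suc n)
      then have n: "n < m" "n \<le> m" by auto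
      define h where "h = s (Suc n) - s n"
      have st: "0 \<le> s n" "s n < s (Suc n)" "s (Suc n) \<le> 1"
        using time_grid_range[OF g, of n] time_grid_range[OF g, of "Suc n"] g n by (auto simp: time_grid_def)
      have h: "0 < h" "h \<le> 1" using st by (auto simp: h_def)
      have levm: "bounded_meas a K (lev s m G (Suc n))" "bounded_meas (- K) K (lev s m (D n) (Suc n))"
        using lev_bounded_meas[OF g G] lev_bounded_meas[OF g D(1)[OF n(1)]] n by auto
      have [measurable]: "lev s m G (Suc n) \<in> borel_measurable seq_borel" using levm(1) by (simp add: bounded_meas_def)
      have [measurable]: "incr s n \<in> measurable (F (s n)) seq_borel" by (rule incr_measurable[OF g n(2)])
      have [measurable]: "\<xi> n \<in> borel_measurable (F (s n))" using \<xi> n by (simp add: step_process_iff)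
      note [measurable] = Lm[OF n(2)] Jm[OF n(2)]
      define r where "r = (\<lambda>(x, z). ennreal (sqrt (lev s m G (Suc n) ((incr s n x)(n := z)) / L n x *
           exp (- \<xi> n x * z - (\<xi> n x)\<^sup>2 * h / 2))))"
      have rm: "r \<in> borel_measurable (F (s n) \<Otimes>\<^sub>M borel)" unfolding r_def by measurable
      have JS: "J (Suc n) x = J n x * r (x, W (s (Suc n)) x - W (s n) x)" for x
      proof -
        have "L (Suc n) x / l0 * step_exp_upto W s \<xi> (Suc n) x = (L n x / l0 * step_exp_upto W s \<xi> n x) *
           (L (Suc n) x / L n x * exp (- \<xi> n x * (W (s (Suc n)) x - W (s n) x) - (\<xi> n x)\<^sup>2 * h / 2))"
          using Lpos[OF n(2), of x] by (simp add: step_exp_upto_Suc h_def)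
        moreover have "L (Suc n) x = lev s m G (Suc n) ((incr s n x)(n := W (s (Suc n)) x - W (s n) x))"
          by (simp only: L_def incr_Suc)
        ultimately show ?thesis
          unfolding J_def r_def prod.case using l0 Lpos[OF n(2), of x] Lpos[of "Suc n" x] n step_exp_pos(2)[of W s \<xi> n x]
          by (simp only: real_sqrt_mult) (subst ennreal_mult, auto simp: less_imp_le)
      qed
      have low: "ennreal (1 - C * h\<^sup>2) \<le> (\<integral>\<^sup>+z. r (x, z) \<partial>gauss h)" if x: "x \<in> space M" for x
      proof -
        let ?P = "\<lambda>z. lev s m G (Suc n) ((incr s n x)(n := z))"
        let ?d = "lev s m (D n) (Suc n) ((incr s n x)(n := 0))"
        let ?D = "lev s m (D n) n (incr s n x)"
        have T: "taylor_at n K (lev s m G (Suc n)) (lev s m (D n) (Suc n))"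
          using n by (intro lev_taylor_at[OF g G _ _ D(1,2)]) auto
        have Lip: "lipschitz_at n K (lev s m (D n) (Suc n))"
          using n by (intro lev_lipschitz_at[OF g D(1) _ _ D(3)]) auto
        have DK: "\<bar>?D\<bar> \<le> K"
          using lev_bounded_meas[OF g D(1)[OF n(1)] n(2)] by (simp add: bounded_meas_def abs_le_iff minus_le_iff)
        \<comment> \<open>\<open>?D\<close> averages over increment n what \<open>?d\<close> takes
          at 0; by the Lipschitz bound they differ by at most K times E |z|, and E |z| \<le> sqrt
          h.\<close>
        have dD: "\<bar>?D - ?d\<bar> \<le> K * sqrt h"
        proof -
          interpret G: prob_space "gauss h" by (rule prob_space_gauss[OF h(1)])
          have i: "integrable (gauss h) (\<lambda>z. lev s m (D n) (Suc n) ((incr s n x)(n := z)))"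
            by (rule bounded_meas_integrable[OF levm(2) h(1)])
          have eq: "?D - ?d = (\<integral>z. lev s m (D n) (Suc n) ((incr s n x)(n := z)) - ?d \<partial>gauss h)"
          proof -
            have "?D = (\<integral>z. lev s m (D n) (Suc n) ((incr s n x)(n := z)) \<partial>gauss h)"
              unfolding lev_step[OF n(1)] avg_def h_def ..
            moreover have "(\<integral>z. lev s m (D n) (Suc n) ((incr s n x)(n := z)) - c \<partial>gauss h)
               = (\<integral>z. lev s m (D n) (Suc n) ((incr s n x)(n := z)) \<partial>gauss h) - c" for c
              using i G.prob_space by simp
            ultimately show ?thesis by simp
          qed
          have "\<bar>?D - ?d\<bar> \<le> (\<integral>z. \<bar>lev s m (D n) (Suc n) ((incr s n x)(n := z)) - ?d\<bar> \<partial>gauss h)"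
            unfolding eq by (rule integral_abs_bound)
          also have "\<dots> \<le> (\<integral>z. K * \<bar>z\<bar> \<partial>gauss h)"
          proof (rule integral_mono)
            fix z show "\<bar>lev s m (D n) (Suc n) ((incr s n x)(n := z)) - ?d\<bar> \<le> K * \<bar>z\<bar>"
              using Lip unfolding lipschitz_at_def by blast
          qed (use i gauss_abs_moment(1)[OF h(1)] in auto)
          also have "\<dots> \<le> K * sqrt h"
            using gauss_abs_moment(2)[OF h(1)] K by (simp add: mult_left_mono)
          finally show ?thesis .
        qed
        have "ennreal (1 - C * h\<^sup>2) \<le> ennreal (1 - C0 * h\<^sup>2)"
          by (intro ennreal_leI diff_left_mono mult_right_mono) (auto simp: C_def)
        also have "\<dots> \<le> (\<integral>\<^sup>+z. ennreal (sqrt (?P z / L n x * exp (- \<xi> n x * z - (\<xi> n x)\<^sup>2 * h / 2))) \<partial>gauss h)"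
        proof (rule C0[rule_format, OF h])
          show "?P \<in> borel_measurable borel" by (rule bounded_meas_upd[OF levm(1)])
          show "a \<le> ?P z \<and> ?P z \<le> K \<and> \<bar>?P z - ?P 0 - ?d * z\<bar> \<le> K * z\<^sup>2" for z
            using levm(1) T unfolding bounded_meas_def taylor_at_def by blast
          show "L n x = (\<integral>z. ?P z \<partial>gauss h)" using n by (simp add: L_def lev_step avg_def h_def)
          show "\<bar>?D\<bar> \<le> K" by (rule DK)
          show "\<bar>?D - ?d\<bar> \<le> K * sqrt h" by (rule dD)
          show "\<xi> n x = - ?D / L n x" by (simp add: \<xi>_def log_deriv_step_def L_def)
        qed
        finally show ?thesis by (simp add: r_def)
      qed
      have "ennreal (1 - C * (\<Sum>i<Suc n. (s (Suc i) - s i)\<^sup>2)) = ennreal (1 - (C * (\<Sum>i<n. (s (Suc i) - s i)\<^sup>2) + C * h\<^sup>2))"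
        by (simp add: h_def algebra_simps)
      also have "\<dots> \<le> ennreal (1 - C * h\<^sup>2) * ennreal (1 - C * (\<Sum>i<n. (s (Suc i) - s i)\<^sup>2))"
        by (rule ennreal_one_minus_mult) (auto simp: C_def sum_nonneg)
      also have "\<dots> \<le> ennreal (1 - C * h\<^sup>2) * (\<integral>\<^sup>+x. J n x \<partial>M)"
        using Suc by (intro mult_left_mono) auto
      also have "\<dots> = (\<integral>\<^sup>+x. J n x * ennreal (1 - C * h\<^sup>2) \<partial>M)"
      proof -
        have "J n \<in> borel_measurable M" by (rule measurable_from_subalg[OF subalg_F Jm[OF n(2)]]) (use st in auto)
        then show ?thesis by (subst nn_integral_multc) (auto simp: mult.commute)
      qed
      also have "\<dots> \<le> (\<integral>\<^sup>+x. J n x * (\<integral>\<^sup>+z. r (x, z) \<partial>gauss h) \<partial>M)"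
        by (intro nn_integral_mono mult_left_mono low) auto
      also have "\<dots> = (\<integral>\<^sup>+x. (\<integral>\<^sup>+z. J n x * r (x, z) \<partial>gauss h) \<partial>M)"
      proof (rule nn_integral_cong)
        fix x assume "x \<in> space M"
        then have "(\<lambda>z. r (x, z)) \<in> borel_measurable (gauss h)"
          using rm by (auto intro!: measurable_compose[OF measurable_Pair1' rm])
        then show "J n x * (\<integral>\<^sup>+z. r (x, z) \<partial>gauss h) = (\<integral>\<^sup>+z. J n x * r (x, z) \<partial>gauss h)"
          by (rule nn_integral_cmult[symmetric])
      qed
      also have "\<dots> = (\<integral>\<^sup>+x. J n x * r (x, W (s (Suc n)) x - W (s n) x) \<partial>M)"
      proof -
        have "(\<lambda>(x, z). J n x * r (x, z)) \<in> borel_measurable (F (s n) \<Otimes>\<^sub>M borel)"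
          using rm by measurable
        from nn_integral_increment[OF st this] show ?thesis by (simp add: h_def)
      qed
      also have "\<dots> = (\<integral>\<^sup>+x. J (Suc n) x \<partial>M)" by (simp add: JS)
      finally show ?case .
    qed
    show "ennreal (1 - C * (\<Sum>i<m. (s (Suc i) - s i)\<^sup>2)) \<le>
       (\<integral>\<^sup>+x. ennreal (sqrt (G (incr s m x) / lev s m G 0 (\<lambda>_. 0) * step_exp W m s (log_deriv_step s m G D) x)) \<partial>M)"
      using main[of m] by (simp add: J_def L_def l0_def step_exp_eq[OF g] \<xi>_def)
  qed
qed

lemma integral_abs_increment:
  assumes st: "0 \<le> s" "s < t" "t \<le> 1"
  shows "integrable M (\<lambda>x. \<bar>W t x - W s x\<bar>)" "(\<integral>x. \<bar>W t x - W s x\<bar> \<partial>M) \<le> sqrt (t - s)"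
proof -
  have [measurable]: "W t \<in> borel_measurable M" "W s \<in> borel_measurable M" using W_M st by auto
  have m: "(\<lambda>x. W t x - W s x) \<in> measurable M borel" by measurable
  have a: "(\<lambda>z::real. \<bar>z\<bar>) \<in> borel_measurable borel" by measurable
  have h: "0 < t - s" using st by simp
  show "integrable M (\<lambda>x. \<bar>W t x - W s x\<bar>)"
    using gauss_abs_moment(1)[OF h] integrable_distr_eq[OF m a] by (simp add: distr_increment[OF st])
  show "(\<integral>x. \<bar>W t x - W s x\<bar> \<partial>M) \<le> sqrt (t - s)"
    using gauss_abs_moment(2)[OF h] integral_distr[OF m a] by (simp add: distr_increment[OF st])
qed

text \<open>Freezing increment i at 0 yields a functional whose conditional expectation is one and
  the same variable \<open>Z\<close> throughout the interval, because given
  \<open>F (s (Suc i))\<close> it only involves the increments before i. Freezing costs K sqrt h in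
  L^1, once at t and once at \<open>s i\<close>, hence the factor 2.\<close>

lemma cond_exp_time_regularity:
  assumes g: "time_grid m s" and G: "bounded_meas a b G" and i: "i < m"
    and Lip: "lipschitz_at i K G" and K: "0 \<le> K" and t: "s i \<le> t" "t \<le> s (Suc i)"
  shows "(\<integral>x. \<bar>real_cond_exp M (F t) (\<lambda>x. G (incr s m x)) x - lev s m G i (incr s i x)\<bar> \<partial>M) \<le> 2 * K * sqrt (s (Suc i) - s i)"
    and "integrable M (\<lambda>x. real_cond_exp M (F t) (\<lambda>x. G (incr s m x)) x - lev s m G i (incr s i x))"
proof -
  have st: "0 \<le> s i" "s i < s (Suc i)" "s (Suc i) \<le> 1"
    using time_grid_range[OF g, of i] time_grid_range[OF g, of "Suc i"] g i by (auto simp: time_grid_def)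
  define X where "X = (\<lambda>x. G (incr s m x))"
  define G' where "G' = (\<lambda>y. G (y(i := 0)))"
  define X' where "X' = (\<lambda>x. G' (incr s m x))"
  have G': "bounded_meas a b G'"
  proof -
    have [measurable]: "G \<in> borel_measurable seq_borel" using G by (simp add: bounded_meas_def)
    have "G' \<in> borel_measurable seq_borel" unfolding G'_def by measurable
    then show ?thesis using G by (auto simp: bounded_meas_def G'_def)
  qed
  define Z where "Z = (\<lambda>x. lev s m G (Suc i) (incr s i x))"
  have Zeq: "lev s m G' (Suc i) (incr s (Suc i) x) = Z x" for x
  proof -
    have "lev s m G' (Suc i) = (\<lambda>y. lev s m G (Suc i) (y(i := 0)))"
      unfolding G'_def by (rule lev_upd_zero) (use i in auto)
    then show ?thesis by (simp add: Z_def incr_Suc)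
  qed
  have si: "Suc i \<le> m" "i \<le> m" using i by auto
  have iX: "integrable M X" "integrable M X'"
    using cond_exp_lev(2)[OF g G order_refl] cond_exp_lev(2)[OF g G' order_refl] by (auto simp: X_def X'_def)
  have cZ: "AE x in M. real_cond_exp M (F (s (Suc i))) X' x = Z x"
    using cond_exp_lev(1)[OF g G' si(1)] by (simp add: Zeq X'_def)
  have iZ: "integrable M Z" using cond_exp_lev(2)[OF g G' si(1)] by (simp add: Zeq)
  have Zm: "Z \<in> borel_measurable (F (s i))"
    unfolding Z_def by (rule measurable_compose[OF incr_measurable[OF g si(2)]])
      (use lev_bounded_meas[OF g G si(1)] in \<open>simp add: bounded_meas_def\<close>)
  have cr: "AE x in M. real_cond_exp M (F r) X' x = Z x" if r: "s i \<le> r" "r \<le> s (Suc i)" for r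
  proof -
    have r01: "r \<in> {0..1}" using r st by auto
    interpret R: finite_measure_subalgebra M "F r" by unfold_locales (rule subalg_F[OF r01])
    have "AE x in M. real_cond_exp M (F r) (real_cond_exp M (F (s (Suc i))) X') x = real_cond_exp M (F r) X' x"
      by (rule R.real_cond_exp_nested_subalg) (use iX subalg_F[of "s (Suc i)"] st F_mono[OF r(2)] in \<open>auto simp: subalgebra_def\<close>)
    moreover have "AE x in M. real_cond_exp M (F r) (real_cond_exp M (F (s (Suc i))) X') x = real_cond_exp M (F r) Z x"
      by (rule R.real_cond_exp_cong[OF cZ]) (use iZ in auto)
    moreover have "AE x in M. real_cond_exp M (F r) Z x = Z x"
      by (rule R.real_cond_exp_F_meas[OF iZ measurable_F_mono[OF Zm r(1)]])
    ultimately show ?thesis by eventually_elim simp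
  qed
  have XX: "(\<integral>x. \<bar>X x - X' x\<bar> \<partial>M) \<le> K * sqrt (s (Suc i) - s i)"
  proof -
    have "(\<integral>x. \<bar>X x - X' x\<bar> \<partial>M) \<le> (\<integral>x. K * \<bar>W (s (Suc i)) x - W (s i) x\<bar> \<partial>M)"
    proof (rule integral_mono)
      show "integrable M (\<lambda>x. K * \<bar>W (s (Suc i)) x - W (s i) x\<bar>)"
        using integral_abs_increment(1)[OF st] by simp
      fix x
      have "\<bar>G ((incr s m x)(i := incr s m x i)) - G ((incr s m x)(i := 0))\<bar> \<le> K * \<bar>incr s m x i\<bar>"
        using Lip unfolding lipschitz_at_def by blast
      moreover have "incr s m x i = W (s (Suc i)) x - W (s i) x" using i by (simp add: incr_def)
      ultimately show "\<bar>X x - X' x\<bar> \<le> K * \<bar>W (s (Suc i)) x - W (s i) x\<bar>"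
        by (simp add: X_def X'_def G'_def fun_upd_idem)
    qed (use iX in auto)
    also have "\<dots> \<le> K * sqrt (s (Suc i) - s i)"
      using integral_abs_increment(2)[OF st] K by (simp add: mult_left_mono)
    finally show ?thesis .
  qed
  have near: "(\<integral>x. \<bar>real_cond_exp M (F r) X x - Z x\<bar> \<partial>M) \<le> K * sqrt (s (Suc i) - s i)"
    "integrable M (real_cond_exp M (F r) X)" if r: "s i \<le> r" "r \<le> s (Suc i)" for r
  proof -
    have r01: "r \<in> {0..1}" using r st by auto
    interpret R: finite_measure_subalgebra M "F r" by unfold_locales (rule subalg_F[OF r01])
    show "integrable M (real_cond_exp M (F r) X)" by (rule R.real_cond_exp_int(1)[OF iX(1)])
    have "AE x in M. real_cond_exp M (F r) (\<lambda>x. X x - X' x) x = real_cond_exp M (F r) X x - real_cond_exp M (F r) X' x"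
      by (rule R.real_cond_exp_diff[OF iX])
    with cr[OF r] have "AE x in M. \<bar>real_cond_exp M (F r) X x - Z x\<bar> = \<bar>real_cond_exp M (F r) (\<lambda>x. X x - X' x) x\<bar>"
      by eventually_elim simp
    then have "(\<integral>x. \<bar>real_cond_exp M (F r) X x - Z x\<bar> \<partial>M) = (\<integral>x. \<bar>real_cond_exp M (F r) (\<lambda>x. X x - X' x) x\<bar> \<partial>M)"
      using R.real_cond_exp_int(1)[OF iX(1)] iZ R.real_cond_exp_int(1)[OF Bochner_Integration.integrable_diff[OF iX]]
      by (intro integral_cong_AE) auto
    also have "\<dots> \<le> (\<integral>x. \<bar>X x - X' x\<bar> \<partial>M)"
      by (rule R.real_cond_exp_L1_contraction) (use iX in auto)
    finally show "(\<integral>x. \<bar>real_cond_exp M (F r) X x - Z x\<bar> \<partial>M) \<le> K * sqrt (s (Suc i) - s i)" using XX by simp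
  qed
  let ?l = "\<lambda>x. lev s m G i (incr s i x)"
  have il: "integrable M ?l" by (rule cond_exp_lev(2)[OF g G si(2)])
  have lZ: "(\<integral>x. \<bar>?l x - Z x\<bar> \<partial>M) \<le> K * sqrt (s (Suc i) - s i)"
  proof -
    have "(\<integral>x. \<bar>?l x - Z x\<bar> \<partial>M) = (\<integral>x. \<bar>real_cond_exp M (F (s i)) X x - Z x\<bar> \<partial>M)"
    proof (rule integral_cong_AE)
      show "AE x in M. \<bar>?l x - Z x\<bar> = \<bar>real_cond_exp M (F (s i)) X x - Z x\<bar>"
        using cond_exp_lev(1)[OF g G si(2)] by eventually_elim (simp add: X_def)
    qed (use il iZ near(2)[of "s i"] st in auto)
    then show ?thesis using near(1)[of "s i"] st by simp
  qed
  note iE = near(2)[OF t]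
  have "(\<integral>x. \<bar>real_cond_exp M (F t) X x - ?l x\<bar> \<partial>M) \<le> (\<integral>x. \<bar>real_cond_exp M (F t) X x - Z x\<bar> + \<bar>?l x - Z x\<bar> \<partial>M)"
    using iE il iZ by (intro integral_mono) auto
  also have "\<dots> = (\<integral>x. \<bar>real_cond_exp M (F t) X x - Z x\<bar> \<partial>M) + (\<integral>x. \<bar>?l x - Z x\<bar> \<partial>M)"
    using iE il iZ by simp
  also have "\<dots> \<le> 2 * K * sqrt (s (Suc i) - s i)" using near(1)[OF t] lZ by simp
  finally show "(\<integral>x. \<bar>real_cond_exp M (F t) (\<lambda>x. G (incr s m x)) x - ?l x\<bar> \<partial>M) \<le> 2 * K * sqrt (s (Suc i) - s i)"
    by (simp add: X_def)
  show "integrable M (\<lambda>x. real_cond_exp M (F t) (\<lambda>x. G (incr s m x)) x - ?l x)"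
    using iE il by (simp add: X_def)
qed

end

section \<open>Cylindrical functions\<close>

definition recip :: "real \<Rightarrow> real \<Rightarrow> real" where
  "recip \<kappa> r = 1 / (exp r + \<kappa>)"

definition recip' :: "real \<Rightarrow> real \<Rightarrow> real" where
  "recip' \<kappa> r = - exp r / (exp r + \<kappa>)\<^sup>2"

lemma recip_bounds:
  assumes \<kappa>: "\<kappa> > 0"
  shows "0 < recip \<kappa> r" "recip \<kappa> r \<le> 1 / \<kappa>" "recip \<kappa> r \<le> exp (- r)"
    "recip' \<kappa> r \<le> 0" "\<bar>recip' \<kappa> r\<bar> \<le> recip \<kappa> r" "\<bar>recip' \<kappa> r\<bar> \<le> 1 / \<kappa>"
proof -
  have pos: "0 < exp r + \<kappa>" using \<kappa> by (simp add: add_pos_pos)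
  show "0 < recip \<kappa> r" using pos by (simp add: recip_def)
  show 1: "recip \<kappa> r \<le> 1 / \<kappa>" unfolding recip_def using \<kappa> by (intro frac_le) auto
  show "recip \<kappa> r \<le> exp (- r)" unfolding recip_def exp_minus inverse_eq_divide using \<kappa> by (intro frac_le) auto
  show "recip' \<kappa> r \<le> 0" by (simp add: recip'_def)
  have "\<bar>recip' \<kappa> r\<bar> = exp r / (exp r + \<kappa>) * recip \<kappa> r"
    using pos by (simp add: recip'_def recip_def power2_eq_square)
  also have "\<dots> \<le> 1 * recip \<kappa> r"
    using pos \<kappa> \<open>0 < recip \<kappa> r\<close> by (intro mult_right_mono) auto
  finally show 2: "\<bar>recip' \<kappa> r\<bar> \<le> recip \<kappa> r" by simp
  show "\<bar>recip' \<kappa> r\<bar> \<le> 1 / \<kappa>" using 1 2 by linarith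
qed

lemma recip_deriv:
  assumes \<kappa>: "\<kappa> > 0"
  shows "(recip \<kappa> has_real_derivative recip' \<kappa> r) (at r)"
proof -
  have pos: "exp r + \<kappa> \<noteq> 0" using \<kappa> by (smt (verit) exp_gt_zero)
  have "((\<lambda>r. 1 / (exp r + \<kappa>)) has_real_derivative recip' \<kappa> r) (at r)"
    by (auto intro!: derivative_eq_intros simp: pos recip'_def power2_eq_square)
  then show ?thesis unfolding recip_def[abs_def] .
qed

text \<open>With p = exp r / (exp r + \<kappa>), which lies in [0, 1], the second derivative is (2
  p^2 - p) / (exp r + \<kappa>); the crude bound 2 + 1 gives the 3.\<close>

lemma recip'_deriv:
  assumes \<kappa>: "\<kappa> > 0"
  obtains d where "(recip' \<kappa> has_real_derivative d) (at r)" "\<bar>d\<bar> \<le> 3 / \<kappa>"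
proof -
  have pos: "exp r + \<kappa> > 0" using \<kappa> by (simp add: add_pos_pos)
  define E where "E = exp r"
  have E: "E > 0" "E + \<kappa> > 0" using pos by (auto simp: E_def)
  define d where "d = - E / (E + \<kappa>)\<^sup>2 + 2 * E\<^sup>2 / (E + \<kappa>) ^ 3"
  have "((\<lambda>r. - exp r / (exp r + \<kappa>)\<^sup>2) has_real_derivative d) (at r)"
  proof -
    define P where "P = E + \<kappa>"
    have P: "P \<noteq> 0" using E by (simp add: P_def)
    have "((\<lambda>r. - exp r / (exp r + \<kappa>)\<^sup>2) has_real_derivative ((- E) * P\<^sup>2 - (- E) * (2 * P * E)) / (P\<^sup>2 * P\<^sup>2)) (at r)"
      using P unfolding E_def P_def
      by (auto intro!: derivative_eq_intros) (simp only: minus_divide_left, simp add: algebra_simps)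
    moreover have "((- E) * P\<^sup>2 - (- E) * (2 * P * E)) / (P\<^sup>2 * P\<^sup>2) = d"
      using P unfolding d_def P_def[symmetric] by (simp add: field_simps power2_eq_square power3_eq_cube)
    ultimately show ?thesis by simp
  qed
  then have "(recip' \<kappa> has_real_derivative d) (at r)" unfolding recip'_def[abs_def] .
  moreover have "\<bar>d\<bar> \<le> 3 / \<kappa>"
  proof -
    have q: "0 \<le> E / (E + \<kappa>)" "E / (E + \<kappa>) \<le> 1" using E \<kappa> by auto
    have r: "0 \<le> 1 / (E + \<kappa>)" "1 / (E + \<kappa>) \<le> 1 / \<kappa>" using E \<kappa> by (auto intro!: frac_le)
    have "d = - (E / (E + \<kappa>)) * (1 / (E + \<kappa>)) + 2 * ((E / (E + \<kappa>)) * (E / (E + \<kappa>)) * (1 / (E + \<kappa>)))"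
      unfolding d_def by (simp add: power2_eq_square power3_eq_cube)
    also have "\<bar>\<dots>\<bar> \<le> \<bar>(E / (E + \<kappa>)) * (1 / (E + \<kappa>))\<bar> + 2 * \<bar>(E / (E + \<kappa>)) * (E / (E + \<kappa>)) * (1 / (E + \<kappa>))\<bar>"
      by linarith
    also have "\<dots> \<le> 1 / \<kappa> + 2 * (1 / \<kappa>)"
    proof -
      have a: "(E / (E + \<kappa>)) * (1 / (E + \<kappa>)) \<le> 1 * (1 / \<kappa>)" by (intro mult_mono q r) auto
      have b: "(E / (E + \<kappa>)) * (E / (E + \<kappa>)) * (1 / (E + \<kappa>)) \<le> 1 * 1 * (1 / \<kappa>)"
        by (intro mult_mono q r) (use q in auto)
      have h: "0 \<le> (E / (E + \<kappa>)) * (1 / (E + \<kappa>))" "0 \<le> (E / (E + \<kappa>)) * (E / (E + \<kappa>)) * (1 / (E + \<kappa>))"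
        by (intro mult_nonneg_nonneg q r)+
      show ?thesis unfolding abs_of_nonneg[OF h(1)] abs_of_nonneg[OF h(2)]
        by (intro add_mono mult_left_mono) (use a b in auto)
    qed
    finally show ?thesis by simp
  qed
  ultimately show ?thesis by (rule that)
qed

lemma lipschitz_of_deriv_bound:
  fixes f :: "real \<Rightarrow> real"
  assumes "\<And>r. \<exists>d. (f has_real_derivative d) (at r) \<and> \<bar>d\<bar> \<le> B"
  shows "\<bar>f a - f b\<bar> \<le> B * \<bar>a - b\<bar>"
proof -
  obtain f' where f': "\<And>r. (f has_real_derivative f' r) (at r)" "\<And>r. \<bar>f' r\<bar> \<le> B" using assms by metis
  have "norm (f a - f b) \<le> B * norm (a - b)"
    by (rule field_differentiable_bound[where S=UNIV and f'=f']) (use f' in auto)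
  then show ?thesis by simp
qed

lemma recip_lipschitz: "\<kappa> > 0 \<Longrightarrow> \<bar>recip \<kappa> a - recip \<kappa> b\<bar> \<le> 1 / \<kappa> * \<bar>a - b\<bar>"
  by (rule lipschitz_of_deriv_bound) (use recip_deriv recip_bounds(6) in blast)

lemma recip'_lipschitz: "\<kappa> > 0 \<Longrightarrow> \<bar>recip' \<kappa> a - recip' \<kappa> b\<bar> \<le> 3 / \<kappa> * \<bar>a - b\<bar>"
  by (rule lipschitz_of_deriv_bound) (use recip'_deriv in blast)

lemma recip_taylor:
  assumes \<kappa>: "\<kappa> > 0"
  shows "\<bar>recip \<kappa> b - recip \<kappa> a - recip' \<kappa> a * (b - a)\<bar> \<le> 3 / \<kappa> * (b - a)\<^sup>2"
proof -
  let ?S = "closed_segment a b"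
  have "norm ((recip \<kappa> b - recip' \<kappa> a * b) - (recip \<kappa> a - recip' \<kappa> a * a)) \<le> (3 / \<kappa> * \<bar>b - a\<bar>) * norm (b - a)"
  proof (rule field_differentiable_bound[where S="?S" and f'="\<lambda>r. recip' \<kappa> r - recip' \<kappa> a"])
    fix r assume r: "r \<in> ?S"
    show "((\<lambda>r. recip \<kappa> r - recip' \<kappa> a * r) has_real_derivative recip' \<kappa> r - recip' \<kappa> a) (at r within ?S)"
      by (rule has_field_derivative_at_within) (auto intro!: derivative_eq_intros recip_deriv[OF \<kappa>])
    have "\<bar>recip' \<kappa> r - recip' \<kappa> a\<bar> \<le> 3 / \<kappa> * \<bar>r - a\<bar>" by (rule recip'_lipschitz[OF \<kappa>])
    also have "\<dots> \<le> 3 / \<kappa> * \<bar>b - a\<bar>"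
      using r \<kappa> by (intro mult_left_mono) (auto simp: closed_segment_eq_real_ivl split: if_splits)
    finally show "norm (recip' \<kappa> r - recip' \<kappa> a) \<le> 3 / \<kappa> * \<bar>b - a\<bar>" by simp
  qed auto
  also have "(3 / \<kappa> * \<bar>b - a\<bar>) * norm (b - a) = 3 / \<kappa> * (b - a)\<^sup>2"
    by (simp add: power2_eq_square abs_mult_self_eq mult.assoc)
  also have "(recip \<kappa> b - recip' \<kappa> a * b) - (recip \<kappa> a - recip' \<kappa> a * a) = recip \<kappa> b - recip \<kappa> a - recip' \<kappa> a * (b - a)"
    by (simp add: algebra_simps)
  finally show ?thesis by simp
qed

lemma recip_tendsto:
  "(\<lambda>k. recip (1 / real (Suc k)) r) \<longlonglongrightarrow> exp (- r)" "(\<lambda>k. recip' (1 / real (Suc k)) r) \<longlonglongrightarrow> - exp (- r)"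
proof -
  have z: "(\<lambda>k. 1 / real (Suc k)) \<longlonglongrightarrow> 0" using LIMSEQ_inverse_real_of_nat by (simp add: inverse_eq_divide)
  have "(\<lambda>k. recip (1 / real (Suc k)) r) \<longlonglongrightarrow> 1 / (exp r + 0)"
    unfolding recip_def by (intro tendsto_intros z) simp
  then show "(\<lambda>k. recip (1 / real (Suc k)) r) \<longlonglongrightarrow> exp (- r)" by (simp add: exp_minus inverse_eq_divide)
  have "(\<lambda>k. recip' (1 / real (Suc k)) r) \<longlonglongrightarrow> - exp r / (exp r + 0)\<^sup>2"
    unfolding recip'_def by (intro tendsto_intros z) simp
  then show "(\<lambda>k. recip' (1 / real (Suc k)) r) \<longlonglongrightarrow> - exp (- r)"
    by (simp add: exp_minus inverse_eq_divide power2_eq_square)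
qed

text \<open>The monotonicity on which conditional monotone convergence will rest, for numerator and
  denominator alike.\<close>

lemma recip_mono:
  assumes "0 < \<kappa>" "\<kappa> \<le> \<kappa>'"
  shows "recip \<kappa>' r \<le> recip \<kappa> r" "- recip' \<kappa>' r \<le> - recip' \<kappa> r"
proof -
  have pos: "0 < exp r + \<kappa>" using assms by (simp add: add_pos_pos)
  then show "recip \<kappa>' r \<le> recip \<kappa> r" unfolding recip_def using assms by (intro frac_le) auto
  have "(exp r + \<kappa>)\<^sup>2 \<le> (exp r + \<kappa>')\<^sup>2" using pos assms by (intro power_mono) auto
  then show "- recip' \<kappa>' r \<le> - recip' \<kappa> r" unfolding recip'_def using pos by (simp add: frac_le)
qed

section \<open>First and second order estimates for smooth functions of n variables\<close>

context
  fixes n :: nat and q :: "nat list \<Rightarrow> (nat \<Rightarrow> real) \<Rightarrow> real"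
  assumes q: "smooth_bounded n q"
begin

lemma smooth_bounded_const:
  obtains C where "1 \<le> C" "\<And>\<alpha> y. \<alpha> \<in> lists {..<n} \<Longrightarrow> length \<alpha> \<le> 2 \<Longrightarrow> \<bar>q \<alpha> y\<bar> \<le> C"
proof -
  define A where "A = {\<alpha>. set \<alpha> \<subseteq> {..<n} \<and> length \<alpha> \<le> 2}"
  have fin: "finite A" unfolding A_def by (rule finite_lists_length_le) simp
  have "\<forall>\<alpha>\<in>A. \<exists>C. \<forall>y. \<bar>q \<alpha> y\<bar> \<le> C" using q by (auto simp: smooth_bounded_def A_def lists_eq_set)
  from bchoice[OF this] obtain c where c: "\<forall>\<alpha>\<in>A. \<forall>y. \<bar>q \<alpha> y\<bar> \<le> c \<alpha>" ..
  have c0: "0 \<le> c \<alpha>" if "\<alpha> \<in> A" for \<alpha> using c that by (meson abs_ge_zero order_trans)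
  show ?thesis
  proof (rule that[of "1 + sum c A"])
    show "1 \<le> 1 + sum c A" using c0 by (simp add: sum_nonneg)
    fix \<alpha> :: "nat list" and y assume "\<alpha> \<in> lists {..<n}" "length \<alpha> \<le> 2"
    then have a: "\<alpha> \<in> A" by (auto simp: A_def lists_eq_set)
    have "\<bar>q \<alpha> y\<bar> \<le> c \<alpha>" using c a by blast
    also have "\<dots> \<le> sum c A" by (rule member_le_sum[OF a]) (use c0 fin in auto)
    finally show "\<bar>q \<alpha> y\<bar> \<le> 1 + sum c A" by simp
  qed
qed

lemma smooth_cong: "\<alpha> \<in> lists {..<n} \<Longrightarrow> (\<And>i. i < n \<Longrightarrow> y i = z i) \<Longrightarrow> q \<alpha> y = q \<alpha> z"
  using q by (auto simp: smooth_bounded_def)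

lemma smooth_deriv:
  assumes "\<alpha> \<in> lists {..<n}" "i < n"
  shows "((\<lambda>r. q \<alpha> (y(i := r))) has_real_derivative q (i # \<alpha>) (y(i := r))) (at r)"
  using q[unfolded smooth_bounded_def, rule_format, OF assms(1)] assms(2)
  by (elim conjE allE[of _ "y(i := r)"]) auto

context
  fixes C :: real
  assumes C: "1 \<le> C" "\<And>\<alpha> y. \<alpha> \<in> lists {..<n} \<Longrightarrow> length \<alpha> \<le> 2 \<Longrightarrow> \<bar>q \<alpha> y\<bar> \<le> C"
begin

lemma smooth_lipschitz:
  assumes \<alpha>: "\<alpha> \<in> lists {..<n}" "length \<alpha> \<le> 1"
  shows "\<bar>q \<alpha> z - q \<alpha> y\<bar> \<le> C * (\<Sum>i<n. \<bar>z i - y i\<bar>)"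
proof -
  \<comment> \<open>Hybrid points: the passage from \<open>w k\<close> to \<open>w (Suc k)\<close>
    moves coordinate k alone, from \<open>y k\<close> to \<open>z k\<close>.\<close>
  define w where "w = (\<lambda>k i. if i < k then z i else y i)"
  have step: "\<bar>q \<alpha> (w (Suc k)) - q \<alpha> (w k)\<bar> \<le> C * \<bar>z k - y k\<bar>" if "k < n" for k
  proof -
    have "w (Suc k) = (w k)(k := z k)" "w k = (w k)(k := y k)" by (auto simp: w_def fun_eq_iff less_Suc_eq)
    moreover have "\<bar>q \<alpha> ((w k)(k := z k)) - q \<alpha> ((w k)(k := y k))\<bar> \<le> C * \<bar>z k - y k\<bar>"
    proof (rule lipschitz_of_deriv_bound, intro exI conjI)
      fix r
      show "((\<lambda>r. q \<alpha> ((w k)(k := r))) has_real_derivative q (k # \<alpha>) ((w k)(k := r))) (at r)"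
        by (rule smooth_deriv[OF \<alpha>(1) that])
      show "\<bar>q (k # \<alpha>) ((w k)(k := r))\<bar> \<le> C" by (rule C(2)) (use \<alpha> that in auto)
    qed
    ultimately show ?thesis by simp
  qed
  have "\<bar>q \<alpha> (w k) - q \<alpha> (w 0)\<bar> \<le> C * (\<Sum>i<k. \<bar>z i - y i\<bar>)" if "k \<le> n" for k
    using that
  proof (induction k)
    case (Suc k)
    then show ?case using step[of k] by (simp add: distrib_left)
  qed simp
  from this[of n] show ?thesis
    using smooth_cong[OF \<alpha>(1), of "w n" z] by (simp add: w_def)
qed

lemma smooth_taylor:
  "\<bar>q [] z - q [] y - (\<Sum>i<n. q [i] y * (z i - y i))\<bar> \<le> C * (\<Sum>i<n. \<bar>z i - y i\<bar>)\<^sup>2"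
proof -
  define w where "w = (\<lambda>k i. if i < k then z i else y i)"
  define S where "S = (\<Sum>i<n. \<bar>z i - y i\<bar>)"
  have S0: "0 \<le> S" by (simp add: S_def sum_nonneg)
  \<comment> \<open>The mean value inequality for q minus its linear part in coordinate k: along the
    segment the partial derivative stays within C * S of its value at y, by
    \<open>smooth_lipschitz\<close>.\<close>
  have step: "\<bar>q [] (w (Suc k)) - q [] (w k) - q [k] y * (z k - y k)\<bar> \<le> C * S * \<bar>z k - y k\<bar>" if k: "k < n" for k
  proof -
    have w1: "w (Suc k) = (w k)(k := z k)" "w k = (w k)(k := y k)" by (auto simp: w_def fun_eq_iff less_Suc_eq)
    let ?S = "closed_segment (y k) (z k)"
    have "norm ((q [] ((w k)(k := z k)) - q [k] y * z k) - (q [] ((w k)(k := y k)) - q [k] y * y k))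
       \<le> (C * S) * norm (z k - y k)"
    proof (rule field_differentiable_bound[where S="?S" and f'="\<lambda>r. q [k] ((w k)(k := r)) - q [k] y"])
      fix r assume r: "r \<in> ?S"
      show "((\<lambda>r. q [] ((w k)(k := r)) - q [k] y * r) has_real_derivative q [k] ((w k)(k := r)) - q [k] y) (at r within ?S)"
        by (rule has_field_derivative_at_within) (auto intro!: derivative_eq_intros smooth_deriv k)
      have "\<bar>q [k] ((w k)(k := r)) - q [k] y\<bar> \<le> C * (\<Sum>i<n. \<bar>((w k)(k := r)) i - y i\<bar>)"
        by (rule smooth_lipschitz) (use k in auto)
      also have "\<dots> \<le> C * S"
        unfolding S_def using C(1) r
        by (intro mult_left_mono sum_mono) (auto simp: w_def closed_segment_eq_real_ivl split: if_splits)
      finally show "norm (q [k] ((w k)(k := r)) - q [k] y) \<le> C * S" by simp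
    qed auto
    then show ?thesis using w1 by (simp add: algebra_simps)
  qed
  have "\<bar>q [] (w k) - q [] (w 0) - (\<Sum>i<k. q [i] y * (z i - y i))\<bar> \<le> C * S * (\<Sum>i<k. \<bar>z i - y i\<bar>)" if "k \<le> n" for k
    using that
  proof (induction k)
    case (Suc k)
    then have "\<bar>q [] (w k) - q [] (w 0) - (\<Sum>i<k. q [i] y * (z i - y i))\<bar> \<le> C * S * (\<Sum>i<k. \<bar>z i - y i\<bar>)" by simp
    then show ?case using step[of k] Suc.prems by (simp add: distrib_left)
  qed simp
  from this[of n] show ?thesis
    using smooth_cong[of "[]" "w n" z] by (simp add: w_def S_def[symmetric] power2_eq_square mult.assoc)
qed

end

text \<open>The Lipschitz bound makes the function continuous for the product topology, whose Borel
  sets are those of \<open>seq_borel\<close>.\<close>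

lemma smooth_measurable:
  assumes \<alpha>: "\<alpha> \<in> lists {..<n}" "length \<alpha> \<le> 1"
  shows "q \<alpha> \<in> borel_measurable seq_borel"
proof -
  obtain C where C: "1 \<le> C" "\<And>\<alpha> y. \<alpha> \<in> lists {..<n} \<Longrightarrow> length \<alpha> \<le> 2 \<Longrightarrow> \<bar>q \<alpha> y\<bar> \<le> C"
    using smooth_bounded_const by blast
  have "isCont (q \<alpha>) y" for y
    unfolding isCont_def
  proof (rule LIM_zero_cancel, rule Lim_null_comparison[rotated])
    have "((\<lambda>z. C * (\<Sum>i<n. \<bar>z i - y i\<bar>)) \<longlongrightarrow> C * (\<Sum>i<n. \<bar>y i - y i\<bar>)) (at y)"
    proof (intro tendsto_mult tendsto_const tendsto_sum tendsto_rabs tendsto_diff)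
      fix i
      have "continuous_on UNIV (\<lambda>z::nat \<Rightarrow> real. z i)" by (rule continuous_on_product_coordinates)
      then show "((\<lambda>z. z i) \<longlongrightarrow> y i) (at y)" by (simp add: continuous_on_def)
    qed
    then show "((\<lambda>z. C * (\<Sum>i<n. \<bar>z i - y i\<bar>)) \<longlongrightarrow> 0) (at y)" by simp
    show "\<forall>\<^sub>F z in at y. norm (q \<alpha> z - q \<alpha> y) \<le> C * (\<Sum>i<n. \<bar>z i - y i\<bar>)"
      using smooth_lipschitz[OF C \<alpha>] by simp
  qed
  then have "continuous_on UNIV (q \<alpha>)" by (simp add: continuous_at_imp_continuous_on)
  then have "q \<alpha> \<in> borel_measurable borel" by (rule borel_measurable_continuous_onI)
  then show ?thesis using measurable_cong_sets[OF sets_PiM_equal_borel refl] by blast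
qed

end

text \<open>\<open>cyl_point idx y\<close> is the vector of values, at the grid points with index \<open>idx j\<close>, of the path
  with increments \<open>y\<close> along the grid.\<close>

definition cyl_point :: "(nat \<Rightarrow> nat) \<Rightarrow> (nat \<Rightarrow> real) \<Rightarrow> nat \<Rightarrow> real" where
  "cyl_point idx y j = (\<Sum>l<idx j. y l)"

definition cyl_fun :: "real \<Rightarrow> (nat list \<Rightarrow> (nat \<Rightarrow> real) \<Rightarrow> real) \<Rightarrow> (nat \<Rightarrow> nat) \<Rightarrow> (nat \<Rightarrow> real) \<Rightarrow> real" where
  "cyl_fun \<kappa> q idx y = recip \<kappa> (q [] (cyl_point idx y))"

definition cyl_deriv ::
    "real \<Rightarrow> nat \<Rightarrow> (nat list \<Rightarrow> (nat \<Rightarrow> real) \<Rightarrow> real) \<Rightarrow> (nat \<Rightarrow> nat) \<Rightarrow> nat \<Rightarrow> (nat \<Rightarrow> real) \<Rightarrow> real" where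
  "cyl_deriv \<kappa> n q idx i y = recip' \<kappa> (q [] (cyl_point idx y)) *
     (\<Sum>j<n. if i < idx j then q [j] (cyl_point idx y) else 0)"

lemma cyl_point_upd: "cyl_point idx (y(i := z)) j - cyl_point idx (y(i := 0)) j = (if i < idx j then z else 0)"
proof -
  have "cyl_point idx (y(i := z)) j - cyl_point idx (y(i := 0)) j = (\<Sum>l<idx j. if l = i then z else 0)"
    unfolding cyl_point_def sum_subtractf[symmetric] by (rule sum.cong) auto
  then show ?thesis by (simp add: sum.delta)
qed

lemma cyl_point_measurable [measurable]: "cyl_point idx \<in> measurable seq_borel seq_borel"
proof (rule measurable_PiM_single')
  fix j
  show "(\<lambda>y. cyl_point idx y j) \<in> borel_measurable seq_borel"
    unfolding cyl_point_def by (intro borel_measurable_sum measurable_component_singleton) simp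
qed (auto simp: space_PiM)

lemma recip_measurable [measurable]: "recip \<kappa> \<in> borel_measurable borel" "recip' \<kappa> \<in> borel_measurable borel"
  unfolding recip_def[abs_def] recip'_def[abs_def] by measurable

text \<open>The index map depends on the grid, but \<open>a\<close> and \<open>K\<close> do not
  depend on it, so the mesh can be chosen after the constants.\<close>

lemma cyl_uniform:
  assumes q: "smooth_bounded n q" and \<kappa>: "\<kappa> > 0"
  obtains a K where "0 < a" "a \<le> 1" "1 \<le> K"
    "\<And>idx i. bounded_meas a K (cyl_fun \<kappa> q idx) \<and> lipschitz_at i K (cyl_fun \<kappa> q idx) \<and>
       bounded_meas (- K) K (cyl_deriv \<kappa> n q idx i) \<and> taylor_at i K (cyl_fun \<kappa> q idx) (cyl_deriv \<kappa> n q idx i) \<and>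
       lipschitz_at i K (cyl_deriv \<kappa> n q idx i)"
proof -
  obtain C where C: "1 \<le> C" "\<And>\<alpha> y. \<alpha> \<in> lists {..<n} \<Longrightarrow> length \<alpha> \<le> 2 \<Longrightarrow> \<bar>q \<alpha> y\<bar> \<le> C"
    using smooth_bounded_const[OF q] by blast
  define N where "N = real n"
  have N0: "0 \<le> N" by (simp add: N_def)
  define a where "a = min 1 (1 / (exp C + \<kappa>))"
  \<comment> \<open>\<open>K1\<close> bounds the first derivative, \<open>K2\<close> the Taylor
    remainder, from the curvature of \<open>recip\<close> and of q, and \<open>K3\<close> the
    Lipschitz constant of the derivative.\<close>
  define K1 where "K1 = 1 / \<kappa> * C * N"
  define K2 where "K2 = 3 / \<kappa> * (C * N)\<^sup>2 + 1 / \<kappa> * (C * N\<^sup>2)"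
  define K3 where "K3 = N * (3 / \<kappa> * (C * N) * C + 1 / \<kappa> * (C * N))"
  define K where "K = 1 + 1 / \<kappa> + K1 + K2 + K3"
  have nn: "0 \<le> 1 / \<kappa>" "0 \<le> K1" "0 \<le> K2" "0 \<le> K3"
    using \<kappa> C N0 by (auto simp: K1_def K2_def K3_def)
  have KK: "1 / \<kappa> \<le> K" "K1 \<le> K" "K2 \<le> K" "K3 \<le> K" "1 \<le> K" using nn by (auto simp: K_def)
  have apos: "0 < a" "a \<le> 1" using \<kappa> by (auto simp: a_def add_pos_pos)
  have qm: "q [] \<in> borel_measurable seq_borel" "j < n \<Longrightarrow> q [j] \<in> borel_measurable seq_borel" for j
    using smooth_measurable[OF q, of "[]"] smooth_measurable[OF q, of "[j]"] by auto
  have qb: "\<bar>q [] y\<bar> \<le> C" "j < n \<Longrightarrow> \<bar>q [j] y\<bar> \<le> C" for j y using C(2)[of "[]" y] C(2)[of "[j]" y] by auto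
  have props: "bounded_meas a K (cyl_fun \<kappa> q idx)" "lipschitz_at i K (cyl_fun \<kappa> q idx)"
    "bounded_meas (- K) K (cyl_deriv \<kappa> n q idx i)" "taylor_at i K (cyl_fun \<kappa> q idx) (cyl_deriv \<kappa> n q idx i)"
    "lipschitz_at i K (cyl_deriv \<kappa> n q idx i)" for idx i
  proof -
    note [measurable] = qm(1)
    have [measurable]: "(\<lambda>y. q [] (cyl_point idx y)) \<in> borel_measurable seq_borel" by measurable
    have sumD: "\<bar>\<Sum>j<n. if i < idx j then q [j] w else 0\<bar> \<le> N * C" for w
    proof -
      have "\<bar>\<Sum>j<n. if i < idx j then q [j] w else 0\<bar> \<le> (\<Sum>j<n. \<bar>if i < idx j then q [j] w else 0\<bar>)" by (rule sum_abs)
      also have "\<dots> \<le> (\<Sum>j<n. C)" using qb(2) C(1) by (intro sum_mono) auto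
      finally show ?thesis by (simp add: N_def)
    qed
    show "bounded_meas a K (cyl_fun \<kappa> q idx)"
      unfolding bounded_meas_def
    proof (intro conjI allI)
      show "cyl_fun \<kappa> q idx \<in> borel_measurable seq_borel" unfolding cyl_fun_def[abs_def] by measurable
      fix y
      let ?r = "q [] (cyl_point idx y)"
      have "recip \<kappa> ?r \<le> 1 / \<kappa>" by (rule recip_bounds(2)[OF \<kappa>])
      then show "cyl_fun \<kappa> q idx y \<le> K" using KK by (simp add: cyl_fun_def)
      have "exp ?r \<le> exp C" using qb(1)[of "cyl_point idx y"] by simp
      then have "1 / (exp C + \<kappa>) \<le> recip \<kappa> ?r" unfolding recip_def using \<kappa> by (intro frac_le) (auto simp: add_pos_pos)
      then show "a \<le> cyl_fun \<kappa> q idx y" by (simp add: cyl_fun_def a_def)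
    qed
    show "bounded_meas (- K) K (cyl_deriv \<kappa> n q idx i)"
      unfolding bounded_meas_def
    proof (intro conjI allI)
      have "(\<lambda>y. if i < idx j then q [j] (cyl_point idx y) else 0) \<in> borel_measurable seq_borel" if "j < n" for j
        using qm(2)[OF that] by (cases "i < idx j") auto
      then have [measurable]: "(\<lambda>y. \<Sum>j<n. if i < idx j then q [j] (cyl_point idx y) else 0) \<in> borel_measurable seq_borel"
        by (intro borel_measurable_sum) auto
      show "cyl_deriv \<kappa> n q idx i \<in> borel_measurable seq_borel" unfolding cyl_deriv_def[abs_def] by measurable
      fix y
      have "\<bar>cyl_deriv \<kappa> n q idx i y\<bar> \<le> 1 / \<kappa> * (N * C)"
        unfolding cyl_deriv_def abs_mult using recip_bounds(6)[OF \<kappa>] sumD \<kappa> by (intro mult_mono) auto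
      also have "\<dots> \<le> K" using KK(2) by (simp add: K1_def mult_ac)
      finally show "- K \<le> cyl_deriv \<kappa> n q idx i y" "cyl_deriv \<kappa> n q idx i y \<le> K" by linarith+
    qed
    have est: "\<bar>q [] w' - q [] w\<bar> \<le> C * N * \<bar>z\<bar>"
        "j < n \<Longrightarrow> \<bar>q [j] w' - q [j] w\<bar> \<le> C * N * \<bar>z\<bar>"
        "\<bar>q [] w' - q [] w - (\<Sum>j<n. if i < idx j then q [j] w else 0) * z\<bar> \<le> C * N\<^sup>2 * z\<^sup>2"
      if w: "w' = cyl_point idx (y(i := z))" "w = cyl_point idx (y(i := 0))" for y z w w' j
    proof -
      have d: "w' j - w j = (if i < idx j then z else 0)" for j
        unfolding w by (rule cyl_point_upd)
      have S: "(\<Sum>j<n. \<bar>w' j - w j\<bar>) \<le> N * \<bar>z\<bar>"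
      proof -
        have "(\<Sum>j<n. \<bar>w' j - w j\<bar>) \<le> (\<Sum>j<n. \<bar>z\<bar>)" by (intro sum_mono) (simp add: d)
        then show ?thesis by (simp add: N_def)
      qed
      have S0: "0 \<le> (\<Sum>j<n. \<bar>w' j - w j\<bar>)" by (simp add: sum_nonneg)
      have CS: "C * (\<Sum>j<n. \<bar>w' j - w j\<bar>) \<le> C * N * \<bar>z\<bar>" using mult_left_mono[OF S, of C] C(1) by (simp add: mult.assoc)
      show "\<bar>q [] w' - q [] w\<bar> \<le> C * N * \<bar>z\<bar>" using smooth_lipschitz[OF q C, of "[]" w' w] CS by simp
      show "j < n \<Longrightarrow> \<bar>q [j] w' - q [j] w\<bar> \<le> C * N * \<bar>z\<bar>" using smooth_lipschitz[OF q C, of "[j]" w' w] CS by simp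
      have "(\<Sum>j<n. \<bar>w' j - w j\<bar>)\<^sup>2 \<le> (N * \<bar>z\<bar>)\<^sup>2" by (rule power_mono[OF S S0])
      then have "C * (\<Sum>j<n. \<bar>w' j - w j\<bar>)\<^sup>2 \<le> C * N\<^sup>2 * z\<^sup>2"
        using C(1) by (simp add: power_mult_distrib mult.assoc)
      moreover have "(\<Sum>j<n. q [j] w * (w' j - w j)) = (\<Sum>j<n. if i < idx j then q [j] w else 0) * z"
        unfolding d sum_distrib_right by (rule sum.cong) auto
      ultimately show "\<bar>q [] w' - q [] w - (\<Sum>j<n. if i < idx j then q [j] w else 0) * z\<bar> \<le> C * N\<^sup>2 * z\<^sup>2"
        using smooth_taylor[OF q C, of w' w] by simp
    qed
    show "lipschitz_at i K (cyl_fun \<kappa> q idx)"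
      unfolding lipschitz_at_def
    proof (intro allI)
      fix y z
      have "\<bar>cyl_fun \<kappa> q idx (y(i := z)) - cyl_fun \<kappa> q idx (y(i := 0))\<bar> \<le> 1 / \<kappa> * (C * N * \<bar>z\<bar>)"
        unfolding cyl_fun_def
        by (rule order_trans[OF recip_lipschitz[OF \<kappa>] mult_left_mono[OF est(1)]]) (use \<kappa> in auto)
      also have "\<dots> = K1 * \<bar>z\<bar>" by (simp add: K1_def)
      also have "\<dots> \<le> K * \<bar>z\<bar>" using KK(2) by (intro mult_right_mono) auto
      finally show "\<bar>cyl_fun \<kappa> q idx (y(i := z)) - cyl_fun \<kappa> q idx (y(i := 0))\<bar> \<le> K * \<bar>z\<bar>" .
    qed
    show "taylor_at i K (cyl_fun \<kappa> q idx) (cyl_deriv \<kappa> n q idx i)"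
      unfolding taylor_at_def
    proof (intro allI)
      fix y z
      define w' where "w' = cyl_point idx (y(i := z))"
      define w where "w = cyl_point idx (y(i := 0))"
      define A where "A = q [] w' - q [] w"
      define S where "S = (\<Sum>j<n. if i < idx j then q [j] w else 0)"
      note e = est[OF w'_def w_def, folded A_def S_def]
      have "\<bar>recip \<kappa> (q [] w') - recip \<kappa> (q [] w) - recip' \<kappa> (q [] w) * A\<bar> \<le> 3 / \<kappa> * A\<^sup>2"
        unfolding A_def by (rule recip_taylor[OF \<kappa>])
      also have "\<dots> \<le> 3 / \<kappa> * ((C * N)\<^sup>2 * z\<^sup>2)"
      proof (intro mult_left_mono)
        have "\<bar>A\<bar>\<^sup>2 \<le> (C * N * \<bar>z\<bar>)\<^sup>2" by (rule power_mono[OF e(1)]) simp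
        then show "A\<^sup>2 \<le> (C * N)\<^sup>2 * z\<^sup>2" by (simp add: power_mult_distrib)
      qed (use \<kappa> in simp)
      finally have 1: "\<bar>recip \<kappa> (q [] w') - recip \<kappa> (q [] w) - recip' \<kappa> (q [] w) * A\<bar> \<le> 3 / \<kappa> * ((C * N)\<^sup>2 * z\<^sup>2)" .
      have "\<bar>recip' \<kappa> (q [] w) * (A - S * z)\<bar> \<le> 1 / \<kappa> * (C * N\<^sup>2 * z\<^sup>2)"
        unfolding abs_mult using recip_bounds(6)[OF \<kappa>] e(3) \<kappa> by (intro mult_mono) auto
      then have "\<bar>recip' \<kappa> (q [] w) * A - recip' \<kappa> (q [] w) * (S * z)\<bar> \<le> 1 / \<kappa> * (C * N\<^sup>2 * z\<^sup>2)"
        by (simp add: algebra_simps)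
      with 1 have "\<bar>recip \<kappa> (q [] w') - recip \<kappa> (q [] w) - recip' \<kappa> (q [] w) * (S * z)\<bar>
         \<le> 3 / \<kappa> * ((C * N)\<^sup>2 * z\<^sup>2) + 1 / \<kappa> * (C * N\<^sup>2 * z\<^sup>2)" by linarith
      also have "\<dots> = K2 * z\<^sup>2" by (simp add: K2_def algebra_simps)
      also have "\<dots> \<le> K * z\<^sup>2" using KK(3) by (intro mult_right_mono) auto
      finally show "\<bar>cyl_fun \<kappa> q idx (y(i := z)) - cyl_fun \<kappa> q idx (y(i := 0)) - cyl_deriv \<kappa> n q idx i (y(i := 0)) * z\<bar> \<le> K * z\<^sup>2"
        unfolding cyl_fun_def cyl_deriv_def w'_def[symmetric] w_def[symmetric] S_def[symmetric] mult.assoc .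
    qed
    show "lipschitz_at i K (cyl_deriv \<kappa> n q idx i)"
      unfolding lipschitz_at_def
    proof (intro allI)
      fix y z
      define w' where "w' = cyl_point idx (y(i := z))"
      define w where "w = cyl_point idx (y(i := 0))"
      note e = est[OF w'_def w_def]
      have summand: "\<bar>recip' \<kappa> (q [] w') * (if i < idx j then q [j] w' else 0) - recip' \<kappa> (q [] w) * (if i < idx j then q [j] w else 0)\<bar>
          \<le> (3 / \<kappa> * (C * N) * C + 1 / \<kappa> * (C * N)) * \<bar>z\<bar>" if j: "j < n" for j
      proof -
        have "\<bar>recip' \<kappa> (q [] w') - recip' \<kappa> (q [] w)\<bar> \<le> 3 / \<kappa> * (C * N * \<bar>z\<bar>)"
          by (rule order_trans[OF recip'_lipschitz[OF \<kappa>] mult_left_mono[OF e(1)]]) (use \<kappa> in auto)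
        then have 1: "\<bar>(recip' \<kappa> (q [] w') - recip' \<kappa> (q [] w)) * q [j] w'\<bar> \<le> 3 / \<kappa> * (C * N * \<bar>z\<bar>) * C"
          unfolding abs_mult using qb(2)[OF j] C(1) \<kappa> N0 by (intro mult_mono) auto
        have 2: "\<bar>recip' \<kappa> (q [] w) * (q [j] w' - q [j] w)\<bar> \<le> 1 / \<kappa> * (C * N * \<bar>z\<bar>)"
          unfolding abs_mult using recip_bounds(6)[OF \<kappa>] e(2)[OF j] \<kappa> by (intro mult_mono) auto
        have eq: "recip' \<kappa> (q [] w') * q [j] w' - recip' \<kappa> (q [] w) * q [j] w
           = (recip' \<kappa> (q [] w') - recip' \<kappa> (q [] w)) * q [j] w' + recip' \<kappa> (q [] w) * (q [j] w' - q [j] w)"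
          by (simp add: algebra_simps)
        have "\<bar>recip' \<kappa> (q [] w') * q [j] w' - recip' \<kappa> (q [] w) * q [j] w\<bar> \<le> 3 / \<kappa> * (C * N * \<bar>z\<bar>) * C + 1 / \<kappa> * (C * N * \<bar>z\<bar>)"
          unfolding eq using 1 2 by linarith
        then have 3: "\<bar>recip' \<kappa> (q [] w') * q [j] w' - recip' \<kappa> (q [] w) * q [j] w\<bar> \<le> (3 / \<kappa> * (C * N) * C + 1 / \<kappa> * (C * N)) * \<bar>z\<bar>"
          by (simp add: algebra_simps)
        have "0 \<le> (3 / \<kappa> * (C * N) * C + 1 / \<kappa> * (C * N)) * \<bar>z\<bar>" using C(1) \<kappa> N0 by auto
        with 3 show ?thesis by auto
      qed
      have eq2: "cyl_deriv \<kappa> n q idx i (y(i := z)) - cyl_deriv \<kappa> n q idx i (y(i := 0)) =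
        (\<Sum>j<n. recip' \<kappa> (q [] w') * (if i < idx j then q [j] w' else 0) - recip' \<kappa> (q [] w) * (if i < idx j then q [j] w else 0))"
        unfolding cyl_deriv_def w'_def w_def sum_subtractf sum_distrib_left ..
      have "\<bar>cyl_deriv \<kappa> n q idx i (y(i := z)) - cyl_deriv \<kappa> n q idx i (y(i := 0))\<bar>
         \<le> (\<Sum>j<n. \<bar>recip' \<kappa> (q [] w') * (if i < idx j then q [j] w' else 0) - recip' \<kappa> (q [] w) * (if i < idx j then q [j] w else 0)\<bar>)"
        unfolding eq2 by (rule sum_abs)
      also have "\<dots> \<le> (\<Sum>j<n. (3 / \<kappa> * (C * N) * C + 1 / \<kappa> * (C * N)) * \<bar>z\<bar>)"
        by (rule sum_mono) (use summand in blast)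
      also have "\<dots> = K3 * \<bar>z\<bar>" by (simp add: K3_def N_def mult.assoc)
      also have "\<dots> \<le> K * \<bar>z\<bar>" using KK(4) by (intro mult_right_mono) auto
      finally show "\<bar>cyl_deriv \<kappa> n q idx i (y(i := z)) - cyl_deriv \<kappa> n q idx i (y(i := 0))\<bar> \<le> K * \<bar>z\<bar>" .
    qed
  qed
  show ?thesis by (rule that[OF apos KK(5)]) (intro conjI props)
qed

section \<open>Densities of cylindrical gradients\<close>

text \<open>The density of a cylindrical gradient, since \<open>min t (r i)\<close> has derivative 1
  before \<open>r i\<close> and 0 after it.\<close>

definition cyl_density :: "nat \<Rightarrow> (nat \<Rightarrow> real) \<Rightarrow> (nat list \<Rightarrow> (nat \<Rightarrow> real) \<Rightarrow> real) \<Rightarrow> real \<Rightarrow> path \<Rightarrow> real" where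
  "cyl_density n r q t x = (\<Sum>i<n. if t < r i then q [i] (\<lambda>j. x (r j)) else 0)"

lemma integral_step_indicator:
  fixes a t r :: real
  assumes t: "0 \<le> t" "t \<le> 1" and r: "0 \<le> r" "r \<le> 1"
  shows "integrable leb01 (\<lambda>\<tau>. indicator {0..t} \<tau> * (if \<tau> < r then a else 0))"
    "(LINT \<tau>|leb01. indicator {0..t} \<tau> * (if \<tau> < r then a else 0)) = a * min t r"
proof -
  have eq: "indicator {0..t} \<tau> * (if \<tau> < r then a else 0) = a * (indicator ({0..t} \<inter> {..<r}) \<tau> :: real)" for \<tau>
    by (auto simp: indicator_def)
  have m: "measure lborel ({0..t} \<inter> {..<r}) = min t r"
  proof (cases "t < r")
    case True
    then have "{0..t} \<inter> {..<r} = {0..t}" by auto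
    then show ?thesis using t True by simp
  next
    case False
    then have "{0..t} \<inter> {..<r} = {0..<r}" by auto
    then show ?thesis using r False by simp
  qed
  have ml: "measure leb01 ({0..t} \<inter> {..<r}) = min t r"
    using m t by (subst measure_restrict_space) auto
  interpret finite_measure leb01 by (rule finite_measure_leb01)
  have s: "{0..t} \<inter> {..<r} \<in> sets leb01" using t by (auto simp: sets_restrict_space_iff)
  show "integrable leb01 (\<lambda>\<tau>. indicator {0..t} \<tau> * (if \<tau> < r then a else 0))"
    unfolding eq by (intro integrable_mult_right integrable_real_indicator s) (simp add: emeasure_eq_measure)
  show "(LINT \<tau>|leb01. indicator {0..t} \<tau> * (if \<tau> < r then a else 0)) = a * min t r"
  proof -
    have "({0..t} \<inter> {..<r}) \<inter> {0..1} = {0..t} \<inter> {..<r}" using t by auto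
    then show ?thesis unfolding eq using ml s by simp
  qed
qed

lemma cyl_density_integral:
  assumes r: "\<And>i. i < n \<Longrightarrow> r i \<in> {0..1}" and t: "t \<in> {0..1}"
  shows "(LINT \<tau>:{0..t}|lborel. cyl_density n r q \<tau> x) = (\<Sum>i<n. q [i] (\<lambda>j. x (r j)) * min t (r i))"
proof -
  have t': "0 \<le> t" "t \<le> 1" using t by auto
  have "(LINT \<tau>:{0..t}|lborel. cyl_density n r q \<tau> x)
     = (LINT \<tau>|leb01. (\<Sum>i<n. indicator {0..t} \<tau> * (if \<tau> < r i then q [i] (\<lambda>j. x (r j)) else 0)))"
    unfolding set_integral_leb01[OF t'(2)] cyl_density_def sum_distrib_left ..
  also have "\<dots> = (\<Sum>i<n. q [i] (\<lambda>j. x (r j)) * min t (r i))"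
    by (subst Bochner_Integration.integral_sum)
       (use integral_step_indicator[OF t'] r in \<open>auto intro!: sum.cong simp: atLeastAtMost_iff\<close>)
  finally show ?thesis .
qed

lemma cyl_density_integrable:
  assumes r: "\<And>i. i < n \<Longrightarrow> r i \<in> {0..1}"
  shows "integrable leb01 (\<lambda>\<tau>. cyl_density n r q \<tau> x)"
proof -
  have "integrable leb01 (\<lambda>\<tau>. \<Sum>i<n. indicator {0..1} \<tau> * (if \<tau> < r i then q [i] (\<lambda>j. x (r j)) else 0))"
    by (intro Bochner_Integration.integrable_sum integral_step_indicator(1)) (use r in auto)
  then show ?thesis
    by (subst Bochner_Integration.integrable_cong[OF refl, where g="\<lambda>\<tau>. \<Sum>i<n. indicator {0..1} \<tau> * (if \<tau> < r i then q [i] (\<lambda>j. x (r j)) else 0)"])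
       (auto simp: cyl_density_def intro!: sum.cong)
qed

text \<open>By Lebesgue's differentiation theorem the derivative of an indefinite integral is its density;
  the inequality is trivial if the function is not in the Cameron--Martin space.\<close>

lemma density_sq_le_cm_norm_sq:
  assumes g: "integrable leb01 g" and h: "\<And>t. t \<in> {0..1} \<Longrightarrow> h t = (LINT \<tau>:{0..t}|lborel. g \<tau>)"
  shows "(\<integral>\<^sup>+t. ennreal ((g t)\<^sup>2) \<partial>leb01) \<le> cm_norm_sq h"
proof (cases "h \<in> cameron_martin")
  case True
  have si: "set_integrable lborel {0..1} g"
    unfolding set_integrable_def using g by (subst (asm) integrable_restrict_space) auto
  then have gi: "g integrable_on {0..1}" by (rule set_borel_integral_eq_integral(1))
  have hi: "h t = integral {0..t} g" if "t \<in> {0..1}" for t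
    unfolding h[OF that]
    by (rule set_borel_integral_eq_integral(2), rule set_integrable_subset[OF si]) (use that in auto)
  have neg: "negligible {x\<in>{0<..<1}. \<not> ((\<lambda>t. integral {0..t} g) has_real_derivative g x) (at x)}" (is "negligible ?N")
    by (rule negligible_indefinite_integral_deriv[OF gi])
  have "AE t in lebesgue. t \<notin> ?N" using neg negligible_iff_null_sets by (metis AE_not_in)
  then have "AE t in lborel. t \<notin> ?N" by (simp only: AE_completion_iff)
  moreover have "AE t in lborel. t \<noteq> (0::real)" "AE t in lborel. t \<noteq> (1::real)" by (rule AE_lborel_singleton)+
  ultimately have "AE t in lborel. t \<in> {0..1} \<longrightarrow> deriv h t = g t"
  proof eventually_elim
    case (elim t)
    show ?case
    proof
      assume "t \<in> {0..1}"
      then have t: "t \<in> {0<..<1}" using elim by auto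
      then have "((\<lambda>t. integral {0..t} g) has_real_derivative g t) (at t)" using elim(1) by blast
      then have "(h has_real_derivative g t) (at t)"
      proof (rule has_field_derivative_transform_within_open[where S="{0<..<1}"])
        show "integral {0..y} g = h y" if "y \<in> {0<..<1}" for y using hi[of y] that by simp
      qed (use t in auto)
      then show "deriv h t = g t" by (rule DERIV_imp_deriv)
    qed
  qed
  then have "AE t in leb01. deriv h t = g t" by (subst AE_restrict_space_iff) auto
  then have "(\<integral>\<^sup>+t. ennreal ((g t)\<^sup>2) \<partial>leb01) = (\<integral>\<^sup>+t. ennreal ((deriv h t)\<^sup>2) \<partial>leb01)"
    by (intro nn_integral_cong_AE) auto
  then show ?thesis using True by (simp add: cm_norm_sq_def)
qed (simp add: cm_norm_sq_def)

text \<open>The gradients converge in the Cameron-Martin norm, and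
  \<open>density_sq_le_cm_norm_sq\<close>, applied to their differences, turns this into L^2
  convergence of the densities.\<close>

lemma malliavin_cyl_approx:
  assumes mal: "malliavin_derivative \<mu> f G" and den: "lebesgue_density \<mu> G D"
  obtains n :: "nat \<Rightarrow> nat" and r q where
    "\<And>k i. i < n k \<Longrightarrow> r k i \<in> {0..1}" "\<And>k. smooth_bounded (n k) (q k)"
    "(\<lambda>k. \<integral>\<^sup>+x. ennreal ((q k [] (\<lambda>j. x (r k j)) - f x)\<^sup>2) \<partial>\<mu>) \<longlonglongrightarrow> 0"
    "(\<lambda>k. \<integral>\<^sup>+x. \<integral>\<^sup>+t. ennreal ((cyl_density (n k) (r k) (q k) t x - D t x)\<^sup>2) \<partial>leb01 \<partial>\<mu>) \<longlonglongrightarrow> 0"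
proof -
  obtain Fs \<Gamma> where cyl: "\<And>k::nat. cylindrical (Fs k) (\<Gamma> k)"
    and l1: "(\<lambda>k. \<integral>\<^sup>+x. ennreal ((Fs k x - f x)\<^sup>2) \<partial>\<mu>) \<longlonglongrightarrow> 0"
    and l2: "(\<lambda>k. \<integral>\<^sup>+x. cm_norm_sq (\<lambda>t. \<Gamma> k x t - G x t) \<partial>\<mu>) \<longlonglongrightarrow> 0"
    using mal by (auto simp: malliavin_derivative_def)
  have "\<forall>k. \<exists>d. case d of (n, s, q) \<Rightarrow> (\<forall>i<n. s i \<in> {0..1}) \<and> smooth_bounded n q \<and>
     Fs k = (\<lambda>x. q [] (\<lambda>j. x (s j))) \<and>
     \<Gamma> k = (\<lambda>x t. indicator {0..1} t * (\<Sum>i<n. q [i] (\<lambda>j. x (s j)) * min t (s i)))"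
  proof
    fix k
    obtain n s q where "(\<forall>i<n. s i \<in> {0..1}) \<and> smooth_bounded n q \<and>
     Fs k = (\<lambda>x. q [] (\<lambda>j. x (s j))) \<and>
     \<Gamma> k = (\<lambda>x t. indicator {0..1} t * (\<Sum>i<n. q [i] (\<lambda>j. x (s j)) * min t (s i)))"
      using cyl[of k] unfolding cylindrical_def by (elim exE)
    then show "\<exists>d. case d of (n, s, q) \<Rightarrow> (\<forall>i<n. s i \<in> {0..1}) \<and> smooth_bounded n q \<and>
     Fs k = (\<lambda>x. q [] (\<lambda>j. x (s j))) \<and>
     \<Gamma> k = (\<lambda>x t. indicator {0..1} t * (\<Sum>i<n. q [i] (\<lambda>j. x (s j)) * min t (s i)))"
      by (intro exI[of _ "(n, s, q)"]) (unfold prod.case)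
  qed
  from choice[OF this] obtain d where d: "\<forall>k. case d k of (n, s, q) \<Rightarrow> (\<forall>i<n. s i \<in> {0..1}) \<and> smooth_bounded n q \<and>
     Fs k = (\<lambda>x. q [] (\<lambda>j. x (s j))) \<and>
     \<Gamma> k = (\<lambda>x t. indicator {0..1} t * (\<Sum>i<n. q [i] (\<lambda>j. x (s j)) * min t (s i)))" ..
  define n where "n = (\<lambda>k. fst (d k))"
  define r where "r = (\<lambda>k. fst (snd (d k)))"
  define q where "q = (\<lambda>k. snd (snd (d k)))"
  have dk: "(\<forall>i<n k. r k i \<in> {0..1}) \<and> smooth_bounded (n k) (q k) \<and>
     Fs k = (\<lambda>x. q k [] (\<lambda>j. x (r k j))) \<and>
     \<Gamma> k = (\<lambda>x t. indicator {0..1} t * (\<Sum>i<n k. q k [i] (\<lambda>j. x (r k j)) * min t (r k i)))" for k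
    using d[rule_format, of k] unfolding n_def r_def q_def split_beta .
  have r: "r k i \<in> {0..1}" if "i < n k" for k i using dk[of k] that by blast
  have q: "smooth_bounded (n k) (q k)" for k using dk[of k] by blast
  have Fs: "Fs k = (\<lambda>x. q k [] (\<lambda>j. x (r k j)))" for k using dk[of k] by blast
  have \<Gamma>: "\<Gamma> k = (\<lambda>x t. indicator {0..1} t * (\<Sum>i<n k. q k [i] (\<lambda>j. x (r k j)) * min t (r k i)))" for k
    using dk[of k] by blast
  show ?thesis
  proof (rule that[OF r q])
    show "(\<lambda>k. \<integral>\<^sup>+x. ennreal ((q k [] (\<lambda>j. x (r k j)) - f x)\<^sup>2) \<partial>\<mu>) \<longlonglongrightarrow> 0"
      using l1 by (simp add: Fs)
    have le: "(\<integral>\<^sup>+x. \<integral>\<^sup>+t. ennreal ((cyl_density (n k) (r k) (q k) t x - D t x)\<^sup>2) \<partial>leb01 \<partial>\<mu>)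
       \<le> (\<integral>\<^sup>+x. cm_norm_sq (\<lambda>t. \<Gamma> k x t - G x t) \<partial>\<mu>)" for k
    proof (rule nn_integral_mono_AE)
      have "AE x in \<mu>. integrable leb01 (\<lambda>t. D t x) \<and> (\<forall>t\<in>{0..1}. G x t = (LINT \<tau>:{0..t}|lborel. D \<tau> x))"
        using den by (simp add: lebesgue_density_def)
      then show "AE x in \<mu>. (\<integral>\<^sup>+t. ennreal ((cyl_density (n k) (r k) (q k) t x - D t x)\<^sup>2) \<partial>leb01) \<le> cm_norm_sq (\<lambda>t. \<Gamma> k x t - G x t)"
      proof eventually_elim
        case (elim x)
        have iD: "integrable leb01 (\<lambda>t. D t x)" using elim by simp
        have ic: "integrable leb01 (\<lambda>t. cyl_density (n k) (r k) (q k) t x)" by (rule cyl_density_integrable[OF r])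
        show ?case
        proof (rule density_sq_le_cm_norm_sq)
          show "integrable leb01 (\<lambda>t. cyl_density (n k) (r k) (q k) t x - D t x)"
            by (rule Bochner_Integration.integrable_diff[OF ic iD])
          fix t :: real assume t: "t \<in> {0..1}"
          then have t1: "t \<le> 1" by simp
          have [measurable]: "(\<lambda>\<tau>. indicator {0..t} \<tau> :: real) \<in> borel_measurable leb01"
            by (intro measurable_restrict_space1) simp
          have ii: "integrable leb01 (\<lambda>\<tau>. indicator {0..t} \<tau> * g \<tau>)" if "integrable leb01 g" for g :: "real \<Rightarrow> real"
          proof (rule Bochner_Integration.integrable_bound[OF that])
            show "(\<lambda>\<tau>. indicator {0..t} \<tau> * g \<tau>) \<in> borel_measurable leb01" using borel_measurable_integrable[OF that] by measurable
          qed (auto simp: indicator_def intro!: AE_I2)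
          have "(LINT \<tau>:{0..t}|lborel. cyl_density (n k) (r k) (q k) \<tau> x - D \<tau> x)
              = (LINT \<tau>|leb01. indicator {0..t} \<tau> * cyl_density (n k) (r k) (q k) \<tau> x - indicator {0..t} \<tau> * D \<tau> x)"
            unfolding set_integral_leb01[OF t1] right_diff_distrib ..
          also have "\<dots> = (LINT \<tau>:{0..t}|lborel. cyl_density (n k) (r k) (q k) \<tau> x) - (LINT \<tau>:{0..t}|lborel. D \<tau> x)"
            unfolding set_integral_leb01[OF t1] by (rule Bochner_Integration.integral_diff[OF ii[OF ic] ii[OF iD]])
          also have "\<dots> = \<Gamma> k x t - G x t"
            using elim t cyl_density_integral[where n="n k" and r="r k" and q="q k", OF r t] by (simp add: \<Gamma>)
          finally show "\<Gamma> k x t - G x t = (LINT \<tau>:{0..t}|lborel. cyl_density (n k) (r k) (q k) \<tau> x - D \<tau> x)" ..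
        qed
      qed
    qed
    show "(\<lambda>k. \<integral>\<^sup>+x. \<integral>\<^sup>+t. ennreal ((cyl_density (n k) (r k) (q k) t x - D t x)\<^sup>2) \<partial>leb01 \<partial>\<mu>) \<longlonglongrightarrow> 0"
      by (rule tendsto_sandwich[OF _ _ tendsto_const l2]) (use le in auto)
  qed
qed

section \<open>Conditional expectations under a change of measure\<close>

context finite_measure_subalgebra
begin

text \<open>By monotone convergence on each event, the supremum of the conditional expectations
  satisfies the identity that characterises the conditional expectation of the limit.\<close>

lemma nn_cond_exp_monotone_convergence:
  assumes [measurable]: "\<And>k::nat. g k \<in> borel_measurable M" "g' \<in> borel_measurable M"
    and mono: "\<And>k x. x \<in> space M \<Longrightarrow> g k x \<le> g (Suc k) x"
    and lim: "\<And>x. x \<in> space M \<Longrightarrow> (\<lambda>k. g k x) \<longlonglongrightarrow> g' x"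
  shows "AE x in M. (\<lambda>k. nn_cond_exp M F (g k) x) \<longlonglongrightarrow> nn_cond_exp M F g' x"
proof -
  let ?h = "\<lambda>k. nn_cond_exp M F (g k)"
  have "AE x in M. \<forall>k. ?h k x \<le> ?h (Suc k) x"
    unfolding AE_all_countable
  proof
    fix k show "AE x in M. ?h k x \<le> ?h (Suc k) x"
      by (rule nn_cond_exp_mono) (use mono in auto)
  qed
  then have inc: "AE x in M. incseq (\<lambda>k. ?h k x)"
    by eventually_elim (simp add: incseq_Suc_iff)
  define H where "H = (\<lambda>x. SUP k. ?h k x)"
  have HF: "H \<in> borel_measurable F" unfolding H_def by measurable
  have "AE x in M. H x = nn_cond_exp M F g' x"
  proof (rule nn_cond_exp_charact)
    fix A assume A: "A \<in> sets F"
    then have AM[measurable]: "A \<in> sets M" using subalg by (auto simp: subalgebra_def)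
    have "(\<integral>\<^sup>+x\<in>A. g' x \<partial>M) = (\<integral>\<^sup>+x. (SUP k. g k x * indicator A x) \<partial>M)"
    proof (rule nn_integral_cong)
      fix x assume x: "x \<in> space M"
      have "incseq (\<lambda>k. g k x * indicator A x)" using mono[OF x] by (auto simp: incseq_Suc_iff intro: mult_right_mono)
      moreover have "(\<lambda>k. g k x * indicator A x) \<longlonglongrightarrow> g' x * indicator A x"
        using lim[OF x] by (auto simp: indicator_def)
      ultimately show "g' x * indicator A x = (SUP k. g k x * indicator A x)"
        using LIMSEQ_unique LIMSEQ_SUP by blast
    qed
    also have "\<dots> = (SUP k. \<integral>\<^sup>+x. g k x * indicator A x \<partial>M)"
      by (rule nn_integral_monotone_convergence_SUP_AE)
         (use mono in \<open>auto intro!: AE_I2 mult_right_mono\<close>)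
    also have "\<dots> = (SUP k. \<integral>\<^sup>+x. ?h k x * indicator A x \<partial>M)"
    proof (rule SUP_cong[OF refl])
      fix k
      have "(indicator A :: 'a \<Rightarrow> ennreal) \<in> borel_measurable F" using A by simp
      from nn_cond_exp_intg[OF this, of "g k"]
      show "(\<integral>\<^sup>+x. g k x * indicator A x \<partial>M) = (\<integral>\<^sup>+x. ?h k x * indicator A x \<partial>M)"
        by (simp add: mult.commute)
    qed
    also have "\<dots> = (\<integral>\<^sup>+x. (SUP k. ?h k x * indicator A x) \<partial>M)"
    proof (rule nn_integral_monotone_convergence_SUP_AE[symmetric])
      fix k show "AE x in M. ?h k x * indicator A x \<le> ?h (Suc k) x * indicator A x"
        using inc by eventually_elim (auto simp: incseq_Suc_iff intro: mult_right_mono)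
    qed measurable
    also have "\<dots> = (\<integral>\<^sup>+x\<in>A. H x \<partial>M)"
      by (intro nn_integral_cong) (auto simp: H_def indicator_def)
    finally show "(\<integral>\<^sup>+x\<in>A. g' x \<partial>M) = (\<integral>\<^sup>+x\<in>A. H x \<partial>M)" .
  qed (use HF in auto)
  with inc show ?thesis
  proof eventually_elim
    case (elim x)
    then show ?case using LIMSEQ_SUP[of "\<lambda>k. ?h k x"] by (simp add: H_def)
  qed
qed

lemma nn_cond_exp_cmult:
  assumes [measurable]: "g \<in> borel_measurable M"
  shows "AE x in M. nn_cond_exp M F (\<lambda>x. c * g x) x = c * nn_cond_exp M F g x"
proof -
  have "AE x in M. c * nn_cond_exp M F g x = nn_cond_exp M F (\<lambda>x. c * g x) x"
    by (rule nn_cond_exp_prod[of "\<lambda>_. c"]) auto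
  then show ?thesis by eventually_elim simp
qed

text \<open>Bayes' formula, kept in product form so that no quotient of extended reals
  arises.\<close>

lemma nn_cond_exp_density:
  assumes L[measurable]: "L \<in> borel_measurable M" and fin: "finite_measure (density M L)"
    and g[measurable]: "g \<in> borel_measurable M"
  shows "AE x in M. nn_cond_exp M F (\<lambda>x. L x * g x) x = nn_cond_exp (density M L) F g x * nn_cond_exp M F L x"
proof -
  let ?N = "density M L"
  interpret N: finite_measure_subalgebra ?N F
    by (intro finite_measure_subalgebra.intro fin finite_measure_subalgebra_axioms.intro)
       (use subalg in \<open>simp add: subalgebra_def\<close>)
  let ?h = "nn_cond_exp ?N F g"
  have hF[measurable]: "?h \<in> borel_measurable F" by (rule borel_measurable_nn_cond_exp)
  then have [measurable]: "?h \<in> borel_measurable M" using measurable_from_subalg[OF subalg] by blast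
  have "AE x in M. ?h x * nn_cond_exp M F L x = nn_cond_exp M F (\<lambda>x. L x * g x) x"
  proof (rule nn_cond_exp_charact)
    fix A assume A[measurable]: "A \<in> sets F"
    then have [measurable]: "A \<in> sets M" using subalg by (auto simp: subalgebra_def)
    have iA[measurable]: "(indicator A :: 'a \<Rightarrow> ennreal) \<in> borel_measurable F" using A by simp
    have "(\<integral>\<^sup>+x\<in>A. L x * g x \<partial>M) = (\<integral>\<^sup>+x. indicator A x * g x \<partial>?N)"
      by (subst nn_integral_density) (auto intro!: nn_integral_cong simp: mult_ac)
    also have "\<dots> = (\<integral>\<^sup>+x. indicator A x * ?h x \<partial>?N)"
      by (rule N.nn_cond_exp_intg[symmetric, OF iA]) simp
    also have "\<dots> = (\<integral>\<^sup>+x. (indicator A x * ?h x) * L x \<partial>M)"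
      by (subst nn_integral_density) (auto intro!: nn_integral_cong simp: mult_ac)
    also have "\<dots> = (\<integral>\<^sup>+x. (indicator A x * ?h x) * nn_cond_exp M F L x \<partial>M)"
      by (rule nn_cond_exp_intg[symmetric]) measurable
    also have "\<dots> = (\<integral>\<^sup>+x\<in>A. ?h x * nn_cond_exp M F L x \<partial>M)"
      by (intro nn_integral_cong) (simp add: mult_ac)
    finally show "(\<integral>\<^sup>+x\<in>A. L x * g x \<partial>M) = (\<integral>\<^sup>+x\<in>A. ?h x * nn_cond_exp M F L x \<partial>M)" .
  qed measurable
  then show ?thesis by eventually_elim simp
qed

end

lemma AE_tendsto_zero_of_summable:
  assumes [measurable]: "\<And>k::nat. X k \<in> borel_measurable M"
    and fin: "(\<Sum>k. \<integral>\<^sup>+x. ennreal \<bar>X k x\<bar> \<partial>M) < \<infinity>"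
  shows "AE x in M. (\<lambda>k. X k x :: real) \<longlonglongrightarrow> 0"
proof -
  have "(\<integral>\<^sup>+x. (\<Sum>k. ennreal \<bar>X k x\<bar>) \<partial>M) = (\<Sum>k. \<integral>\<^sup>+x. ennreal \<bar>X k x\<bar> \<partial>M)"
    by (rule nn_integral_suminf) measurable
  then have "AE x in M. (\<Sum>k. ennreal \<bar>X k x\<bar>) \<noteq> \<infinity>"
    using fin by (intro nn_integral_PInf_AE) auto
  then show ?thesis
  proof eventually_elim
    case (elim x)
    then have "summable (\<lambda>k. \<bar>X k x\<bar>)" by (intro summable_suminf_not_top) auto
    then have "(\<lambda>k. \<bar>X k x\<bar>) \<longlonglongrightarrow> 0" by (rule summable_LIMSEQ_zero)
    then show ?case by (rule tendsto_rabs_zero_cancel)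
  qed
qed

section \<open>Approximation of the density by exponentials of step processes\<close>

text \<open>The multiples of 1 / N control the mesh. \<open>S\<close> will hold the evaluation times
  of a cylindrical function, which thereby becomes a function of the grid increments.\<close>

lemma uniform_refined_grid:
  fixes N :: nat and S :: "real set"
  assumes N: "N > 0" and S: "finite S" "S \<subseteq> {0..1}"
  obtains m s where "time_grid m s" "S \<subseteq> s ` {..m}" "\<And>i. i < m \<Longrightarrow> s (Suc i) - s i \<le> 1 / real N"
proof -
  define U where "U = (\<lambda>k. real k / real N) ` {..N}"
  have U: "finite U" "0 \<in> U" "1 \<in> U" "U \<subseteq> {0..1}"
    using N by (auto simp: U_def image_iff intro!: bexI[of _ 0] bexI[of _ N])
  obtain m s where g: "time_grid m s" and im: "s ` {..m} = U \<union> S"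
    using time_grid_of_finite[of "U \<union> S"] U S by auto
  have mesh: "s (Suc i) - s i \<le> 1 / real N" if i: "i < m" for i
  proof -
    have si: "0 \<le> s i" "s i < 1"
      using time_grid_range[OF g, of i] time_grid_less[OF g i] g i by (auto simp: time_grid_def)
    \<comment> \<open>The first multiple of 1 / N strictly after \<open>s i\<close>, at distance at
      most 1 / N; \<open>s (Suc i)\<close> cannot lie beyond it.\<close>
    define k where "k = Suc (nat \<lfloor>s i * real N\<rfloor>)"
    have fl: "real (nat \<lfloor>s i * real N\<rfloor>) \<le> s i * real N" "s i * real N < real k"
      using si N unfolding k_def by (auto simp: of_nat_floor) linarith
    have "s i * real N < real N" using si N by simp
    then have "real (nat \<lfloor>s i * real N\<rfloor>) < real N" using fl(1) by linarith
    then have kN: "k \<le> N" unfolding k_def by (simp only: of_nat_less_iff Suc_le_eq)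
    then have "real k / real N \<in> s ` {..m}" using im by (auto simp: U_def)
    then obtain j where j: "j \<le> m" "real k / real N = s j" by auto
    have "s i < s j" unfolding j(2)[symmetric] using fl(2) N by (simp add: pos_less_divide_eq)
    then have "Suc i \<le> j" using time_grid_less_iff[OF g, of i j] i j by auto
    then have "s (Suc i) \<le> s j" using time_grid_le[OF g _ j(1)] by blast
    also have "s j \<le> s i + 1 / real N"
    proof -
      have "real k \<le> s i * real N + 1" using fl(1) by (simp add: k_def)
      then have "real k / real N \<le> (s i * real N + 1) / real N" using N by (intro divide_right_mono) auto
      then show ?thesis using N j(2) by (simp add: add_divide_distrib)
    qed
    finally show ?thesis by simp
  qed
  show ?thesis by (rule that[OF g _ mesh]) (use im in auto)
qed

locale wiener_setting =
  fixes \<mu> :: "path measure"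
  assumes wiener: "wiener_measure \<mu>"
begin

abbreviation "F \<equiv> natural_filtration \<mu> coord"

sublocale brownian_setting \<mu> F coord
  by unfold_locales (use wiener in \<open>simp add: wiener_measure_def\<close>)

lemma space_\<mu>: "space \<mu> = path_space"
proof -
  obtain P where P: "sets P = sets path_borel" "\<mu> = completion P" using wiener by (auto simp: wiener_measure_def)
  have "space P = space path_borel" using sets_eq_imp_space_eq[OF P(1)] .
  also have "\<dots> = path_space" unfolding path_borel_def by (rule space_measure_of) auto
  finally show ?thesis using P(2) by simp
qed

lemma coord_zero: "x \<in> space \<mu> \<Longrightarrow> x 0 = 0"
  by (simp add: space_\<mu> path_space_def)

lemma finite_measure_subalgebra_F: "t \<in> {0..1} \<Longrightarrow> finite_measure_subalgebra \<mu> (F t)"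
  by (intro finite_measure_subalgebra.intro finite_measure_subalgebra_axioms.intro subalg_F) unfold_locales

text \<open>Numerator and denominator are returned separately because their limits are identified
  separately. Grid points are excluded: there the step value belongs to the interval on the left,
  whereas the density may already have jumped. They are finitely many, hence negligible in
  time.\<close>

lemma step_approx_cyl:
  assumes q: "smooth_bounded n q" and r: "\<And>i. i < n \<Longrightarrow> r i \<in> {0..1}" and \<kappa>: "\<kappa> > 0" and \<epsilon>: "\<epsilon> > 0"
  defines "X \<equiv> \<lambda>x. recip \<kappa> (q [] (\<lambda>j. x (r j)))"
    and "Y \<equiv> \<lambda>t x. recip' \<kappa> (q [] (\<lambda>j. x (r j))) * cyl_density n r q t x"
  obtains m s \<xi> num den where "step_process F m s \<xi>"
    "(\<integral>x. \<bar>step_exp coord m s \<xi> x - X x / (\<integral>x. X x \<partial>\<mu>)\<bar> \<partial>\<mu>) \<le> \<epsilon>"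
    "\<And>t x. step_value m s \<xi> t x = - num t x / den t x"
    "\<And>t. t \<in> {0..1} - s ` {..m} \<Longrightarrow> num t \<in> borel_measurable \<mu> \<and> den t \<in> borel_measurable \<mu> \<and>
       (\<integral>\<^sup>+x. ennreal \<bar>num t x - real_cond_exp \<mu> (F t) (Y t) x\<bar> \<partial>\<mu>) \<le> ennreal \<epsilon> \<and>
       (\<integral>\<^sup>+x. ennreal \<bar>den t x - real_cond_exp \<mu> (F t) X x\<bar> \<partial>\<mu>) \<le> ennreal \<epsilon>"
    "integrable \<mu> X" "\<And>t. t \<in> {0..1} - s ` {..m} \<Longrightarrow> integrable \<mu> (Y t)" "0 < (\<integral>x. X x \<partial>\<mu>)"
proof -
  obtain a K where aK: "0 < a" "a \<le> 1" "1 \<le> K"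
    and cyl: "\<And>idx i. bounded_meas a K (cyl_fun \<kappa> q idx) \<and> lipschitz_at i K (cyl_fun \<kappa> q idx) \<and>
       bounded_meas (- K) K (cyl_deriv \<kappa> n q idx i) \<and> taylor_at i K (cyl_fun \<kappa> q idx) (cyl_deriv \<kappa> n q idx i) \<and>
       lipschitz_at i K (cyl_deriv \<kappa> n q idx i)"
    using cyl_uniform[OF q \<kappa>] by blast
  obtain C where C: "0 \<le> C"
    and hell: "\<And>m s G D. time_grid m s \<Longrightarrow> bounded_meas a K G \<Longrightarrow>
     (\<forall>i<m. bounded_meas (- K) K (D i) \<and> taylor_at i K G (D i) \<and> lipschitz_at i K (D i)) \<Longrightarrow>
     ennreal (1 - C * (\<Sum>i<m. (s (Suc i) - s i)\<^sup>2)) \<le>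
       (\<integral>\<^sup>+x. ennreal (sqrt (G (incr s m x) / lev s m G 0 (\<lambda>_. 0) * step_exp coord m s (log_deriv_step s m G D) x)) \<partial>\<mu>)"
    using hellinger_log_deriv[OF aK] by blast
  \<comment> \<open>With mesh 1 / N0 the L^1 error of the exponential is 3 sqrt (C / N0), which asks
    for 9 C, and the time regularity error is 2 K sqrt (1 / N0), which asks for 4 K^2; the 1 makes
    N0 positive.\<close>
  obtain N0 :: nat where N0: "(9 * C + 4 * K\<^sup>2 + 1) / \<epsilon>\<^sup>2 < real N0" using reals_Archimedean2 by blast
  have e2: "0 < \<epsilon>\<^sup>2" using \<epsilon> by simp
  have bnd: "9 * C + 4 * K\<^sup>2 + 1 < real N0 * \<epsilon>\<^sup>2" using N0 e2 by (simp add: pos_divide_less_eq)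
  have "0 < 9 * C + 4 * K\<^sup>2 + 1" using C by (intro add_nonneg_pos) auto
  then have "0 < real N0 * \<epsilon>\<^sup>2" using bnd by linarith
  then have N0pos: "N0 > 0" by (cases "N0 = 0") auto
  have rS: "finite (r ` {..<n})" "r ` {..<n} \<subseteq> {0..1}" using r by auto
  obtain m s where g: "time_grid m s" and rs: "r ` {..<n} \<subseteq> s ` {..m}"
    and mesh: "\<And>i. i < m \<Longrightarrow> s (Suc i) - s i \<le> 1 / real N0"
    using uniform_refined_grid[OF N0pos rS] by blast
  have "\<forall>j\<in>{..<n}. \<exists>i. i \<le> m \<and> s i = r j"
  proof
    fix j assume "j \<in> {..<n}"
    then have "r j \<in> s ` {..m}" using rs by auto
    then show "\<exists>i. i \<le> m \<and> s i = r j" by auto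
  qed
  from bchoice[OF this] obtain idx where idx: "\<forall>j\<in>{..<n}. idx j \<le> m \<and> s (idx j) = r j" ..
  define G where "G = cyl_fun \<kappa> q idx"
  define D where "D = cyl_deriv \<kappa> n q idx"
  have Gb: "bounded_meas a K G" and Gl: "\<And>i. lipschitz_at i K G" and Db: "\<And>i. bounded_meas (- K) K (D i)"
    and Dt: "\<And>i. taylor_at i K G (D i)" and Dl: "\<And>i. lipschitz_at i K (D i)"
    using cyl by (auto simp: G_def D_def)
  have point: "cyl_point idx (incr s m x) j = x (r j)" if x: "x \<in> space \<mu>" and j: "j < n" for x j
  proof -
    have ij: "idx j \<le> m" "s (idx j) = r j" using idx j by auto
    have "cyl_point idx (incr s m x) j = (\<Sum>l<idx j. coord (s (Suc l)) x - coord (s l) x)"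
      unfolding cyl_point_def incr_def by (rule sum.cong) (use ij in auto)
    also have "\<dots> = coord (s (idx j)) x - coord (s 0) x" by (rule sum_lessThan_telescope)
    also have "\<dots> = x (r j)" using coord_zero[OF x] g ij by (simp add: coord_def time_grid_def)
    finally show ?thesis .
  qed
  have qpoint: "q \<alpha> (cyl_point idx (incr s m x)) = q \<alpha> (\<lambda>j. x (r j))" if "x \<in> space \<mu>" "\<alpha> \<in> lists {..<n}" for \<alpha> x
    by (rule smooth_cong[OF q that(2)]) (use point[OF that(1)] in simp)
  have GX: "G (incr s m x) = X x" if "x \<in> space \<mu>" for x
    using qpoint[OF that, of "[]"] by (simp add: G_def cyl_fun_def X_def)
  \<comment> \<open>No evaluation time lies in the interior of the interval, so t < r j holds
    exactly when j has its grid index after i.\<close>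
  have DY: "D i (incr s m x) = Y t x" if x: "x \<in> space \<mu>" and i: "i < m" "s i \<le> t" "t < s (Suc i)" for i t x
  proof -
    have "(if i < idx j then q [j] (cyl_point idx (incr s m x)) else 0) = (if t < r j then q [j] (\<lambda>j. x (r j)) else 0)"
      if j: "j < n" for j
    proof -
      have ij: "idx j \<le> m" "s (idx j) = r j" using idx j by auto
      have "i < idx j \<longleftrightarrow> t < r j"
        using time_grid_le[OF g, of "Suc i" "idx j"] time_grid_le[OF g, of "idx j" i] ij i
        by (cases "i < idx j") auto
      then show ?thesis using qpoint[OF x, of "[j]"] j by simp
    qed
    then show ?thesis
      using qpoint[OF x, of "[]"] unfolding D_def cyl_deriv_def Y_def cyl_density_def by simp
  qed
  define \<xi> where "\<xi> = log_deriv_step s m G D"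
  have \<xi>: "step_process F m s \<xi>" unfolding \<xi>_def by (rule step_process_log_deriv[OF g aK(1) Gb Db])
  define num where "num = step_value m s (\<lambda>i x. lev s m (D i) i (incr s i x))"
  define den where "den = step_value m s (\<lambda>i x. lev s m G i (incr s i x))"
  have sv: "step_value m s \<xi> t x = - num t x / den t x" for t x
    unfolding num_def den_def \<xi>_def log_deriv_step_def[abs_def]
    by (rule step_value_comp[OF g, of "\<lambda>a b. - a / b", symmetric]) simp
  have iG: "integrable \<mu> (\<lambda>x. G (incr s m x))" and iD: "integrable \<mu> (\<lambda>x. D i (incr s m x))" for i
    using cond_exp_lev(2)[OF g Gb order_refl] cond_exp_lev(2)[OF g Db order_refl] by auto
  have iX: "integrable \<mu> X" using iG by (subst Bochner_Integration.integrable_cong[OF refl GX[symmetric]])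
  have sub1: "t \<in> {0..1} - s ` {..m} \<Longrightarrow> \<exists>i<m. s i < t \<and> t < s (Suc i)" for t
  proof -
    assume t: "t \<in> {0..1} - s ` {..m}"
    moreover have "0 \<in> s ` {..m}" "1 \<in> s ` {..m}" using g by (auto simp: time_grid_def image_iff intro: bexI[of _ 0] bexI[of _ m])
    ultimately have t': "0 < t" "t \<le> 1" by (auto simp: less_eq_real_def)
    obtain i where i: "i < m" "s i < t" "t \<le> s (Suc i)" using time_grid_locate[OF g t'] .
    moreover have "t \<noteq> s (Suc i)" using t i by auto
    ultimately show ?thesis by auto
  qed
  have KN: "2 * K * sqrt h \<le> \<epsilon>" if "0 \<le> h" "h \<le> 1 / real N0" for h
  proof -
    have "(2 * K * sqrt h)\<^sup>2 = 4 * K\<^sup>2 * h" using that by (simp add: power_mult_distrib)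
    also have "\<dots> \<le> 4 * K\<^sup>2 * (1 / real N0)" using that by (intro mult_left_mono) auto
    also have "\<dots> \<le> \<epsilon>\<^sup>2"
    proof -
      have "4 * K\<^sup>2 \<le> real N0 * \<epsilon>\<^sup>2" using bnd C by linarith
      then have "4 * K\<^sup>2 / real N0 \<le> \<epsilon>\<^sup>2" using N0pos by (simp only: pos_divide_le_eq of_nat_0_less_iff mult.commute)
      then show ?thesis by (simp only: times_divide_eq_right mult_1_right)
    qed
    finally show ?thesis by (rule power2_le_imp_le) (use \<epsilon> in simp)
  qed
  have reg: "num t \<in> borel_measurable \<mu> \<and> den t \<in> borel_measurable \<mu> \<and>
       (\<integral>\<^sup>+x. ennreal \<bar>num t x - real_cond_exp \<mu> (F t) (Y t) x\<bar> \<partial>\<mu>) \<le> ennreal \<epsilon> \<and>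
       (\<integral>\<^sup>+x. ennreal \<bar>den t x - real_cond_exp \<mu> (F t) X x\<bar> \<partial>\<mu>) \<le> ennreal \<epsilon> \<and> integrable \<mu> (Y t)"
    if t: "t \<in> {0..1} - s ` {..m}" for t
  proof -
    obtain i where i: "i < m" "s i < t" "t < s (Suc i)" using sub1[OF t] by blast
    have t01: "t \<in> {0..1}" using t by auto
    interpret R: finite_measure_subalgebra \<mu> "F t" by (rule finite_measure_subalgebra_F[OF t01])
    have il: "i \<le> m" using i by simp
    have nt: "num t x = lev s m (D i) i (incr s i x)" and dt: "den t x = lev s m G i (incr s i x)" for x
      unfolding num_def den_def using i by (simp_all add: step_value_at[OF g i(1,2) less_imp_le[OF i(3)]])
    have nt': "num t = (\<lambda>x. lev s m (D i) i (incr s i x))" by (rule ext) (rule nt)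
    have dt': "den t = (\<lambda>x. lev s m G i (incr s i x))" by (rule ext) (rule dt)
    have inum: "integrable \<mu> (num t)" unfolding nt' by (rule cond_exp_lev(2)[OF g Db il])
    have iden: "integrable \<mu> (den t)" unfolding dt' by (rule cond_exp_lev(2)[OF g Gb il])
    have YD: "x \<in> space \<mu> \<Longrightarrow> Y t x = D i (incr s m x)" for x using DY[of x i t] i by simp
    have iY: "integrable \<mu> (Y t)" using iD[of i] by (subst Bochner_Integration.integrable_cong[OF refl YD])
    have h: "0 \<le> s (Suc i) - s i" "s (Suc i) - s i \<le> 1 / real N0" using mesh[OF i(1)] i by auto
    have est: "(\<integral>\<^sup>+x. ennreal \<bar>z x - real_cond_exp \<mu> (F t) H' x\<bar> \<partial>\<mu>) \<le> ennreal \<epsilon>"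
      if z: "\<And>x. z x = lev s m H i (incr s i x)" and HH: "\<And>x. x \<in> space \<mu> \<Longrightarrow> H' x = H (incr s m x)"
        and Hb: "bounded_meas b c H" and Hl: "lipschitz_at i K H" and iH: "integrable \<mu> H'" for z H H' b c
    proof -
      have K0: "0 \<le> K" using aK by simp
      note ctr = cond_exp_time_regularity[OF g Hb i(1) Hl K0 less_imp_le[OF i(2)] less_imp_le[OF i(3)]]
      have iH2: "integrable \<mu> (\<lambda>x. H (incr s m x))" using cond_exp_lev(2)[OF g Hb order_refl] by simp
      have ae: "AE x in \<mu>. real_cond_exp \<mu> (F t) H' x = real_cond_exp \<mu> (F t) (\<lambda>x. H (incr s m x)) x"
        by (rule R.real_cond_exp_cong) (use HH iH iH2 in auto)
      have "(\<integral>\<^sup>+x. ennreal \<bar>z x - real_cond_exp \<mu> (F t) H' x\<bar> \<partial>\<mu>)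
         = (\<integral>\<^sup>+x. ennreal \<bar>real_cond_exp \<mu> (F t) (\<lambda>x. H (incr s m x)) x - lev s m H i (incr s i x)\<bar> \<partial>\<mu>)"
        by (rule nn_integral_cong_AE) (use ae in eventually_elim, simp add: z abs_minus_commute)
      also have "\<dots> = ennreal (\<integral>x. \<bar>real_cond_exp \<mu> (F t) (\<lambda>x. H (incr s m x)) x - lev s m H i (incr s i x)\<bar> \<partial>\<mu>)"
        by (rule nn_integral_eq_integral) (use ctr(2) in auto)
      also have "\<dots> \<le> ennreal \<epsilon>"
        by (rule ennreal_leI, rule order_trans[OF ctr(1) KN[OF h]])
      finally show ?thesis .
    qed
    show ?thesis
    proof (intro conjI)
      show "(\<integral>\<^sup>+x. ennreal \<bar>num t x - real_cond_exp \<mu> (F t) (Y t) x\<bar> \<partial>\<mu>) \<le> ennreal \<epsilon>"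
        by (rule est[OF nt YD Db Dl iY])
      show "(\<integral>\<^sup>+x. ennreal \<bar>den t x - real_cond_exp \<mu> (F t) X x\<bar> \<partial>\<mu>) \<le> ennreal \<epsilon>"
        by (rule est[OF dt GX[symmetric] Gb Gl iX])
    qed (use inum iden iY in auto)
  qed
  define l0 where "l0 = lev s m G 0 (\<lambda>_. 0)"
  have l0: "(\<integral>x. X x \<partial>\<mu>) = l0" "0 < l0"
  proof -
    have s0: "s 0 \<in> {0..1}" using g by (simp add: time_grid_def)
    interpret R: finite_measure_subalgebra \<mu> "F (s 0)" by (rule finite_measure_subalgebra_F[OF s0])
    have inc0: "incr s 0 x = (\<lambda>_. 0)" for x by (simp add: incr_def)
    have "(\<integral>x. X x \<partial>\<mu>) = (\<integral>x. G (incr s m x) \<partial>\<mu>)"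
      by (rule Bochner_Integration.integral_cong[OF refl]) (simp add: GX)
    also have "\<dots> = (\<integral>x. real_cond_exp \<mu> (F (s 0)) (\<lambda>x. G (incr s m x)) x \<partial>\<mu>)"
      by (rule R.real_cond_exp_int(2)[OF iG, symmetric])
    also have "\<dots> = (\<integral>x. lev s m G 0 (incr s 0 x) \<partial>\<mu>)"
      by (rule integral_cong_AE) (use cond_exp_lev(1,2)[OF g Gb, of 0] R.real_cond_exp_int(1)[OF iG] in auto)
    also have "\<dots> = l0" by (simp add: inc0 l0_def prob_space)
    finally show "(\<integral>x. X x \<partial>\<mu>) = l0" .
    have "a \<le> l0" using lev_bounded_meas[OF g Gb, of 0] by (simp add: bounded_meas_def l0_def)
    then show "0 < l0" using aK by linarith
  qed
  have L1: "(\<integral>x. \<bar>step_exp coord m s \<xi> x - X x / (\<integral>x. X x \<partial>\<mu>)\<bar> \<partial>\<mu>) \<le> \<epsilon>"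
  proof -
    define \<delta> where "\<delta> = C / real N0"
    have \<delta>: "0 \<le> \<delta>" using C by (simp add: \<delta>_def)
    have sumh: "(\<Sum>i<m. (s (Suc i) - s i)\<^sup>2) \<le> 1 / real N0"
    proof -
      have "(\<Sum>i<m. (s (Suc i) - s i)\<^sup>2) \<le> (\<Sum>i<m. (s (Suc i) - s i) * (1 / real N0))"
      proof (rule sum_mono)
        fix i assume "i \<in> {..<m}"
        then have "0 \<le> s (Suc i) - s i" "s (Suc i) - s i \<le> 1 / real N0" using mesh[of i] g by (auto simp: time_grid_def less_imp_le)
        then show "(s (Suc i) - s i)\<^sup>2 \<le> (s (Suc i) - s i) * (1 / real N0)"
          unfolding power2_eq_square by (intro mult_left_mono) auto
      qed
      also have "\<dots> = (\<Sum>i<m. s (Suc i) - s i) * (1 / real N0)" by (simp only: sum_distrib_right)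
      also have "(\<Sum>i<m. s (Suc i) - s i) = 1" using sum_lessThan_telescope[of s m] g by (simp add: time_grid_def)
      finally show ?thesis by simp
    qed
    have S: "ennreal (1 - \<delta>) \<le> (\<integral>\<^sup>+x. ennreal (sqrt (G (incr s m x) / l0 * step_exp coord m s \<xi> x)) \<partial>\<mu>)"
    proof -
      have "ennreal (1 - \<delta>) \<le> ennreal (1 - C * (\<Sum>i<m. (s (Suc i) - s i)\<^sup>2))"
        using mult_left_mono[OF sumh C] by (intro ennreal_leI) (simp add: \<delta>_def)
      also have "\<dots> \<le> (\<integral>\<^sup>+x. ennreal (sqrt (G (incr s m x) / l0 * step_exp coord m s \<xi> x)) \<partial>\<mu>)"
        unfolding l0_def \<xi>_def by (rule hell[OF g Gb]) (use Db Dt Dl in blast)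
      finally show ?thesis .
    qed
    have iGl: "(\<integral>x. G (incr s m x) / l0 \<partial>\<mu>) = 1"
    proof -
      have "(\<integral>x. G (incr s m x) \<partial>\<mu>) = (\<integral>x. X x \<partial>\<mu>)" by (rule Bochner_Integration.integral_cong[OF refl]) (simp add: GX)
      then show ?thesis using l0 by simp
    qed
    have "(\<integral>x. \<bar>G (incr s m x) / l0 - step_exp coord m s \<xi> x\<bar> \<partial>\<mu>) \<le> 3 * sqrt \<delta>"
    proof (rule hellinger_L1[OF _ iGl _ _ _ _ S \<delta>])
      show "integrable \<mu> (\<lambda>x. G (incr s m x) / l0)" using iG by simp
      show "0 \<le> G (incr s m x) / l0" for x
      proof -
        have "a \<le> G (incr s m x)" using Gb by (simp add: bounded_meas_def)
        then show ?thesis using aK l0 by (intro divide_nonneg_pos) auto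
      qed
    qed (use integral_step_exp[OF \<xi>] in \<open>auto intro!: less_imp_le[OF step_exp_pos(1)]\<close>)
    also have "3 * sqrt \<delta> \<le> \<epsilon>"
    proof -
      have "(3 * sqrt \<delta>)\<^sup>2 = 9 * C * (1 / real N0)" using \<delta> by (simp add: power_mult_distrib \<delta>_def)
      also have "\<dots> \<le> \<epsilon>\<^sup>2"
      proof -
        have "9 * C \<le> real N0 * \<epsilon>\<^sup>2" using bnd zero_le_power2[of K] by linarith
        then have "9 * C / real N0 \<le> \<epsilon>\<^sup>2" using N0pos by (simp only: pos_divide_le_eq of_nat_0_less_iff mult.commute)
        then show ?thesis by (simp only: times_divide_eq_right mult_1_right)
      qed
      finally show ?thesis by (rule power2_le_imp_le) (use \<epsilon> in simp)
    qed
    also have "(\<integral>x. \<bar>G (incr s m x) / l0 - step_exp coord m s \<xi> x\<bar> \<partial>\<mu>) = (\<integral>x. \<bar>step_exp coord m s \<xi> x - X x / (\<integral>x. X x \<partial>\<mu>)\<bar> \<partial>\<mu>)"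
      by (rule Bochner_Integration.integral_cong[OF refl]) (simp add: GX l0 abs_minus_commute)
    finally show ?thesis .
  qed
  show ?thesis
  proof (rule that[OF \<xi> L1 sv _ iX])
    show "0 < (\<integral>x. X x \<partial>\<mu>)" using l0 by simp
  qed (use reg in blast)+
qed

end

section \<open>Bayes' formula in the limit of the truncations\<close>

context finite_measure_subalgebra
begin

text \<open>The weights increase to c L, so monotone convergence followed by Bayes' formula applies
  to the positive and the negative part of \<open>d\<close> separately. Finiteness of the
  conditional expectation of |d| under the new measure then allows their difference to be formed,
  with no integrability of \<open>d\<close> under that measure.\<close>

lemma real_cond_exp_bayes_limit:
  fixes p :: "nat \<Rightarrow> 'a \<Rightarrow> real" and c :: real
  assumes [measurable]: "\<And>k. p k \<in> borel_measurable M" "d \<in> borel_measurable M"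
    and p0: "\<And>k x. 0 \<le> p k x" and pmono: "\<And>k x. p k x \<le> p (Suc k) x"
    and plim: "\<And>x. (\<lambda>k. p k x) \<longlonglongrightarrow> c * L x"
    and L: "integrable M L" "\<And>x. 0 < L x" and c: "0 < c"
    and fin: "AE x in density M (\<lambda>x. ennreal (L x)).
       nn_cond_exp (density M (\<lambda>x. ennreal (L x))) F (\<lambda>x. ennreal \<bar>d x\<bar>) x < \<infinity>"
  shows "AE x in M. (\<lambda>k. real_cond_exp M F (\<lambda>x. p k x * d x) x)
    \<longlonglongrightarrow> c * real_cond_exp (density M (\<lambda>x. ennreal (L x))) F d x * enn2real (nn_cond_exp M F (\<lambda>x. ennreal (L x)) x)"
proof -
  let ?N = "density M (\<lambda>x. ennreal (L x))"
  let ?e = "nn_cond_exp ?N F"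
  let ?l = "nn_cond_exp M F (\<lambda>x. ennreal (L x))"
  have Lm[measurable]: "L \<in> borel_measurable M" using L(1) by simp
  have iL: "(\<integral>\<^sup>+x. ennreal (L x) \<partial>M) = ennreal (\<integral>x. L x \<partial>M)"
    by (rule nn_integral_eq_integral[OF L(1)]) (simp add: L(2) less_imp_le)
  have finN: "finite_measure ?N"
    by (rule finite_measureI) (simp add: emeasure_density iL cong: nn_integral_cong)
  interpret N: finite_measure_subalgebra ?N F
    by (intro finite_measure_subalgebra.intro finN finite_measure_subalgebra_axioms.intro)
       (use subalg in \<open>simp add: subalgebra_def\<close>)
  have AEN: "(AE x in ?N. P x) \<longleftrightarrow> (AE x in M. P x)" for P
    by (simp add: AE_density L(2))
  have lfin: "AE x in M. ?l x \<noteq> \<infinity>"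
  proof (rule nn_integral_PInf_AE)
    have "(\<integral>\<^sup>+x. 1 * ?l x \<partial>M) = (\<integral>\<^sup>+x. 1 * ennreal (L x) \<partial>M)" by (rule nn_cond_exp_intg) simp_all
    then show "(\<integral>\<^sup>+x. ?l x \<partial>M) \<noteq> \<infinity>" using iL by simp
  qed simp
  \<comment> \<open>Used for g = d and for g = - d: since \<open>ennreal\<close> truncates at 0,
    these are the positive and the negative part of \<open>d\<close>.\<close>
  have part: "AE x in M. ?e (\<lambda>x. ennreal (g x)) x < \<infinity> \<and>
      (\<lambda>k. enn2real (nn_cond_exp M F (\<lambda>x. ennreal (p k x * g x)) x)) \<longlonglongrightarrow> c * enn2real (?e (\<lambda>x. ennreal (g x)) x) * enn2real (?l x)"
    if g[measurable]: "g \<in> borel_measurable M" and gd: "\<And>x. g x \<le> \<bar>d x\<bar>" for g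
  proof -
    have gN: "(\<lambda>x. ennreal (g x)) \<in> borel_measurable ?N" by simp
    have le: "AE x in M. ?e (\<lambda>x. ennreal (g x)) x \<le> ?e (\<lambda>x. ennreal \<bar>d x\<bar>) x"
      unfolding AEN[symmetric] by (rule N.nn_cond_exp_mono) (auto intro: ennreal_leI gd)
    have conv: "AE x in M. (\<lambda>k. nn_cond_exp M F (\<lambda>x. ennreal (p k x) * ennreal (g x)) x)
        \<longlonglongrightarrow> nn_cond_exp M F (\<lambda>x. ennreal c * (ennreal (L x) * ennreal (g x))) x"
    proof (rule nn_cond_exp_monotone_convergence)
      fix k x show "ennreal (p k x) * ennreal (g x) \<le> ennreal (p (Suc k) x) * ennreal (g x)"
        by (intro mult_right_mono ennreal_leI pmono) simp
    next
      fix x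
      have "(\<lambda>k. ennreal (p k x * g x)) \<longlonglongrightarrow> ennreal (c * L x * g x)"
        by (intro tendsto_ennrealI tendsto_mult plim tendsto_const)
      moreover have "ennreal (c * L x * g x) = ennreal c * (ennreal (L x) * ennreal (g x))"
        using c L(2)[of x] by (simp only: ennreal_mult' less_imp_le mult.assoc)
      ultimately show "(\<lambda>k. ennreal (p k x) * ennreal (g x)) \<longlonglongrightarrow> ennreal c * (ennreal (L x) * ennreal (g x))"
        by (simp only: ennreal_mult'[OF p0])
    qed simp_all
    have cm: "AE x in M. nn_cond_exp M F (\<lambda>x. ennreal c * (ennreal (L x) * ennreal (g x))) x
       = ennreal c * nn_cond_exp M F (\<lambda>x. ennreal (L x) * ennreal (g x)) x"
      by (rule nn_cond_exp_cmult) simp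
    have bay: "AE x in M. nn_cond_exp M F (\<lambda>x. ennreal (L x) * ennreal (g x)) x = ?e (\<lambda>x. ennreal (g x)) x * ?l x"
      by (rule nn_cond_exp_density) (use finN in simp_all)
    show ?thesis
      using conv cm bay le fin[unfolded AEN] lfin
    proof eventually_elim
      case (elim x)
      have f: "?e (\<lambda>x. ennreal (g x)) x < \<infinity>" using elim by (auto intro: le_less_trans)
      have "(\<lambda>k. nn_cond_exp M F (\<lambda>x. ennreal (p k x) * ennreal (g x)) x) \<longlonglongrightarrow> ennreal c * (?e (\<lambda>x. ennreal (g x)) x * ?l x)"
        using elim by simp
      moreover have "ennreal c * (?e (\<lambda>x. ennreal (g x)) x * ?l x) = ennreal (c * enn2real (?e (\<lambda>x. ennreal (g x)) x) * enn2real (?l x))"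
        using f elim c by (simp add: ennreal_mult mult.assoc ennreal_enn2real_if less_top)
      ultimately have "(\<lambda>k. enn2real (nn_cond_exp M F (\<lambda>x. ennreal (p k x) * ennreal (g x)) x)) \<longlonglongrightarrow> c * enn2real (?e (\<lambda>x. ennreal (g x)) x) * enn2real (?l x)"
        by (intro tendsto_enn2real) (use c in simp_all)
      moreover have "(\<lambda>x. ennreal (p k x * g x)) = (\<lambda>x. ennreal (p k x) * ennreal (g x))" for k
        by (rule ext) (rule ennreal_mult'[OF p0])
      ultimately show ?case using f by simp
    qed
  qed
  have md: "(\<lambda>x. - d x) \<in> borel_measurable M" by simp
  show ?thesis
    using part[OF assms(2) abs_ge_self] part[OF md abs_ge_minus_self]
  proof eventually_elim
    case (elim x)
    then have "(\<lambda>k. enn2real (nn_cond_exp M F (\<lambda>x. ennreal (p k x * d x)) x) - enn2real (nn_cond_exp M F (\<lambda>x. ennreal (- (p k x * d x))) x))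
       \<longlonglongrightarrow> c * enn2real (?e (\<lambda>x. ennreal (d x)) x) * enn2real (?l x) - c * enn2real (?e (\<lambda>x. ennreal (- d x)) x) * enn2real (?l x)"
      by (intro tendsto_diff) auto
    then show ?case unfolding real_cond_exp_def by (simp add: algebra_simps)
  qed
qed

lemma real_cond_exp_one: "AE x in M. real_cond_exp M F (\<lambda>_. 1) x = 1"
  by (rule real_cond_exp_F_meas) auto

text \<open>\<open>real_cond_exp_bayes_limit\<close> is applied to \<open>d\<close> with the weights
  - \<open>recip'\<close> and to the constant 1 with the weights \<open>recip\<close>. Both limits
  carry the factor c E[L | F], almost surely positive, which cancels in the quotient.\<close>

lemma cond_exp_ratio_limit:
  fixes c :: real
  assumes [measurable]: "f \<in> borel_measurable M" "d \<in> borel_measurable M"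
    and L: "integrable M L" and Lf: "\<And>x. c * L x = exp (- f x)" and c: "0 < c"
    and fin: "AE x in density M (\<lambda>x. ennreal (L x)).
       nn_cond_exp (density M (\<lambda>x. ennreal (L x))) F (\<lambda>x. ennreal \<bar>d x\<bar>) x < \<infinity>"
    and num: "AE x in M. (\<lambda>k. num k x - real_cond_exp M F (\<lambda>x. recip' (1 / real (Suc k)) (f x) * d x) x) \<longlonglongrightarrow> 0"
    and den: "AE x in M. (\<lambda>k. den k x - real_cond_exp M F (\<lambda>x. recip (1 / real (Suc k)) (f x)) x) \<longlonglongrightarrow> 0"
  shows "AE x in M. (\<lambda>k. - num k x / den k x) \<longlonglongrightarrow> real_cond_exp (density M (\<lambda>x. ennreal (L x))) F d x"
proof -
  let ?N = "density M (\<lambda>x. ennreal (L x))"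
  let ?l = "nn_cond_exp M F (\<lambda>x. ennreal (L x))"
  have Lm[measurable]: "L \<in> borel_measurable M" using L by simp
  have Lpos: "0 < L x" for x
  proof -
    have "0 < c * L x" using Lf by simp
    then show ?thesis using c by (simp add: zero_less_mult_iff)
  qed
  have iL: "(\<integral>\<^sup>+x. ennreal (L x) \<partial>M) = ennreal (\<integral>x. L x \<partial>M)"
    by (rule nn_integral_eq_integral[OF L]) (simp add: Lpos less_imp_le)
  have finN: "finite_measure ?N"
    by (rule finite_measureI) (simp add: emeasure_density iL cong: nn_integral_cong)
  interpret N: finite_measure_subalgebra ?N F
    by (intro finite_measure_subalgebra.intro finN finite_measure_subalgebra_axioms.intro)
       (use subalg in \<open>simp add: subalgebra_def\<close>)
  have AEN: "(AE x in ?N. P x) \<longleftrightarrow> (AE x in M. P x)" for P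
    by (simp add: AE_density Lpos)
  have lpos: "AE x in M. 0 < enn2real (?l x)"
  proof -
    have "AE x in M. 0 < real_cond_exp M F L x"
      by (rule real_cond_exp_gr_c[OF L]) (simp add: Lpos)
    then show ?thesis
    proof eventually_elim
      case (elim x)
      have "real_cond_exp M F L x \<le> enn2real (?l x)" unfolding real_cond_exp_def by simp
      then show ?case using elim by linarith
    qed
  qed
  have kap: "0 < 1 / real (Suc k)" "1 / real (Suc (Suc k)) \<le> 1 / real (Suc k)" for k by (auto simp: frac_le)
  have n: "AE x in M. (\<lambda>k. real_cond_exp M F (\<lambda>x. - recip' (1 / real (Suc k)) (f x) * d x) x)
    \<longlonglongrightarrow> c * real_cond_exp ?N F d x * enn2real (?l x)"
  proof (rule real_cond_exp_bayes_limit[OF _ _ _ _ _ L Lpos c fin])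
    fix k x
    show "0 \<le> - recip' (1 / real (Suc k)) (f x)" using recip_bounds(4)[OF kap(1)] by simp
    show "- recip' (1 / real (Suc k)) (f x) \<le> - recip' (1 / real (Suc (Suc k))) (f x)"
      by (rule recip_mono(2)[OF kap(1) kap(2)])
  next
    fix x show "(\<lambda>k. - recip' (1 / real (Suc k)) (f x)) \<longlonglongrightarrow> c * L x"
      using tendsto_minus[OF recip_tendsto(2)[of "f x"]] by (simp only: Lf minus_minus)
  qed simp_all
  have r: "AE x in M. (\<lambda>k. real_cond_exp M F (\<lambda>x. recip (1 / real (Suc k)) (f x) * 1) x)
    \<longlonglongrightarrow> c * real_cond_exp ?N F (\<lambda>_. 1) x * enn2real (?l x)"
  proof (rule real_cond_exp_bayes_limit[OF _ _ _ _ _ L Lpos c])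
    fix k x
    show "0 \<le> recip (1 / real (Suc k)) (f x)" using recip_bounds(1)[OF kap(1)] by (rule less_imp_le)
    show "recip (1 / real (Suc k)) (f x) \<le> recip (1 / real (Suc (Suc k))) (f x)"
      by (rule recip_mono(1)[OF kap(1) kap(2)])
  next
    fix x show "(\<lambda>k. recip (1 / real (Suc k)) (f x)) \<longlonglongrightarrow> c * L x"
      using recip_tendsto(1)[of "f x"] by (simp only: Lf)
  next
    have "AE x in ?N. (1::ennreal) = nn_cond_exp ?N F (\<lambda>_. 1) x"
      by (rule N.nn_cond_exp_F_meas) simp
    then show "AE x in ?N. nn_cond_exp ?N F (\<lambda>x. ennreal \<bar>1\<bar>) x < \<infinity>"
      by eventually_elim simp
  qed simp_all
  have ng: "AE x in M. \<forall>k. real_cond_exp M F (\<lambda>x. - recip' (1 / real (Suc k)) (f x) * d x) x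
     = - real_cond_exp M F (\<lambda>x. recip' (1 / real (Suc k)) (f x) * d x) x"
    by (intro AE_I2 allI) (simp add: real_cond_exp_def)
  show ?thesis
    using n r ng num den lpos N.real_cond_exp_one[unfolded AEN]
  proof eventually_elim
    case (elim x)
    let ?a = "\<lambda>k. real_cond_exp M F (\<lambda>x. recip' (1 / real (Suc k)) (f x) * d x) x"
    let ?b = "\<lambda>k. real_cond_exp M F (\<lambda>x. recip (1 / real (Suc k)) (f x)) x"
    let ?R = "real_cond_exp ?N F d x" and ?y = "enn2real (?l x)"
    have a: "(\<lambda>k. - ?a k) \<longlonglongrightarrow> c * ?R * ?y" using elim(1,3) by simp
    have b: "?b \<longlonglongrightarrow> c * ?y" using elim(2,7) by simp
    have "(\<lambda>k. - ?a k - (num k x - ?a k)) \<longlonglongrightarrow> c * ?R * ?y - 0" by (rule tendsto_diff[OF a elim(4)])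
    then have n': "(\<lambda>k. - num k x) \<longlonglongrightarrow> c * ?R * ?y" by simp
    have "(\<lambda>k. ?b k + (den k x - ?b k)) \<longlonglongrightarrow> c * ?y + 0" by (rule tendsto_add[OF b elim(5)])
    then have d': "(\<lambda>k. den k x) \<longlonglongrightarrow> c * ?y" by simp
    have nz: "c * ?y \<noteq> 0" using c elim(6) by simp
    have "(\<lambda>k. - num k x / den k x) \<longlonglongrightarrow> c * ?R * ?y / (c * ?y)" by (rule tendsto_divide[OF n' d' nz])
    then show ?case using c elim(6) by simp
  qed
qed

end

section \<open>Approximation errors with summable rates\<close>

text \<open>With w = y^2 |z| and v = y^2 |b| this is 1 / y times the sum of w \<le> w^2 + 1 and 3 v
  |d| \<le> 2 v^2 + 2 d^2. For large y the fixed term carries the small factor 1 / y, and y^3 falls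
  on squares that are smaller still.\<close>

lemma weighted_young:
  fixes y z b d :: real
  assumes y: "0 < y"
  shows "y * \<bar>z\<bar> + 3 * y * (\<bar>b\<bar> * \<bar>d\<bar>) \<le> y ^ 3 * z\<^sup>2 + 1 / y * (1 + 2 * d\<^sup>2) + 2 * y ^ 3 * b\<^sup>2"
proof -
  define w where "w = y\<^sup>2 * \<bar>z\<bar>"
  define v where "v = y\<^sup>2 * \<bar>b\<bar>"
  have "0 \<le> (w - 1/2)\<^sup>2 + 3/4 + ((v - \<bar>d\<bar>)\<^sup>2 * 3/2 + (v\<^sup>2 + d\<^sup>2) / 2)" by (intro add_nonneg_nonneg) auto
  also have "\<dots> = w\<^sup>2 - w + 1 + (2 * v\<^sup>2 + 2 * d\<^sup>2 - 3 * (v * \<bar>d\<bar>))"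
    by (simp add: power2_eq_square field_simps)
  finally have "0 \<le> (1 / y) * (w\<^sup>2 - w + 1 + (2 * v\<^sup>2 + 2 * d\<^sup>2 - 3 * (v * \<bar>d\<bar>)))" using y by simp
  also have "\<dots> = y ^ 3 * z\<^sup>2 + 1 / y * (1 + 2 * d\<^sup>2) + 2 * y ^ 3 * b\<^sup>2 - (y * \<bar>z\<bar> + 3 * y * (\<bar>b\<bar> * \<bar>d\<bar>))"
    using y by (simp add: w_def v_def field_simps power2_eq_square power3_eq_cube)
  finally show ?thesis by simp
qed

lemma recip'_product_diff:
  assumes y: "real (Suc k) \<le> y"
  shows "\<bar>recip' (1 / real (Suc k)) a * d' - recip' (1 / real (Suc k)) b * d\<bar>
    \<le> y ^ 3 * (d' - d)\<^sup>2 + 1 / y * (1 + 2 * d\<^sup>2) + 2 * y ^ 3 * (a - b)\<^sup>2"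
proof -
  let ?\<kappa> = "1 / real (Suc k)"
  have \<kappa>: "0 < ?\<kappa>" by simp
  have y0: "0 < y" using y by simp
  have "recip' ?\<kappa> a * d' - recip' ?\<kappa> b * d = recip' ?\<kappa> a * (d' - d) + (recip' ?\<kappa> a - recip' ?\<kappa> b) * d"
    by (simp add: algebra_simps)
  then have "\<bar>recip' ?\<kappa> a * d' - recip' ?\<kappa> b * d\<bar> \<le> \<bar>recip' ?\<kappa> a\<bar> * \<bar>d' - d\<bar> + \<bar>recip' ?\<kappa> a - recip' ?\<kappa> b\<bar> * \<bar>d\<bar>"
    using abs_triangle_ineq[of "recip' ?\<kappa> a * (d' - d)" "(recip' ?\<kappa> a - recip' ?\<kappa> b) * d"] by (simp only: abs_mult)
  moreover have "\<bar>recip' ?\<kappa> a\<bar> * \<bar>d' - d\<bar> \<le> y * \<bar>d' - d\<bar>"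
    by (rule mult_right_mono) (use recip_bounds(6)[OF \<kappa>, of a] y in simp_all)
  moreover have "\<bar>recip' ?\<kappa> a - recip' ?\<kappa> b\<bar> * \<bar>d\<bar> \<le> 3 * y * (\<bar>a - b\<bar> * \<bar>d\<bar>)"
  proof -
    have "\<bar>recip' ?\<kappa> a - recip' ?\<kappa> b\<bar> \<le> (3 * real (Suc k)) * \<bar>a - b\<bar>" using recip'_lipschitz[OF \<kappa>, of a b] by simp
    also have "\<dots> \<le> (3 * y) * \<bar>a - b\<bar>" by (rule mult_right_mono) (use y in simp_all)
    finally have "\<bar>recip' ?\<kappa> a - recip' ?\<kappa> b\<bar> * \<bar>d\<bar> \<le> ((3 * y) * \<bar>a - b\<bar>) * \<bar>d\<bar>" by (rule mult_right_mono) simp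
    then show ?thesis by (simp only: mult.assoc)
  qed
  ultimately show ?thesis using weighted_young[OF y0, of "d' - d" "a - b" d] by linarith
qed

lemma Suc_le_two_power: "real (Suc k) \<le> 2 ^ k"
  by (induction k) auto

lemma suminf_geometric_ennreal: "(\<Sum>k. ennreal ((1/2) ^ k * C)) < \<infinity>"
proof (cases "0 \<le> C")
  case True
  have "summable (\<lambda>k. (1/2::real) ^ k * C)" by (intro summable_mult2 summable_geometric) simp
  then show ?thesis using True by (simp add: ennreal_suminf_neq_top less_top)
next
  case False
  then have "ennreal ((1/2) ^ k * C) = 0" for k by (simp add: ennreal_neg mult_nonneg_nonpos)
  then show ?thesis by simp
qed

context prob_space
begin

text \<open>At truncation level 1 / (k + 1) the Lipschitz constants grow linearly in k, hence are at
  most multiples of y = 2^k. In \<open>weighted_young\<close> the squared errors then contribute y^3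
  16^(- k) = 2^(- k) and the fixed term 1 / y = 2^(- k), so the sum converges; integrating it over
  time gives finiteness for almost every t.\<close>

lemma summable_approximation_errors:
  assumes f[measurable]: "f \<in> borel_measurable M" "\<And>k. f' k \<in> borel_measurable M"
    and D: "measurable_process M D" "\<And>k. measurable_process M (D' k)"
    and A: "\<And>k. (\<integral>\<^sup>+x. ennreal ((f' k x - f x)\<^sup>2) \<partial>M) \<le> ennreal ((1/16) ^ k)"
    and B: "\<And>k. (\<integral>\<^sup>+x. \<integral>\<^sup>+t. ennreal ((D' k t x - D t x)\<^sup>2) \<partial>leb01 \<partial>M) \<le> ennreal ((1/16) ^ k)"
    and C: "(\<integral>\<^sup>+x. \<integral>\<^sup>+t. ennreal ((D t x)\<^sup>2) \<partial>leb01 \<partial>M) < \<infinity>"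
  shows "AE t in leb01. (\<Sum>k. \<integral>\<^sup>+x. ennreal \<bar>recip' (1 / real (Suc k)) (f' k x) * D' k t x
      - recip' (1 / real (Suc k)) (f x) * D t x\<bar> \<partial>M) < \<infinity>"
    and "(\<integral>\<^sup>+x. ennreal \<bar>recip (1 / real (Suc k)) (f' k x) - recip (1 / real (Suc k)) (f x)\<bar> \<partial>M) \<le> ennreal ((1/2) ^ k * 2)"
proof -
  interpret T: prob_space leb01 by (rule prob_space_leb01)
  interpret P: pair_prob_space leb01 M ..
  let ?P = "leb01 \<Otimes>\<^sub>M M"
  have [measurable]: "(\<lambda>p. D (fst p) (snd p)) \<in> borel_measurable ?P" "(\<lambda>p. D' k (fst p) (snd p)) \<in> borel_measurable ?P" for k
    using D by (auto simp: measurable_process_def split_beta)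
  define Cr where "Cr = enn2real (\<integral>\<^sup>+x. \<integral>\<^sup>+t. ennreal ((D t x)\<^sup>2) \<partial>leb01 \<partial>M)"
  define g where "g = (\<lambda>k p. ennreal \<bar>recip' (1 / real (Suc k)) (f' k (snd p)) * D' k (fst p) (snd p)
      - recip' (1 / real (Suc k)) (f (snd p)) * D (fst p) (snd p)\<bar>)"
  have gm[measurable]: "g k \<in> borel_measurable ?P" for k unfolding g_def by measurable
  have one: "emeasure ?P (space ?P) = 1" by (rule P.P.emeasure_space_1)
  have CP: "(\<integral>\<^sup>+p. ennreal ((D (fst p) (snd p))\<^sup>2) \<partial>?P) = ennreal Cr"
    using P.nn_integral_snd[of "\<lambda>p. ennreal ((D (fst p) (snd p))\<^sup>2)"] C by (simp add: Cr_def less_top)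
  have BP: "(\<integral>\<^sup>+p. ennreal ((D' k (fst p) (snd p) - D (fst p) (snd p))\<^sup>2) \<partial>?P) \<le> ennreal ((1/16) ^ k)" for k
    using P.nn_integral_snd[of "\<lambda>p. ennreal ((D' k (fst p) (snd p) - D (fst p) (snd p))\<^sup>2)"] B[of k] by simp
  have AP: "(\<integral>\<^sup>+p. ennreal ((f' k (snd p) - f (snd p))\<^sup>2) \<partial>?P) \<le> ennreal ((1/16) ^ k)" for k
  proof -
    have "(\<integral>\<^sup>+p. ennreal ((f' k (snd p) - f (snd p))\<^sup>2) \<partial>?P) = (\<integral>\<^sup>+x. \<integral>\<^sup>+t. ennreal ((f' k x - f x)\<^sup>2) \<partial>leb01 \<partial>M)"
      using P.nn_integral_snd[of "\<lambda>p. ennreal ((f' k (snd p) - f (snd p))\<^sup>2)"] by simp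
    also have "\<dots> = (\<integral>\<^sup>+x. ennreal ((f' k x - f x)\<^sup>2) \<partial>M)" by (simp add: T.emeasure_space_1[simplified])
    finally show ?thesis using A by simp
  qed
  have CP1: "(\<integral>\<^sup>+p. ennreal (1 + 2 * (D (fst p) (snd p))\<^sup>2) \<partial>?P) = ennreal (1 + 2 * Cr)"
  proof -
    have "(\<integral>\<^sup>+p. ennreal (1 + 2 * (D (fst p) (snd p))\<^sup>2) \<partial>?P) = (\<integral>\<^sup>+p. 1 + 2 * ennreal ((D (fst p) (snd p))\<^sup>2) \<partial>?P)"
      by (intro nn_integral_cong) (simp add: ennreal_mult'')
    also have "\<dots> = 1 + 2 * ennreal Cr"
      by (subst nn_integral_add) (auto simp: nn_integral_cmult CP one)
    also have "\<dots> = ennreal (1 + 2 * Cr)" by (simp add: Cr_def ennreal_mult'')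
    finally show ?thesis .
  qed
  have y8: "((2::real) ^ k) ^ 3 * (1/16) ^ k = (1/2) ^ k" for k
  proof -
    have "((2::real) ^ k) ^ 3 = (2 ^ 3) ^ k" by (simp only: power_mult[symmetric] mult.commute)
    then show ?thesis by (simp only: power_mult_distrib[symmetric]) simp
  qed
  have gk: "(\<integral>\<^sup>+p. g k p \<partial>?P) \<le> ennreal ((1/2) ^ k * (4 + 2 * Cr))" for k
  proof -
    define y :: real where "y = 2 ^ k"
    have y: "real (Suc k) \<le> y" "0 < y" using Suc_le_two_power by (auto simp: y_def)
    have "(\<integral>\<^sup>+p. g k p \<partial>?P) \<le> (\<integral>\<^sup>+p. ennreal (y^3) * ennreal ((D' k (fst p) (snd p) - D (fst p) (snd p))\<^sup>2)
        + ennreal (1/y) * ennreal (1 + 2 * (D (fst p) (snd p))\<^sup>2)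
        + ennreal (2 * y^3) * ennreal ((f' k (snd p) - f (snd p))\<^sup>2) \<partial>?P)"
    proof (rule nn_integral_mono)
      fix p
      have "g k p \<le> ennreal (y ^ 3 * (D' k (fst p) (snd p) - D (fst p) (snd p))\<^sup>2 + 1 / y * (1 + 2 * (D (fst p) (snd p))\<^sup>2)
          + 2 * y ^ 3 * (f' k (snd p) - f (snd p))\<^sup>2)"
        unfolding g_def by (rule ennreal_leI, rule recip'_product_diff[OF y(1)])
      also have "\<dots> = ennreal (y^3) * ennreal ((D' k (fst p) (snd p) - D (fst p) (snd p))\<^sup>2)
        + ennreal (1/y) * ennreal (1 + 2 * (D (fst p) (snd p))\<^sup>2)
        + ennreal (2 * y^3) * ennreal ((f' k (snd p) - f (snd p))\<^sup>2)"
      proof -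
        have n: "0 \<le> y^3" "0 \<le> 1/y" "0 \<le> 2 * y^3" "0 \<le> 1 + 2 * (D (fst p) (snd p))\<^sup>2" using y(2) by auto
        show ?thesis
          by (subst ennreal_plus, use n in \<open>simp\<close>, use n in \<open>simp\<close>, subst ennreal_plus, use n in \<open>simp\<close>, use n in \<open>simp\<close>,
              simp only: ennreal_mult[OF n(1)] ennreal_mult[OF n(2,4)] ennreal_mult[OF n(3)] zero_le_power2)
      qed
      finally show "g k p \<le> ennreal (y^3) * ennreal ((D' k (fst p) (snd p) - D (fst p) (snd p))\<^sup>2)
        + ennreal (1/y) * ennreal (1 + 2 * (D (fst p) (snd p))\<^sup>2)
        + ennreal (2 * y^3) * ennreal ((f' k (snd p) - f (snd p))\<^sup>2)" .
    qed
    also have "\<dots> = ennreal (y^3) * (\<integral>\<^sup>+p. ennreal ((D' k (fst p) (snd p) - D (fst p) (snd p))\<^sup>2) \<partial>?P)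
        + ennreal (1/y) * ennreal (1 + 2 * Cr) + ennreal (2 * y^3) * (\<integral>\<^sup>+p. ennreal ((f' k (snd p) - f (snd p))\<^sup>2) \<partial>?P)"
      by (subst nn_integral_add, measurable, subst nn_integral_add, measurable)
         (simp add: nn_integral_cmult CP1 del: ennreal_plus)
    also have "\<dots> \<le> ennreal (y^3) * ennreal ((1/16)^k) + ennreal (1/y) * ennreal (1 + 2 * Cr) + ennreal (2 * y^3) * ennreal ((1/16)^k)"
      by (intro add_mono mult_left_mono BP AP order_refl) simp_all
    also have "\<dots> = ennreal (y^3 * (1/16)^k + 1/y * (1 + 2 * Cr) + 2 * y^3 * (1/16)^k)"
      using y(2) by (simp add: ennreal_mult[symmetric] Cr_def ennreal_plus[symmetric] del: ennreal_plus)
    also have "y^3 * (1/16)^k + 1/y * (1 + 2 * Cr) + 2 * y^3 * (1/16)^k = (1/2) ^ k * (4 + 2 * Cr)"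
    proof -
      have h: "y^3 * (1/16)^k = (1/2)^k" "1/y = (1/2)^k" using y8[of k] by (simp_all add: y_def power_one_over)
      show ?thesis unfolding mult.assoc[of 2] h by (simp add: algebra_simps)
    qed
    finally show ?thesis .
  qed
  have "(\<integral>\<^sup>+t. (\<Sum>k. \<integral>\<^sup>+x. g k (t, x) \<partial>M) \<partial>leb01) = (\<Sum>k. \<integral>\<^sup>+t. \<integral>\<^sup>+x. g k (t, x) \<partial>M \<partial>leb01)"
    by (rule nn_integral_suminf) measurable
  also have "\<dots> = (\<Sum>k. \<integral>\<^sup>+p. g k p \<partial>?P)"
    by (rule suminf_cong) (rule nn_integral_fst[OF gm])
  also have "\<dots> \<le> (\<Sum>k. ennreal ((1/2) ^ k * (4 + 2 * Cr)))"
    by (intro suminf_le gk) simp_all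
  also have "\<dots> < \<infinity>" by (rule suminf_geometric_ennreal)
  finally have "AE t in leb01. (\<Sum>k. \<integral>\<^sup>+x. g k (t, x) \<partial>M) \<noteq> \<infinity>"
    by (intro nn_integral_PInf_AE) (simp_all, measurable)
  then show "AE t in leb01. (\<Sum>k. \<integral>\<^sup>+x. ennreal \<bar>recip' (1 / real (Suc k)) (f' k x) * D' k t x
      - recip' (1 / real (Suc k)) (f x) * D t x\<bar> \<partial>M) < \<infinity>"
    unfolding g_def fst_conv snd_conv by eventually_elim (simp add: less_top)
  define y :: real where "y = 2 ^ k"
  have y: "real (Suc k) \<le> y" "0 < y" using Suc_le_two_power by (auto simp: y_def)
  have "(\<integral>\<^sup>+x. ennreal \<bar>recip (1 / real (Suc k)) (f' k x) - recip (1 / real (Suc k)) (f x)\<bar> \<partial>M)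
      \<le> (\<integral>\<^sup>+x. ennreal (y^3) * ennreal ((f' k x - f x)\<^sup>2) + ennreal (1/y) \<partial>M)"
  proof (rule nn_integral_mono)
    fix x
    have "\<bar>recip (1 / real (Suc k)) (f' k x) - recip (1 / real (Suc k)) (f x)\<bar> \<le> real (Suc k) * \<bar>f' k x - f x\<bar>"
      using recip_lipschitz[of "1 / real (Suc k)" "f' k x" "f x"] by simp
    also have "\<dots> \<le> y * \<bar>f' k x - f x\<bar>" by (rule mult_right_mono[OF y(1)]) simp
    also have "\<dots> \<le> y^3 * (f' k x - f x)\<^sup>2 + 1/y"
      using weighted_young[OF y(2), of "f' k x - f x" 0 0] by simp
    finally have "ennreal \<bar>recip (1 / real (Suc k)) (f' k x) - recip (1 / real (Suc k)) (f x)\<bar> \<le> ennreal (y^3 * (f' k x - f x)\<^sup>2 + 1/y)"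
      by (rule ennreal_leI)
    also have "\<dots> = ennreal (y^3) * ennreal ((f' k x - f x)\<^sup>2) + ennreal (1/y)"
      using y(2) by (simp add: ennreal_mult)
    finally show "ennreal \<bar>recip (1 / real (Suc k)) (f' k x) - recip (1 / real (Suc k)) (f x)\<bar> \<le> ennreal (y^3) * ennreal ((f' k x - f x)\<^sup>2) + ennreal (1/y)" .
  qed
  also have "\<dots> = ennreal (y^3) * (\<integral>\<^sup>+x. ennreal ((f' k x - f x)\<^sup>2) \<partial>M) + ennreal (1/y)"
    by (subst nn_integral_add) (simp_all add: nn_integral_cmult emeasure_space_1)
  also have "\<dots> \<le> ennreal (y^3) * ennreal ((1/16)^k) + ennreal (1/y)"
    by (intro add_mono mult_left_mono A order_refl) simp
  also have "\<dots> = ennreal (y^3 * (1/16)^k + 1/y)" using y(2) by (simp add: ennreal_mult)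
  also have "y^3 * (1/16)^k + 1/y = (1/2)^k * 2" using y8[of k] by (simp add: y_def power_one_over)
  finally show "(\<integral>\<^sup>+x. ennreal \<bar>recip (1 / real (Suc k)) (f' k x) - recip (1 / real (Suc k)) (f x)\<bar> \<partial>M) \<le> ennreal ((1/2) ^ k * 2)" .
qed

end

text \<open>Exchanging the normalising constants costs no more than the L^1 distance divided by the
  first of them, which explains the 2.\<close>

lemma (in prob_space) normalized_L1_distance:
  fixes X E :: "'a \<Rightarrow> real"
  assumes X: "integrable M X" and E: "integrable M E" "\<And>x. 0 \<le> E x"
    and a: "0 < (\<integral>x. X x \<partial>M)" and c: "0 < (\<integral>x. E x \<partial>M)"
  shows "(\<integral>x. \<bar>X x / (\<integral>x. X x \<partial>M) - E x / (\<integral>x. E x \<partial>M)\<bar> \<partial>M) \<le> 2 / (\<integral>x. X x \<partial>M) * (\<integral>x. \<bar>X x - E x\<bar> \<partial>M)"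
proof -
  define a where "a = (\<integral>x. X x \<partial>M)"
  define c where "c = (\<integral>x. E x \<partial>M)"
  define d where "d = (\<integral>x. \<bar>X x - E x\<bar> \<partial>M)"
  have ac: "0 < a" "0 < c" using assms by (simp_all add: a_def c_def)
  have "\<bar>a - c\<bar> = \<bar>\<integral>x. X x - E x \<partial>M\<bar>" using X E by (simp add: a_def c_def)
  then have d: "\<bar>a - c\<bar> \<le> d" unfolding d_def using integral_abs_bound[of M "\<lambda>x. X x - E x"] by simp
  have "(\<integral>x. \<bar>X x / a - E x / c\<bar> \<partial>M) \<le> (\<integral>x. 1 / a * \<bar>X x - E x\<bar> + \<bar>a - c\<bar> / (a * c) * E x \<partial>M)"
  proof (rule integral_mono)
    fix x
    have "X x / a - E x / c = 1 / a * (X x - E x) + (c - a) / (a * c) * E x" using ac by (simp add: field_simps)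
    then have "\<bar>X x / a - E x / c\<bar> \<le> \<bar>1 / a * (X x - E x)\<bar> + \<bar>(c - a) / (a * c) * E x\<bar>" by (simp only: abs_triangle_ineq)
    also have "\<bar>1 / a * (X x - E x)\<bar> + \<bar>(c - a) / (a * c) * E x\<bar> = 1 / a * \<bar>X x - E x\<bar> + \<bar>a - c\<bar> / (a * c) * E x"
      using ac E(2)[of x] by (simp add: abs_mult abs_minus_commute)
    finally show "\<bar>X x / a - E x / c\<bar> \<le> 1 / a * \<bar>X x - E x\<bar> + \<bar>a - c\<bar> / (a * c) * E x" .
  qed (use X E in simp_all)
  also have "\<dots> = 1 / a * d + \<bar>a - c\<bar> / (a * c) * c" using X E by (simp add: d_def c_def)
  also have "\<dots> = 1 / a * d + 1 / a * \<bar>a - c\<bar>" using ac by simp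
  also have "\<dots> \<le> 1 / a * d + 1 / a * d" using d ac by (intro add_left_mono mult_left_mono) auto
  finally show ?thesis by (simp add: a_def c_def d_def)
qed

context finite_measure_subalgebra
begin

lemma nn_integral_cond_exp_diff_le:
  assumes "integrable M Y" "integrable M Z"
  shows "(\<integral>\<^sup>+x. ennreal \<bar>real_cond_exp M F Y x - real_cond_exp M F Z x\<bar> \<partial>M) \<le> (\<integral>\<^sup>+x. ennreal \<bar>Y x - Z x\<bar> \<partial>M)"
proof -
  have i: "integrable M (\<lambda>x. Y x - Z x)" using assms by simp
  have ae: "AE x in M. real_cond_exp M F (\<lambda>x. Y x - Z x) x = real_cond_exp M F Y x - real_cond_exp M F Z x"
    by (rule real_cond_exp_diff[OF assms])
  have "(\<integral>\<^sup>+x. ennreal \<bar>real_cond_exp M F Y x - real_cond_exp M F Z x\<bar> \<partial>M) = (\<integral>\<^sup>+x. ennreal \<bar>real_cond_exp M F (\<lambda>x. Y x - Z x) x\<bar> \<partial>M)"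
    by (rule nn_integral_cong_AE) (use ae in eventually_elim, simp)
  also have "\<dots> = ennreal (\<integral>x. \<bar>real_cond_exp M F (\<lambda>x. Y x - Z x) x\<bar> \<partial>M)"
    by (rule nn_integral_eq_integral) (use real_cond_exp_int(1)[OF i] in simp_all)
  also have "\<dots> \<le> ennreal (\<integral>x. \<bar>Y x - Z x\<bar> \<partial>M)"
    by (rule ennreal_leI, rule real_cond_exp_L1_contraction[OF i])
  also have "\<dots> = (\<integral>\<^sup>+x. ennreal \<bar>Y x - Z x\<bar> \<partial>M)"
    by (rule nn_integral_eq_integral[symmetric]) (use i in simp_all)
  finally show ?thesis .
qed

text \<open>The error is split at the conditional expectation of \<open>Y k\<close>. Conditioning
  contracts L^1, so both parts have summable norms and the whole sequence converges almost
  surely.\<close>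

lemma AE_cond_exp_approx:
  assumes [measurable]: "\<And>k. X k \<in> borel_measurable M"
    and X: "\<And>k. (\<integral>\<^sup>+x. ennreal \<bar>X k x - real_cond_exp M F (Y k) x\<bar> \<partial>M) \<le> ennreal ((1/2) ^ k)"
    and i: "\<And>k. integrable M (Y k)" "\<And>k. integrable M (Z k)"
    and YZ: "(\<Sum>k. \<integral>\<^sup>+x. ennreal \<bar>Y k x - Z k x\<bar> \<partial>M) < \<infinity>"
  shows "AE x in M. (\<lambda>k. X k x - real_cond_exp M F (Z k) x) \<longlonglongrightarrow> 0"
proof (rule AE_tendsto_zero_of_summable)
  have "(\<integral>\<^sup>+x. ennreal \<bar>X k x - real_cond_exp M F (Z k) x\<bar> \<partial>M) \<le> ennreal ((1/2) ^ k * 1) + (\<integral>\<^sup>+x. ennreal \<bar>Y k x - Z k x\<bar> \<partial>M)" for k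
  proof -
    have "(\<integral>\<^sup>+x. ennreal \<bar>X k x - real_cond_exp M F (Z k) x\<bar> \<partial>M)
       \<le> (\<integral>\<^sup>+x. ennreal \<bar>X k x - real_cond_exp M F (Y k) x\<bar> + ennreal \<bar>real_cond_exp M F (Y k) x - real_cond_exp M F (Z k) x\<bar> \<partial>M)"
      by (rule nn_integral_mono) (simp add: ennreal_plus[symmetric] del: ennreal_plus)
    also have "\<dots> = (\<integral>\<^sup>+x. ennreal \<bar>X k x - real_cond_exp M F (Y k) x\<bar> \<partial>M) + (\<integral>\<^sup>+x. ennreal \<bar>real_cond_exp M F (Y k) x - real_cond_exp M F (Z k) x\<bar> \<partial>M)"
      by (rule nn_integral_add) measurable
    also have "\<dots> \<le> ennreal ((1/2) ^ k * 1) + (\<integral>\<^sup>+x. ennreal \<bar>Y k x - Z k x\<bar> \<partial>M)"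
      using X[of k] nn_integral_cond_exp_diff_le[OF i(1)[of k] i(2)[of k]] by (intro add_mono) simp_all
    finally show ?thesis .
  qed
  then have "(\<Sum>k. \<integral>\<^sup>+x. ennreal \<bar>X k x - real_cond_exp M F (Z k) x\<bar> \<partial>M) \<le> (\<Sum>k. ennreal ((1/2) ^ k * 1) + (\<integral>\<^sup>+x. ennreal \<bar>Y k x - Z k x\<bar> \<partial>M))"
    by (intro suminf_le) simp_all
  also have "\<dots> = (\<Sum>k. ennreal ((1/2) ^ k * 1)) + (\<Sum>k. \<integral>\<^sup>+x. ennreal \<bar>Y k x - Z k x\<bar> \<partial>M)"
    by (rule suminf_add[symmetric]) simp_all
  also have "\<dots> < \<infinity>"
    using suminf_geometric_ennreal[of 1] YZ by (simp only: ennreal_add_less_top[folded infinity_ennreal_def] simp_thms)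
  finally show "(\<Sum>k. \<integral>\<^sup>+x. ennreal \<bar>X k x - real_cond_exp M F (Z k) x\<bar> \<partial>M) < \<infinity>" .
qed measurable

end

section \<open>Assembly of the approximating step processes\<close>

context wiener_setting
begin

lemma cyl_measurable:
  assumes q: "smooth_bounded n q" and r: "\<And>i. i < n \<Longrightarrow> r i \<in> {0..1}" and \<alpha>: "\<alpha> \<in> lists {..<n}" "length \<alpha> \<le> 1"
  shows "(\<lambda>x. q \<alpha> (\<lambda>j. x (r j))) \<in> borel_measurable \<mu>"
proof -
  \<comment> \<open>The times \<open>r j\<close> with j \<ge> n are unconstrained, so these entries
    are replaced by 0, which q does not see.\<close>
  have eq: "(\<lambda>x. q \<alpha> (\<lambda>j. x (r j))) = (\<lambda>x. q \<alpha> (\<lambda>j. if j < n then coord (r j) x else 0))"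
    by (rule ext, rule smooth_cong[OF q \<alpha>(1)]) (simp add: coord_def)
  have "(\<lambda>x j. if j < n then coord (r j) x else 0) \<in> measurable \<mu> seq_borel"
  proof (rule measurable_PiM_single')
    fix j
    show "(\<lambda>x. if j < n then coord (r j) x else 0) \<in> borel_measurable \<mu>"
      by (cases "j < n") (use W_M[OF r] in simp_all)
  qed simp
  then show ?thesis unfolding eq by (rule measurable_compose[OF _ smooth_measurable[OF q \<alpha>]])
qed

lemma cyl_density_process:
  assumes q: "smooth_bounded n q" and r: "\<And>i. i < n \<Longrightarrow> r i \<in> {0..1}"
  shows "measurable_process \<mu> (cyl_density n r q)"
  unfolding measurable_process_def cyl_density_def split_beta
proof (rule borel_measurable_sum)
  fix i assume i: "i \<in> {..<n}"
  have [measurable]: "(\<lambda>x. q [i] (\<lambda>j. x (r j))) \<in> borel_measurable \<mu>"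
    by (rule cyl_measurable[OF q r]) (use i in auto)
  have [measurable]: "(\<lambda>t::real. indicator {..<r i} t :: real) \<in> borel_measurable leb01"
    by (intro measurable_restrict_space1) simp
  have "(\<lambda>p. indicator {..<r i} (fst p) * q [i] (\<lambda>j. snd p (r j))) \<in> borel_measurable (leb01 \<Otimes>\<^sub>M \<mu>)"
    by measurable
  then show "(\<lambda>p. if fst p < r i then q [i] (\<lambda>j. snd p (r j)) else 0) \<in> borel_measurable (leb01 \<Otimes>\<^sub>M \<mu>)"
    by (rule measurable_cong[THEN iffD1, rotated]) (simp add: indicator_def)
qed

text \<open>Some cylindrical density is at squared L^2 distance less than 1 from D, and a
  cylindrical density is bounded.\<close>

lemma density_square_integrable:
  assumes mal: "malliavin_derivative \<mu> f G" and den: "lebesgue_density \<mu> G D"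
  shows "(\<integral>\<^sup>+x. \<integral>\<^sup>+t. ennreal ((D t x)\<^sup>2) \<partial>leb01 \<partial>\<mu>) < \<infinity>"
proof -
  obtain n :: "nat \<Rightarrow> nat" and r q where r: "\<And>k i. i < n k \<Longrightarrow> r k i \<in> {0..1}" and q: "\<And>k. smooth_bounded (n k) (q k)"
    and "(\<lambda>k. \<integral>\<^sup>+x. ennreal ((q k [] (\<lambda>j. x (r k j)) - f x)\<^sup>2) \<partial>\<mu>) \<longlonglongrightarrow> 0"
    and l: "(\<lambda>k. \<integral>\<^sup>+x. \<integral>\<^sup>+t. ennreal ((cyl_density (n k) (r k) (q k) t x - D t x)\<^sup>2) \<partial>leb01 \<partial>\<mu>) \<longlonglongrightarrow> 0"
    by (rule malliavin_cyl_approx[OF mal den]) (rule that)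
  have "\<forall>\<^sub>F k in sequentially. (\<integral>\<^sup>+x. \<integral>\<^sup>+t. ennreal ((cyl_density (n k) (r k) (q k) t x - D t x)\<^sup>2) \<partial>leb01 \<partial>\<mu>) < 1"
    by (rule order_tendstoD(2)[OF l]) simp
  then obtain k where k: "(\<integral>\<^sup>+x. \<integral>\<^sup>+t. ennreal ((cyl_density (n k) (r k) (q k) t x - D t x)\<^sup>2) \<partial>leb01 \<partial>\<mu>) < 1"
    by (auto simp: eventually_sequentially)
  obtain C where C: "1 \<le> C" "\<And>\<alpha> y. \<alpha> \<in> lists {..<n k} \<Longrightarrow> length \<alpha> \<le> 2 \<Longrightarrow> \<bar>q k \<alpha> y\<bar> \<le> C"
    by (rule smooth_bounded_const[OF q[of k]]) (rule that)
  let ?\<delta> = "cyl_density (n k) (r k) (q k)"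
  define B where "B = real (n k) * C"
  have db: "\<bar>?\<delta> t x\<bar> \<le> B" for t x
  proof -
    have "\<bar>?\<delta> t x\<bar> \<le> (\<Sum>i<n k. \<bar>if t < r k i then q k [i] (\<lambda>j. x (r k j)) else 0\<bar>)"
      unfolding cyl_density_def by (rule sum_abs)
    also have "\<dots> \<le> (\<Sum>i<n k. C)" using C by (intro sum_mono) auto
    finally show ?thesis by (simp add: B_def)
  qed
  interpret T: prob_space leb01 by (rule prob_space_leb01)
  interpret P: pair_prob_space leb01 \<mu> ..
  let ?P = "leb01 \<Otimes>\<^sub>M \<mu>"
  have [measurable]: "(\<lambda>p. D (fst p) (snd p)) \<in> borel_measurable ?P" "(\<lambda>p. ?\<delta> (fst p) (snd p)) \<in> borel_measurable ?P"
    using den cyl_density_process[OF q[of k] r] by (auto simp: lebesgue_density_def measurable_process_def split_beta)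
  have "(\<integral>\<^sup>+x. \<integral>\<^sup>+t. ennreal ((D t x)\<^sup>2) \<partial>leb01 \<partial>\<mu>) = (\<integral>\<^sup>+p. ennreal ((D (fst p) (snd p))\<^sup>2) \<partial>?P)"
    using P.nn_integral_snd[of "\<lambda>p. ennreal ((D (fst p) (snd p))\<^sup>2)"] by simp
  also have "\<dots> \<le> (\<integral>\<^sup>+p. 2 * ennreal ((?\<delta> (fst p) (snd p) - D (fst p) (snd p))\<^sup>2) + ennreal (2 * B\<^sup>2) \<partial>?P)"
  proof (rule nn_integral_mono)
    fix p
    let ?a = "?\<delta> (fst p) (snd p)" and ?b = "D (fst p) (snd p)"
    have "?b\<^sup>2 \<le> 2 * (?a - ?b)\<^sup>2 + 2 * ?a\<^sup>2"
      using zero_le_power2[of "2 * ?a - ?b"] by (simp add: power2_eq_square algebra_simps)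
    also have "?a\<^sup>2 \<le> B\<^sup>2" using power_mono[OF db[of "fst p" "snd p"], of 2] by simp
    finally have "?b\<^sup>2 \<le> 2 * (?a - ?b)\<^sup>2 + 2 * B\<^sup>2" by simp
    then have "ennreal (?b\<^sup>2) \<le> ennreal (2 * (?a - ?b)\<^sup>2 + 2 * B\<^sup>2)" by (rule ennreal_leI)
    also have "\<dots> = 2 * ennreal ((?a - ?b)\<^sup>2) + ennreal (2 * B\<^sup>2)" by (simp add: ennreal_mult'')
    finally show "ennreal (?b\<^sup>2) \<le> 2 * ennreal ((?a - ?b)\<^sup>2) + ennreal (2 * B\<^sup>2)" .
  qed
  also have "\<dots> = 2 * (\<integral>\<^sup>+p. ennreal ((?\<delta> (fst p) (snd p) - D (fst p) (snd p))\<^sup>2) \<partial>?P) + ennreal (2 * B\<^sup>2)"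
    by (subst nn_integral_add) (simp_all add: nn_integral_cmult P.P.emeasure_space_1)
  also have "(\<integral>\<^sup>+p. ennreal ((?\<delta> (fst p) (snd p) - D (fst p) (snd p))\<^sup>2) \<partial>?P)
     = (\<integral>\<^sup>+x. \<integral>\<^sup>+t. ennreal ((?\<delta> t x - D t x)\<^sup>2) \<partial>leb01 \<partial>\<mu>)"
    using P.nn_integral_snd[of "\<lambda>p. ennreal ((?\<delta> (fst p) (snd p) - D (fst p) (snd p))\<^sup>2)"] by simp
  also have "2 * \<dots> + ennreal (2 * B\<^sup>2) < \<infinity>"
    using less_trans[OF k ennreal_one_less_top] by (simp add: ennreal_mult_less_top)
  finally show ?thesis .
qed

text \<open>Truncation level, cylindrical approximation and grid are tied to one index k, with error
  bounds that are summable in k. Hence for almost every t the quotients converge almost surely along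
  the full sequence; convergence in L^1 alone would yield a subsequence depending on t.\<close>

lemma step_approximation:
  fixes c :: real
  assumes mal: "malliavin_derivative \<mu> f G" and den: "lebesgue_density \<mu> G D"
    and E: "integrable \<mu> (\<lambda>x. exp (- f x))" and c_def: "c = (\<integral>x. exp (- f x) \<partial>\<mu>)" and c: "0 < c"
    and L: "\<And>x. L x = 1 / c * exp (- f x)"
    and u: "cond_exp_process (density \<mu> (\<lambda>x. ennreal (L x))) F D u"
  obtains m s \<xi> where "\<And>k::nat. step_process F (m k) (s k) (\<xi> k)"
    "(\<lambda>k. \<integral>x. \<bar>step_exp coord (m k) (s k) (\<xi> k) x - L x\<bar> \<partial>\<mu>) \<longlonglongrightarrow> 0"
    "AE x in \<mu>. AE t in leb01. (\<lambda>k. step_value (m k) (s k) (\<xi> k) t x) \<longlonglongrightarrow> u t x"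
proof -
  obtain n0 :: "nat \<Rightarrow> nat" and r0 q0 where r0: "\<And>k i. i < n0 k \<Longrightarrow> r0 k i \<in> {0..1}" and q0: "\<And>k. smooth_bounded (n0 k) (q0 k)"
    and l1: "(\<lambda>k. \<integral>\<^sup>+x. ennreal ((q0 k [] (\<lambda>j. x (r0 k j)) - f x)\<^sup>2) \<partial>\<mu>) \<longlonglongrightarrow> 0"
    and l2: "(\<lambda>k. \<integral>\<^sup>+x. \<integral>\<^sup>+t. ennreal ((cyl_density (n0 k) (r0 k) (q0 k) t x - D t x)\<^sup>2) \<partial>leb01 \<partial>\<mu>) \<longlonglongrightarrow> 0"
    by (rule malliavin_cyl_approx[OF mal den]) (rule that)
  \<comment> \<open>The rate 1 / 16 is set against the factor \<open>y ^ 3\<close>, that is 8^k, of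
    \<open>summable_approximation_errors\<close>.\<close>
  have "\<forall>k::nat. \<exists>j. (\<integral>\<^sup>+x. ennreal ((q0 j [] (\<lambda>i. x (r0 j i)) - f x)\<^sup>2) \<partial>\<mu>) < ennreal ((1/16) ^ k) \<and>
      (\<integral>\<^sup>+x. \<integral>\<^sup>+t. ennreal ((cyl_density (n0 j) (r0 j) (q0 j) t x - D t x)\<^sup>2) \<partial>leb01 \<partial>\<mu>) < ennreal ((1/16) ^ k)"
  proof
    fix k :: nat
    have p: "0 < ennreal ((1/16) ^ k)" by simp
    show "\<exists>j. (\<integral>\<^sup>+x. ennreal ((q0 j [] (\<lambda>i. x (r0 j i)) - f x)\<^sup>2) \<partial>\<mu>) < ennreal ((1/16) ^ k) \<and>
      (\<integral>\<^sup>+x. \<integral>\<^sup>+t. ennreal ((cyl_density (n0 j) (r0 j) (q0 j) t x - D t x)\<^sup>2) \<partial>leb01 \<partial>\<mu>) < ennreal ((1/16) ^ k)"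
      using eventually_happens'[OF sequentially_bot eventually_conj[OF order_tendstoD(2)[OF l1 p] order_tendstoD(2)[OF l2 p]]] .
  qed
  from choice[OF this] obtain j where j: "\<forall>k::nat. (\<integral>\<^sup>+x. ennreal ((q0 (j k) [] (\<lambda>i. x (r0 (j k) i)) - f x)\<^sup>2) \<partial>\<mu>) < ennreal ((1/16) ^ k) \<and>
      (\<integral>\<^sup>+x. \<integral>\<^sup>+t. ennreal ((cyl_density (n0 (j k)) (r0 (j k)) (q0 (j k)) t x - D t x)\<^sup>2) \<partial>leb01 \<partial>\<mu>) < ennreal ((1/16) ^ k)" ..
  define n r q where "n = (\<lambda>k. n0 (j k))" and "r = (\<lambda>k. r0 (j k))" and "q = (\<lambda>k. q0 (j k))"
  have r: "\<And>k i. i < n k \<Longrightarrow> r k i \<in> {0..1}" and q: "\<And>k. smooth_bounded (n k) (q k)"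
    using r0 q0 by (simp_all add: n_def r_def q_def)
  define f' D' where "f' = (\<lambda>k x. q k [] (\<lambda>i. x (r k i)))" and "D' = (\<lambda>k. cyl_density (n k) (r k) (q k))"
  have A: "(\<integral>\<^sup>+x. ennreal ((f' k x - f x)\<^sup>2) \<partial>\<mu>) \<le> ennreal ((1/16) ^ k)" for k
    using j by (auto simp: f'_def q_def r_def intro: less_imp_le)
  have B: "(\<integral>\<^sup>+x. \<integral>\<^sup>+t. ennreal ((D' k t x - D t x)\<^sup>2) \<partial>leb01 \<partial>\<mu>) \<le> ennreal ((1/16) ^ k)" for k
    using j by (auto simp: D'_def n_def q_def r_def intro: less_imp_le)
  have fm[measurable]: "f \<in> borel_measurable \<mu>" using mal by (simp add: malliavin_derivative_def)
  have f'm[measurable]: "f' k \<in> borel_measurable \<mu>" for k unfolding f'_def by (rule cyl_measurable[OF q r]) auto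
  have Dp: "measurable_process \<mu> D" using den by (simp add: lebesgue_density_def)
  have D'p: "measurable_process \<mu> (D' k)" for k unfolding D'_def by (rule cyl_density_process[OF q r])
  have D2: "(\<integral>\<^sup>+x. \<integral>\<^sup>+t. ennreal ((D t x)\<^sup>2) \<partial>leb01 \<partial>\<mu>) < \<infinity>" by (rule density_square_integrable[OF mal den])
  note errors = summable_approximation_errors[OF fm f'm Dp D'p A B D2]
  define \<kappa> where "\<kappa> = (\<lambda>k. 1 / real (Suc k))"
  have \<kappa>: "\<kappa> k > 0" for k by (simp add: \<kappa>_def)
  define X where "X = (\<lambda>k x. recip (\<kappa> k) (f' k x))"
  define Y where "Y = (\<lambda>k t x. recip' (\<kappa> k) (f' k x) * D' k t x)"
  define Q where "Q k m s \<xi> num den \<longleftrightarrow> step_process F m s \<xi> \<and>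
    (\<integral>x. \<bar>step_exp coord m s \<xi> x - X k x / (\<integral>x. X k x \<partial>\<mu>)\<bar> \<partial>\<mu>) \<le> (1/2)^k \<and>
    (\<forall>t x. step_value m s \<xi> t x = - num t x / den t x) \<and>
    (\<forall>t\<in>{0..1} - s ` {..m}. num t \<in> borel_measurable \<mu> \<and> den t \<in> borel_measurable \<mu> \<and>
       (\<integral>\<^sup>+x. ennreal \<bar>num t x - real_cond_exp \<mu> (F t) (Y k t) x\<bar> \<partial>\<mu>) \<le> ennreal ((1/2)^k) \<and>
       (\<integral>\<^sup>+x. ennreal \<bar>den t x - real_cond_exp \<mu> (F t) (X k) x\<bar> \<partial>\<mu>) \<le> ennreal ((1/2)^k) \<and> integrable \<mu> (Y k t)) \<and>
    integrable \<mu> (X k) \<and> 0 < (\<integral>x. X k x \<partial>\<mu>)" for k m s \<xi> num den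
  have "\<forall>k. \<exists>m s \<xi> num den. Q k m s \<xi> num den"
  proof
    fix k
    have e: "0 < (1/2::real) ^ k" by simp
    show "\<exists>m s \<xi> num den. Q k m s \<xi> num den"
    proof (rule step_approx_cyl[OF q[of k] r \<kappa>[of k] e, folded f'_def[THEN fun_cong, THEN fun_cong] D'_def[THEN fun_cong]])
      fix m s \<xi> num den
      assume "step_process F m s \<xi>"
        "(\<integral>x. \<bar>step_exp coord m s \<xi> x - recip (\<kappa> k) (q k [] (\<lambda>j. x (r k j))) / (\<integral>x. recip (\<kappa> k) (q k [] (\<lambda>j. x (r k j))) \<partial>\<mu>)\<bar> \<partial>\<mu>) \<le> (1/2)^k"
        "\<And>t x. step_value m s \<xi> t x = - num t x / den t x"
        "\<And>t. t \<in> {0..1} - s ` {..m} \<Longrightarrow> num t \<in> borel_measurable \<mu> \<and> den t \<in> borel_measurable \<mu> \<and>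
           (\<integral>\<^sup>+x. ennreal \<bar>num t x - real_cond_exp \<mu> (F t) (\<lambda>x. recip' (\<kappa> k) (q k [] (\<lambda>j. x (r k j))) * cyl_density (n k) (r k) (q k) t x) x\<bar> \<partial>\<mu>) \<le> ennreal ((1/2)^k) \<and>
           (\<integral>\<^sup>+x. ennreal \<bar>den t x - real_cond_exp \<mu> (F t) (\<lambda>x. recip (\<kappa> k) (q k [] (\<lambda>j. x (r k j)))) x\<bar> \<partial>\<mu>) \<le> ennreal ((1/2)^k)"
        "integrable \<mu> (\<lambda>x. recip (\<kappa> k) (q k [] (\<lambda>j. x (r k j))))"
        "\<And>t. t \<in> {0..1} - s ` {..m} \<Longrightarrow> integrable \<mu> (\<lambda>x. recip' (\<kappa> k) (q k [] (\<lambda>j. x (r k j))) * cyl_density (n k) (r k) (q k) t x)"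
        "0 < (\<integral>x. recip (\<kappa> k) (q k [] (\<lambda>j. x (r k j))) \<partial>\<mu>)"
      then have "Q k m s \<xi> num den" unfolding Q_def X_def Y_def f'_def D'_def by blast
      then show ?thesis by blast
    qed
  qed
  from choice[OF this] obtain m where "\<forall>k. \<exists>s \<xi> num den. Q k (m k) s \<xi> num den" ..
  from choice[OF this] obtain s where "\<forall>k. \<exists>\<xi> num den. Q k (m k) (s k) \<xi> num den" ..
  from choice[OF this] obtain \<xi> where "\<forall>k. \<exists>num den. Q k (m k) (s k) (\<xi> k) num den" ..
  from choice[OF this] obtain num where "\<forall>k. \<exists>den. Q k (m k) (s k) (\<xi> k) (num k) den" ..
  from choice[OF this] obtain den' where Q: "\<forall>k. Q k (m k) (s k) (\<xi> k) (num k) (den' k)" ..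
  have step: "step_process F (m k) (s k) (\<xi> k)" and sv: "step_value (m k) (s k) (\<xi> k) t x = - num k t x / den' k t x"
    and N: "(\<integral>x. \<bar>step_exp coord (m k) (s k) (\<xi> k) x - X k x / (\<integral>x. X k x \<partial>\<mu>)\<bar> \<partial>\<mu>) \<le> (1/2)^k"
    and iX: "integrable \<mu> (X k)" "0 < (\<integral>x. X k x \<partial>\<mu>)" for k t x
    using Q unfolding Q_def by blast+
  have nd: "num k t \<in> borel_measurable \<mu>" "den' k t \<in> borel_measurable \<mu>"
       "(\<integral>\<^sup>+x. ennreal \<bar>num k t x - real_cond_exp \<mu> (F t) (Y k t) x\<bar> \<partial>\<mu>) \<le> ennreal ((1/2)^k)"
       "(\<integral>\<^sup>+x. ennreal \<bar>den' k t x - real_cond_exp \<mu> (F t) (X k) x\<bar> \<partial>\<mu>) \<le> ennreal ((1/2)^k)" "integrable \<mu> (Y k t)"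
    if "t \<in> {0..1}" "t \<notin> (\<Union>k. s k ` {..m k})" for k t
    using Q that unfolding Q_def by blast+
  have Lm[measurable]: "L \<in> borel_measurable \<mu>" unfolding L[abs_def] by measurable
  have iL: "integrable \<mu> L" unfolding L[abs_def] using E by simp
  have Lf: "c * L x = exp (- f x)" for x using c by (simp add: L)
  have Lpos: "0 < L x" for x using c by (simp add: L)
  define Z where "Z = (\<lambda>k x. recip (\<kappa> k) (f x))"
  have Z: "0 \<le> Z k x" "Z k x \<le> exp (- f x)" for k x
    unfolding Z_def using recip_bounds(1,3)[OF \<kappa>[of k]] by (simp_all add: less_imp_le)
  have Zm[measurable]: "Z k \<in> borel_measurable \<mu>" for k unfolding Z_def by measurable
  have iZ: "integrable \<mu> (Z k)" for k
    by (rule Bochner_Integration.integrable_bound[OF E]) (use Z in auto)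
  have XZ: "(\<integral>\<^sup>+x. ennreal \<bar>X k x - Z k x\<bar> \<partial>\<mu>) \<le> ennreal ((1/2) ^ k * 2)" for k
    using errors(2)[of k] by (simp add: X_def Z_def \<kappa>_def)
  have XZ': "(\<integral>x. \<bar>X k x - Z k x\<bar> \<partial>\<mu>) \<le> (1/2) ^ k * 2" for k
  proof -
    have eq: "ennreal (\<integral>x. \<bar>X k x - Z k x\<bar> \<partial>\<mu>) = (\<integral>\<^sup>+x. ennreal \<bar>X k x - Z k x\<bar> \<partial>\<mu>)"
      by (rule nn_integral_eq_integral[symmetric]) (use iX iZ in auto)
    show ?thesis using XZ[of k] unfolding eq[symmetric] by (rule ennreal_le_iff[THEN iffD1, rotated]) simp
  qed
  have pow0: "(\<lambda>k. (1/2::real) ^ k) \<longlonglongrightarrow> 0" by (rule LIMSEQ_power_zero) simp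
  have pow2: "(\<lambda>k. (1/2::real) ^ k * 2) \<longlonglongrightarrow> 0" using tendsto_mult[OF pow0 tendsto_const[of "2::real"]] by simp
  have ZE: "(\<lambda>k. \<integral>x. \<bar>Z k x - exp (- f x)\<bar> \<partial>\<mu>) \<longlonglongrightarrow> (\<integral>x. 0 \<partial>\<mu>)"
  proof (rule integral_dominated_convergence)
    show "integrable \<mu> (\<lambda>x. exp (- f x))" by (rule E)
    show "AE x in \<mu>. (\<lambda>k. \<bar>Z k x - exp (- f x)\<bar>) \<longlonglongrightarrow> 0"
    proof (rule AE_I2)
      fix x
      have "(\<lambda>k. Z k x - exp (- f x)) \<longlonglongrightarrow> 0"
        unfolding LIM_zero_iff Z_def \<kappa>_def by (rule recip_tendsto)
      then show "(\<lambda>k. \<bar>Z k x - exp (- f x)\<bar>) \<longlonglongrightarrow> 0" by (rule tendsto_rabs_zero)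
    qed
    show "AE x in \<mu>. norm \<bar>Z k x - exp (- f x)\<bar> \<le> exp (- f x)" for k
    proof (rule AE_I2)
      fix x show "norm \<bar>Z k x - exp (- f x)\<bar> \<le> exp (- f x)" using Z[of k x] by (simp add: abs_real_def)
    qed
  qed simp_all
  define d where "d k = (\<integral>x. \<bar>X k x - exp (- f x)\<bar> \<partial>\<mu>)" for k
  have d_le: "d k \<le> (1/2) ^ k * 2 + (\<integral>x. \<bar>Z k x - exp (- f x)\<bar> \<partial>\<mu>)" for k
  proof -
    have "d k \<le> (\<integral>x. \<bar>X k x - Z k x\<bar> + \<bar>Z k x - exp (- f x)\<bar> \<partial>\<mu>)"
      unfolding d_def by (rule integral_mono) (use iX iZ E in auto)
    also have "\<dots> = (\<integral>x. \<bar>X k x - Z k x\<bar> \<partial>\<mu>) + (\<integral>x. \<bar>Z k x - exp (- f x)\<bar> \<partial>\<mu>)"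
      using iX iZ E by (intro Bochner_Integration.integral_add) auto
    finally show ?thesis using XZ'[of k] by linarith
  qed
  have d0: "d \<longlonglongrightarrow> 0"
  proof (rule tendsto_sandwich[OF _ _ tendsto_const])
    show "\<forall>\<^sub>F k in sequentially. 0 \<le> d k" by (simp add: d_def)
    show "\<forall>\<^sub>F k in sequentially. d k \<le> (1/2) ^ k * 2 + (\<integral>x. \<bar>Z k x - exp (- f x)\<bar> \<partial>\<mu>)" using d_le by simp
    show "(\<lambda>k. (1/2) ^ k * 2 + (\<integral>x. \<bar>Z k x - exp (- f x)\<bar> \<partial>\<mu>)) \<longlonglongrightarrow> 0"
      using tendsto_add[OF pow2 ZE] by simp
  qed
  define a where "a k = (\<integral>x. X k x \<partial>\<mu>)" for k
  have a: "a \<longlonglongrightarrow> c"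
  proof -
    have "(\<lambda>k. a k - c) \<longlonglongrightarrow> 0"
    proof (rule tendsto_0_le[OF d0, where K=1], rule always_eventually, rule allI)
      fix k
      have "a k - c = (\<integral>x. X k x - exp (- f x) \<partial>\<mu>)" using iX E by (simp add: a_def c_def)
      then show "norm (a k - c) \<le> norm (d k) * 1"
        using integral_abs_bound[of \<mu> "\<lambda>x. X k x - exp (- f x)"] by (simp add: d_def)
    qed
    then show ?thesis by (rule LIM_zero_cancel)
  qed
  have L1: "(\<lambda>k. \<integral>x. \<bar>step_exp coord (m k) (s k) (\<xi> k) x - L x\<bar> \<partial>\<mu>) \<longlonglongrightarrow> 0"
  proof (rule tendsto_sandwich[OF _ _ tendsto_const])
    show "\<forall>\<^sub>F k in sequentially. 0 \<le> (\<integral>x. \<bar>step_exp coord (m k) (s k) (\<xi> k) x - L x\<bar> \<partial>\<mu>)" by simp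
    show "\<forall>\<^sub>F k in sequentially. (\<integral>x. \<bar>step_exp coord (m k) (s k) (\<xi> k) x - L x\<bar> \<partial>\<mu>) \<le> (1/2) ^ k + 2 / a k * d k"
    proof (rule always_eventually, rule allI)
      fix k
      have iN: "integrable \<mu> (step_exp coord (m k) (s k) (\<xi> k))" by (rule integral_step_exp[OF step])
      have iXa: "integrable \<mu> (\<lambda>x. X k x / a k)" using iX by simp
      have "(\<integral>x. \<bar>step_exp coord (m k) (s k) (\<xi> k) x - L x\<bar> \<partial>\<mu>)
        \<le> (\<integral>x. \<bar>step_exp coord (m k) (s k) (\<xi> k) x - X k x / a k\<bar> + \<bar>X k x / a k - L x\<bar> \<partial>\<mu>)"
        by (rule integral_mono) (use iN iXa iL in auto)
      also have "\<dots> = (\<integral>x. \<bar>step_exp coord (m k) (s k) (\<xi> k) x - X k x / a k\<bar> \<partial>\<mu>) + (\<integral>x. \<bar>X k x / a k - L x\<bar> \<partial>\<mu>)"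
        using iN iXa iL by (intro Bochner_Integration.integral_add) auto
      also have "\<dots> \<le> (1/2) ^ k + 2 / a k * d k"
      proof (rule add_mono)
        show "(\<integral>x. \<bar>step_exp coord (m k) (s k) (\<xi> k) x - X k x / a k\<bar> \<partial>\<mu>) \<le> (1/2) ^ k"
          using N[of k] by (simp only: a_def)
        have "(\<integral>x. \<bar>X k x / (\<integral>x. X k x \<partial>\<mu>) - exp (- f x) / (\<integral>x. exp (- f x) \<partial>\<mu>)\<bar> \<partial>\<mu>)
          \<le> 2 / (\<integral>x. X k x \<partial>\<mu>) * (\<integral>x. \<bar>X k x - exp (- f x)\<bar> \<partial>\<mu>)"
          by (rule normalized_L1_distance) (use iX E c c_def in auto)
        then show "(\<integral>x. \<bar>X k x / a k - L x\<bar> \<partial>\<mu>) \<le> 2 / a k * d k"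
          by (simp only: a_def d_def L c_def[symmetric] mult_1_left times_divide_eq_left)
      qed
      finally show "(\<integral>x. \<bar>step_exp coord (m k) (s k) (\<xi> k) x - L x\<bar> \<partial>\<mu>) \<le> (1/2) ^ k + 2 / a k * d k" .
    qed
    have "(\<lambda>k. (1/2) ^ k + 2 / a k * d k) \<longlonglongrightarrow> 0 + 2 / c * 0"
      by (intro tendsto_intros pow0 a d0) (use c in simp)
    then show "(\<lambda>k. (1/2) ^ k + 2 / a k * d k) \<longlonglongrightarrow> 0" by simp
  qed
  interpret T: prob_space leb01 by (rule prob_space_leb01)
  interpret P: pair_prob_space leb01 \<mu> ..
  let ?P = "leb01 \<Otimes>\<^sub>M \<mu>"
  have AEN: "(AE x in density \<mu> (\<lambda>x. ennreal (L x)). R x) \<longleftrightarrow> (AE x in \<mu>. R x)" for R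
    by (simp add: AE_density Lpos)
  have up: "measurable_process \<mu> u"
  proof -
    have "sets (leb01 \<Otimes>\<^sub>M density \<mu> (\<lambda>x. ennreal (L x))) = sets ?P" by (intro sets_pair_measure_cong) simp_all
    then show ?thesis using u by (simp add: cond_exp_process_def measurable_process_def cong: measurable_cong_sets)
  qed
  have Dpm[measurable]: "(\<lambda>(t, x). D t x) \<in> borel_measurable ?P" using Dp by (simp add: measurable_process_def)
  have Dt: "D t \<in> borel_measurable \<mu>" if t: "t \<in> {0..1}" for t
  proof -
    have "t \<in> space leb01" using t by simp
    from measurable_Pair2[OF Dpm this] show ?thesis by simp
  qed
  have "(\<integral>\<^sup>+t. \<integral>\<^sup>+x. ennreal ((D t x)\<^sup>2) \<partial>\<mu> \<partial>leb01) < \<infinity>"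
    using P.Fubini[of "\<lambda>(t, x). ennreal ((D t x)\<^sup>2)"] D2 by simp
  then have "AE t in leb01. (\<integral>\<^sup>+x. ennreal ((D t x)\<^sup>2) \<partial>\<mu>) \<noteq> \<infinity>"
    by (intro nn_integral_PInf_AE) auto
  \<comment> \<open>Integrability under \<mu> is what the truncated derivatives require; under \<nu>
    only the finiteness of a conditional expectation is at hand.\<close>
  then have Dint: "AE t in leb01. t \<in> {0..1} \<longrightarrow> integrable \<mu> (D t)"
  proof eventually_elim
    case (elim t)
    show ?case
    proof
      assume t: "t \<in> {0..1}"
      have "integrable \<mu> (\<lambda>x. (D t x)\<^sup>2)"
        by (rule integrableI_nonneg) (use elim Dt[OF t] in \<open>auto simp: less_top\<close>)
      then show "integrable \<mu> (D t)" by (rule square_integrable_imp_integrable[OF Dt[OF t]])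
    qed
  qed
  \<comment> \<open>The grid points of all k together are countable, so one null set of times covers
    every exclusion made by \<open>step_approx_cyl\<close>.\<close>
  have grid: "AE t in leb01. t \<notin> (\<Union>k. s k ` {..m k})"
  proof -
    have "AE t in lborel. t \<notin> (\<Union>k. s k ` {..m k})"
      by (rule AE_not_in) (intro countable_imp_null_set_lborel countable_UN, auto)
    then have "AE t in lborel. t \<in> {0..1} \<longrightarrow> t \<notin> (\<Union>k. s k ` {..m k})" by eventually_elim blast
    then show ?thesis by (subst AE_restrict_space_iff) simp_all
  qed
  have uc: "AE t in leb01. AE x in density \<mu> (\<lambda>x. ennreal (L x)).
        nn_cond_exp (density \<mu> (\<lambda>x. ennreal (L x))) (F t) (\<lambda>x. ennreal \<bar>D t x\<bar>) x < \<infinity> \<and>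
        u t x = real_cond_exp (density \<mu> (\<lambda>x. ennreal (L x))) (F t) (D t) x"
    using u by (simp add: cond_exp_process_def)
  have XZsum: "(\<Sum>k. \<integral>\<^sup>+x. ennreal \<bar>X k x - Z k x\<bar> \<partial>\<mu>) < \<infinity>"
    by (rule le_less_trans[OF suminf_le[OF XZ] suminf_geometric_ennreal]) simp_all
  have "AE t in leb01. t \<in> {0..1} \<longrightarrow> (AE x in \<mu>. (\<lambda>k. step_value (m k) (s k) (\<xi> k) t x) \<longlonglongrightarrow> u t x)"
    using errors(1) Dint grid uc
  proof eventually_elim
    case (elim t)
    show ?case
    proof
      assume t: "t \<in> {0..1}"
      interpret R: finite_measure_subalgebra \<mu> "F t" by (rule finite_measure_subalgebra_F[OF t])
      note ndt = nd[OF t elim(3)]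
      have iD: "integrable \<mu> (D t)" using elim(2) t by blast
      have iZD: "integrable \<mu> (\<lambda>x. recip' (\<kappa> k) (f x) * D t x)" for k
      proof (rule Bochner_Integration.integrable_bound)
        show "integrable \<mu> (\<lambda>x. 1 / \<kappa> k * D t x)" using iD by simp
        show "(\<lambda>x. recip' (\<kappa> k) (f x) * D t x) \<in> borel_measurable \<mu>" using Dt[OF t] by measurable
        show "AE x in \<mu>. norm (recip' (\<kappa> k) (f x) * D t x) \<le> norm (1 / \<kappa> k * D t x)"
        proof (rule AE_I2)
          fix x
          have "\<bar>recip' (\<kappa> k) (f x)\<bar> * \<bar>D t x\<bar> \<le> 1 / \<kappa> k * \<bar>D t x\<bar>"
            by (rule mult_right_mono[OF recip_bounds(6)[OF \<kappa>]]) simp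
          then show "norm (recip' (\<kappa> k) (f x) * D t x) \<le> norm (1 / \<kappa> k * D t x)"
            using \<kappa>[of k] by (simp add: abs_mult)
        qed
      qed
      have 1: "AE x in \<mu>. (\<lambda>k. num k t x - real_cond_exp \<mu> (F t) (\<lambda>x. recip' (\<kappa> k) (f x) * D t x) x) \<longlonglongrightarrow> 0"
        by (rule R.AE_cond_exp_approx[OF ndt(1) ndt(3) ndt(5) iZD]) (use elim(1) in \<open>simp add: Y_def \<kappa>_def\<close>)
      have 2: "AE x in \<mu>. (\<lambda>k. den' k t x - real_cond_exp \<mu> (F t) (Z k) x) \<longlonglongrightarrow> 0"
        by (rule R.AE_cond_exp_approx[OF ndt(2) ndt(4) iX(1) iZ XZsum])
      have fin: "AE x in density \<mu> (\<lambda>x. ennreal (L x)). nn_cond_exp (density \<mu> (\<lambda>x. ennreal (L x))) (F t) (\<lambda>x. ennreal \<bar>D t x\<bar>) x < \<infinity>"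
        using elim(4) by eventually_elim simp
      have "AE x in \<mu>. (\<lambda>k. - num k t x / den' k t x) \<longlonglongrightarrow> real_cond_exp (density \<mu> (\<lambda>x. ennreal (L x))) (F t) (D t) x"
        by (rule R.cond_exp_ratio_limit[OF fm Dt[OF t] iL Lf c fin 1[unfolded \<kappa>_def] 2[unfolded Z_def \<kappa>_def]])
      then show "AE x in \<mu>. (\<lambda>k. step_value (m k) (s k) (\<xi> k) t x) \<longlonglongrightarrow> u t x"
        using elim(4)[unfolded AEN] by eventually_elim (simp add: sv)
    qed
  qed
  then have AEtx: "AE t in leb01. AE x in \<mu>. (\<lambda>k. step_value (m k) (s k) (\<xi> k) t x) \<longlonglongrightarrow> u t x"
    using AE_space by eventually_elim simp
  have [measurable]: "(\<lambda>p. step_value (m k) (s k) (\<xi> k) (fst p) (snd p)) \<in> borel_measurable ?P" for k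
    using step_process_measurable(2)[OF step[of k]] by (simp add: measurable_process_def split_beta)
  have [measurable]: "(\<lambda>p. u (fst p) (snd p)) \<in> borel_measurable ?P"
    using up by (simp add: measurable_process_def split_beta)
  \<comment> \<open>The convergence set is measurable in the product, which permits exchanging the
    two almost-everywhere quantifiers.\<close>
  have "{p \<in> space ?P. (\<lambda>k. step_value (m k) (s k) (\<xi> k) (fst p) (snd p)) \<longlonglongrightarrow> u (fst p) (snd p)} \<in> sets ?P"
    by measurable
  then have "AE x in \<mu>. AE t in leb01. (\<lambda>k. step_value (m k) (s k) (\<xi> k) t x) \<longlonglongrightarrow> u t x"
    using P.AE_commute[of "\<lambda>t x. (\<lambda>k. step_value (m k) (s k) (\<xi> k) t x) \<longlonglongrightarrow> u t x"] AEtx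
    by (simp add: split_beta)
  then show ?thesis by (rule that[OF step L1])
qed

end

section \<open>Transport of filtrations and stochastic integrals\<close>

lemma (in prob_space) tendsto_in_prob_of_AE:
  assumes X[measurable]: "\<And>n. X n \<in> borel_measurable M" "Y \<in> borel_measurable M"
    and lim: "AE x in M. (\<lambda>n. X n x) \<longlonglongrightarrow> Y x"
  shows "tendsto_in_prob M X Y"
  unfolding tendsto_in_prob_def
proof (intro allI impI)
  fix \<epsilon> :: real assume \<epsilon>: "\<epsilon> > 0"
  define S where "S n = {x \<in> space M. \<bar>X n x - Y x\<bar> > \<epsilon>}" for n
  have [measurable]: "S n \<in> sets M" for n unfolding S_def by measurable
  have "(\<lambda>n. \<integral>x. indicator (S n) x \<partial>M) \<longlonglongrightarrow> (\<integral>x. (0::real) \<partial>M)"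
  proof (rule integral_dominated_convergence[where w="\<lambda>_. 1"])
    show "AE x in M. (\<lambda>n. indicator (S n) x :: real) \<longlonglongrightarrow> 0"
      using lim
    proof eventually_elim
      case (elim x)
      have "(\<lambda>n. \<bar>X n x - Y x\<bar>) \<longlonglongrightarrow> 0" by (rule tendsto_rabs_zero) (use elim in \<open>simp add: LIM_zero_iff\<close>)
      then have "\<forall>\<^sub>F n in sequentially. \<bar>X n x - Y x\<bar> < \<epsilon>" by (rule order_tendstoD(2)) (rule \<epsilon>)
      then have "\<forall>\<^sub>F n in sequentially. (indicator (S n) x :: real) = 0" by eventually_elim (simp add: S_def)
      then show ?case by (rule tendsto_eventually)
    qed
  qed simp_all
  then show "(\<lambda>n. measure M {x \<in> space M. \<bar>X n x - Y x\<bar> > \<epsilon>}) \<longlonglongrightarrow> 0"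
    by (simp add: S_def[symmetric])
qed

lemma
  shows space_natural_filtration: "space (natural_filtration M X t) = space M"
    and sets_natural_filtration: "sets (natural_filtration M X t) = sigma_sets (space M)
     ({X s -` A \<inter> space M | s A. s \<in> {0..t} \<and> A \<in> sets borel} \<union> null_sets M)"
proof -
  have sub: "{X s -` A \<inter> space M | s A. s \<in> {0..t} \<and> A \<in> sets borel} \<union> null_sets M \<subseteq> Pow (space M)"
    using sets.sets_into_space[of _ M] by (auto simp: null_sets_def)
  show "space (natural_filtration M X t) = space M"
    unfolding natural_filtration_def by (rule space_measure_of[OF sub])
  show "sets (natural_filtration M X t) = sigma_sets (space M)
     ({X s -` A \<inter> space M | s A. s \<in> {0..t} \<and> A \<in> sets borel} \<union> null_sets M)"
    unfolding natural_filtration_def by (rule sets_measure_of[OF sub])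
qed

lemma null_sets_natural_filtration: "null_sets M \<subseteq> sets (natural_filtration M X t)"
  unfolding sets_natural_filtration by (auto intro: sigma_sets.Basic)

lemma sets_natural_filtration_mono:
  assumes "s \<le> t"
  shows "sets (natural_filtration M X s) \<subseteq> sets (natural_filtration M X t)"
proof -
  have "{0..s} \<subseteq> {0..t}" using assms by auto
  then show ?thesis unfolding sets_natural_filtration by (intro sigma_sets_mono' Un_mono order_refl) blast
qed

lemma subalgebra_natural_filtration:
  assumes X: "\<And>t. t \<in> {0..1} \<Longrightarrow> X t \<in> borel_measurable M" and t: "t \<le> 1"
  shows "subalgebra M (natural_filtration M X t)"
  unfolding subalgebra_def space_natural_filtration sets_natural_filtration
proof (intro conjI refl sets.sigma_sets_subset Un_least subsetI)
  fix B assume "B \<in> {X s -` A \<inter> space M | s A. s \<in> {0..t} \<and> A \<in> sets borel}"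
  then obtain s A where "B = X s -` A \<inter> space M" "s \<in> {0..t}" "A \<in> sets borel" by blast
  then show "B \<in> sets M" using t by (auto intro!: measurable_sets[OF X])
qed auto

text \<open>A map \<open>T\<close> with image measure \<open>N\<close> carries the Brownian motions and stochastic integrals of
  \<open>(N, F)\<close> to those of \<open>(M, G)\<close>.\<close>

locale filtration_transport =
  fixes M N :: "'a measure" and T :: "'a \<Rightarrow> 'a" and X :: "real \<Rightarrow> 'a \<Rightarrow> real"
  assumes prob_M: "prob_space M" and sets_N: "sets N = sets M"
    and null_N: "null_sets M \<subseteq> null_sets N"
    and T_N: "T \<in> measurable M N" and distr_T: "distr M N T = N"
    and X_M: "\<And>t. t \<in> {0..1} \<Longrightarrow> X t \<in> borel_measurable M"
begin

abbreviation "F \<equiv> natural_filtration M X"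
abbreviation "G \<equiv> natural_filtration M (\<lambda>t x. X t (T x))"

sublocale prob_space M by (rule prob_M)

lemma space_N: "space N = space M" by (rule sets_eq_imp_space_eq[OF sets_N])

lemma T_M [measurable]: "T \<in> measurable M M"
  using T_N measurable_cong_sets[OF refl sets_N, of M] by blast

lemma T_space: "x \<in> space M \<Longrightarrow> T x \<in> space M"
  by (rule measurable_space[OF T_M])

lemma emeasure_T: "A \<in> sets M \<Longrightarrow> emeasure M (T -` A \<inter> space M) = emeasure N A"
  using emeasure_distr[OF T_N, of A] by (simp add: distr_T sets_N)

text \<open>\<open>N\<close> is the image of \<open>M\<close> under \<open>T\<close> and charges no
  \<open>M\<close>-null set, so \<open>T\<close> pulls null sets back to null sets.\<close>

lemma AE_T:
  assumes "AE x in M. P x"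
  shows "AE x in M. P (T x)"
proof -
  obtain B where B: "B \<in> null_sets M" "{x \<in> space M. \<not> P x} \<subseteq> B" using assms by (auto simp: eventually_ae_filter)
  have "AE x in N. P x"
    unfolding eventually_ae_filter using B null_N by (auto simp: space_N)
  then show ?thesis by (rule AE_distrD[OF T_N, unfolded distr_T])
qed

lemma T_filtration: "T \<in> measurable (G t) (F t)"
proof -
  have "T \<in> measurable (G t) (sigma (space M) ({X s -` A \<inter> space M | s A. s \<in> {0..t} \<and> A \<in> sets borel} \<union> null_sets M))"
  proof (rule measurable_measure_of)
    show "{X s -` A \<inter> space M | s A. s \<in> {0..t} \<and> A \<in> sets borel} \<union> null_sets M \<subseteq> Pow (space M)"
      using sets.sets_into_space[of _ M] by (auto simp: null_sets_def)
    show "T \<in> space (G t) \<rightarrow> space M" using T_space by (auto simp: space_natural_filtration)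
    fix B assume "B \<in> {X s -` A \<inter> space M | s A. s \<in> {0..t} \<and> A \<in> sets borel} \<union> null_sets M"
    then show "T -` B \<inter> space (G t) \<in> sets (G t)"
    proof
      assume "B \<in> {X s -` A \<inter> space M | s A. s \<in> {0..t} \<and> A \<in> sets borel}"
      then obtain s A where B: "B = X s -` A \<inter> space M" and sA: "s \<in> {0..t}" "A \<in> sets borel" by blast
      have "T -` B \<inter> space (G t) = (\<lambda>x. X s (T x)) -` A \<inter> space M"
        using T_space by (auto simp: B space_natural_filtration)
      then show ?thesis unfolding sets_natural_filtration using sA by (intro sigma_sets.Basic) blast
    next
      assume B: "B \<in> null_sets M"
      then have "T -` B \<inter> space M \<in> null_sets M"
        using null_N emeasure_T[of B] measurable_sets[OF T_M, of B] by (auto simp: null_sets_def)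
      then show ?thesis using null_sets_natural_filtration by (auto simp: space_natural_filtration)
    qed
  qed
  then show ?thesis by (simp only: natural_filtration_def[of M X])
qed

lemma measurable_T: "f \<in> borel_measurable (F t) \<Longrightarrow> (\<lambda>x. f (T x)) \<in> borel_measurable (G t)"
  by (rule measurable_compose[OF T_filtration])

text \<open>The augmentation puts all null sets into \<open>G\<close>, so a set of \<open>G\<close>
  is a preimage of a set of \<open>F\<close> only modulo a null set; this property passes through
  complements and countable unions.\<close>

lemma G_preimage:
  assumes "A \<in> sets (G t)"
  shows "\<exists>B\<in>sets (F t). AE x in M. x \<in> A \<longleftrightarrow> T x \<in> B"
  using assms unfolding sets_natural_filtration[of M "\<lambda>t x. X t (T x)"]
proof (induction rule: sigma_sets.induct)
  case (Basic A)
  then show ?case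
  proof
    assume "A \<in> {(\<lambda>x. X s (T x)) -` A \<inter> space M | s A. s \<in> {0..t} \<and> A \<in> sets borel}"
    then obtain s C where A: "A = (\<lambda>x. X s (T x)) -` C \<inter> space M" and sC: "s \<in> {0..t}" "C \<in> sets borel" by blast
    have "X s -` C \<inter> space M \<in> sets (F t)"
      unfolding sets_natural_filtration using sC by (intro sigma_sets.Basic) blast
    moreover have "AE x in M. x \<in> A \<longleftrightarrow> T x \<in> X s -` C \<inter> space M"
      by (rule AE_I2) (use T_space in \<open>auto simp: A\<close>)
    ultimately show ?thesis by blast
  next
    assume "A \<in> null_sets M"
    then have "AE x in M. x \<in> A \<longleftrightarrow> T x \<in> {}" using AE_not_in by (simp, blast)
    then show ?thesis by blast
  qed
next
  case Empty
  then show ?case by (intro bexI[of _ "{}"]) auto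
next
  case (Compl A)
  then obtain B where B: "B \<in> sets (F t)" "AE x in M. x \<in> A \<longleftrightarrow> T x \<in> B" by blast
  have "space M - B \<in> sets (F t)" using sets.compl_sets[OF B(1)] by (simp add: space_natural_filtration)
  moreover have "AE x in M. x \<in> space M - A \<longleftrightarrow> T x \<in> space M - B"
    using B(2) AE_space by eventually_elim (use T_space in auto)
  ultimately show ?case by blast
next
  case (Union A)
  have "\<forall>i. \<exists>B. B \<in> sets (F t) \<and> (AE x in M. x \<in> A i \<longleftrightarrow> T x \<in> B)" using Union.IH by blast
  from choice[OF this] obtain B where B: "\<forall>i::nat. B i \<in> sets (F t) \<and> (AE x in M. x \<in> A i \<longleftrightarrow> T x \<in> B i)" ..
  have "AE x in M. \<forall>i. x \<in> A i \<longleftrightarrow> T x \<in> B i" unfolding AE_all_countable using B by blast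
  then have "AE x in M. x \<in> (\<Union>i. A i) \<longleftrightarrow> T x \<in> (\<Union>i. B i)" by eventually_elim blast
  moreover have "(\<Union>i. B i) \<in> sets (F t)" using B by blast
  ultimately show ?case by blast
qed

lemma sub_G: "t \<le> 1 \<Longrightarrow> subalgebra M (G t)"
  by (rule subalgebra_natural_filtration) (use measurable_compose[OF T_M X_M] in auto)

lemma sub_F: "t \<le> 1 \<Longrightarrow> subalgebra M (F t)"
  by (rule subalgebra_natural_filtration) (use X_M in auto)

text \<open>Laws and almost sure properties transfer because \<open>T\<close> maps \<open>M\<close>
  to \<open>N\<close>. Independence of the past requires in addition that \<open>G\<close> holds
  nothing beyond preimages of \<open>F\<close>, up to null sets.\<close>

lemma brownian_motion_T:
  assumes bm: "brownian_motion N F B"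
  shows "brownian_motion M G (\<lambda>t x. B t (T x))"
proof -
  have N: "prob_space N" and B_F: "\<And>t. t \<in> {0..1} \<Longrightarrow> B t \<in> borel_measurable (F t)"
    and B0: "AE x in N. B 0 x = 0" and Bc: "AE x in N. continuous_on {0..1} (\<lambda>t. B t x)"
    and inc: "\<And>s t. 0 \<le> s \<Longrightarrow> s < t \<Longrightarrow> t \<le> 1 \<Longrightarrow>
        distributed N lborel (\<lambda>x. B t x - B s x) (\<lambda>y. ennreal (normal_density 0 (sqrt (t - s)) y))"
    and ind: "\<And>s t. 0 \<le> s \<Longrightarrow> s < t \<Longrightarrow> t \<le> 1 \<Longrightarrow>
        prob_space.indep_set N (sets (F s)) {(\<lambda>x. B t x - B s x) -` A \<inter> space N | A. A \<in> sets borel}"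
    using bm by (auto simp: brownian_motion_def adapted_01_def)
  have AE_N: "(AE x in M. P (T x))" if "AE x in N. P x" for P
    using that by (rule AE_distrD[OF T_N, unfolded distr_T])
  have BG: "(\<lambda>x. B t (T x)) \<in> borel_measurable (G t)" if "t \<in> {0..1}" for t
    by (rule measurable_T[OF B_F[OF that]])
  have BM[measurable]: "B t \<in> borel_measurable M" if "t \<in> {0..1}" for t
    using measurable_from_subalg[OF sub_F B_F[OF that]] that by auto
  have "distributed M lborel (\<lambda>x. B t (T x) - B s (T x)) (\<lambda>y. ennreal (normal_density 0 (sqrt (t - s)) y)) \<and>
      prob_space.indep_set M (sets (G s)) {(\<lambda>x. B t (T x) - B s (T x)) -` A \<inter> space M | A. A \<in> sets borel}"
    if st: "0 \<le> s" "s < t" "t \<le> 1" for s t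
  proof
    have [measurable]: "B s \<in> borel_measurable M" "B t \<in> borel_measurable M" using BM st by auto
    define d where "d = (\<lambda>x. B t x - B s x)"
    have dM[measurable]: "d \<in> borel_measurable M" unfolding d_def by measurable
    then have dN: "d \<in> borel_measurable N" by (simp add: measurable_cong_sets[OF sets_N refl])
    have dd: "distributed N lborel d (\<lambda>y. ennreal (normal_density 0 (sqrt (t - s)) y))" using inc[OF st] by (simp add: d_def)
    have "distr M lborel (\<lambda>x. d (T x)) = distr (distr M N T) lborel d"
      by (subst distr_distr) (use T_N dN in \<open>auto simp: comp_def\<close>)
    then have "distr M lborel (\<lambda>x. d (T x)) = density lborel (\<lambda>y. ennreal (normal_density 0 (sqrt (t - s)) y))"
      using dd by (simp add: distr_T distributed_def)
    then show "distributed M lborel (\<lambda>x. B t (T x) - B s (T x)) (\<lambda>y. ennreal (normal_density 0 (sqrt (t - s)) y))"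
      using measurable_compose[OF T_M dM] by (simp add: distributed_def d_def)
    show "indep_set (sets (G s)) {(\<lambda>x. B t (T x) - B s (T x)) -` A \<inter> space M | A. A \<in> sets borel}"
    proof (rule indep_setI)
      show Gs: "sets (G s) \<subseteq> events" using sub_G[of s] st by (simp add: subalgebra_def)
      have dT: "(\<lambda>x. B t (T x) - B s (T x)) \<in> borel_measurable M" by measurable
      show "{(\<lambda>x. B t (T x) - B s (T x)) -` A \<inter> space M | A. A \<in> sets borel} \<subseteq> events"
        using measurable_sets[OF dT] by auto
      fix a b assume a: "a \<in> sets (G s)" and "b \<in> {(\<lambda>x. B t (T x) - B s (T x)) -` A \<inter> space M | A. A \<in> sets borel}"
      then obtain C where C: "C \<in> sets borel" and b: "b = (\<lambda>x. d (T x)) -` C \<inter> space M" by (auto simp: d_def)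
      \<comment> \<open>Independence is verified for this preimage, which has the same probabilities
        as \<open>a\<close>.\<close>
      obtain a' where a': "a' \<in> sets (F s)" "AE x in M. x \<in> a \<longleftrightarrow> T x \<in> a'" using G_preimage[OF a] by blast
      define b' where "b' = d -` C \<inter> space M"
      have aM: "a \<in> sets M" "a' \<in> sets M" using Gs a a' sub_F[of s] st by (auto simp: subalgebra_def)
      have bM: "b' \<in> sets M" unfolding b'_def by (rule measurable_sets[OF dM C])
      have bb: "b = T -` b' \<inter> space M" using T_space by (auto simp: b b'_def)
      have bM': "b \<in> sets M" unfolding bb by (rule measurable_sets[OF T_M bM])
      have mT: "measure M (T -` A \<inter> space M) = measure N A" if "A \<in> sets M" for A
        using emeasure_T[OF that] by (simp add: measure_def)
      have m1: "measure M a = measure N a'"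
      proof -
        have "measure M a = measure M (T -` a' \<inter> space M)"
          by (rule finite_measure_eq_AE) (use a'(2) AE_space measurable_sets[OF T_M aM(2)] aM in \<open>auto elim: AE_mp\<close>)
        then show ?thesis using mT[OF aM(2)] by simp
      qed
      have m2: "measure M (a \<inter> b) = measure N (a' \<inter> b')"
      proof -
        have "measure M (a \<inter> b) = measure M (T -` (a' \<inter> b') \<inter> space M)"
        proof (rule finite_measure_eq_AE)
          show "AE x in M. x \<in> a \<inter> b \<longleftrightarrow> x \<in> T -` (a' \<inter> b') \<inter> space M"
            using a'(2) AE_space by eventually_elim (auto simp: bb)
        qed (use aM bM bM' measurable_sets[OF T_M, of "a' \<inter> b'"] in auto)
        then show ?thesis using mT[of "a' \<inter> b'"] aM bM by auto
      qed
      have "b' \<in> {(\<lambda>x. B t x - B s x) -` A \<inter> space N | A. A \<in> sets borel}"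
        using C by (auto simp: b'_def d_def space_N)
      then have "measure N (a' \<inter> b') = measure N a' * measure N b'"
        by (rule prob_space.indep_setD[OF N ind[OF st] a'(1)])
      then show "prob (a \<inter> b) = prob a * prob b"
        unfolding m2 m1 using mT[OF bM] by (simp add: bb)
    qed
  qed
  moreover have "filtration (space M) G"
    by unfold_locales (auto simp: space_natural_filtration dest: subsetD[OF sets_natural_filtration_mono])
  ultimately show ?thesis
    unfolding brownian_motion_def adapted_01_def
    using prob_M sub_G BG AE_N[OF B0] AE_N[OF Bc] by auto
qed

text \<open>The approximating step processes are composed with \<open>T\<close>, which keeps them
  adapted, now to \<open>G\<close>; by \<open>AE_T\<close> their almost sure limits are preserved,
  and these give convergence in probability.\<close>

lemma has_ito_integral_T:
  assumes step: "\<And>k. step_process F (m k) (s k) (\<xi> k)"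
    and u: "measurable_process M u" "adapted_01 F u"
    and u_sq: "AE x in M. integrable leb01 (\<lambda>t. (u t x)\<^sup>2)"
    and J[measurable]: "J \<in> borel_measurable M" and B: "\<And>t. t \<in> {0..1} \<Longrightarrow> B t \<in> borel_measurable M"
    and conv_u: "AE x in M. (\<lambda>k. LINT t|leb01. (step_value (m k) (s k) (\<xi> k) t x - u t x)\<^sup>2) \<longlonglongrightarrow> 0"
    and conv_J: "AE x in M. (\<lambda>k. step_integral B (m k) (s k) (\<xi> k) x) \<longlonglongrightarrow> J x"
  shows "has_ito_integral M G (\<lambda>t x. B t (T x)) (\<lambda>t x. u t (T x)) (\<lambda>x. J (T x))"
proof -
  interpret L: sigma_finite_measure leb01 by (rule sigma_finite_leb01)
  have [measurable]: "(\<lambda>(t, x). u t x) \<in> borel_measurable (leb01 \<Otimes>\<^sub>M M)"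
    using u(1) by (simp add: measurable_process_def)
  have grid: "time_grid (m k) (s k)" for k using step by (simp add: step_process_iff)
  have s01: "i \<le> m k \<Longrightarrow> s k i \<in> {0..1}" for k i using time_grid_range[OF grid, of i] by auto
  have \<xi>: "i < m k \<Longrightarrow> \<xi> k i \<in> borel_measurable (F (s k i))" for k i
    using step by (simp add: step_process_iff)
  have \<xi>M: "i < m k \<Longrightarrow> \<xi> k i \<in> borel_measurable M" for k i
    using measurable_from_subalg[OF sub_F \<xi>] s01[of i k] by auto
  have [measurable]: "(\<lambda>(t, x). step_value (m k) (s k) (\<xi> k) t x) \<in> borel_measurable (leb01 \<Otimes>\<^sub>M M)" for k
    using measurable_step_value[OF grid \<xi>M, of k] by (simp add: measurable_process_def)
  have stepT: "step_process G (m k) (s k) (\<lambda>i x. \<xi> k i (T x))" for k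
    unfolding step_process_def
  proof (intro conjI allI impI)
    show "s k 0 = 0" "s k (m k) = 1" using step[of k] by (auto simp: step_process_def)
    fix i assume i: "i < m k"
    show "s k i < s k (Suc i)" using step[of k] i by (auto simp: step_process_def)
    show "(\<lambda>x. \<xi> k i (T x)) \<in> borel_measurable (G (s k i))" by (rule measurable_T[OF \<xi>[OF i]])
    obtain C where "\<forall>x\<in>space (F (s k i)). \<bar>\<xi> k i x\<bar> \<le> C" using step[of k] i by (auto simp: step_process_def)
    then show "\<exists>C. \<forall>x\<in>space (G (s k i)). \<bar>\<xi> k i (T x)\<bar> \<le> C"
      using T_space by (auto simp: space_natural_filtration)
  qed
  have uT: "measurable_process M (\<lambda>t x. u t (T x))"
  proof -
    have "(\<lambda>p. (fst p, T (snd p))) \<in> measurable (leb01 \<Otimes>\<^sub>M M) (leb01 \<Otimes>\<^sub>M M)" by measurable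
    from measurable_compose[OF this u(1)[unfolded measurable_process_def]]
    have "(\<lambda>p. u (fst p) (T (snd p))) \<in> borel_measurable (leb01 \<Otimes>\<^sub>M M)" by simp
    then show ?thesis by (simp add: measurable_process_def split_beta)
  qed
  have 1: "tendsto_in_prob M (\<lambda>k x. LINT t|leb01. (step_value (m k) (s k) (\<lambda>i x. \<xi> k i (T x)) t x - u t (T x))\<^sup>2) (\<lambda>x. 0)"
  proof (rule tendsto_in_prob_of_AE)
    fix k
    have sv: "step_value (m k) (s k) (\<lambda>i x. \<xi> k i (T x)) t x = step_value (m k) (s k) (\<xi> k) t (T x)" for t x
      by (simp add: step_value_def)
    have "(\<lambda>x. LINT t|leb01. (step_value (m k) (s k) (\<xi> k) t x - u t x)\<^sup>2) \<in> borel_measurable M"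
      by measurable
    from measurable_compose[OF T_M this]
    show "(\<lambda>x. LINT t|leb01. (step_value (m k) (s k) (\<lambda>i x. \<xi> k i (T x)) t x - u t (T x))\<^sup>2) \<in> borel_measurable M"
      by (simp only: sv)
  next
    show "AE x in M. (\<lambda>k. LINT t|leb01. (step_value (m k) (s k) (\<lambda>i x. \<xi> k i (T x)) t x - u t (T x))\<^sup>2) \<longlonglongrightarrow> 0"
      using AE_T[OF conv_u] by (simp only: step_value_def)
  qed simp
  have 2: "tendsto_in_prob M (\<lambda>k. step_integral (\<lambda>t x. B t (T x)) (m k) (s k) (\<lambda>i x. \<xi> k i (T x))) (\<lambda>x. J (T x))"
  proof (rule tendsto_in_prob_of_AE)
    fix k
    show "step_integral (\<lambda>t x. B t (T x)) (m k) (s k) (\<lambda>i x. \<xi> k i (T x)) \<in> borel_measurable M"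
      unfolding step_integral_def[abs_def]
    proof (rule borel_measurable_sum)
      fix i assume "i \<in> {..<m k}"
      then have [measurable]: "\<xi> k i \<in> borel_measurable M" "B (s k i) \<in> borel_measurable M" "B (s k (Suc i)) \<in> borel_measurable M"
        using \<xi>M B s01[of i k] s01[of "Suc i" k] by auto
      show "(\<lambda>x. \<xi> k i (T x) * (B (s k (Suc i)) (T x) - B (s k i) (T x))) \<in> borel_measurable M" by measurable
    qed
  next
    show "AE x in M. (\<lambda>k. step_integral (\<lambda>t x. B t (T x)) (m k) (s k) (\<lambda>i x. \<xi> k i (T x)) x) \<longlonglongrightarrow> J (T x)"
      using AE_T[OF conv_J] by (simp only: step_integral_def)
  qed simp
  show ?thesis
    unfolding has_ito_integral_def
  proof (intro conjI)
    show "adapted_01 G (\<lambda>t x. u t (T x))"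
      using u(2) measurable_T by (auto simp: adapted_01_def)
    show "\<exists>m s \<xi>. (\<forall>n. step_process G (m n) (s n) (\<xi> n)) \<and>
        tendsto_in_prob M (\<lambda>n x. LINT t|leb01. (step_value (m n) (s n) (\<xi> n) t x - u t (T x))\<^sup>2) (\<lambda>x. 0) \<and>
        tendsto_in_prob M (\<lambda>n. step_integral (\<lambda>t x. B t (T x)) (m n) (s n) (\<xi> n)) (\<lambda>x. J (T x))"
      by (intro exI[of _ m] exI[of _ s] exI[of _ "\<lambda>k i x. \<xi> k i (T x)"] conjI allI stepT 1 2)
  qed (use uT AE_T[OF u_sq] in auto)
qed

end

theorem theorem6p1:
  fixes \<mu> \<nu> :: "path measure"
    and f L \<Lambda> \<phi> :: "path \<Rightarrow> real"
    and grad_f T :: "path \<Rightarrow> path"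
    and Df u BT :: "real \<Rightarrow> path \<Rightarrow> real"
    and FT :: "real \<Rightarrow> path measure"
    and c :: real
  assumes "wiener_measure \<mu>"
    and "malliavin_derivative \<mu> f grad_f"
    and "lebesgue_density \<mu> grad_f Df"
    and "integrable \<mu> (\<lambda>x. exp (- f x))"
    and "c = (\<integral>x. exp (- f x) \<partial>\<mu>)"
    and "L = (\<lambda>x. 1 / c * exp (- f x))"
    and "\<nu> = density \<mu> (\<lambda>x. ennreal (L x))"
    and "cm_dist_sq \<mu> \<nu> < \<infinity>"
    and "optimal_transport_map \<mu> \<nu> \<phi> T"
    and "\<Lambda> = (\<lambda>x. 1 / L (T x))"
    and "cond_exp_process \<nu> (natural_filtration \<mu> coord) Df u"
    and "FT = natural_filtration \<mu> (\<lambda>t x. T x t)"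
    and "BT = (\<lambda>t x. T x t + (LINT \<tau>:{0..t}|lborel. u \<tau> (T x)))"
  shows "brownian_motion \<mu> FT BT \<and>
    (\<exists>I. has_ito_integral \<mu> FT BT (\<lambda>t x. u t (T x)) I \<and>
       (AE x in \<mu>. \<Lambda> x = exp (I x - 1 / 2 * (LINT t:{0..1}|lborel. (u t (T x))\<^sup>2))))"
proof -
  interpret wiener_setting \<mu> by unfold_locales (rule assms(1))
  interpret T: prob_space leb01 by (rule prob_space_leb01)
  have c: "0 < c"
  proof -
    have "0 \<le> c" unfolding assms(5) by (rule Bochner_Integration.integral_nonneg) simp
    moreover have "c \<noteq> 0"
    proof
      assume "c = 0"
      then have "AE x in \<mu>. exp (- f x) = 0"
        using integral_nonneg_eq_0_iff_AE[OF assms(4)] assms(5) by simp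
      then show False by simp
    qed
    ultimately show ?thesis by simp
  qed
  have L: "L x = 1 / c * exp (- f x)" for x by (simp add: assms(6))
  have Lpos: "0 < L x" for x using c by (simp add: L)
  have iL: "integrable \<mu> L" unfolding L[abs_def] using assms(4) by simp
  then have [measurable]: "L \<in> borel_measurable \<mu>" by simp
  have L1: "(\<integral>x. L x \<partial>\<mu>) = 1" unfolding L[abs_def] using c by (simp add: assms(5)[symmetric])
  note cep = assms(11)[unfolded assms(7)]
  have setsN: "sets \<nu> = sets \<mu>" by (simp add: assms(7))
  have up: "measurable_process \<mu> u"
  proof -
    have "sets (leb01 \<Otimes>\<^sub>M \<nu>) = sets (leb01 \<Otimes>\<^sub>M \<mu>)" by (intro sets_pair_measure_cong setsN refl)
    then show ?thesis using assms(11) by (simp add: cond_exp_process_def measurable_process_def cong: measurable_cong_sets)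
  qed
  have ua: "adapted_01 F u" using cep by (simp add: cond_exp_process_def)
  obtain m0 s0 \<xi>0 where st0: "\<And>k::nat. step_process F (m0 k) (s0 k) (\<xi>0 k)"
    and N0: "(\<lambda>k. \<integral>x. \<bar>step_exp coord (m0 k) (s0 k) (\<xi>0 k) x - L x\<bar> \<partial>\<mu>) \<longlonglongrightarrow> 0"
    and v0: "AE x in \<mu>. AE t in leb01. (\<lambda>k. step_value (m0 k) (s0 k) (\<xi>0 k) t x) \<longlonglongrightarrow> u t x"
    by (rule step_approximation[OF assms(2-5) c L cep]) (rule that)
  \<comment> \<open>Extraction is legitimate here, because the integrands already converge for
    almost every path and time and the subsequence depends on neither.\<close>
  obtain r where r: "strict_mono r"
    and Nc: "AE x in \<mu>. (\<lambda>k. step_exp coord (m0 (r k)) (s0 (r k)) (\<xi>0 (r k)) x) \<longlonglongrightarrow> L x"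
    and usq: "AE x in \<mu>. integrable leb01 (\<lambda>t. (u t x)\<^sup>2)"
    and vc: "AE x in \<mu>. (\<lambda>k. LINT t|leb01. (step_value (m0 (r k)) (s0 (r k)) (\<xi>0 (r k)) t x - u t x)\<^sup>2) \<longlonglongrightarrow> 0"
    by (rule step_limit_subseq[OF st0 iL Lpos N0 up v0]) (rule that)
  have N1: "(\<lambda>k. \<integral>x. \<bar>step_exp coord (m0 (r k)) (s0 (r k)) (\<xi>0 (r k)) x - L x\<bar> \<partial>\<mu>) \<longlonglongrightarrow> 0"
    using LIMSEQ_subseq_LIMSEQ[OF N0 r] by (simp add: comp_def)
  interpret G: girsanov_limit \<mu> F coord L u "\<lambda>k. m0 (r k)" "\<lambda>k. s0 (r k)" "\<lambda>k. \<xi>0 (r k)"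
    by unfold_locales (fact st0 iL Lpos L1 N1 Nc up usq vc null_sets_natural_filtration)+
  have \<nu>: "G.\<nu> = \<nu>" by (simp add: G.\<nu>_def assms(7))
  have T: "T \<in> measurable \<mu> \<nu>" "distr \<mu> \<nu> T = \<nu>" using assms(9) by (auto simp: optimal_transport_map_def)
  interpret X: filtration_transport \<mu> \<nu> T coord
  proof unfold_locales
    show "null_sets \<mu> \<subseteq> null_sets \<nu>"
    proof
      fix A assume A: "A \<in> null_sets \<mu>"
      have "AE x in \<mu>. x \<in> A \<longrightarrow> ennreal (L x) = 0" using AE_not_in[OF A] by eventually_elim simp
      then show "A \<in> null_sets \<nu>" unfolding assms(7) using A by (subst null_sets_density_iff) auto
    qed
  qed (use setsN T W_M in auto)
  have FT: "FT = X.G" unfolding assms(12) coord_def ..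
  have BT: "BT = (\<lambda>t x. G.B t (T x))" unfolding assms(13) G.B_def coord_def ..
  \<comment> \<open>The stochastic integral of \<open>u\<close> under \<nu>, found as a function on
    path space. Its composition with \<open>T\<close> is the integral wanted under \<mu>, and with
    this version the identity for \<open>\<Lambda>\<close> is pure algebra.\<close>
  define J where "J x = - ln (L x) + (LINT t|leb01. (u t x)\<^sup>2) / 2" for x
  have [measurable]: "(\<lambda>(t, x). u t x) \<in> borel_measurable (leb01 \<Otimes>\<^sub>M \<mu>)"
    using up by (simp add: measurable_process_def)
  have Jm: "J \<in> borel_measurable \<mu>" unfolding J_def[abs_def] by measurable
  have bm: "brownian_motion \<mu> FT BT"
    unfolding FT BT by (rule X.brownian_motion_T[OF G.brownian_motion_\<nu>[unfolded \<nu>]])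
  have ito: "has_ito_integral \<mu> FT BT (\<lambda>t x. u t (T x)) (\<lambda>x. J (T x))"
    unfolding FT BT
    by (rule X.has_ito_integral_T[OF st0 up ua usq Jm G.B_M vc G.AE_step_integral_conv[folded J_def]])
  have "\<Lambda> x = exp (J (T x) - 1 / 2 * (LINT t:{0..1}|lborel. (u t (T x))\<^sup>2))" for x
  proof -
    have "(LINT t:{0..1}|lborel. (u t (T x))\<^sup>2) = (LINT t|leb01. (u t (T x))\<^sup>2)"
      unfolding set_integral_leb01[OF order_refl] by (rule Bochner_Integration.integral_cong) simp_all
    then have "J (T x) - 1 / 2 * (LINT t:{0..1}|lborel. (u t (T x))\<^sup>2) = - ln (L (T x))" by (simp add: J_def)
    then show ?thesis using Lpos[of "T x"] by (simp add: assms(10) exp_minus inverse_eq_divide)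
  qed
  then show ?thesis using bm ito by blast
qed

end
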